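(* Let $(\Omega,T)$ be a topologically mixing topological Markov shift endowed with a positive recurrent potential $\phi$ satisfying Walters' condition and $P_G(\phi)<+\infty$, and let $\mu$ be the associated shift-invariant probability measure. Let $x\in\Omega$ and $B_n:=[x_0^{n-1}]$ for $n\ge1$. For measurable $B$ with $\mu(B)>0$ set $N_B^{\mathrm{id}}:=\sum_{k\ge1}\delta_{\mu(B)\,r_B^{(k)}}$. 1. If $x$ is not periodic, then $N_{B_n}^{\mathrm{id}}$ converges in law as $n\to+\infty$ to the standard Poisson point process $\mathrm{PPP}(1)$, both under $\mu$ and under $\mu_{B_n}$. 2. If $x$ is periodic of prime period $q$, set $\theta:=1-\exp(S_q\phi(x)-qP_G(\phi))$. Then, as $n\to+\infty$, $N_{B_n}^{\mathrm{id}}$ converges in law under $\mu$ to $\mathrm{CPPP}(\theta,\mathrm{Geo}(\theta))$, and under $\mu_{B_n}$ to $\mathrm{RPP}(W_{1,\theta})$.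
   Context: Topological Markov shifts. Let $V$ be an at most countable alphabet and $A:V\times V\to\{0,1\}$ a transition matrix. $\Omega=\{x=(x_n)_{n\ge0}\in V^{\mathbb N}: A(x_n,x_{n+1})=1\ \forall n\ge0\}$, $T$ is the left shift on $\Omega$, and the topology is given by $d(x,y)=\eta^{\min\{n\ge0:x_n\ne y_n\}}$, $\eta\in(0,1)$ fixed. A word $v_0^{n-1}=(v_0,\dots,v_{n-1})$ is admissible if $A(v_i,v_{i+1})=1$ for all $i$; $[v_0^{n-1}]=\{x\in\Omega:x_i=v_i,\ 0\le i<n\}$. Topologically mixing: for all $v,w\in V$ there is $N$ such that for all $n\ge N$ there is an admissible path of $n$ steps from $v$ to $w$. Potentials. $\phi:\Omega\to\mathbb R$ is measurable, $S_n\phi=\sum_{k=0}^{n-1}\phi\circ T^k$, $\mathrm{var}_n(\phi)=\sup\{|\phi(x)-\phi(y)|:x_0^{n-1}=y_0^{n-1}\}$. Walters' condition: for all $k\ge1$, $W_k(\phi):=\sup_{n\ge1}\mathrm{var}_{n+k}(S_n\phi)<\infty$, and $W_k(\phi)\to0$ as $k\to\infty$. For measurable $B$, $r_B=r_B^{(1)}(x)=\inf\{n\ge1:T^nx\in B\}$ and $r_B^{(k+1)}(x)=\inf\{n>r_B^{(k)}(x):T^nx\in B\}$. Put $Z_n(\phi,v)=\sum_{T^nx=x}e^{S_n\phi(x)}\mathbf 1_{[v]}(x)$ and $Z_n^*(\phi,v)=\sum_{T^nx=x}e^{S_n\phi(x)}\mathbf 1_{\{r_{[v]}=n\}}(x)\mathbf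 1_{[v]}(x)$. The Gurevich pressure is $P_G(\phi)=\lim_n\frac1n\log Z_n(\phi,v)$ (independent of $v$), $\lambda_\phi=e^{P_G(\phi)}$. $\phi$ is positive recurrent if $\sum_n\lambda_\phi^{-n}Z_n(\phi,v)=\infty$ and $\sum_n n\lambda_\phi^{-n}Z_n^*(\phi,v)<\infty$ for some (all) $v$. In that case (generalized Ruelle–Perron–Frobenius theorem), with $L_\phi f(x)=\sum_{Ty=x}e^{\phi(y)}f(y)$, there are a continuous $h_\phi>0$ and a conservative measure $\nu_\phi$, finite on cylinders, with $L_\phi h_\phi=\lambda_\phi h_\phi$, $L_\phi^*\nu_\phi=\lambda_\phi\nu_\phi$, $\int h_\phi\,d\nu_\phi=1$, and $\mu=h_\phi\nu_\phi$ is an ergodic shift-invariant probability. As a standing assumption $\mu$ is non-atomic, so that $\mu(B_n)>0$ and $\mu(B_n)\to0$. $\mu_B=\mu(\cdot\cap B)/\mu(B)$. Point processes on $\mathbb R_+=[0,\infty)$ are random boundedly finite counting measures; convergence in law is with respect to the weak$^*$ (vague) topology on such measures. $\mathrm{RPP}(W)$, for a finite nonnegative random variable $W$ with $\mathbb P(W>0)>0$, is the renewal point process $\sum_{i\ge1}\delta_{W_1+\dots+W_i}$ with $(W_i)$ i.i.d. copies of $W$. $\mathrm{PPP}(\lambda)=\mathrm{RPP}(\mathcal E(\lambda))$ with $\mathcal E(\lambda)$ exponential of parameter $\lambda$. $\mathrm{Geo}(\theta)$ is the law $\pi(k)=\theta(1-\theta)^{k-1}$, $k\ge1$. $\mathrm{CPPP}(\lambda,\pi)=\sum_iX_i\delta_{T_i}$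 where $\sum_i\delta_{T_i}$ is $\mathrm{PPP}(\lambda)$ and $(X_i)$ are i.i.d. of law $\pi$, independent of $(T_i)$. $W_{1,\theta}$ is the nonnegative random variable with $\mathbb P(W_{1,\theta}\le t)=1-\theta+\theta(1-e^{-\theta t})$, $t\ge0$. *)

theory Defs
  imports "HOL-Probability.Probability"
begin

section \<open>Topological Markov shifts\<close>

text \<open>
  The alphabet is a countable type \<open>'v\<close>, the transition matrix a relation \<open>A\<close> on it (\<open>A v w\<close> for
  entry 1). Functions on the shift space are total functions on all sequences; only their values
  on \<open>tms A\<close> are ever used.
\<close>

definition tms :: "('v \<Rightarrow> 'v \<Rightarrow> bool) \<Rightarrow> (nat \<Rightarrow> 'v) set" where
  "tms A = {x. \<forall>n. A (x n) (x (Suc n))}"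

definition shift :: "(nat \<Rightarrow> 'v) \<Rightarrow> nat \<Rightarrow> 'v" where
  "shift x = (\<lambda>n. x (Suc n))"

definition shift_dist :: "real \<Rightarrow> (nat \<Rightarrow> 'v) \<Rightarrow> (nat \<Rightarrow> 'v) \<Rightarrow> real" where
  "shift_dist \<eta> x y = (if x = y then 0 else \<eta> ^ (LEAST n. x n \<noteq> y n))"

lemma Metric_space_tms:
  assumes "0 < \<eta>" "\<eta> < 1"
  shows "Metric_space (tms A) (shift_dist \<eta>)"
proof
  show "0 \<le> shift_dist \<eta> x y" for x y :: "nat \<Rightarrow> 'a"
    using assms by (simp add: shift_dist_def)
  show "shift_dist \<eta> x y = shift_dist \<eta> y x" for x y :: "nat \<Rightarrow> 'a"
  proof -
    have "(\<lambda>n. x n \<noteq> y n) = (\<lambda>n. y n \<noteq> x n)" by auto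
    then show ?thesis by (auto simp: shift_dist_def)
  qed
  show "shift_dist \<eta> x y = 0 \<longleftrightarrow> x = y" for x y :: "nat \<Rightarrow> 'a"
    using assms by (simp add: shift_dist_def)
  show "shift_dist \<eta> x z \<le> shift_dist \<eta> x y + shift_dist \<eta> y z" for x y z :: "nat \<Rightarrow> 'a"
  proof (cases "x = y \<or> y = z \<or> x = z")
    case True
    then show ?thesis using assms by (auto simp: shift_dist_def)
  next
    case False
    define a where "a = (LEAST n. x n \<noteq> y n)"
    define b where "b = (LEAST n. y n \<noteq> z n)"
    define c where "c = (LEAST n. x n \<noteq> z n)"
    have "\<exists>n. x n \<noteq> z n" using False by auto
    then have "x c \<noteq> z c" unfolding c_def by (rule LeastI_ex)
    then have "x c \<noteq> y c \<or> y c \<noteq> z c" by auto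
    then have "a \<le> c \<or> b \<le> c" unfolding a_def b_def by (auto intro: Least_le)
    then have "\<eta> ^ c \<le> \<eta> ^ a \<or> \<eta> ^ c \<le> \<eta> ^ b"
      using assms by (auto intro: power_decreasing)
    moreover have "0 < \<eta> ^ a" "0 < \<eta> ^ b" using assms by auto
    ultimately have "\<eta> ^ c \<le> \<eta> ^ a + \<eta> ^ b" by linarith
    then show ?thesis using False by (simp add: shift_dist_def a_def b_def c_def)
  qed
qed

definition shift_topology :: "real \<Rightarrow> ('v \<Rightarrow> 'v \<Rightarrow> bool) \<Rightarrow> (nat \<Rightarrow> 'v) topology" where
  "shift_topology \<eta> A = Metric_space.mtopology (tms A) (shift_dist \<eta>)"

definition borel_of :: "'a topology \<Rightarrow> 'a measure" where
  "borel_of X = sigma (topspace X) {U. openin X U}"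

definition cylinder :: "('v \<Rightarrow> 'v \<Rightarrow> bool) \<Rightarrow> 'v list \<Rightarrow> (nat \<Rightarrow> 'v) set" where
  "cylinder A w = {x \<in> tms A. \<forall>i < length w. x i = w ! i}"

definition topologically_mixing :: "('v \<Rightarrow> 'v \<Rightarrow> bool) \<Rightarrow> bool" where
  "topologically_mixing A \<longleftrightarrow>
     (\<forall>v w. \<exists>N. \<forall>n\<ge>N. \<exists>p :: nat \<Rightarrow> 'v. p 0 = v \<and> p n = w \<and> (\<forall>i<n. A (p i) (p (Suc i))))"

definition is_periodic :: "(nat \<Rightarrow> 'v) \<Rightarrow> bool" where
  "is_periodic x \<longleftrightarrow> (\<exists>q\<ge>1. (shift ^^ q) x = x)"

definition prime_period :: "(nat \<Rightarrow> 'v) \<Rightarrow> nat \<Rightarrow> bool" where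
  "prime_period x q \<longleftrightarrow>
     q \<ge> 1 \<and> (shift ^^ q) x = x \<and> (\<forall>j. 1 \<le> j \<and> j < q \<longrightarrow> (shift ^^ j) x \<noteq> x)"

section \<open>Potentials\<close>

definition birkhoff :: "((nat \<Rightarrow> 'v) \<Rightarrow> real) \<Rightarrow> nat \<Rightarrow> (nat \<Rightarrow> 'v) \<Rightarrow> real" where
  "birkhoff \<phi> n x = (\<Sum>k<n. \<phi> ((shift ^^ k) x))"

definition variation ::
    "('v \<Rightarrow> 'v \<Rightarrow> bool) \<Rightarrow> nat \<Rightarrow> ((nat \<Rightarrow> 'v) \<Rightarrow> real) \<Rightarrow> ennreal" where
  "variation A n \<phi> =
     (SUP (x, y) \<in> {(x, y). x \<in> tms A \<and> y \<in> tms A \<and> (\<forall>i<n. x i = y i)}. ennreal \<bar>\<phi> x - \<phi> y\<bar>)"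

definition walters_var ::
    "('v \<Rightarrow> 'v \<Rightarrow> bool) \<Rightarrow> ((nat \<Rightarrow> 'v) \<Rightarrow> real) \<Rightarrow> nat \<Rightarrow> ennreal" where
  "walters_var A \<phi> k = (SUP n\<in>{1..}. variation A (n + k) (birkhoff \<phi> n))"

definition walters_condition :: "('v \<Rightarrow> 'v \<Rightarrow> bool) \<Rightarrow> ((nat \<Rightarrow> 'v) \<Rightarrow> real) \<Rightarrow> bool" where
  "walters_condition A \<phi> \<longleftrightarrow>
     (\<forall>k\<ge>1. walters_var A \<phi> k < \<infinity>) \<and> (walters_var A \<phi>) \<longlonglongrightarrow> 0"

text \<open>
  \<open>hit_time B k\<close> is the \<open>k\<close>-th entry time to \<open>B\<close> for \<open>k \<ge> 1\<close> (the infimum of the empty set being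
  \<open>\<infinity>\<close>). The value 0 at \<open>k = 0\<close> is an auxiliary start that makes the case \<open>k = 1\<close> the infimum
  over \<open>n \<ge> 1\<close>; it is not one of the entry times.
\<close>

primrec hit_time :: "(nat \<Rightarrow> 'v) set \<Rightarrow> nat \<Rightarrow> (nat \<Rightarrow> 'v) \<Rightarrow> enat" where
  "hit_time B 0 x = 0"
| "hit_time B (Suc k) x =
     Inf {enat n | n. hit_time B k x < enat n \<and> (shift ^^ n) x \<in> B}"

definition Z ::
    "('v \<Rightarrow> 'v \<Rightarrow> bool) \<Rightarrow> ((nat \<Rightarrow> 'v) \<Rightarrow> real) \<Rightarrow> 'v \<Rightarrow> nat \<Rightarrow> ennreal" where
  "Z A \<phi> v n =
     (\<Sum>\<^sub>\<infinity> x \<in> {x \<in> cylinder A [v]. (shift ^^ n) x = x}. ennreal (exp (birkhoff \<phi> n x)))"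

definition Z_star ::
    "('v \<Rightarrow> 'v \<Rightarrow> bool) \<Rightarrow> ((nat \<Rightarrow> 'v) \<Rightarrow> real) \<Rightarrow> 'v \<Rightarrow> nat \<Rightarrow> ennreal" where
  "Z_star A \<phi> v n =
     (\<Sum>\<^sub>\<infinity> x \<in> {x \<in> cylinder A [v]. (shift ^^ n) x = x \<and> hit_time (cylinder A [v]) 1 x = enat n}.
        ennreal (exp (birkhoff \<phi> n x)))"

definition elog :: "ennreal \<Rightarrow> ereal" where
  "elog a = (if a = 0 then - \<infinity> else if a = \<infinity> then \<infinity> else ereal (ln (enn2real a)))"

text \<open>
  The limit defining the pressure exists in the extended reals and is the same for all symbols
  for mixing shifts and potentials with Walters' condition.
\<close>

definition gurevich_pressure ::
    "('v \<Rightarrow> 'v \<Rightarrow> bool) \<Rightarrow> ((nat \<Rightarrow> 'v) \<Rightarrow> real) \<Rightarrow> ereal" where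
  "gurevich_pressure A \<phi> = (THE P. \<forall>v. (\<lambda>n. elog (Z A \<phi> v n) / ereal (real n)) \<longlonglongrightarrow> P)"

text \<open>Meaningful when the pressure is finite.\<close>

definition gurevich_eigenvalue ::
    "('v \<Rightarrow> 'v \<Rightarrow> bool) \<Rightarrow> ((nat \<Rightarrow> 'v) \<Rightarrow> real) \<Rightarrow> real" where
  "gurevich_eigenvalue A \<phi> = exp (real_of_ereal (gurevich_pressure A \<phi>))"

text \<open>
  The series run over \<open>n \<ge> 1\<close>: every point is fixed by the 0-th iterate, so \<open>Z A \<phi> v 0\<close> is the
  (usually infinite) cardinality of a cylinder.
\<close>

definition positive_recurrent ::
    "('v \<Rightarrow> 'v \<Rightarrow> bool) \<Rightarrow> ((nat \<Rightarrow> 'v) \<Rightarrow> real) \<Rightarrow> bool" where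
  "positive_recurrent A \<phi> \<longleftrightarrow> (\<exists>v.
     (\<Sum>n. ennreal (1 / gurevich_eigenvalue A \<phi> ^ Suc n) * Z A \<phi> v (Suc n)) = \<infinity> \<and>
     (\<Sum>n. of_nat (Suc n) * ennreal (1 / gurevich_eigenvalue A \<phi> ^ Suc n) * Z_star A \<phi> v (Suc n))
       < \<infinity>)"

section \<open>The Ruelle--Perron--Frobenius measure\<close>

text \<open>The transfer operator on nonnegative functions.\<close>

definition transfer_op ::
    "('v \<Rightarrow> 'v \<Rightarrow> bool) \<Rightarrow> ((nat \<Rightarrow> 'v) \<Rightarrow> real) \<Rightarrow> ((nat \<Rightarrow> 'v) \<Rightarrow> ennreal) \<Rightarrow>
     (nat \<Rightarrow> 'v) \<Rightarrow> ennreal" where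
  "transfer_op A \<phi> f x = (\<Sum>\<^sub>\<infinity> y \<in> {y \<in> tms A. shift y = x}. ennreal (exp (\<phi> y)) * f y)"

definition conservative :: "(nat \<Rightarrow> 'v) measure \<Rightarrow> bool" where
  "conservative \<nu> \<longleftrightarrow>
     (\<forall>E \<in> sets \<nu>. disjoint_family (\<lambda>n. (shift ^^ n) -` E \<inter> space \<nu>) \<longrightarrow> emeasure \<nu> E = 0)"

definition shift_invariant :: "(nat \<Rightarrow> 'v) measure \<Rightarrow> bool" where
  "shift_invariant \<mu> \<longleftrightarrow> shift \<in> measurable \<mu> \<mu> \<and> distr \<mu> \<mu> shift = \<mu>"

definition shift_ergodic :: "(nat \<Rightarrow> 'v) measure \<Rightarrow> bool" where
  "shift_ergodic \<mu> \<longleftrightarrow>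
     (\<forall>E \<in> sets \<mu>. shift -` E \<inter> space \<mu> = E \<longrightarrow>
        emeasure \<mu> E = 0 \<or> emeasure \<mu> (space \<mu> - E) = 0)"

text \<open>
  The data provided by the generalized Ruelle--Perron--Frobenius theorem: an eigenfunction \<open>h\<close>,
  an eigenmeasure \<open>\<nu>\<close>, and the measure \<open>\<mu> = h \<nu>\<close>, which is uniquely determined by \<open>\<phi>\<close>.
  The equation for the dual operator is tested on nonnegative measurable functions.
\<close>

definition RPF_measure ::
    "real \<Rightarrow> ('v \<Rightarrow> 'v \<Rightarrow> bool) \<Rightarrow> ((nat \<Rightarrow> 'v) \<Rightarrow> real) \<Rightarrow> ((nat \<Rightarrow> 'v) \<Rightarrow> real) \<Rightarrow>
     (nat \<Rightarrow> 'v) measure \<Rightarrow> (nat \<Rightarrow> 'v) measure \<Rightarrow> bool" where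
  "RPF_measure \<eta> A \<phi> h \<nu> \<mu> \<longleftrightarrow>
     continuous_map (shift_topology \<eta> A) euclideanreal h \<and>
     (\<forall>x \<in> tms A. h x > 0) \<and>
     sets \<nu> = sets (borel_of (shift_topology \<eta> A)) \<and>
     conservative \<nu> \<and>
     (\<forall>w. w \<noteq> [] \<longrightarrow> emeasure \<nu> (cylinder A w) < \<infinity>) \<and>
     (\<forall>x \<in> tms A. transfer_op A \<phi> (\<lambda>y. ennreal (h y)) x
                    = ennreal (gurevich_eigenvalue A \<phi> * h x)) \<and>
     (\<forall>f \<in> borel_measurable \<nu>. (\<integral>\<^sup>+ x. transfer_op A \<phi> f x \<partial>\<nu>)
                    = ennreal (gurevich_eigenvalue A \<phi>) * (\<integral>\<^sup>+ x. f x \<partial>\<nu>)) \<and>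
     (\<integral>\<^sup>+ x. ennreal (h x) \<partial>\<nu>) = 1 \<and>
     \<mu> = density \<nu> (\<lambda>x. ennreal (h x)) \<and>
     prob_space \<mu> \<and> shift_invariant \<mu> \<and> shift_ergodic \<mu>"

section \<open>Point processes on the half line\<close>

definition half_line :: "real measure" where
  "half_line = restrict_space borel {0..}"

definition point_measures :: "real measure set" where
  "point_measures =
     {m. sets m = sets half_line \<and>
         (\<forall>C \<in> sets half_line. bounded C \<longrightarrow> emeasure m C \<in> range of_nat)}"

text \<open>Continuous functions with compact support on \<open>[0,\<infinity>)\<close>; values on the negative axis do not matter.\<close>

definition test_functions :: "(real \<Rightarrow> real) set" where
  "test_functions = {f. continuous_on {0..} f \<and> (\<exists>K. \<forall>t\<ge>0. t \<ge> K \<longrightarrow> f t = 0)}"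

definition vague_topology :: "real measure topology" where
  "vague_topology = topology_generated_by
     {{m \<in> point_measures. integral\<^sup>L m f \<in> U} | f U. f \<in> test_functions \<and> open U}"

lemma topspace_vague_topology: "topspace vague_topology = point_measures"
proof -
  have "(\<lambda>_. 0) \<in> test_functions" by (simp add: test_functions_def)
  then have "point_measures \<in>
      {{m \<in> point_measures. integral\<^sup>L m f \<in> U} | f U. f \<in> test_functions \<and> open U}"
    by (auto intro!: exI[of _ "\<lambda>_. 0"] exI[of _ UNIV])
  then show ?thesis
    by (auto simp: vague_topology_def topology_generated_by_topspace)
qed

definition weakly_converges ::
    "'a topology \<Rightarrow> (nat \<Rightarrow> 'a measure) \<Rightarrow> 'a measure \<Rightarrow> bool" where
  "weakly_converges X P Q \<longleftrightarrow>
     (\<forall>F. continuous_map X euclideanreal F \<and> bounded (F ` topspace X) \<longrightarrow>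
        (\<lambda>n. integral\<^sup>L (P n) F) \<longlonglongrightarrow> integral\<^sup>L Q F)"

text \<open>
  Convergence in law of point processes \<open>N n\<close>, defined on the probability spaces \<open>M n\<close>, to the law
  \<open>Q\<close>; being a point process includes measurability.
\<close>

definition converges_in_law ::
    "(nat \<Rightarrow> 'a measure) \<Rightarrow> (nat \<Rightarrow> 'a \<Rightarrow> real measure) \<Rightarrow> real measure measure \<Rightarrow> bool" where
  "converges_in_law M N Q \<longleftrightarrow>
     (\<forall>n. N n \<in> measurable (M n) (borel_of vague_topology)) \<and>
     weakly_converges vague_topology (\<lambda>n. distr (M n) (borel_of vague_topology) (N n)) Q"

text \<open>
  The measure \<open>\<Sum>i\<in>I. c i * \<delta> (p i)\<close> on the half line, as the image of a weighted counting
  measure.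
\<close>

definition dirac_sum :: "nat set \<Rightarrow> (nat \<Rightarrow> nat) \<Rightarrow> (nat \<Rightarrow> real) \<Rightarrow> real measure" where
  "dirac_sum I c p = distr (density (count_space I) (\<lambda>i. of_nat (c i))) half_line p"

text \<open>
  On a null set of realizations the points of the random measures below may accumulate; there the
  value is replaced by the zero measure.
\<close>

definition as_point_measure :: "real measure \<Rightarrow> real measure" where
  "as_point_measure m = (if m \<in> point_measures then m else null_measure half_line)"

text \<open>
  The laws of the limit processes. \<open>RPP w\<close> is the law of the renewal process whose waiting times
  have the law \<open>w\<close> on \<open>[0,\<infinity>)\<close>: the \<open>i\<close>-th point (counted from 0) is the sum of the first \<open>Suc i\<close>
  waiting times.
\<close>

definition renewal_times :: "(nat \<Rightarrow> real) \<Rightarrow> nat \<Rightarrow> real" where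
  "renewal_times W i = (\<Sum>j\<le>i. W j)"

definition RPP :: "real measure \<Rightarrow> real measure measure" where
  "RPP w = distr (PiM UNIV (\<lambda>_ :: nat. w)) (borel_of vague_topology)
     (\<lambda>W. as_point_measure (dirac_sum UNIV (\<lambda>_. 1) (renewal_times W)))"

definition exponential_law :: "real \<Rightarrow> real measure" where
  "exponential_law l = density lborel (\<lambda>t. ennreal (exponential_density l t))"

definition PPP :: "real \<Rightarrow> real measure measure" where
  "PPP l = RPP (exponential_law l)"

definition CPPP :: "real \<Rightarrow> nat pmf \<Rightarrow> real measure measure" where
  "CPPP l \<pi> =
     distr (PiM UNIV (\<lambda>_ :: nat. exponential_law l) \<Otimes>\<^sub>M PiM UNIV (\<lambda>_ :: nat. measure_pmf \<pi>))
       (borel_of vague_topology)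
       (\<lambda>(W, X). as_point_measure (dirac_sum UNIV X (renewal_times W)))"

text \<open>\<open>geometric_pmf\<close> counts failures, starting at 0; here the support is \<open>{1, 2, ...}\<close>.\<close>

definition Geo :: "real \<Rightarrow> nat pmf" where
  "Geo \<theta> = map_pmf Suc (geometric_pmf \<theta>)"

text \<open>The law with the given distribution function; it has an atom of mass \<open>1 - \<theta>\<close> at 0.\<close>

definition W1_law :: "real \<Rightarrow> real measure" where
  "W1_law \<theta> = interval_measure (\<lambda>t. if t < 0 then 0 else 1 - \<theta> + \<theta> * (1 - exp (- \<theta> * t)))"

text \<open>Infinite entry times contribute no point.\<close>

definition N_id ::
    "(nat \<Rightarrow> 'v) measure \<Rightarrow> (nat \<Rightarrow> 'v) set \<Rightarrow> (nat \<Rightarrow> 'v) \<Rightarrow> real measure" where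
  "N_id \<mu> B y = dirac_sum {k. 1 \<le> k \<and> hit_time B k y < \<infinity>} (\<lambda>_. 1)
     (\<lambda>k. measure \<mu> B * real (the_enat (hit_time B k y)))"

end

theory Submission
  imports Defs
begin

text \<open>
  A point process is encoded by \<open>u k = exp (- w k)\<close>, where \<open>w\<close> is its sequence of waiting times. By
  compactness of the cube and the Stone--Weierstrass theorem, convergence in law follows from convergence of
  all mixed moments of \<open>u\<close>. For the entry times to \<open>B n\<close> let \<open>a\<close> and \<open>b\<close> be these moments under \<open>\<mu>\<close> and
  under the conditional measure on \<open>B n\<close>, indexed by the list of exponents. Invariance of \<open>\<mu>\<close> alone gives
  \<open>s * a (s # ss) = b ss - b (s # ss)\<close> in the limit. Together with the second relation
  \<open>b (s # ss) = (1 - \<theta>) * b ss + \<theta> * a (s # ss)\<close> this determines all limits, and they are the moments of the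
  limit processes (\<open>\<theta> = 1\<close> for an aperiodic point).

  For the second relation, the points of \<open>B n\<close> that follow a periodic \<open>x\<close> for another period return after
  \<open>q\<close> steps; conformality of \<open>\<nu>\<close> and Walters' condition show that they are a fraction \<open>1 - \<theta>\<close>
  and contribute the term \<open>(1 - \<theta>) * b ss\<close>. The other points make no visit to \<open>B n\<close> at any fixed time
  when \<open>n\<close> is large. They are followed up to the first visit to \<open>[x 0]\<close> after the initial word has been read.
  By bounded distortion their law then has an almost constant density with respect to \<open>\<nu>\<close> on small
  cylinders, and since the Laplace transforms are asymptotically shift invariant, ergodicity turns their
  integrals into integrals with respect to \<open>\<mu>\<close>. Visits to \<open>B n\<close> up to that time are negligible, because the
  measures of the cylinders \<open>[x 0, \<dots>, x j]\<close>, taken over the visits \<open>j\<close> of \<open>x\<close> to \<open>[x 0]\<close>, form a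
  convergent series, even after multiplication by \<open>j\<close>.
\<close>

section \<open>Point measures as images of decreasing sequences\<close>

text \<open>With an infinite alphabet neither a spectral gap of the transfer operator nor a global
  lower bound for \<open>h\<close> can be expected, so no mixing rate is at hand and ergodicity has
  to suffice. It does because the Laplace transforms are almost invariant: one shift changes them in
  mean by at most a multiple of \<open>prob (B n)\<close>, and a compactness argument gives
  decorrelation of almost invariant functions from any fixed integrable density, uniformly over all
  such functions. Everything is localized to the cylinder of \<open>x 0\<close>: there
  \<open>h\<close> has a positive lower bound, one distortion constant serves all inverse branches,
  and Kac's bound makes the mean return time finite. This first moment is all that is available, and
  it is just enough: restarting at the stopping time \<open>tau\<close> costs
  \<open>prob (B n) * tau\<close>, so after conditioning on \<open>B n\<close> the integral of
  \<open>tau\<close> over \<open>B n\<close> has to vanish, and the extra factor \<open>j\<close> in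
  the series stands for the time already spent. At exponent \<open>s = 0\<close> the relation from
  invariance is empty, and there the second relation alone determines \<open>a\<close>.\<close>

lemma space_half_line [simp]: "space half_line = {0..}"
  by (simp add: half_line_def space_restrict_space)

lemma sets_half_line: "sets half_line = sigma_sets {0..} (range (\<lambda>t::real. {0..t}))"
proof -
  have "sets half_line = (\<inter>) {0..} ` sigma_sets UNIV (range (\<lambda>a::real. {..a}))"
    unfolding half_line_def by (simp add: sets_restrict_space borel_eq_atMost)
  also have "\<dots> = sigma_sets {0..} ((\<inter>) {0..} ` range (\<lambda>a::real. {..a}))"
  proof (rule sigma_sets_Int)
    have "{0..} \<in> sets (borel :: real measure)" by simp
    then show "{0..} \<in> sigma_sets UNIV (range (\<lambda>a::real. {..a}))"
      unfolding borel_eq_atMost by simp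
  qed simp
  also have "(\<inter>) {0..} ` range (\<lambda>a::real. {..a}) = range (\<lambda>t::real. {0..t})"
    by (auto simp: image_iff atLeastAtMost_def atLeast_def)
  finally show ?thesis .
qed

lemma atLeastAtMost_half_line [simp]: "{0..t} \<in> sets half_line"
  unfolding sets_half_line by auto

lemma sets_dirac_sum [simp]: "sets (dirac_sum I c p) = sets half_line"
  by (simp add: dirac_sum_def)

lemma point_measures_atMostE:
  assumes "m \<in> point_measures"
  obtains N where "emeasure m {0..t} = of_nat N"
proof -
  have "emeasure m {0..t} \<in> range of_nat" using assms by (simp add: point_measures_def)
  then show ?thesis using that by auto
qed

text \<open>No measurability of \<open>p\<close> is needed: points outside the half line are simply not counted.\<close>

lemma emeasure_dirac_sum:
  assumes A: "A \<in> sets half_line"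
  shows "emeasure (dirac_sum I c p) A = (\<integral>\<^sup>+ i. of_nat (c i) * indicator A (p i) \<partial>count_space I)"
proof -
  let ?D = "density (count_space I) (\<lambda>i. of_nat (c i))"
  have "emeasure (dirac_sum I c p) A = emeasure ?D (p -` A \<inter> space ?D)"
    unfolding dirac_sum_def distr_def
  proof (rule emeasure_measure_of_sigma)
    show "sigma_algebra (space half_line) (sets half_line)" by (rule sets.sigma_algebra_axioms)
    show "positive (sets half_line) (\<lambda>A. emeasure ?D (p -` A \<inter> space ?D))"
      by (simp add: positive_def)
    show "countably_additive (sets half_line) (\<lambda>A. emeasure ?D (p -` A \<inter> space ?D))"
    proof (rule countably_additiveI)
      fix F :: "nat \<Rightarrow> real set"
      assume "disjoint_family F"
      then have "(\<Sum>i. emeasure ?D (p -` F i \<inter> space ?D)) = emeasure ?D (\<Union>i. p -` F i \<inter> space ?D)"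
        by (intro suminf_emeasure) (auto simp: disjoint_family_on_def)
      also have "(\<Union>i. p -` F i \<inter> space ?D) = p -` (\<Union>i. F i) \<inter> space ?D" by auto
      finally show "(\<Sum>i. emeasure ?D (p -` F i \<inter> space ?D)) = emeasure ?D (p -` (\<Union>i. F i) \<inter> space ?D)" .
    qed
  qed (rule A)
  also have "\<dots> = (\<integral>\<^sup>+ i. of_nat (c i) * indicator A (p i) \<partial>count_space I)"
    by (subst emeasure_density) (auto intro!: nn_integral_cong split: split_indicator)
  finally show ?thesis .
qed

lemma emeasure_dirac_sum_card:
  assumes A: "A \<in> sets half_line" and fin: "finite {i \<in> I. p i \<in> A}"
  shows "emeasure (dirac_sum I (\<lambda>_. 1) p) A = of_nat (card {i \<in> I. p i \<in> A})"
proof -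
  have "emeasure (dirac_sum I (\<lambda>_. 1) p) A = (\<integral>\<^sup>+ i. indicator {i \<in> I. p i \<in> A} i \<partial>count_space I)"
    unfolding emeasure_dirac_sum[OF A] by (intro nn_integral_cong) (auto split: split_indicator)
  also have "\<dots> = emeasure (count_space I) {i \<in> I. p i \<in> A}" by (rule nn_integral_indicator) auto
  also have "\<dots> = of_nat (card {i \<in> I. p i \<in> A})" using fin by (subst emeasure_count_space) auto
  finally show ?thesis .
qed

text \<open>The coordinate \<open>v k = exp (- t)\<close> places the \<open>k\<close>-th point at
  time \<open>t\<close>. The value 0 encodes a point at infinity and produces no atom, so processes
  with finitely many points fit into the same picture.\<close>

definition points_of :: "(nat \<Rightarrow> real) \<Rightarrow> real measure" where
  "points_of v = dirac_sum {k. 0 < v k} (\<lambda>_. 1) (\<lambda>k. - ln (v k))"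

text \<open>Decreasing coordinates list the points in order of time; convergence to 0 is local
  finiteness, since then only finitely many points lie before any given time.\<close>

definition null_seqs :: "(nat \<Rightarrow> real) set" where
  "null_seqs = {v. decseq v \<and> (\<forall>k. 0 \<le> v k \<and> v k \<le> 1) \<and> v \<longlonglongrightarrow> 0}"

lemma null_seqs_eventually_less:
  assumes "v \<in> null_seqs" "0 < e"
  obtains n where "\<And>k. n \<le> k \<Longrightarrow> v k < e"
proof -
  have "\<forall>\<^sub>F k in sequentially. v k < e"
    using assms by (auto simp: null_seqs_def intro: order_tendstoD)
  then show ?thesis using that by (auto simp: eventually_sequentially)
qed

lemma emeasure_points_of:
  assumes A: "A \<in> sets half_line" and fin: "finite {k. 0 < v k \<and> - ln (v k) \<in> A}"
  shows "emeasure (points_of v) A = of_nat (card {k. 0 < v k \<and> - ln (v k) \<in> A})"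
  using emeasure_dirac_sum_card[OF A, of "{k. 0 < v k}" "\<lambda>k. - ln (v k)"] fin by (simp add: points_of_def)

lemma points_of_point_measures:
  assumes v: "v \<in> null_seqs"
  shows "points_of v \<in> point_measures"
proof -
  have "emeasure (points_of v) C \<in> range of_nat" if C: "C \<in> sets half_line" "bounded C" for C
  proof -
    obtain K where K: "\<And>t. t \<in> C \<Longrightarrow> t \<le> K"
      using C(2) by (metis bounded_real abs_le_iff)
    obtain n where n: "\<And>k. n \<le> k \<Longrightarrow> v k < exp (- K)"
      using null_seqs_eventually_less[OF v, of "exp (- K)"] by auto
    have "k < n" if "0 < v k" "- ln (v k) \<in> C" for k
    proof (rule ccontr)
      assume "\<not> k < n"
      then have "ln (v k) < - K" using n[of k] that by (metis not_less ln_exp ln_less_cancel_iff exp_gt_zero)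
      then show False using K[OF that(2)] by simp
    qed
    then have "{k. 0 < v k \<and> - ln (v k) \<in> C} \<subseteq> {..<n}" by auto
    then have "finite {k. 0 < v k \<and> - ln (v k) \<in> C}" by (rule finite_subset) simp
    then show ?thesis by (simp add: emeasure_points_of[OF C(1)])
  qed
  then show ?thesis by (simp add: point_measures_def points_of_def)
qed

lemma point_measures_eqI:
  assumes "m1 \<in> point_measures" "m2 \<in> point_measures"
    and eq: "\<And>t. 0 \<le> t \<Longrightarrow> emeasure m1 {0..t} = emeasure m2 {0..t}"
  shows "m1 = m2"
proof (rule measure_eqI_generator_eq)
  let ?E = "range (\<lambda>t::real. {0..t})"
  show "Int_stable ?E"
  proof (rule Int_stableI_image)
    fix i j :: real
    show "\<exists>k\<in>UNIV. {0..i} \<inter> {0..j} = {0..k}"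
      by (rule bexI[of _ "min i j"]) auto
  qed
  show "?E \<subseteq> Pow {0..}" by auto
  show "emeasure m1 X = emeasure m2 X" if X: "X \<in> ?E" for X
  proof -
    obtain t where t: "X = {0..t}" using X by auto
    show ?thesis using eq[of t] by (cases "0 \<le> t") (auto simp: t)
  qed
  show "sets m1 = sigma_sets {0..} ?E" "sets m2 = sigma_sets {0..} ?E"
    using assms by (simp_all add: point_measures_def sets_half_line)
  show "range (\<lambda>n. {0..real n}) \<subseteq> ?E" by auto
  show "(\<Union>n. {0..real n}) = {0..}"
    by (auto simp: real_arch_simple)
  show "emeasure m1 {0..real n} \<noteq> \<infinity>" for n
  proof -
    have "emeasure m1 {0..real n} \<in> range of_nat" using assms(1) by (simp add: point_measures_def)
    then show ?thesis by auto
  qed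
qed

text \<open>\<open>- ln (quantile_seq m k)\<close> is the position of the \<open>k\<close>-th point of \<open>m\<close>, counted from 0.\<close>

definition quantile_seq :: "real measure \<Rightarrow> nat \<Rightarrow> real" where
  "quantile_seq m k = Sup (insert 0 {exp (- t) | t. 0 \<le> t \<and> of_nat (Suc k) \<le> emeasure m {0..t}})"

lemma bdd_above_quantile:
  "bdd_above (insert 0 {exp (- t) | t::real. 0 \<le> t \<and> P t})"
  by (rule bdd_aboveI[of _ 1]) auto

text \<open>The Galois connection between a distribution function and its generalized inverse,
  turned into a supremum by the decreasing map \<open>exp (- t)\<close>. The supremum first yields
  the count only on strictly longer intervals; continuity of \<open>m\<close> from above then brings
  it down to \<open>{0..t}\<close>.\<close>

lemma quantile_seq_ge_iff:
  assumes m: "m \<in> point_measures" and t: "0 \<le> t"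
  shows "exp (- t) \<le> quantile_seq m k \<longleftrightarrow> of_nat (Suc k) \<le> emeasure m {0..t}"
proof
  assume "of_nat (Suc k) \<le> emeasure m {0..t}"
  then show "exp (- t) \<le> quantile_seq m k"
    unfolding quantile_seq_def using t by (intro cSup_upper bdd_above_quantile) auto
next
  have sets_m: "sets m = sets half_line" using m by (simp add: point_measures_def)
  assume le: "exp (- t) \<le> quantile_seq m k"
  have *: "of_nat (Suc k) \<le> emeasure m {0..s}" if s: "t < s" for s
  proof -
    have "exp (- s) < quantile_seq m k" using le s by (smt (verit) exp_less_cancel_iff)
    then obtain z where z: "z \<in> insert 0 {exp (- t) | t. 0 \<le> t \<and> of_nat (Suc k) \<le> emeasure m {0..t}}"
        "exp (- s) < z"
      unfolding quantile_seq_def by (subst (asm) less_cSup_iff[OF _ bdd_above_quantile]) auto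
    then obtain t' where t': "z = exp (- t')" "of_nat (Suc k) \<le> emeasure m {0..t'}"
      using exp_gt_zero[of "- s"] by (auto simp del: exp_gt_zero)
    have "{0..t'} \<subseteq> {0..s}" using z(2) t'(1) by auto
    then have "emeasure m {0..t'} \<le> emeasure m {0..s}"
      by (intro emeasure_mono) (auto simp: sets_m)
    then show ?thesis using t'(2) by (rule order_trans[rotated])
  qed
  have "(\<lambda>n. emeasure m {0..t + 1 / real (Suc n)}) \<longlonglongrightarrow> emeasure m (\<Inter>n. {0..t + 1 / real (Suc n)})"
  proof (rule Lim_emeasure_decseq)
    show "range (\<lambda>n. {0..t + 1 / real (Suc n)}) \<subseteq> sets m" by (auto simp: sets_m)
    show "decseq (\<lambda>n. {0..t + 1 / real (Suc n)})"
      by (rule decseq_SucI) (auto simp: field_simps intro: order_trans)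
    show "emeasure m {0..t + 1 / real (Suc n)} \<noteq> \<infinity>" for n
    proof -
      have "emeasure m {0..t + 1 / real (Suc n)} \<in> range of_nat"
        using m by (simp add: point_measures_def)
      then show ?thesis by auto
    qed
  qed
  also have "(\<Inter>n. {0..t + 1 / real (Suc n)}) = {0..t}"
  proof -
    have "y \<le> t" if "\<And>n. y \<le> t + 1 / real (Suc n)" for y
    proof (rule ccontr)
      assume "\<not> y \<le> t"
      then obtain n where "inverse (real (Suc n)) < y - t" using reals_Archimedean[of "y - t"] by auto
      then show False using that[of n] by (simp add: field_simps)
    qed
    then show ?thesis
      by (auto simp del: of_nat_Suc intro!: add_increasing2)
  qed
  finally show "of_nat (Suc k) \<le> emeasure m {0..t}"
    by (rule tendsto_lowerbound) (auto simp del: of_nat_Suc intro!: always_eventually *)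
qed

lemma quantile_seq_null_seqs:
  assumes m: "m \<in> point_measures"
  shows "quantile_seq m \<in> null_seqs"
proof -
  have ge0: "0 \<le> quantile_seq m k" for k
    unfolding quantile_seq_def by (intro cSup_upper bdd_above_quantile) auto
  have le1: "quantile_seq m k \<le> 1" for k
    unfolding quantile_seq_def by (intro cSup_least) auto
  have dec: "decseq (quantile_seq m)"
  proof (rule decseq_SucI)
    fix k
    have "of_nat (Suc k) \<le> z" if "of_nat (Suc (Suc k)) \<le> z" for z :: ennreal
      by (rule order_trans[OF _ that]) (simp add: of_nat_mono del: of_nat_Suc)
    then show "quantile_seq m (Suc k) \<le> quantile_seq m k"
      unfolding quantile_seq_def by (intro cSup_subset_mono bdd_above_quantile) auto
  qed
  have "\<forall>\<^sub>F k in sequentially. quantile_seq m k < e" if "0 < e" for e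
  proof (cases "e \<le> 1")
    case True
    define t where "t = - ln e"
    have t: "0 \<le> t" "exp (- t) = e" using True that by (auto simp: t_def)
    obtain N where N: "emeasure m {0..t} = of_nat N" using m by (rule point_measures_atMostE)
    have "quantile_seq m k < e" if "N \<le> k" for k
    proof -
      have "\<not> of_nat (Suc k) \<le> (of_nat N :: ennreal)" using that by (simp del: of_nat_Suc)
      then show ?thesis using quantile_seq_ge_iff[OF m t(1), of k] N t(2) by simp
    qed
    then show ?thesis by (auto simp: eventually_sequentially)
  next
    case False
    then show ?thesis using le1 by (intro always_eventually) (metis order.strict_trans1 not_le)
  qed
  then have "quantile_seq m \<longlonglongrightarrow> 0"
    using ge0 by (intro order_tendstoI) (auto intro!: always_eventually intro: order.strict_trans2)
  then show ?thesis using ge0 le1 dec by (simp add: null_seqs_def)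
qed

text \<open>Every point measure is thus the image of a null sequence, so a random point measure may
  be handled through its quantile sequence. It suffices to compare the intervals
  \<open>{0..t}\<close>, where the Galois connection singles out exactly the indices below the
  count.\<close>

lemma points_of_quantile_seq:
  assumes m: "m \<in> point_measures"
  shows "points_of (quantile_seq m) = m"
proof (rule point_measures_eqI)
  show "points_of (quantile_seq m) \<in> point_measures"
    by (intro points_of_point_measures quantile_seq_null_seqs m)
  fix t :: real assume t: "0 \<le> t"
  let ?v = "quantile_seq m"
  obtain N where N: "emeasure m {0..t} = of_nat N" using m by (rule point_measures_atMostE)
  have bd: "0 \<le> ?v k" "?v k \<le> 1" for k
    using quantile_seq_null_seqs[OF m] by (auto simp: null_seqs_def)
  have "0 < ?v k \<and> - ln (?v k) \<in> {0..t} \<longleftrightarrow> exp (- t) \<le> ?v k" for k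
  proof
    assume *: "0 < ?v k \<and> - ln (?v k) \<in> {0..t}"
    then have "- t \<le> ln (?v k)" by auto
    then show "exp (- t) \<le> ?v k" using * by (simp add: ln_ge_iff)
  next
    assume *: "exp (- t) \<le> ?v k"
    then have "0 < ?v k" using exp_gt_zero[of "- t"] by linarith
    then show "0 < ?v k \<and> - ln (?v k) \<in> {0..t}"
      using * bd[of k] by (auto simp: ln_ge_iff minus_le_iff[of _ t])
  qed
  moreover have "exp (- t) \<le> ?v k \<longleftrightarrow> k < N" for k
    using quantile_seq_ge_iff[OF m t, of k] by (simp add: N Suc_le_eq del: of_nat_Suc)
  ultimately have "{k. 0 < ?v k \<and> - ln (?v k) \<in> {0..t}} = {..<N}"
    by (simp add: lessThan_def)
  then show "emeasure (points_of ?v) {0..t} = emeasure m {0..t}"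
    by (simp add: emeasure_points_of N)
qed (rule m)

lemma test_functionsE:
  assumes "f \<in> test_functions"
  obtains K where "0 \<le> K" "\<And>t. K \<le> t \<Longrightarrow> f t = 0" "continuous_on {0..} f"
proof -
  obtain K where K: "\<forall>t\<ge>0. t \<ge> K \<longrightarrow> f t = 0" and c: "continuous_on {0..} f"
    using assms by (auto simp: test_functions_def)
  show ?thesis by (rule that[of "max 0 K"]) (use K c in auto)
qed

lemma integral_points_of:
  fixes f :: "real \<Rightarrow> real"
  assumes f: "continuous_on {0..} f" and K: "\<And>t. K \<le> t \<Longrightarrow> f t = 0"
    and v: "\<And>k. v k \<le> 1" and n: "\<And>k. n \<le> k \<Longrightarrow> v k < exp (- K)"
  shows "integral\<^sup>L (points_of v) f = (\<Sum>k<n. if 0 < v k then f (- ln (v k)) else 0)"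
proof -
  have meas: "f \<in> borel_measurable half_line"
    unfolding half_line_def by (rule borel_measurable_continuous_on_restrict[OF f])
  let ?I = "{k. 0 < v k}"
  have dens: "density (count_space ?I) (\<lambda>i. of_nat 1) = count_space ?I"
    by (simp add: density_1)
  have "integral\<^sup>L (points_of v) f = integral\<^sup>L (count_space ?I) (\<lambda>k. f (- ln (v k)))"
    unfolding points_of_def dirac_sum_def dens
    by (rule integral_distr[OF _ meas]) (use v in auto)
  also have "\<dots> = (\<Sum>k | k \<in> ?I \<and> f (- ln (v k)) \<noteq> 0. f (- ln (v k)))"
  proof (rule lebesgue_integral_count_space_finite_support)
    have "k < n" if "0 < v k" "f (- ln (v k)) \<noteq> 0" for k
    proof (rule ccontr)
      assume "\<not> k < n"
      then have "ln (v k) < - K" using n[of k] that by (metis not_less ln_exp ln_less_cancel_iff exp_gt_zero)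
      then show False using K[of "- ln (v k)"] that by simp
    qed
    then have "{k \<in> ?I. f (- ln (v k)) \<noteq> 0} \<subseteq> {..<n}" by auto
    then show "finite {k \<in> ?I. f (- ln (v k)) \<noteq> 0}" by (rule finite_subset) simp
  qed
  also have "\<dots> = (\<Sum>k<n. if 0 < v k then f (- ln (v k)) else 0)"
  proof (rule sum.mono_neutral_cong_left)
    show "{k. k \<in> ?I \<and> f (- ln (v k)) \<noteq> 0} \<subseteq> {..<n}"
    proof
      fix k assume "k \<in> {k. k \<in> ?I \<and> f (- ln (v k)) \<noteq> 0}"
      then have *: "0 < v k" "f (- ln (v k)) \<noteq> 0" by auto
      show "k \<in> {..<n}"
      proof (rule ccontr)
        assume "k \<notin> {..<n}"
        then have "ln (v k) < - K" using n[of k] * by (metis lessThan_iff not_less ln_exp ln_less_cancel_iff exp_gt_zero)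
        then show False using K[of "- ln (v k)"] * by simp
      qed
    qed
  qed auto
  finally show ?thesis .
qed

text \<open>Coordinatewise convergence alone would not control infinitely many points. As the
  sequences decrease, one index \<open>n\<close> with \<open>v n < exp (- K)\<close> confines all
  later points of nearby sequences to times beyond the support of \<open>f\<close>, and the integral
  becomes a sum of \<open>n\<close> continuous terms.\<close>

lemma continuous_on_integral_points_of:
  assumes f: "f \<in> test_functions"
  shows "continuous_on null_seqs (\<lambda>v. integral\<^sup>L (points_of v) f)"
proof -
  obtain K where K: "0 \<le> K" "\<And>t. K \<le> t \<Longrightarrow> f t = 0" and c: "continuous_on {0..} f"
    using test_functionsE[OF f] by metis
  \<comment> \<open>Truncation at \<open>exp (- (K + 1))\<close>, where the test function already
    vanishes, gives a function that is continuous also at \<open>w = 0\<close> and so covers missing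
    points.\<close>
  define g where "g w = f (- ln (max (exp (- (K + 1))) w))" for w
  have g: "(if 0 < w then f (- ln w) else 0) = g w" if "w \<le> 1" for w
  proof (cases "exp (- (K + 1)) \<le> w")
    case True
    then have "0 < w" using exp_gt_zero[of "- (K + 1)"] by linarith
    then show ?thesis using True by (simp add: g_def max_def)
  next
    case False
    have "f (- ln w) = 0" if "0 < w"
    proof -
      have "ln w < - (K + 1)" using False that
        by (metis not_le ln_exp ln_less_cancel_iff exp_gt_zero)
      then show ?thesis by (intro K(2)) simp
    qed
    then show ?thesis using False K(2)[of "K + 1"] by (auto simp: g_def max_def add.commute)
  qed
  have gc: "continuous_on {..1} g"
    unfolding g_def
  proof (rule continuous_on_compose2[OF c])
    have pos: "0 < max (exp (- (K + 1))) w" for w :: real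
      using exp_gt_zero[of "- (K + 1)"] by linarith
    show "continuous_on {..1} (\<lambda>w. - ln (max (exp (- (K + 1))) w))"
      using pos by (intro continuous_intros) (metis less_irrefl)
    show "(\<lambda>w. - ln (max (exp (- (K + 1))) w)) ` {..1} \<subseteq> {0..}"
      using pos K(1) by auto
  qed
  show ?thesis
    unfolding continuous_on_sequentially comp_def
  proof (intro allI impI ballI, elim conjE)
    fix X :: "nat \<Rightarrow> nat \<Rightarrow> real" and v
    assume v: "v \<in> null_seqs" and X: "\<forall>n. X n \<in> null_seqs" and lim: "X \<longlonglongrightarrow> v"
    have lim_k: "(\<lambda>n. X n k) \<longlonglongrightarrow> v k" for k
    proof -
      have "continuous_on UNIV (\<lambda>v::nat \<Rightarrow> real. v k)" by (rule continuous_on_product_coordinates)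
      then show ?thesis by (rule continuous_on_tendsto_compose[OF _ lim]) simp_all
    qed
    obtain n where n: "\<And>k. n \<le> k \<Longrightarrow> v k < exp (- K)"
      using null_seqs_eventually_less[OF v, of "exp (- K)"] by auto
    have le1: "v k \<le> 1" "X i k \<le> 1" for i k using v X by (auto simp: null_seqs_def)
    have "\<forall>\<^sub>F i in sequentially. X i n < exp (- K)"
      using order_tendstoD(2)[OF lim_k n[OF order_refl]] .
    then have ev: "\<forall>\<^sub>F i in sequentially. (\<Sum>k<n. g (X i k)) = integral\<^sup>L (points_of (X i)) f"
    proof eventually_elim
      case (elim i)
      have "X i k < exp (- K)" if "n \<le> k" for k
      proof -
        have "X i k \<le> X i n" using X that by (auto simp: null_seqs_def decseq_def)
        then show ?thesis using elim by linarith
      qed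
      then show ?case
        by (subst integral_points_of[OF c K(2)]) (auto simp: le1 g)
    qed
    have "(\<lambda>i. \<Sum>k<n. g (X i k)) \<longlonglongrightarrow> (\<Sum>k<n. g (v k))"
      by (intro tendsto_sum continuous_on_tendsto_compose[OF gc lim_k] always_eventually)
        (auto simp: le1)
    also have "(\<Sum>k<n. g (v k)) = integral\<^sup>L (points_of v) f"
      by (subst integral_points_of[OF c K(2)]) (auto simp: le1 g n)
    finally show "(\<lambda>i. integral\<^sup>L (points_of (X i)) f) \<longlonglongrightarrow> integral\<^sup>L (points_of v) f"
      using Lim_transform_eventually[OF _ ev] by blast
  qed
qed

lemma continuous_map_points_of:
  "continuous_map (top_of_set null_seqs) vague_topology points_of"
  unfolding vague_topology_def
proof (rule continuous_on_generated_topo)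
  let ?S = "{{m \<in> point_measures. integral\<^sup>L m f \<in> U} | f U. f \<in> test_functions \<and> open U}"
  show "points_of ` topspace (top_of_set null_seqs) \<subseteq> \<Union> ?S"
  proof -
    have "\<Union> ?S = point_measures"
      using topspace_vague_topology
      by (simp add: vague_topology_def topology_generated_by_topspace)
    then show ?thesis using points_of_point_measures by auto
  qed
  fix E assume "E \<in> ?S"
  then obtain f U where E: "E = {m \<in> point_measures. integral\<^sup>L m f \<in> U}"
    and f: "f \<in> test_functions" and U: "open U" by blast
  have "points_of -` E \<inter> topspace (top_of_set null_seqs)
      = null_seqs \<inter> (\<lambda>v. integral\<^sup>L (points_of v) f) -` U"
    using points_of_point_measures by (auto simp: E)
  also have "openin (top_of_set null_seqs) \<dots>"
    by (rule continuous_openin_preimage_gen[OF continuous_on_integral_points_of[OF f] U])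
  finally show "openin (top_of_set null_seqs) (points_of -` E \<inter> topspace (top_of_set null_seqs))" .
qed

section \<open>Measurability of random point measures\<close>

lemma space_borel_of: "space (borel_of X) = topspace X"
  unfolding borel_of_def by (rule space_measure_of) (auto dest: openin_subset)

lemma sets_borel_of: "sets (borel_of X) = sigma_sets (topspace X) {U. openin X U}"
  unfolding borel_of_def by (rule sets_measure_of) (auto dest: openin_subset)

lemma borel_measurable_borel_of:
  assumes "continuous_map X euclidean F"
  shows "F \<in> borel_measurable (borel_of X)"
proof (rule borel_measurableI)
  fix S :: "'b set" assume "open S"
  then have "openin X {x \<in> topspace X. F x \<in> S}"
    using assms by (auto simp: continuous_map_def)
  moreover have "{x \<in> topspace X. F x \<in> S} = F -` S \<inter> space (borel_of X)"
    by (auto simp: space_borel_of)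
  ultimately show "F -` S \<inter> space (borel_of X) \<in> sets (borel_of X)"
    by (auto simp: sets_borel_of)
qed

lemma measurable_points_of:
  assumes v: "v \<in> borel_measurable M" and null: "\<And>\<omega>. \<omega> \<in> space M \<Longrightarrow> v \<omega> \<in> null_seqs"
  shows "(\<lambda>\<omega>. points_of (v \<omega>)) \<in> measurable M (borel_of vague_topology)"
  unfolding borel_of_def
proof (rule measurable_measure_of)
  show "{U. openin vague_topology U} \<subseteq> Pow (topspace vague_topology)"
    by (auto dest: openin_subset)
  show "(\<lambda>\<omega>. points_of (v \<omega>)) \<in> space M \<rightarrow> topspace vague_topology"
    by (auto simp: topspace_vague_topology intro: points_of_point_measures null)
  fix E assume "E \<in> {U. openin vague_topology U}"
  then have "openin (top_of_set null_seqs) {w \<in> topspace (top_of_set null_seqs). points_of w \<in> E}"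
    by (intro openin_continuous_map_preimage[OF continuous_map_points_of]) simp
  then obtain Q where Q: "open Q" "{w \<in> null_seqs. points_of w \<in> E} = null_seqs \<inter> Q"
    by (auto simp: openin_open)
  then have "(\<lambda>\<omega>. points_of (v \<omega>)) -` E \<inter> space M = v -` Q \<inter> space M"
    using null by blast
  also have "\<dots> \<in> sets M" using v Q(1) by (simp add: in_borel_measurable_borel)
  finally show "(\<lambda>\<omega>. points_of (v \<omega>)) -` E \<inter> space M \<in> sets M" .
qed

text \<open>The map factors through \<open>quantile_seq\<close>, whose superlevel sets are, by
  \<open>quantile_seq_ge_iff\<close>, events about the counts on intervals \<open>{0..t}\<close>;
  the way back is \<open>points_of\<close>, which is continuous on null sequences.\<close>

proposition measurable_point_process:
  assumes N: "\<And>\<omega>. \<omega> \<in> space M \<Longrightarrow> N \<omega> \<in> point_measures"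
    and meas: "\<And>t. 0 \<le> t \<Longrightarrow> (\<lambda>\<omega>. emeasure (N \<omega>) {0..t}) \<in> borel_measurable M"
  shows "N \<in> measurable M (borel_of vague_topology)"
proof -
  have "(\<lambda>\<omega>. quantile_seq (N \<omega>) k) \<in> borel_measurable M" for k
    unfolding borel_measurable_iff_ge
  proof
    fix c :: real
    have bd: "0 \<le> quantile_seq (N \<omega>) k" "quantile_seq (N \<omega>) k \<le> 1" if "\<omega> \<in> space M" for \<omega>
      using quantile_seq_null_seqs[OF N[OF that]] by (auto simp: null_seqs_def)
    consider "c \<le> 0" | "1 < c" | t where "0 \<le> t" "c = exp (- t)"
    proof (cases "c \<le> 0 \<or> 1 < c")
      case False
      then have "0 \<le> - ln c" "c = exp (- (- ln c))" by auto
      then show ?thesis using that by blast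
    qed (use that in blast)
    then show "{\<omega> \<in> space M. c \<le> quantile_seq (N \<omega>) k} \<in> sets M"
    proof cases
      case 1
      then have "{\<omega> \<in> space M. c \<le> quantile_seq (N \<omega>) k} = space M"
        using bd(1) by (auto intro: order_trans)
      then show ?thesis by simp
    next
      case 2
      then have "{\<omega> \<in> space M. c \<le> quantile_seq (N \<omega>) k} = {}"
        using bd(2) by fastforce
      then show ?thesis by (simp only: sets.empty_sets)
    next
      case (3 t)
      then have "{\<omega> \<in> space M. c \<le> quantile_seq (N \<omega>) k}
          = {\<omega> \<in> space M. of_nat (Suc k) \<le> emeasure (N \<omega>) {0..t}}"
        using quantile_seq_ge_iff[OF N] by auto
      also have "\<dots> \<in> sets M" using meas[OF 3(1)] by measurable
      finally show ?thesis .
    qed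
  qed
  then have "(\<lambda>\<omega>. quantile_seq (N \<omega>)) \<in> borel_measurable M"
    by (rule measurable_coordinatewise_then_product)
  then have "(\<lambda>\<omega>. points_of (quantile_seq (N \<omega>))) \<in> measurable M (borel_of vague_topology)"
    by (rule measurable_points_of) (intro quantile_seq_null_seqs N)
  then show ?thesis
    by (rule measurable_cong[THEN iffD1, rotated]) (simp add: points_of_quantile_seq N)
qed

section \<open>Convergence of point processes from mixed moments\<close>

text \<open>In the coordinates \<open>u k = exp (- w k)\<close>, where \<open>w\<close> are the waiting times, sequences of points
  become elements of a compact cube, and an infinite waiting time is the regular value 0.\<close>

definition unit_cube :: "(nat \<Rightarrow> real) set" where
  "unit_cube = {u. \<forall>k. 0 \<le> u k \<and> u k \<le> 1}"

text \<open>Products of gap coordinates are position coordinates: they equal \<open>exp\<close> of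
  minus the sum of the first \<open>Suc k\<close> waiting times, and stay 0 after an infinite
  gap.\<close>

definition cumprod :: "(nat \<Rightarrow> real) \<Rightarrow> nat \<Rightarrow> real" where
  "cumprod u k = (\<Prod>i\<le>k. u i)"

definition monomial :: "nat \<Rightarrow> (nat \<Rightarrow> nat) \<Rightarrow> (nat \<Rightarrow> real) \<Rightarrow> real" where
  "monomial m e u = (\<Prod>i<m. u i ^ e i)"

inductive_set monomial_span :: "((nat \<Rightarrow> real) \<Rightarrow> real) set" where
  smult: "(\<lambda>u. c * monomial m e u) \<in> monomial_span"
| add: "f \<in> monomial_span \<Longrightarrow> g \<in> monomial_span \<Longrightarrow> (\<lambda>u. f u + g u) \<in> monomial_span"

lemma monomial_mult:
  "monomial m e u * monomial m' e' u =
     monomial (max m m') (\<lambda>i. (if i < m then e i else 0) + (if i < m' then e' i else 0)) u"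
proof -
  have *: "monomial m e u = (\<Prod>i<n. u i ^ (if i < m then e i else 0))" if "m \<le> n" for m n e
    unfolding monomial_def using that by (intro prod.mono_neutral_cong_left) auto
  show ?thesis
    unfolding *[OF max.cobounded1[of m m'], of e] *[OF max.cobounded2[of m' m], of e']
    by (simp add: monomial_def power_add prod.distrib)
qed

lemma monomial_span_mult:
  assumes "f \<in> monomial_span" "g \<in> monomial_span"
  shows "(\<lambda>u. f u * g u) \<in> monomial_span"
  using assms
proof (induction f arbitrary: g)
  case (smult c m e)
  from smult.prems show ?case
  proof induction
    case (smult c' m' e')
    have eq: "(\<lambda>u. c * monomial m e u * (c' * monomial m' e' u)) = (\<lambda>u. (c * c') *
       monomial (max m m') (\<lambda>i. (if i < m then e i else 0) + (if i < m' then e' i else 0)) u)"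
      by (simp add: monomial_mult[symmetric] fun_eq_iff)
    show ?case unfolding eq by (rule monomial_span.smult)
  next
    case (add f g)
    then show ?case using monomial_span.add by (simp add: distrib_left)
  qed
next
  case (add f g h)
  then show ?case using monomial_span.add by (simp add: distrib_right)
qed

lemma continuous_on_monomial: "continuous_on S (monomial m e)"
  unfolding monomial_def
  by (intro continuous_intros continuous_on_subset[OF continuous_on_product_coordinates]) auto

lemma continuous_on_monomial_span: "f \<in> monomial_span \<Longrightarrow> continuous_on S f"
  by (induction rule: monomial_span.induct) (auto intro!: continuous_intros continuous_on_monomial)

lemma compact_unit_cube: "compact unit_cube"
proof -
  have "unit_cube = PiE UNIV (\<lambda>_. {0..1})"
    by (auto simp: unit_cube_def PiE_def)
  moreover have "compactin (product_topology (\<lambda>_::nat. euclidean :: real topology) UNIV) (PiE UNIV (\<lambda>_. {0..1}))"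
    unfolding compactin_PiE by (simp add: compactin_euclidean_iff)
  ultimately show ?thesis
    by (simp add: euclidean_product_topology compactin_euclidean_iff)
qed

interpretation cube_ring: function_ring_on monomial_span unit_cube
proof
  show "compact unit_cube" by (rule compact_unit_cube)
  show "continuous_on unit_cube f" if "f \<in> monomial_span" for f
    using that by (rule continuous_on_monomial_span)
  show "(\<lambda>x. f x + g x) \<in> monomial_span" if "f \<in> monomial_span" "g \<in> monomial_span" for f g
    using that by (rule monomial_span.add)
  show "(\<lambda>x. f x * g x) \<in> monomial_span" if "f \<in> monomial_span" "g \<in> monomial_span" for f g
    using that by (rule monomial_span_mult)
  show "(\<lambda>_. c) \<in> monomial_span" for c
    using monomial_span.smult[of c 0] by (simp add: monomial_def)
  show "\<exists>f\<in>monomial_span. f x \<noteq> f y" if "x \<noteq> y" for x y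
  proof -
    obtain k where k: "x k \<noteq> y k" using \<open>x \<noteq> y\<close> by (meson ext)
    have "monomial (Suc k) (\<lambda>i. if i = k then 1 else 0) u = u k" for u
      unfolding monomial_def by (simp add: lessThan_Suc prod.neutral)
    then have "(\<lambda>u. u k) \<in> monomial_span"
      using monomial_span.smult[of 1 "Suc k" "\<lambda>i. if i = k then 1 else 0"] by simp
    then show ?thesis using k by (intro bexI[of _ "\<lambda>u. u k"])
  qed
qed

lemma monomial_bounds: "u \<in> unit_cube \<Longrightarrow> 0 \<le> monomial m e u \<and> monomial m e u \<le> 1"
  unfolding monomial_def
  by (auto simp: unit_cube_def intro!: prod_nonneg prod_le_1 power_le_one)

lemma monomial_measurable [measurable (raw)]:
  fixes U :: "'a \<Rightarrow> nat \<Rightarrow> real"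
  shows "U \<in> borel_measurable M \<Longrightarrow> (\<lambda>\<omega>. monomial m e (U \<omega>)) \<in> borel_measurable M"
  using borel_measurable_continuous_onI[OF continuous_on_monomial]
  by (rule measurable_compose[rotated])

lemma (in prob_space) integrable_monomial:
  assumes "U \<in> borel_measurable M" "\<And>\<omega>. \<omega> \<in> space M \<Longrightarrow> U \<omega> \<in> unit_cube"
  shows "integrable M (\<lambda>\<omega>. monomial m e (U \<omega>))"
proof (rule integrable_const_bound)
  show "AE \<omega> in M. norm (monomial m e (U \<omega>)) \<le> 1"
    using monomial_bounds[OF assms(2)] by (intro AE_I2) simp
qed (use assms(1) in measurable)

lemma (in prob_space) integrable_monomial_span:
  assumes "f \<in> monomial_span"
    and "U \<in> borel_measurable M" "\<And>\<omega>. \<omega> \<in> space M \<Longrightarrow> U \<omega> \<in> unit_cube"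
  shows "integrable M (\<lambda>\<omega>. f (U \<omega>))"
  using assms by (induction rule: monomial_span.induct) (auto intro: integrable_monomial)

lemma moments_imp_continuous:
  fixes M :: "nat \<Rightarrow> 'a measure" and U :: "nat \<Rightarrow> 'a \<Rightarrow> nat \<Rightarrow> real"
    and Q :: "'b measure" and V :: "'b \<Rightarrow> nat \<Rightarrow> real" and g :: "(nat \<Rightarrow> real) \<Rightarrow> real"
  assumes prob: "\<And>n. prob_space (M n)" "prob_space Q"
    and U: "\<And>n. U n \<in> borel_measurable (M n)" "\<And>n \<omega>. \<omega> \<in> space (M n) \<Longrightarrow> U n \<omega> \<in> unit_cube"
    and V: "V \<in> borel_measurable Q" "\<And>\<omega>. \<omega> \<in> space Q \<Longrightarrow> V \<omega> \<in> unit_cube"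
    and moments: "\<And>m e. (\<lambda>n. \<integral>\<omega>. monomial m e (U n \<omega>) \<partial>M n) \<longlonglongrightarrow> (\<integral>\<omega>. monomial m e (V \<omega>) \<partial>Q)"
    and g: "continuous_on UNIV g"
  shows "(\<lambda>n. \<integral>\<omega>. g (U n \<omega>) \<partial>M n) \<longlonglongrightarrow> (\<integral>\<omega>. g (V \<omega>) \<partial>Q)"
proof -
  have span: "(\<lambda>n. \<integral>\<omega>. p (U n \<omega>) \<partial>M n) \<longlonglongrightarrow> (\<integral>\<omega>. p (V \<omega>) \<partial>Q)" if "p \<in> monomial_span" for p
    using that
  proof induction
    case (smult c m e)
    then show ?case by (simp add: tendsto_mult_left moments)
  next
    case (add f g)
    then show ?case
      using prob U V by (simp add: Bochner_Integration.integral_add prob_space.integrable_monomial_span tendsto_add)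
  qed
  have gm: "g \<in> borel_measurable borel" using g by (rule borel_measurable_continuous_onI)
  have "compact (g ` unit_cube)"
    by (rule compact_continuous_image[OF continuous_on_subset[OF g] compact_unit_cube]) simp
  then obtain B where B: "\<And>u. u \<in> unit_cube \<Longrightarrow> \<bar>g u\<bar> \<le> B"
    by (force dest!: compact_imp_bounded simp: bounded_iff)
  \<comment> \<open>Stated for an arbitrary probability space, as it serves the approximating
    processes and the limit process, which live on different spaces.\<close>
  have close: "\<bar>(\<integral>\<omega>. g (W \<omega>) \<partial>P) - (\<integral>\<omega>. p (W \<omega>) \<partial>P)\<bar> \<le> d"
    if P: "prob_space P" and W: "W \<in> borel_measurable P" "\<And>\<omega>. \<omega> \<in> space P \<Longrightarrow> W \<omega> \<in> unit_cube"
      and p: "p \<in> monomial_span" and d: "\<And>u. u \<in> unit_cube \<Longrightarrow> \<bar>g u - p u\<bar> < d"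
    for P :: "'c measure" and W p d
  proof -
    interpret P: prob_space P by (rule P)
    have ig: "integrable P (\<lambda>\<omega>. g (W \<omega>))"
      using W B gm by (intro P.integrable_const_bound[of _ B]) auto
    have ip: "integrable P (\<lambda>\<omega>. p (W \<omega>))"
      by (rule P.integrable_monomial_span[OF p W])
    have "\<bar>\<integral>\<omega>. g (W \<omega>) - p (W \<omega>) \<partial>P\<bar> \<le> (\<integral>\<omega>. \<bar>g (W \<omega>) - p (W \<omega>)\<bar> \<partial>P)"
      by (rule integral_abs_bound)
    also have "\<dots> \<le> (\<integral>\<omega>. d \<partial>P)"
      using d W(2) ig ip by (intro integral_mono) (auto intro: less_imp_le)
    finally show ?thesis using ig ip by (simp add: P.prob_space)
  qed
  show ?thesis
    unfolding tendsto_iff dist_real_def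
  proof (intro allI impI)
    fix e :: real assume e: "0 < e"
    obtain p where p: "p \<in> monomial_span" "\<And>u. u \<in> unit_cube \<Longrightarrow> \<bar>g u - p u\<bar> < e / 3"
      using cube_ring.Stone_Weierstrass_basic[of g "e / 3"] g e
      by (auto intro: continuous_on_subset)
    have "\<forall>\<^sub>F n in sequentially. \<bar>(\<integral>\<omega>. p (U n \<omega>) \<partial>M n) - (\<integral>\<omega>. p (V \<omega>) \<partial>Q)\<bar> < e / 3"
      using tendstoD[OF span[OF p(1)], of "e / 3"] e by (simp add: dist_real_def)
    then show "\<forall>\<^sub>F n in sequentially. \<bar>(\<integral>\<omega>. g (U n \<omega>) \<partial>M n) - (\<integral>\<omega>. g (V \<omega>) \<partial>Q)\<bar> < e"
    proof eventually_elim
      case (elim n)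
      have "\<bar>(\<integral>\<omega>. g (U n \<omega>) \<partial>M n) - (\<integral>\<omega>. p (U n \<omega>) \<partial>M n)\<bar> \<le> e / 3"
        by (rule close[OF prob(1) U p])
      moreover have "\<bar>(\<integral>\<omega>. g (V \<omega>) \<partial>Q) - (\<integral>\<omega>. p (V \<omega>) \<partial>Q)\<bar> \<le> e / 3"
        by (rule close[OF prob(2) V p])
      ultimately show ?case using elim by linarith
    qed
  qed
qed

text \<open>The set \<open>S\<close> need not be closed, so \<open>f\<close> may have no continuous
  extension. The Lipschitz envelopes (infimal convolutions with \<open>k\<close> times the distance)
  are continuous on the whole space, stay below \<open>f\<close> on \<open>S\<close>, and rise to
  \<open>f\<close> at its points of continuity.\<close>

lemma inf_convolution:
  fixes f :: "'a::metric_space \<Rightarrow> real"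
  assumes S: "S \<noteq> {}" and B: "\<And>q. q \<in> S \<Longrightarrow> \<bar>f q\<bar> \<le> B" and f: "continuous_on S f"
  obtains g :: "nat \<Rightarrow> 'a \<Rightarrow> real" where "\<And>k. continuous_on UNIV (g k)"
    and "\<And>k p. - B \<le> g k p" and "\<And>k p. p \<in> S \<Longrightarrow> g k p \<le> f p"
    and "\<And>p. p \<in> S \<Longrightarrow> (\<lambda>k. g k p) \<longlonglongrightarrow> f p"
proof -
  define g where "g k p = (INF q\<in>S. f q + real k * dist p q)" for k p
  have low: "- B \<le> f q + real k * dist p q" if "q \<in> S" for p q k
    using B[OF that] by (smt (verit) mult_nonneg_nonneg of_nat_0_le_iff zero_le_dist)
  have bdd: "bdd_below ((\<lambda>q. f q + real k * dist p q) ` S)" for k p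
    by (rule bdd_belowI2[of _ "- B"]) (rule low)
  have ge: "- B \<le> g k p" for k p
    unfolding g_def using S low by (intro cINF_greatest)
  have le: "g k p \<le> f p" if "p \<in> S" for k p
    unfolding g_def using cINF_lower[OF bdd that, of k p] by simp
  have lip: "g k p \<le> g k p' + real k * dist p p'" for k p p'
  proof -
    have "g k p - real k * dist p p' \<le> f q + real k * dist p' q" if "q \<in> S" for q
    proof -
      have "g k p \<le> f q + real k * dist p q" unfolding g_def by (rule cINF_lower[OF bdd that])
      moreover have "real k * dist p q \<le> real k * (dist p p' + dist p' q)"
        by (intro mult_left_mono dist_triangle) simp
      ultimately show ?thesis by (simp add: distrib_left)
    qed
    then have "g k p - real k * dist p p' \<le> g k p'"
      unfolding g_def[of k p'] by (rule cINF_greatest[OF S])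
    then show ?thesis by simp
  qed
  have cont: "continuous_on UNIV (g k)" for k
  proof (rule lipschitz_on_continuous_on[of "real k"], rule lipschitz_onI)
    fix x y show "dist (g k x) (g k y) \<le> real k * dist x y"
      using lip[of k x y] lip[of k y x] by (auto simp: dist_real_def dist_commute abs_le_iff)
  qed simp
  have lim: "(\<lambda>k. g k p) \<longlonglongrightarrow> f p" if p: "p \<in> S" for p
  proof (rule LIMSEQ_I)
    fix e :: real assume e: "0 < e"
    obtain d where d: "0 < d" "\<And>q. q \<in> S \<Longrightarrow> dist q p < d \<Longrightarrow> dist (f q) (f p) < e / 2"
      using f p e unfolding continuous_on_iff by (metis half_gt_zero)
    \<comment> \<open>Once \<open>k * d\<close> is at least \<open>2 * B\<close>, a competitor
      \<open>q\<close> at distance at least \<open>d\<close> pays at least the oscillation of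
      \<open>f\<close>, so only nearby points can lower the infimum.\<close>
    obtain K :: nat where K: "2 * B / d \<le> real K" using real_arch_simple by blast
    have "norm (g k p - f p) < e" if k: "K \<le> k" for k
    proof -
      have "f p - e / 2 \<le> f q + real k * dist p q" if q: "q \<in> S" for q
      proof (cases "dist q p < d")
        case True
        then have "\<bar>f q - f p\<bar> < e / 2" using d(2)[OF q] by (simp add: dist_real_def)
        moreover have "0 \<le> real k * dist p q" by simp
        ultimately show ?thesis by linarith
      next
        case False
        have "2 * B \<le> real K * d" using K d(1) by (simp add: field_simps)
        also have "\<dots> \<le> real k * dist p q"
          using False d(1) k by (intro mult_mono) (auto simp: dist_commute)
        finally show ?thesis using B[OF q] B[OF p] e by (simp add: abs_le_iff)
      qed
      then have "f p - e / 2 \<le> g k p" unfolding g_def by (rule cINF_greatest[OF S])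
      then show ?thesis using le[OF p, of k] e by simp
    qed
    then show "\<exists>no. \<forall>n\<ge>no. norm (g n p - f p) < e" by blast
  qed
  show ?thesis by (rule that[OF cont ge le lim])
qed

lemma cumprod_null_seqs:
  assumes "u \<in> unit_cube" "cumprod u \<longlonglongrightarrow> 0"
  shows "cumprod u \<in> null_seqs"
proof -
  have u: "0 \<le> u k" "u k \<le> 1" for k using assms(1) by (auto simp: unit_cube_def)
  have b: "0 \<le> cumprod u k" "cumprod u k \<le> 1" for k
    unfolding cumprod_def using u by (auto intro: prod_nonneg prod_le_1)
  have "cumprod u (Suc k) \<le> cumprod u k" for k
    using mult_left_le[OF u(2)[of "Suc k"] b(1)[of k]] by (simp add: cumprod_def atMost_Suc mult.commute)
  then show ?thesis using assms(2) b by (auto simp: null_seqs_def intro: decseq_SucI)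
qed

lemma continuous_on_cumprod: "continuous_on S cumprod"
proof (rule continuous_on_coordinatewise_then_product)
  fix k show "continuous_on S (\<lambda>u. cumprod u k)"
    unfolding cumprod_def
    by (intro continuous_intros continuous_on_subset[OF continuous_on_product_coordinates]) auto
qed

text \<open>A vaguely continuous functional of the process is a continuous function of \<open>u\<close> on the dense
  set where the products vanish in the limit; it is approximated from below by continuous functions on
  the whole cube, to which the convergence of moments applies.\<close>

theorem converges_in_lawI:
  fixes M :: "nat \<Rightarrow> 'a measure" and U :: "nat \<Rightarrow> 'a \<Rightarrow> nat \<Rightarrow> real"
    and Q :: "'b measure" and V :: "'b \<Rightarrow> nat \<Rightarrow> real"
  assumes prob: "\<And>n. prob_space (M n)" "prob_space Q"
    and N: "\<And>n. N n \<in> measurable (M n) (borel_of vague_topology)"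
    and R: "R \<in> measurable Q (borel_of vague_topology)"
    and U: "\<And>n. U n \<in> borel_measurable (M n)" "\<And>n \<omega>. \<omega> \<in> space (M n) \<Longrightarrow> U n \<omega> \<in> unit_cube"
    and V: "V \<in> borel_measurable Q" "\<And>\<omega>. \<omega> \<in> space Q \<Longrightarrow> V \<omega> \<in> unit_cube"
    and U_null: "\<And>n. AE \<omega> in M n. cumprod (U n \<omega>) \<longlonglongrightarrow> 0"
    and V_null: "AE \<omega> in Q. cumprod (V \<omega>) \<longlonglongrightarrow> 0"
    and N_eq: "\<And>n. AE \<omega> in M n. N n \<omega> = points_of (cumprod (U n \<omega>))"
    and R_eq: "AE \<omega> in Q. R \<omega> = points_of (cumprod (V \<omega>))"
    and moments: "\<And>m e. (\<lambda>n. \<integral>\<omega>. monomial m e (U n \<omega>) \<partial>M n) \<longlonglongrightarrow> (\<integral>\<omega>. monomial m e (V \<omega>) \<partial>Q)"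
  shows "converges_in_law M N (distr Q (borel_of vague_topology) R)"
proof -
  interpret Q: prob_space Q by (rule prob)
  define S where "S = {u \<in> unit_cube. cumprod u \<longlonglongrightarrow> 0}"
  have V_S: "AE \<omega> in Q. V \<omega> \<in> S" using V_null V(2) by (auto simp: S_def)
  have U_S: "AE \<omega> in M n. U n \<omega> \<in> S" for n using U_null[of n] U(2)[of _ n] by (auto simp: S_def)
  have S: "S \<noteq> {}"
  proof
    assume "S = {}"
    then have "AE \<omega> in Q. False" using V_S by simp
    then show False by simp
  qed
  \<comment> \<open>Approximation from below gives one inequality only; it is used for
    \<open>F\<close> and for \<open>- F\<close>.\<close>
  have lower: "\<forall>\<^sub>F n in sequentially. (\<integral>\<omega>. F (R \<omega>) \<partial>Q) - e < (\<integral>\<omega>. F (N n \<omega>) \<partial>M n)"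
    if F: "continuous_map vague_topology euclideanreal F"
      and B: "\<And>m. m \<in> point_measures \<Longrightarrow> \<bar>F m\<bar> \<le> B" and e: "0 < e" for F B e
  proof -
    define f where "f u = F (points_of (cumprod u))" for u
    have "continuous_map (top_of_set S) euclideanreal (F \<circ> (points_of \<circ> cumprod))"
    proof (rule continuous_map_compose[OF _ F], rule continuous_map_compose[OF _ continuous_map_points_of])
      show "continuous_map (top_of_set S) (top_of_set null_seqs) cumprod"
        using continuous_on_cumprod[of S] cumprod_null_seqs by (auto simp: S_def)
    qed
    then have fc: "continuous_on S f" by (simp add: f_def comp_def)
    have fB: "\<bar>f u\<bar> \<le> B" if "u \<in> S" for u
      unfolding f_def using that
      by (intro B points_of_point_measures cumprod_null_seqs) (auto simp: S_def)
    obtain g :: "nat \<Rightarrow> (nat \<Rightarrow> real) \<Rightarrow> real" where gc: "\<And>k. continuous_on UNIV (g k)"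
      and gB: "\<And>k p. - B \<le> g k p" and gf: "\<And>k p. p \<in> S \<Longrightarrow> g k p \<le> f p"
      and glim: "\<And>p. p \<in> S \<Longrightarrow> (\<lambda>k. g k p) \<longlonglongrightarrow> f p"
      using inf_convolution[OF S fB fc] by blast
    have g_abs: "\<bar>g k p\<bar> \<le> B" if "p \<in> S" for k p
      using gB[of k p] gf[OF that, of k] fB[OF that] by linarith
    have gm: "g k \<in> borel_measurable borel" for k
      using gc by (rule borel_measurable_continuous_onI)
    have Fm: "F \<in> borel_measurable (borel_of vague_topology)"
      using F by (rule borel_measurable_borel_of)
    have R_f: "AE \<omega> in Q. F (R \<omega>) = f (V \<omega>)" using R_eq by (auto simp: f_def)
    \<comment> \<open>The index \<open>k\<close> is fixed by the limit law alone; only afterwards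
      \<open>n\<close> tends to infinity, and \<open>g k \<le> f\<close> on \<open>S\<close>
      transfers the bound to \<open>N n\<close>.\<close>
    have "(\<lambda>k. \<integral>\<omega>. g k (V \<omega>) \<partial>Q) \<longlonglongrightarrow> (\<integral>\<omega>. F (R \<omega>) \<partial>Q)"
    proof (rule integral_dominated_convergence[where w = "\<lambda>_. B"])
      show "(\<lambda>\<omega>. F (R \<omega>)) \<in> borel_measurable Q" using R Fm by measurable
      show "(\<lambda>\<omega>. g k (V \<omega>)) \<in> borel_measurable Q" for k using V(1) gm by measurable
      show "AE \<omega> in Q. (\<lambda>k. g k (V \<omega>)) \<longlonglongrightarrow> F (R \<omega>)" using V_S R_f glim by auto
      show "AE \<omega> in Q. norm (g k (V \<omega>)) \<le> B" for k using V_S g_abs by auto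
    qed simp
    then have "\<forall>\<^sub>F k in sequentially. (\<integral>\<omega>. F (R \<omega>) \<partial>Q) - e < (\<integral>\<omega>. g k (V \<omega>) \<partial>Q)"
      by (rule order_tendstoD) (use e in simp)
    then obtain k where k: "(\<integral>\<omega>. F (R \<omega>) \<partial>Q) - e < (\<integral>\<omega>. g k (V \<omega>) \<partial>Q)"
      by (auto simp: eventually_sequentially)
    have "(\<lambda>n. \<integral>\<omega>. g k (U n \<omega>) \<partial>M n) \<longlonglongrightarrow> (\<integral>\<omega>. g k (V \<omega>) \<partial>Q)"
      by (rule moments_imp_continuous[OF prob U V moments gc])
    from order_tendstoD(1)[OF this k]
    show ?thesis
    proof eventually_elim
      case (elim n)
      interpret Mn: prob_space "M n" by (rule prob)
      have "(\<integral>\<omega>. g k (U n \<omega>) \<partial>M n) \<le> (\<integral>\<omega>. F (N n \<omega>) \<partial>M n)"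
      proof (rule integral_mono_AE)
        show "integrable (M n) (\<lambda>\<omega>. g k (U n \<omega>))"
        proof (rule Mn.integrable_const_bound)
          show "AE \<omega> in M n. norm (g k (U n \<omega>)) \<le> B" using U_S[of n] g_abs by auto
        qed (use U(1)[of n] gm in measurable)
        have NF: "AE \<omega> in M n. F (N n \<omega>) = f (U n \<omega>)" using N_eq[of n] by (auto simp: f_def)
        show "integrable (M n) (\<lambda>\<omega>. F (N n \<omega>))"
        proof (rule Mn.integrable_const_bound)
          show "AE \<omega> in M n. norm (F (N n \<omega>)) \<le> B" using U_S[of n] NF fB by auto
        qed (use N[of n] Fm in measurable)
        show "AE \<omega> in M n. g k (U n \<omega>) \<le> F (N n \<omega>)" using U_S[of n] NF gf by auto
      qed
      then show ?case using elim by linarith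
    qed
  qed
  have "weakly_converges vague_topology (\<lambda>n. distr (M n) (borel_of vague_topology) (N n))
      (distr Q (borel_of vague_topology) R)"
    unfolding weakly_converges_def
  proof (intro allI impI, elim conjE)
    fix F assume F: "continuous_map vague_topology euclideanreal F"
      and "bounded (F ` topspace vague_topology)"
    then obtain B where B: "\<And>m. m \<in> point_measures \<Longrightarrow> \<bar>F m\<bar> \<le> B"
      by (auto simp: bounded_iff topspace_vague_topology)
    have Fm: "F \<in> borel_measurable (borel_of vague_topology)"
      using F by (rule borel_measurable_borel_of)
    have "(\<lambda>n. \<integral>\<omega>. F (N n \<omega>) \<partial>M n) \<longlonglongrightarrow> (\<integral>\<omega>. F (R \<omega>) \<partial>Q)"
      unfolding tendsto_iff dist_real_def
    proof (intro allI impI)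
      fix e :: real assume e: "0 < e"
      have F': "continuous_map vague_topology euclideanreal (\<lambda>m. - F m)"
        using F by (rule continuous_map_minus)
      have B': "\<bar>- F m\<bar> \<le> B" if "m \<in> point_measures" for m using B[OF that] by simp
      have "\<forall>\<^sub>F n in sequentially. (\<integral>\<omega>. F (R \<omega>) \<partial>Q) - e < (\<integral>\<omega>. F (N n \<omega>) \<partial>M n)"
        using F B e by (rule lower)
      moreover have "\<forall>\<^sub>F n in sequentially. (\<integral>\<omega>. - F (R \<omega>) \<partial>Q) - e < (\<integral>\<omega>. - F (N n \<omega>) \<partial>M n)"
        using F' B' e by (rule lower)
      ultimately show "\<forall>\<^sub>F n in sequentially. \<bar>(\<integral>\<omega>. F (N n \<omega>) \<partial>M n) - (\<integral>\<omega>. F (R \<omega>) \<partial>Q)\<bar> < e"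
        by eventually_elim (simp add: abs_less_iff)
    qed
    then show "(\<lambda>n. integral\<^sup>L (distr (M n) (borel_of vague_topology) (N n)) F)
        \<longlonglongrightarrow> integral\<^sup>L (distr Q (borel_of vague_topology) R) F"
      by (simp add: integral_distr[OF N Fm] integral_distr[OF R Fm])
  qed
  then show ?thesis using N by (simp add: converges_in_law_def)
qed

text \<open>The products decrease to their infimum, whose expectation is the limit of the moments
  with all exponents 1, hence 0. So the absence of accumulation points can be read off from
  moments.\<close>

lemma (in prob_space) cumprod_null_AE:
  assumes U: "U \<in> borel_measurable M" "\<And>\<omega>. \<omega> \<in> space M \<Longrightarrow> U \<omega> \<in> unit_cube"
    and lim: "(\<lambda>k. \<integral>\<omega>. monomial k (\<lambda>_. 1) (U \<omega>) \<partial>M) \<longlonglongrightarrow> 0"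
  shows "AE \<omega> in M. cumprod (U \<omega>) \<longlonglongrightarrow> 0"
proof -
  define L where "L \<omega> = (INF k. cumprod (U \<omega>) k)" for \<omega>
  have mono: "cumprod u k = monomial (Suc k) (\<lambda>_. 1) u" for u k
    by (simp add: cumprod_def monomial_def lessThan_Suc_atMost)
  have b: "0 \<le> cumprod u k" "cumprod u k \<le> 1" if "u \<in> unit_cube" for u k
    using monomial_bounds[OF that] by (auto simp: mono)
  have tend: "cumprod u \<longlonglongrightarrow> (INF k. cumprod u k)" if u: "u \<in> unit_cube" for u
  proof (rule LIMSEQ_decseq_INF)
    show "bdd_below (range (cumprod u))" by (rule bdd_belowI2[of _ 0]) (rule b[OF u])
    have "cumprod u (Suc k) \<le> cumprod u k" for k
      using mult_left_le[of "u (Suc k)", OF _ b(1)[OF u, of k]] u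
      by (simp add: cumprod_def atMost_Suc mult.commute unit_cube_def)
    then show "decseq (cumprod u)" by (rule decseq_SucI)
  qed
  have cm: "(\<lambda>\<omega>. cumprod (U \<omega>) k) \<in> borel_measurable M" for k
    using U(1) by (simp add: mono)
  have lim': "(\<lambda>k. \<integral>\<omega>. cumprod (U \<omega>) k \<partial>M) \<longlonglongrightarrow> 0"
    using LIMSEQ_Suc[OF lim] by (simp add: mono)
  have Lm: "L \<in> borel_measurable M"
    by (rule borel_measurable_LIMSEQ_real[where u = "\<lambda>k \<omega>. cumprod (U \<omega>) k", OF _ cm])
      (use tend U(2) in \<open>auto simp: L_def\<close>)
  have "(\<lambda>k. \<integral>\<omega>. cumprod (U \<omega>) k \<partial>M) \<longlonglongrightarrow> (\<integral>\<omega>. L \<omega> \<partial>M)"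
    by (rule integral_dominated_convergence[where w = "\<lambda>_. 1", OF Lm cm])
      (use tend U(2) b in \<open>auto simp: L_def intro!: AE_I2\<close>)
  with lim' have L0: "(\<integral>\<omega>. L \<omega> \<partial>M) = 0" by (rule LIMSEQ_unique[rotated])
  have Lpos: "0 \<le> L \<omega>" if "\<omega> \<in> space M" for \<omega>
    unfolding L_def by (rule cINF_greatest) (use b U(2)[OF that] in auto)
  have Lle: "L \<omega> \<le> 1" if "\<omega> \<in> space M" for \<omega>
    using LIMSEQ_le_const2[OF tend[OF U(2)[OF that]], of 1] b(2)[OF U(2)[OF that]]
    by (auto simp: L_def)
  have "integrable M L"
    by (rule integrable_const_bound[of _ 1]) (use Lpos Lle Lm in auto)
  then have "AE \<omega> in M. L \<omega> = 0"
    using L0 integral_nonneg_eq_0_iff_AE[of M L] Lpos by auto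
  then show ?thesis
  proof (rule AE_mp, intro AE_I2 impI)
    fix \<omega> assume "\<omega> \<in> space M" "L \<omega> = 0"
    then show "cumprod (U \<omega>) \<longlonglongrightarrow> 0"
      using tend[OF U(2), of \<omega>] by (simp add: L_def)
  qed
qed

section \<open>Mixed moments of the limit processes\<close>

lemma nn_integral_of_nat_range:
  assumes "(\<integral>\<^sup>+ i. of_nat (g i) \<partial>count_space (UNIV :: nat set)) < \<infinity>"
  shows "(\<integral>\<^sup>+ i. of_nat (g i) \<partial>count_space (UNIV :: nat set)) \<in> range of_nat"
proof -
  have "emeasure (count_space UNIV) {i. g i \<noteq> 0} = (\<integral>\<^sup>+ i. indicator {i. g i \<noteq> 0} i \<partial>count_space UNIV)"
    by simp
  also have "\<dots> \<le> (\<integral>\<^sup>+ i. of_nat (g i) \<partial>count_space UNIV)"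
  proof (rule nn_integral_mono)
    show "indicator {i. g i \<noteq> 0} i \<le> (of_nat (g i) :: ennreal)" for i
      by (cases "g i") simp_all
  qed
  finally have "emeasure (count_space UNIV) {i. g i \<noteq> 0} < \<infinity>" using assms by (rule le_less_trans)
  then have fin: "finite {i. g i \<noteq> 0}"
    by (metis emeasure_count_space_infinite infinity_ennreal_def less_irrefl subset_UNIV)
  have "(\<integral>\<^sup>+ i. of_nat (g i) \<partial>count_space (UNIV :: nat set)) = (\<Sum>i | g i \<noteq> 0. of_nat (g i))"
    by (rule nn_integral_count_space') (use fin in auto)
  also have "\<dots> = of_nat (\<Sum>i | g i \<noteq> 0. g i)" by simp
  finally show ?thesis by blast
qed

lemma null_measure_point_measures: "null_measure half_line \<in> point_measures"
  by (auto simp: point_measures_def intro!: range_eqI[of _ _ 0])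

text \<open>Countably many conditions decide whether the points accumulate, which makes the case
  distinction in \<open>as_point_measure\<close> measurable. A finite count is automatically an
  integer, being a sum of integers with finitely many nonzero terms.\<close>

lemma dirac_sum_point_measures_iff:
  "dirac_sum UNIV c p \<in> point_measures \<longleftrightarrow> (\<forall>K::nat. emeasure (dirac_sum UNIV c p) {0..real K} < \<infinity>)"
proof
  assume m: "dirac_sum UNIV c p \<in> point_measures"
  show "\<forall>K::nat. emeasure (dirac_sum UNIV c p) {0..real K} < \<infinity>"
  proof
    fix K :: nat
    obtain N where "emeasure (dirac_sum UNIV c p) {0..real K} = of_nat N"
      using m by (rule point_measures_atMostE)
    then show "emeasure (dirac_sum UNIV c p) {0..real K} < \<infinity>" by (simp add: of_nat_less_top)
  qed
next
  assume fin: "\<forall>K::nat. emeasure (dirac_sum UNIV c p) {0..real K} < \<infinity>"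
  show "dirac_sum UNIV c p \<in> point_measures"
    unfolding point_measures_def
  proof (intro CollectI conjI ballI impI)
    fix C assume C: "C \<in> sets half_line" "bounded C"
    obtain a where a: "\<And>t. t \<in> C \<Longrightarrow> t \<le> a"
      using C(2) by (metis bounded_real abs_le_iff)
    obtain K :: nat where K: "a \<le> real K" using real_arch_simple by blast
    have "C \<subseteq> {0..real K}" using sets.sets_into_space[OF C(1)] a K by force
    then have "emeasure (dirac_sum UNIV c p) C \<le> emeasure (dirac_sum UNIV c p) {0..real K}"
      by (intro emeasure_mono) auto
    then have "emeasure (dirac_sum UNIV c p) C < \<infinity>" using fin by (metis le_less_trans)
    moreover have "emeasure (dirac_sum UNIV c p) C
        = (\<integral>\<^sup>+ i. of_nat (c i * of_bool (p i \<in> C)) \<partial>count_space UNIV)"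
      unfolding emeasure_dirac_sum[OF C(1)]
      by (intro nn_integral_cong) (auto split: split_indicator)
    ultimately show "emeasure (dirac_sum UNIV c p) C \<in> range of_nat"
      using nn_integral_of_nat_range by metis
  qed simp
qed

lemma measurable_as_point_measure:
  assumes T [measurable]: "\<And>i. (\<lambda>\<omega>. T \<omega> i) \<in> borel_measurable M"
    and X [measurable]: "\<And>i. (\<lambda>\<omega>. X \<omega> i) \<in> measurable M (count_space UNIV)"
  shows "(\<lambda>\<omega>. as_point_measure (dirac_sum UNIV (X \<omega>) (T \<omega>))) \<in> measurable M (borel_of vague_topology)"
proof (rule measurable_point_process)
  show "as_point_measure (dirac_sum UNIV (X \<omega>) (T \<omega>)) \<in> point_measures" for \<omega>
    by (simp add: as_point_measure_def null_measure_point_measures)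
  have [measurable]: "(\<lambda>\<omega>. emeasure (dirac_sum UNIV (X \<omega>) (T \<omega>)) {0..t}) \<in> borel_measurable M" for t
    by (simp add: emeasure_dirac_sum nn_integral_count_space_nat)
  have eq: "emeasure (as_point_measure (dirac_sum UNIV (X \<omega>) (T \<omega>))) {0..t} =
      (if \<forall>K::nat. emeasure (dirac_sum UNIV (X \<omega>) (T \<omega>)) {0..real K} < \<infinity>
       then emeasure (dirac_sum UNIV (X \<omega>) (T \<omega>)) {0..t} else 0)" for t \<omega>
    by (simp add: as_point_measure_def dirac_sum_point_measures_iff)
  show "(\<lambda>\<omega>. emeasure (as_point_measure (dirac_sum UNIV (X \<omega>) (T \<omega>))) {0..t}) \<in> borel_measurable M" for t
    unfolding eq by measurable
qed

context sequence_space
begin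

lemma nn_integral_iterate:
  assumes [measurable]: "f \<in> borel_measurable S"
  shows "(\<integral>\<^sup>+ \<omega>. f \<omega> \<partial>S) = (\<integral>\<^sup>+ s. \<integral>\<^sup>+ \<omega>. f (case_nat s \<omega>) \<partial>S \<partial>M)"
proof -
  have "(\<integral>\<^sup>+ \<omega>. f \<omega> \<partial>S) = (\<integral>\<^sup>+ \<omega>. f \<omega> \<partial>distr (M \<Otimes>\<^sub>M S) S (\<lambda>(s, \<omega>). case_nat s \<omega>))"
    by (simp only: PiM_iter)
  also have "\<dots> = (\<integral>\<^sup>+ x. f ((\<lambda>(s, \<omega>). case_nat s \<omega>) x) \<partial>(M \<Otimes>\<^sub>M S))"
    by (rule nn_integral_distr) measurable
  also have "\<dots> = (\<integral>\<^sup>+ s. \<integral>\<^sup>+ \<omega>. f (case_nat s \<omega>) \<partial>S \<partial>M)"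
    by (subst P.nn_integral_fst[symmetric]) simp_all
  finally show ?thesis .
qed

lemma nn_integral_prod_coordinates:
  assumes "\<And>i. g i \<in> borel_measurable M"
  shows "(\<integral>\<^sup>+ \<omega>. (\<Prod>i<m. g i (\<omega> i)) \<partial>S) = (\<Prod>i<m. \<integral>\<^sup>+ t. g i t \<partial>M)"
  using assms
proof (induction m arbitrary: g)
  case 0
  then show ?case by (simp add: emeasure_space_1)
next
  case (Suc m)
  note [measurable] = Suc.prems
  have "(\<integral>\<^sup>+ \<omega>. (\<Prod>i<Suc m. g i (\<omega> i)) \<partial>S)
      = (\<integral>\<^sup>+ s. \<integral>\<^sup>+ \<omega>. g 0 s * (\<Prod>i<m. g (Suc i) (\<omega> i)) \<partial>S \<partial>M)"
    by (subst nn_integral_iterate) (simp_all add: prod.lessThan_Suc_shift del: prod.lessThan_Suc)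
  also have "\<dots> = (\<integral>\<^sup>+ s. g 0 s * (\<Prod>i<m. \<integral>\<^sup>+ t. g (Suc i) t \<partial>M) \<partial>M)"
    by (simp add: nn_integral_cmult Suc.IH[of "\<lambda>i. g (Suc i)"] del: PiM_cong)
  also have "\<dots> = (\<Prod>i<Suc m. \<integral>\<^sup>+ t. g i t \<partial>M)"
    by (simp add: nn_integral_multc prod.lessThan_Suc_shift del: prod.lessThan_Suc)
  finally show ?case .
qed

end

text \<open>\<open>b j\<close> is the value at \<open>j\<close> of the Laplace transform of
  \<open>w\<close>. The \<open>max 0\<close> keeps the integrand bounded by 1 and changes nothing
  when \<open>w\<close> is carried by the half line.\<close>

definition laplace_nat :: "real measure \<Rightarrow> (nat \<Rightarrow> real) \<Rightarrow> bool" where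
  "laplace_nat w b \<longleftrightarrow> (\<forall>j. 0 \<le> b j \<and> (\<integral>\<^sup>+ t. ennreal (exp (- max 0 t) ^ j) \<partial>w) = ennreal (b j))"

lemma cumprod_exp: "cumprod (\<lambda>i. exp (- w i)) k = exp (- renewal_times w k)"
  by (simp add: cumprod_def renewal_times_def exp_sum sum_negf[symmetric])

text \<open>Independence turns the mixed moments of the limit into products. The condition
  \<open>b 1 < 1\<close> says that a waiting time is not almost surely 0; it makes the moments of
  the partial products tend to 0, so the renewal process does not accumulate.\<close>

proposition converges_in_law_RPP:
  fixes M :: "nat \<Rightarrow> 'a measure" and U :: "nat \<Rightarrow> 'a \<Rightarrow> nat \<Rightarrow> real"
  assumes w: "prob_space w" "sets w = sets borel" "AE t in w. 0 \<le> t"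
    and laplace: "laplace_nat w b" "b 1 < 1"
    and prob: "\<And>n. prob_space (M n)"
    and N: "\<And>n. N n \<in> measurable (M n) (borel_of vague_topology)"
    and U: "\<And>n. U n \<in> borel_measurable (M n)" "\<And>n \<omega>. \<omega> \<in> space (M n) \<Longrightarrow> U n \<omega> \<in> unit_cube"
    and U_null: "\<And>n. AE \<omega> in M n. cumprod (U n \<omega>) \<longlonglongrightarrow> 0"
    and N_eq: "\<And>n. AE \<omega> in M n. N n \<omega> = points_of (cumprod (U n \<omega>))"
    and moments: "\<And>m e. (\<lambda>n. \<integral>\<omega>. monomial m e (U n \<omega>) \<partial>M n) \<longlonglongrightarrow> (\<Prod>i<m. b (e i))"
  shows "converges_in_law M N (RPP w)"
proof -
  interpret sequence_space w
    using w(1) by (simp add: sequence_space_def product_prob_space_def product_sigma_finite_def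
      product_prob_space_axioms_def prob_space_imp_sigma_finite)
  note [measurable_cong] = w(2)
  define V :: "(nat \<Rightarrow> real) \<Rightarrow> nat \<Rightarrow> real" where "V W = (\<lambda>i. exp (- max 0 (W i)))" for W
  have Vm: "V \<in> borel_measurable S"
    unfolding V_def by (rule measurable_coordinatewise_then_product) measurable
  have V_cube: "V W \<in> unit_cube" for W by (simp add: V_def unit_cube_def)
  have b: "0 \<le> b j" "(\<integral>\<^sup>+ t. ennreal (exp (- max 0 t) ^ j) \<partial>w) = ennreal (b j)" for j
    using laplace(1) by (auto simp: laplace_nat_def)
  have mom: "(\<integral>W. monomial m e (V W) \<partial>S) = (\<Prod>i<m. b (e i))" for m e
  proof -
    have "(\<integral>\<^sup>+ W. ennreal (monomial m e (V W)) \<partial>S) = (\<integral>\<^sup>+ W. (\<Prod>i<m. ennreal (exp (- max 0 (W i)) ^ e i)) \<partial>S)"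
      by (simp add: monomial_def V_def prod_ennreal)
    also have "\<dots> = (\<Prod>i<m. ennreal (b (e i)))"
      by (subst nn_integral_prod_coordinates) (simp_all add: b)
    also have "\<dots> = ennreal (\<Prod>i<m. b (e i))" using b by (simp add: prod_ennreal)
    finally show ?thesis
      using monomial_bounds[OF V_cube] Vm b(1)
      by (subst integral_eq_nn_integral) (auto simp: prod_nonneg)
  qed
  have "(\<lambda>k. \<Prod>i<k. b 1) \<longlonglongrightarrow> 0" using b(1)[of 1] laplace(2) by (simp add: LIMSEQ_power_zero)
  then have V_null: "AE W in S. cumprod (V W) \<longlonglongrightarrow> 0"
    using Vm V_cube by (intro cumprod_null_AE) (simp_all add: mom)
  have pos: "AE W in S. \<forall>i. 0 \<le> W i"
    unfolding AE_all_countable using w(1,3) by (intro allI AE_PiM_component) auto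
  define R where "R W = as_point_measure (dirac_sum UNIV (\<lambda>_. 1) (renewal_times W))" for W
  have Rm: "R \<in> measurable S (borel_of vague_topology)"
    unfolding R_def renewal_times_def by (rule measurable_as_point_measure) measurable
  have R_eq: "AE W in S. R W = points_of (cumprod (V W))"
    using V_null pos
  proof eventually_elim
    case (elim W)
    have "V W = (\<lambda>i. exp (- W i))" using elim(2) by (auto simp: V_def max_def)
    then have *: "points_of (cumprod (V W)) = dirac_sum UNIV (\<lambda>_. 1) (renewal_times W)"
      by (simp add: points_of_def cumprod_exp)
    have "points_of (cumprod (V W)) \<in> point_measures"
      by (intro points_of_point_measures cumprod_null_seqs V_cube elim(1))
    then show ?case by (simp add: R_def as_point_measure_def *)
  qed
  show ?thesis
    unfolding RPP_def R_def[symmetric, abs_def]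
    by (rule converges_in_lawI[OF prob prob_space_axioms N Rm U Vm V_cube U_null V_null N_eq R_eq])
      (simp_all add: mom moments)
qed

section \<open>Laplace transforms of the waiting time laws\<close>

lemma prob_space_exponential_law: "0 < l \<Longrightarrow> prob_space (exponential_law l)"
  using prob_space_exponential_density by (simp add: exponential_law_def)

lemma sets_exponential_law [measurable_cong]: "sets (exponential_law l) = sets borel"
  by (simp add: exponential_law_def)

lemma AE_exponential_law: "AE t in exponential_law l. 0 \<le> t"
  unfolding exponential_law_def
  by (subst AE_density) (auto simp: exponential_density_def)

lemma emeasure_exponential_law_neg:
  assumes "C \<subseteq> {..<0}"
  shows "emeasure (exponential_law l) C = 0"
proof -
  have "emeasure (exponential_law l) {t \<in> space (exponential_law l). t \<in> C} = 0"
    using AE_exponential_law[of l] assms by (intro emeasure_eq_0_AE) (auto elim!: eventually_mono)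
  moreover have "{t \<in> space (exponential_law l). t \<in> C} = C"
    by (simp add: exponential_law_def)
  ultimately show ?thesis by simp
qed

text \<open>Multiplying the density of parameter \<open>l\<close> by \<open>exp (- j * t)\<close>
  gives \<open>l / (l + j)\<close> times the density of parameter \<open>l + j\<close>.\<close>

lemma laplace_exponential_law:
  assumes l: "0 < l"
  shows "laplace_nat (exponential_law l) (\<lambda>j. l / (l + real j))"
  unfolding laplace_nat_def
proof (intro allI conjI)
  fix j :: nat
  have l': "0 < l + real j" using l by simp
  show "0 \<le> l / (l + real j)" using l by simp
  have "ennreal (exponential_density l t) * ennreal (exp (- max 0 t) ^ j)
      = ennreal (l / (l + real j)) * ennreal (exponential_density (l + real j) t)" for t
  proof (cases "t < 0")
    case False
    then have "exp (- max 0 t) ^ j = exp (- t * real j)"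
      by (simp add: exp_of_nat_mult[symmetric] mult.commute max_def)
    then have "exponential_density l t * exp (- max 0 t) ^ j
        = l / (l + real j) * exponential_density (l + real j) t"
      using False l l' by (simp add: exponential_density_def distrib_left exp_add[symmetric])
    then show ?thesis using l l'
      by (simp add: ennreal_mult[symmetric] exponential_density_nonneg)
  qed (simp add: exponential_density_def)
  then have "(\<integral>\<^sup>+ t. ennreal (exp (- max 0 t) ^ j) \<partial>exponential_law l)
      = (\<integral>\<^sup>+ t. ennreal (l / (l + real j)) * ennreal (exponential_density (l + real j) t) \<partial>lborel)"
    unfolding exponential_law_def by (subst nn_integral_density) auto
  also have "\<dots> = ennreal (l / (l + real j)) * (\<integral>\<^sup>+ t. ennreal (exponential_density (l + real j) t) \<partial>lborel)"
    by (rule nn_integral_cmult) simp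
  also have "(\<integral>\<^sup>+ t. ennreal (exponential_density (l + real j) t) \<partial>lborel) = 1"
    using prob_space.emeasure_space_1[OF prob_space_exponential_density[OF l']]
    by (simp add: emeasure_density)
  finally show "(\<integral>\<^sup>+ t. ennreal (exp (- max 0 t) ^ j) \<partial>exponential_law l) = ennreal (l / (l + real j))"
    by simp
qed

text \<open>\<open>W1_law\<close> is the law of a product of independent Bernoulli and exponential variables.\<close>

lemma W1_law_eq:
  assumes th: "0 < \<theta>" "\<theta> \<le> 1"
  shows "W1_law \<theta> = distr (measure_pmf (bernoulli_pmf \<theta>) \<Otimes>\<^sub>M exponential_law \<theta>) borel
    (\<lambda>(b, t). if b then t else 0)" (is "_ = distr ?P borel ?f")
proof -
  interpret E: prob_space "exponential_law \<theta>" by (rule prob_space_exponential_law[OF th(1)])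
  interpret P: pair_prob_space "measure_pmf (bernoulli_pmf \<theta>)" "exponential_law \<theta>" ..
  define F where "F t = (if t < 0 then 0 else 1 - \<theta> + \<theta> * (1 - exp (- \<theta> * t)))" for t :: real
  have fm: "?f \<in> borel_measurable ?P" by measurable
  have real_distr: "real_distribution (distr ?P borel ?f)"
    using P.prob_space_distr[OF fm] by (simp add: real_distribution_def real_distribution_axioms_def)
  have le: "exp (- \<theta> * t) \<le> 1" if "0 \<le> t" for t using that th by simp
  have mono: "F s \<le> F t" if "s \<le> t" for s t
  proof -
    have "0 \<le> F t" using th le[of t] by (simp add: F_def)
    moreover have "exp (- \<theta> * t) \<le> exp (- \<theta> * s)" using that th by simp
    ultimately show ?thesis using that th by (simp add: F_def)
  qed
  have cont: "continuous (at_right a) F" for a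
  proof (cases "a < 0")
    case True
    have "\<forall>\<^sub>F t in at_right a. F t = 0"
      unfolding eventually_at_right_field F_def using True by (intro exI[of _ 0]) auto
    then have "(F \<longlongrightarrow> 0) (at_right a)" by (rule tendsto_eventually)
    then show ?thesis using True by (simp add: continuous_within F_def)
  next
    case False
    have "\<forall>\<^sub>F t in at_right a. 1 - \<theta> + \<theta> * (1 - exp (- \<theta> * t)) = F t"
      unfolding eventually_at_right_field F_def using False by (intro exI[of _ "a + 1"]) auto
    moreover have "((\<lambda>t. 1 - \<theta> + \<theta> * (1 - exp (- \<theta> * t))) \<longlongrightarrow> 1 - \<theta> + \<theta> * (1 - exp (- \<theta> * a))) (at_right a)"
      by (intro tendsto_intros)
    ultimately have "(F \<longlongrightarrow> 1 - \<theta> + \<theta> * (1 - exp (- \<theta> * a))) (at_right a)"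
      by (rule Lim_transform_eventually[rotated])
    then show ?thesis using False by (simp add: continuous_within F_def)
  qed
  have bot: "(F \<longlongrightarrow> 0) at_bot"
    by (rule tendsto_eventually) (auto simp: F_def eventually_at_bot_dense intro!: exI[of _ 0])
  have top: "(F \<longlongrightarrow> 1) at_top"
  proof -
    have "\<forall>\<^sub>F t in at_top. 1 - \<theta> + \<theta> * (1 - exp (- (\<theta> * t))) = F t"
      using eventually_ge_at_top[of 0] by eventually_elim (simp add: F_def)
    moreover have "((\<lambda>t. 1 - \<theta> + \<theta> * (1 - exp (- (\<theta> * t)))) \<longlongrightarrow> 1 - \<theta> + \<theta> * (1 - 0)) at_top"
      using th(1)
      by (intro tendsto_intros filterlim_compose[OF exp_at_bot]
            filterlim_compose[OF filterlim_uminus_at_bot_at_top] filterlim_tendsto_pos_mult_at_top[OF tendsto_const])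
        (auto intro: filterlim_ident)
    ultimately show ?thesis by (auto intro: Lim_transform_eventually)
  qed
  have exp_cdf: "emeasure (exponential_law \<theta>) {..t} = ennreal (1 - exp (- t * \<theta>))" if "0 \<le> t" for t
  proof -
    have "distributed (exponential_law \<theta>) lborel (\<lambda>x. x) (exponential_density \<theta>)"
      by (auto simp: distributed_def exponential_law_def exponential_density_nonneg[OF th(1)] distr_id2)
    from E.exponential_distributedD_le[OF this that th(1)]
    show ?thesis
      unfolding E.emeasure_eq_measure by (simp add: atMost_def exponential_law_def)
  qed
  have exp_neg: "emeasure (exponential_law \<theta>) {..t} = 0" if "t < 0" for t
    by (rule emeasure_exponential_law_neg) (use that in auto)
  have "measure (distr ?P borel ?f) {..t} = F t" for t
  proof -
    have "emeasure (distr ?P borel ?f) {..t} = (\<integral>\<^sup>+ x. indicator {..t} (?f x) \<partial>?P)"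
      by (subst nn_integral_indicator[symmetric], simp, subst nn_integral_distr[OF fm]) simp_all
    also have "\<dots> = (\<integral>\<^sup>+ b. \<integral>\<^sup>+ s. indicator {..t} (if b then s else 0) \<partial>exponential_law \<theta> \<partial>bernoulli_pmf \<theta>)"
      by (subst E.nn_integral_fst[symmetric]) simp_all
    also have "\<dots> = emeasure (exponential_law \<theta>) {..t} * ennreal \<theta> + indicator {..t} (0::real) * ennreal (1 - \<theta>)"
      using th by (simp add: E.emeasure_space_1)
    also have "\<dots> = ennreal (F t)"
    proof (cases "t < 0")
      case False
      then show ?thesis
        using th le[of t] by (simp add: exp_cdf F_def ennreal_mult[symmetric] ennreal_plus[symmetric] mult.commute
          add.commute del: ennreal_plus)
    qed (simp add: exp_neg F_def)
    \<comment> \<open>\<open>F\<close> vanishes at \<open>min (-1) t\<close>, so monotonicity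
      supplies the nonnegativity of \<open>F t\<close> for the passage from \<open>ennreal\<close>
      to reals.\<close>
    finally show ?thesis using mono[of "min (-1) t" t] by (simp add: measure_def F_def split: if_splits)
  qed
  then have "cdf (distr ?P borel ?f) = F" by (simp add: cdf_def fun_eq_iff)
  then have "interval_measure F = distr ?P borel ?f"
    by (intro cdf_unique real_distr real_distribution_interval_measure)
      (simp_all add: mono cont bot top cdf_interval_measure)
  then show ?thesis unfolding W1_law_def F_def[abs_def] by simp
qed

lemma W1_law_properties:
  assumes th: "0 < \<theta>" "\<theta> \<le> 1"
  shows "prob_space (W1_law \<theta>)" "sets (W1_law \<theta>) = sets borel" "AE t in W1_law \<theta>. 0 \<le> t"
    and "laplace_nat (W1_law \<theta>) (\<lambda>j. 1 - \<theta> + \<theta> * (\<theta> / (\<theta> + real j)))"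
proof -
  interpret E: prob_space "exponential_law \<theta>" by (rule prob_space_exponential_law[OF th(1)])
  interpret P: pair_prob_space "measure_pmf (bernoulli_pmf \<theta>)" "exponential_law \<theta>" ..
  let ?P = "measure_pmf (bernoulli_pmf \<theta>) \<Otimes>\<^sub>M exponential_law \<theta>"
  let ?f = "\<lambda>(b, t). if b then t else (0::real)"
  have fm: "?f \<in> borel_measurable ?P" by measurable
  show "prob_space (W1_law \<theta>)" "sets (W1_law \<theta>) = sets borel"
    using P.prob_space_distr[OF fm] by (simp_all add: W1_law_eq[OF th])
  have int: "(\<integral>\<^sup>+ t. g t \<partial>W1_law \<theta>) = (\<integral>\<^sup>+ t. g t \<partial>exponential_law \<theta>) * ennreal \<theta> + g 0 * ennreal (1 - \<theta>)"
    if [measurable]: "g \<in> borel_measurable borel" for g :: "real \<Rightarrow> ennreal"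
  proof -
    have "(\<integral>\<^sup>+ t. g t \<partial>W1_law \<theta>) = (\<integral>\<^sup>+ x. g (?f x) \<partial>?P)"
      unfolding W1_law_eq[OF th] by (rule nn_integral_distr[OF fm]) simp
    also have "\<dots> = (\<integral>\<^sup>+ b. \<integral>\<^sup>+ s. g (if b then s else 0) \<partial>exponential_law \<theta> \<partial>bernoulli_pmf \<theta>)"
      by (subst E.nn_integral_fst[symmetric]) simp_all
    also have "\<dots> = (\<integral>\<^sup>+ t. g t \<partial>exponential_law \<theta>) * ennreal \<theta> + g 0 * ennreal (1 - \<theta>)"
      using th by (simp add: E.emeasure_space_1)
    finally show ?thesis .
  qed
  have "emeasure (W1_law \<theta>) {..<0} = emeasure (exponential_law \<theta>) {..<0} * ennreal \<theta>"
    using int[of "indicator {..<0}"] by (simp add: W1_law_eq[OF th])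
  also have "emeasure (exponential_law \<theta>) {..<0} = 0"
    by (rule emeasure_exponential_law_neg) simp
  finally show "AE t in W1_law \<theta>. 0 \<le> t"
    by (intro AE_I[of _ _ "{..<0}"]) (auto simp: W1_law_eq[OF th])
  have "(\<integral>\<^sup>+ t. ennreal (exp (- max 0 t) ^ j) \<partial>W1_law \<theta>)
      = ennreal (1 - \<theta> + \<theta> * (\<theta> / (\<theta> + real j)))" for j
    using laplace_exponential_law[OF th(1)] th
    by (subst int) (simp_all add: laplace_nat_def ennreal_mult[symmetric] ennreal_plus[symmetric]
        mult.commute add.commute del: ennreal_plus)
  then show "laplace_nat (W1_law \<theta>) (\<lambda>j. 1 - \<theta> + \<theta> * (\<theta> / (\<theta> + real j)))"
    using th by (simp add: laplace_nat_def)
qed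

text \<open>The cluster containing the \<open>k\<close>-th point, for cluster sizes \<open>X\<close>; all indices start at 0.\<close>

definition cluster_index :: "(nat \<Rightarrow> nat) \<Rightarrow> nat \<Rightarrow> nat" where
  "cluster_index X k = (LEAST i. k < (\<Sum>j\<le>i. X j))"

lemma cluster_index_exists:
  fixes X :: "nat \<Rightarrow> nat"
  assumes "\<And>i. 1 \<le> X i"
  shows "k < (\<Sum>j\<le>k. X j)"
proof -
  show ?thesis using sum_mono[of "{..k}" "\<lambda>_. 1" X] assms by simp
qed

lemma cluster_index_0: "k < X 0 \<Longrightarrow> cluster_index X k = 0"
  unfolding cluster_index_def by (intro Least_eq_0) simp

lemma cluster_index_add:
  assumes X: "\<And>i. 1 \<le> X i"
  shows "cluster_index X (X 0 + k) = Suc (cluster_index (\<lambda>i. X (Suc i)) k)"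
proof -
  have "(LEAST i. X 0 + k < (\<Sum>j\<le>i. X j)) = Suc (LEAST i. X 0 + k < (\<Sum>j\<le>Suc i. X j))"
    by (rule Least_Suc[where n = "X 0 + k"], rule cluster_index_exists[THEN le_less_trans[rotated]], rule X) simp_all
  also have "(LEAST i. X 0 + k < (\<Sum>j\<le>Suc i. X j)) = (LEAST i. k < (\<Sum>j\<le>i. X (Suc j)))"
    by (simp only: sum.atMost_Suc_shift add_less_cancel_left)
  finally show ?thesis by (simp add: cluster_index_def)
qed

lemma cluster_index_eq_iff:
  assumes X: "\<And>i. 1 \<le> X i"
  shows "cluster_index X k = i \<longleftrightarrow> (\<Sum>j<i. X j) \<le> k \<and> k < (\<Sum>j<i. X j) + X i"
proof -
  have le: "(\<Sum>j\<le>a. X j) \<le> (\<Sum>j\<le>b. X j)" if "a \<le> b" for a b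
    using that by (intro sum_mono2) auto
  have 1: "k < (\<Sum>j\<le>cluster_index X k. X j)"
    unfolding cluster_index_def by (rule LeastI, rule cluster_index_exists, rule X)
  have 2: "(\<Sum>j<cluster_index X k. X j) \<le> k"
  proof (cases "cluster_index X k")
    case (Suc i)
    have "\<not> k < (\<Sum>j\<le>i. X j)"
      by (rule not_less_Least) (use Suc in \<open>simp add: cluster_index_def\<close>)
    then show ?thesis by (simp add: Suc lessThan_Suc_atMost)
  qed simp
  show ?thesis
  proof
    assume "cluster_index X k = i"
    then show "(\<Sum>j<i. X j) \<le> k \<and> k < (\<Sum>j<i. X j) + X i"
      using 1 2 by (auto simp: lessThan_Suc_atMost[symmetric])
  next
    assume i: "(\<Sum>j<i. X j) \<le> k \<and> k < (\<Sum>j<i. X j) + X i"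
    show "cluster_index X k = i"
    proof (rule linorder_cases[of "cluster_index X k" i])
      assume "cluster_index X k < i"
      then have "(\<Sum>j\<le>cluster_index X k. X j) \<le> (\<Sum>j<i. X j)" by (intro sum_mono2) auto
      then show ?thesis using 1 i by simp
    next
      assume "i < cluster_index X k"
      then have "(\<Sum>j\<le>i. X j) \<le> (\<Sum>j<cluster_index X k. X j)" by (intro sum_mono2) auto
      then show ?thesis using 2 i by (simp add: lessThan_Suc_atMost[symmetric])
    qed
  qed
qed

lemma cluster_index_mono:
  assumes X: "\<And>i. 1 \<le> X i" and "k \<le> l"
  shows "cluster_index X k \<le> cluster_index X l"
  unfolding cluster_index_def[of X k]
proof (rule Least_le)
  have "l < (\<Sum>j\<le>cluster_index X l. X j)"
    unfolding cluster_index_def by (rule LeastI, rule cluster_index_exists, rule X)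
  then show "k < (\<Sum>j\<le>cluster_index X l. X j)" using assms(2) by simp
qed

text \<open>Exactly \<open>X i\<close> consecutive indices belong to cluster \<open>i\<close>, so
  exchanging the sums over indices and over clusters turns coinciding single points into
  weights.\<close>

lemma dirac_sum_clusters:
  assumes X: "\<And>i. 1 \<le> X i"
  shows "dirac_sum UNIV (\<lambda>_. 1) (\<lambda>k. p (cluster_index X k)) = dirac_sum UNIV X p"
proof (rule measure_eqI)
  fix A assume "A \<in> sets (dirac_sum UNIV (\<lambda>_. 1) (\<lambda>k. p (cluster_index X k)))"
  then have A: "A \<in> sets half_line" by simp
  let ?C = "count_space (UNIV :: nat set)"
  have card: "(\<integral>\<^sup>+ k. indicator {cluster_index X k} i \<partial>?C) = (of_nat (X i) :: ennreal)" for i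
  proof -
    have "{k. cluster_index X k = i} = {(\<Sum>j<i. X j)..<(\<Sum>j<i. X j) + X i}"
      using cluster_index_eq_iff[OF X] by auto
    then have "emeasure ?C {k. cluster_index X k = i} = of_nat (X i)"
      by (simp add: emeasure_count_space)
    moreover have "(\<integral>\<^sup>+ k. indicator {cluster_index X k} i \<partial>?C) = (\<integral>\<^sup>+ k. indicator {k. cluster_index X k = i} k \<partial>?C)"
      by (intro nn_integral_cong) (auto split: split_indicator)
    ultimately show ?thesis by simp
  qed
  have "emeasure (dirac_sum UNIV (\<lambda>_. 1) (\<lambda>k. p (cluster_index X k))) A
      = (\<integral>\<^sup>+ k. \<integral>\<^sup>+ i. indicator A (p i) * indicator {cluster_index X k} i \<partial>?C \<partial>?C)"
    unfolding emeasure_dirac_sum[OF A] by (simp add: nn_integral_indicator_singleton)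
  also have "\<dots> = (\<integral>\<^sup>+ i. \<integral>\<^sup>+ k. indicator A (p i) * indicator {cluster_index X k} i \<partial>?C \<partial>?C)"
    by (rule nn_integral_count_space_nn_integral) auto
  also have "\<dots> = (\<integral>\<^sup>+ i. of_nat (X i) * indicator A (p i) \<partial>?C)"
    by (subst nn_integral_cmult) (simp_all add: card mult.commute)
  finally show "emeasure (dirac_sum UNIV (\<lambda>_. 1) (\<lambda>k. p (cluster_index X k))) A
      = emeasure (dirac_sum UNIV X p) A"
    by (simp add: emeasure_dirac_sum[OF A])
qed simp

text \<open>Gap coordinates of the compound process after each cluster is written as coinciding
  single points: the coordinate is 1 inside a cluster, where the gap is 0.\<close>

definition compound_coord :: "(nat \<Rightarrow> real) \<Rightarrow> (nat \<Rightarrow> nat) \<Rightarrow> nat \<Rightarrow> real" where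
  "compound_coord W X k = (case k of 0 \<Rightarrow> exp (- renewal_times W (cluster_index X 0))
     | Suc l \<Rightarrow> exp (renewal_times W (cluster_index X l) - renewal_times W (cluster_index X (Suc l))))"

lemma cumprod_compound_coord:
  "cumprod (compound_coord W X) k = exp (- renewal_times W (cluster_index X k))"
  by (induction k) (simp_all add: cumprod_def compound_coord_def exp_add[symmetric])

lemma renewal_times_mono:
  assumes "\<And>i. 0 \<le> W i" "i \<le> j"
  shows "renewal_times W i \<le> renewal_times W j"
  unfolding renewal_times_def using assms by (intro sum_mono2) auto

lemma compound_coord_unit_cube:
  assumes "\<And>i. 0 \<le> W i" "\<And>i. 1 \<le> X i"
  shows "compound_coord W X \<in> unit_cube"
proof -
  have "0 \<le> renewal_times W i" for i
    unfolding renewal_times_def by (intro sum_nonneg assms)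
  then show ?thesis
    unfolding unit_cube_def compound_coord_def
    using renewal_times_mono[OF assms(1) cluster_index_mono[OF assms(2)]]
    by (auto split: nat.split)
qed

lemma compound_coord_Cons:
  assumes n: "1 \<le> n" and X: "\<And>i. 1 \<le> X i"
  shows "compound_coord (case_nat s W) (case_nat n X) 0 = exp (- s)"
    and "1 \<le> l \<Longrightarrow> l < n \<Longrightarrow> compound_coord (case_nat s W) (case_nat n X) l = 1"
    and "compound_coord (case_nat s W) (case_nat n X) (n + k) = compound_coord W X k"
proof -
  have X': "1 \<le> case_nat n X i" for i using n X by (simp split: nat.split)
  have ci0: "cluster_index (case_nat n X) l = 0" if "l < n" for l
    using that by (intro cluster_index_0) simp
  have add: "cluster_index (case_nat n X) (n + l) = Suc (cluster_index X l)" for l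
    using cluster_index_add[of "case_nat n X" l, OF X'] by simp
  have r0: "renewal_times (case_nat s W) 0 = s" by (simp add: renewal_times_def)
  have rS: "renewal_times (case_nat s W) (Suc i) = s + renewal_times W i" for i
    unfolding renewal_times_def by (simp only: sum.atMost_Suc_shift nat.case)
  show "compound_coord (case_nat s W) (case_nat n X) 0 = exp (- s)"
    using n by (simp add: compound_coord_def ci0 r0)
  show "compound_coord (case_nat s W) (case_nat n X) l = 1" if "1 \<le> l" "l < n"
    using that by (cases l) (simp_all add: compound_coord_def ci0)
  show "compound_coord (case_nat s W) (case_nat n X) (n + k) = compound_coord W X k"
  proof (cases k)
    case 0
    obtain n' where n': "n = Suc n'" using n by (cases n) auto
    have "cluster_index (case_nat n X) n = Suc (cluster_index X 0)" using add[of 0] by simp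
    then show ?thesis using ci0[of n'] by (simp add: 0 n' compound_coord_def r0 rS)
  next
    case (Suc k')
    then show ?thesis using add[of k'] add[of k] by (simp add: compound_coord_def rS)
  qed
qed

text \<open>The first point contributes \<open>exp (- s)\<close>, the other points of its cluster
  contribute 1, and what follows is again a compound sequence. Truncated subtraction covers a first
  cluster of at least \<open>Suc m\<close> points, where the remaining monomial is the empty
  product.\<close>

lemma monomial_compound_coord_Cons:
  assumes n: "1 \<le> n" and X: "\<And>i. 1 \<le> X i"
  shows "monomial (Suc m) e (compound_coord (case_nat s W) (case_nat n X)) =
    exp (- s) ^ e 0 * monomial (Suc m - n) (\<lambda>k. e (n + k)) (compound_coord W X)"
proof (induction m)
  case 0
  then show ?case using n by (simp add: monomial_def compound_coord_Cons(1)[OF n X])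
next
  case (Suc m)
  have step: "monomial (Suc (Suc m)) e (compound_coord (case_nat s W) (case_nat n X)) =
      monomial (Suc m) e (compound_coord (case_nat s W) (case_nat n X)) *
      compound_coord (case_nat s W) (case_nat n X) (Suc m) ^ e (Suc m)"
    by (simp add: monomial_def)
  show ?case
  proof (cases "Suc m < n")
    case True
    then show ?thesis
      unfolding step Suc.IH using compound_coord_Cons(2)[where l = "Suc m", OF n X] by simp
  next
    case False
    then obtain k where k: "Suc m = n + k" by (metis le_iff_add not_less)
    then have "Suc (Suc m) - n = Suc k" "Suc m - n = k" by simp_all
    then show ?thesis
      unfolding step Suc.IH using compound_coord_Cons(3)[OF n X] by (simp add: monomial_def k)
  qed
qed

lemma nn_integral_pair_iterate:
  assumes "prob_space A" "prob_space B"
  defines "SA \<equiv> PiM (UNIV :: nat set) (\<lambda>_. A)" and "SB \<equiv> PiM (UNIV :: nat set) (\<lambda>_. B)"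
  assumes f [measurable]: "f \<in> borel_measurable (SA \<Otimes>\<^sub>M SB)"
  shows "(\<integral>\<^sup>+ x. f x \<partial>(SA \<Otimes>\<^sub>M SB)) =
    (\<integral>\<^sup>+ s. \<integral>\<^sup>+ n. \<integral>\<^sup>+ x. f (case_nat s (fst x), case_nat n (snd x)) \<partial>(SA \<Otimes>\<^sub>M SB) \<partial>B \<partial>A)"
proof -
  interpret A: sequence_space A
    using assms(1) by (simp add: sequence_space_def product_prob_space_def product_sigma_finite_def
      product_prob_space_axioms_def prob_space_imp_sigma_finite)
  interpret B: sequence_space B
    using assms(2) by (simp add: sequence_space_def product_prob_space_def product_sigma_finite_def
      product_prob_space_axioms_def prob_space_imp_sigma_finite)
  have SA: "prob_space SA" and SB: "prob_space SB"
    unfolding SA_def SB_def by (rule A.prob_space_axioms) (rule B.prob_space_axioms)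
  interpret SB: prob_space SB by (rule SB)
  interpret AB: pair_sigma_finite SA B
    using SA assms(2) by (simp add: pair_sigma_finite_def prob_space_imp_sigma_finite)
  interpret AB': pair_sigma_finite A B
    using assms(1,2) by (simp add: pair_sigma_finite_def prob_space_imp_sigma_finite)
  have [measurable]: "(\<lambda>x. case_nat (fst x) (snd x)) \<in> measurable (A \<Otimes>\<^sub>M SA) SA"
    "(\<lambda>x. case_nat (fst x) (snd x)) \<in> measurable (B \<Otimes>\<^sub>M SB) SB"
    unfolding SA_def SB_def by measurable
  have cA: "(\<lambda>x. case_nat (g x) (h x)) \<in> measurable M SA"
    if "g \<in> measurable M A" "h \<in> measurable M SA" for g h and M :: "'z measure"
    using that unfolding SA_def by measurable
  have cB: "(\<lambda>x. case_nat (g x) (h x)) \<in> measurable M SB"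
    if "g \<in> measurable M B" "h \<in> measurable M SB" for g h and M :: "'z measure"
    using that unfolding SB_def by measurable
  note [measurable (raw)] = cA cB
  have "(\<integral>\<^sup>+ x. f x \<partial>(SA \<Otimes>\<^sub>M SB)) = (\<integral>\<^sup>+ W. \<integral>\<^sup>+ X. f (W, X) \<partial>SB \<partial>SA)"
    by (rule SB.nn_integral_fst[symmetric]) (rule f)
  also have "\<dots> = (\<integral>\<^sup>+ W. \<integral>\<^sup>+ n. \<integral>\<^sup>+ X. f (W, case_nat n X) \<partial>SB \<partial>B \<partial>SA)"
    by (intro nn_integral_cong, unfold SB_def, rule B.nn_integral_iterate) (simp_all flip: SB_def)
  also have "\<dots> = (\<integral>\<^sup>+ n. \<integral>\<^sup>+ W. \<integral>\<^sup>+ X. f (W, case_nat n X) \<partial>SB \<partial>SA \<partial>B)"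
    by (rule AB.Fubini'[symmetric]) measurable
  also have "\<dots> = (\<integral>\<^sup>+ n. \<integral>\<^sup>+ s. \<integral>\<^sup>+ W. \<integral>\<^sup>+ X. f (case_nat s W, case_nat n X) \<partial>SB \<partial>SA \<partial>A \<partial>B)"
    by (intro nn_integral_cong, unfold SA_def, rule A.nn_integral_iterate) (simp_all flip: SA_def)
  also have "\<dots> = (\<integral>\<^sup>+ s. \<integral>\<^sup>+ n. \<integral>\<^sup>+ W. \<integral>\<^sup>+ X. f (case_nat s W, case_nat n X) \<partial>SB \<partial>SA \<partial>B \<partial>A)"
    by (rule AB'.Fubini') measurable
  also have "\<dots> = (\<integral>\<^sup>+ s. \<integral>\<^sup>+ n. \<integral>\<^sup>+ x. f (case_nat s (fst x), case_nat n (snd x)) \<partial>(SA \<Otimes>\<^sub>M SB) \<partial>B \<partial>A)"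
    by (intro nn_integral_cong, subst SB.nn_integral_fst[symmetric]) simp_all
  finally show ?thesis .
qed

text \<open>A geometric cluster has no memory: after each of its points it ends with probability \<open>\<theta>\<close>.
  Hence the waiting times of the compound Poisson process are independent, the first one exponential
  and the others of law \<open>W1_law \<theta>\<close>.\<close>

lemma compound_moments:
  assumes th: "0 < \<theta>" "\<theta> \<le> 1"
  defines "Q \<equiv> PiM UNIV (\<lambda>_ :: nat. exponential_law \<theta>) \<Otimes>\<^sub>M PiM UNIV (\<lambda>_ :: nat. measure_pmf (Geo \<theta>))"
    and "V \<equiv> (\<lambda>(W, X). compound_coord (\<lambda>i. max 0 (W i)) (\<lambda>i. max 1 (X i)))"
    and "a \<equiv> \<lambda>j. \<theta> / (\<theta> + real j)"
  shows "prob_space Q" and "V \<in> borel_measurable Q"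
    and "(\<integral>\<omega>. monomial (Suc m) e (V \<omega>) \<partial>Q) = a (e 0) * (\<Prod>i<m. 1 - \<theta> + \<theta> * a (e (Suc i)))"
proof -
  interpret A: sequence_space "exponential_law \<theta>"
    using prob_space_exponential_law[OF th(1)] by (simp add: sequence_space_def product_prob_space_def product_sigma_finite_def
      product_prob_space_axioms_def prob_space_imp_sigma_finite)
  interpret B: sequence_space "measure_pmf (Geo \<theta>)"
    by (simp add: sequence_space_def product_prob_space_def product_sigma_finite_def
      product_prob_space_axioms_def prob_space_imp_sigma_finite measure_pmf.prob_space_axioms)
  interpret P: pair_prob_space "PiM UNIV (\<lambda>_ :: nat. exponential_law \<theta>)" "PiM UNIV (\<lambda>_ :: nat. measure_pmf (Geo \<theta>))" ..
  show Q: "prob_space Q" unfolding Q_def by (rule P.prob_space_axioms)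
  interpret Q: prob_space Q by (rule Q)
  have [measurable]: "(\<lambda>\<omega>. fst \<omega> i) \<in> borel_measurable Q" for i
    unfolding Q_def by measurable
  have [measurable]: "(\<lambda>\<omega>. snd \<omega> i) \<in> measurable Q (count_space UNIV)" for i
    unfolding Q_def by measurable
  have [measurable]: "(\<lambda>\<omega>. cluster_index (\<lambda>i. max (Suc 0) (snd \<omega> i)) k) \<in> measurable Q (count_space UNIV)" for k
    unfolding cluster_index_def by measurable
  have [measurable]: "(\<lambda>\<omega>. renewal_times (\<lambda>i. max 0 (fst \<omega> i)) (cluster_index (\<lambda>i. max (Suc 0) (snd \<omega> i)) k)) \<in> borel_measurable Q" for k
    by (rule measurable_compose_countable[where f = "\<lambda>j \<omega>. renewal_times (\<lambda>i. max 0 (fst \<omega> i)) j"])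
      (unfold renewal_times_def, measurable)
  show V: "V \<in> borel_measurable Q"
  proof (rule measurable_coordinatewise_then_product)
    fix k show "(\<lambda>\<omega>. V \<omega> k) \<in> borel_measurable Q"
      unfolding V_def compound_coord_def split_beta by (cases k) simp_all
  qed
  have V_cube: "V \<omega> \<in> unit_cube" for \<omega>
    by (auto simp: V_def split_beta intro!: compound_coord_unit_cube)
  \<comment> \<open>\<open>D\<close> is the moment of \<open>m\<close> gaps seen from before a fresh
    cluster; \<open>G\<close> is the moment of the \<open>m\<close> gaps that follow a point of a
    cluster with a geometric number \<open>j\<close> of points still to come.\<close>
  define D where "D m e = (\<integral>\<^sup>+ \<omega>. ennreal (monomial m e (V \<omega>)) \<partial>Q)" for m e
  define G where "G m e = (\<integral>\<^sup>+ j. D (m - j) (\<lambda>k. e (j + k)) \<partial>geometric_pmf \<theta>)" for m e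
  have a: "0 \<le> a j" "(\<integral>\<^sup>+ t. ennreal (exp (- max 0 t) ^ j) \<partial>exponential_law \<theta>) = ennreal (a j)" for j
    using laplace_exponential_law[OF th(1)] by (auto simp: laplace_nat_def a_def)
  have D_Suc: "D (Suc m) e = ennreal (a (e 0)) * G m (\<lambda>k. e (Suc k))" for m e
  proof -
    have "D (Suc m) e = (\<integral>\<^sup>+ s. \<integral>\<^sup>+ n. \<integral>\<^sup>+ x. ennreal (monomial (Suc m) e (V (case_nat s (fst x), case_nat n (snd x)))) \<partial>Q \<partial>Geo \<theta> \<partial>exponential_law \<theta>)"
      unfolding D_def using V unfolding Q_def
      by (intro nn_integral_pair_iterate prob_space_exponential_law th measure_pmf.prob_space_axioms) simp
    also have "\<dots> = (\<integral>\<^sup>+ s. \<integral>\<^sup>+ n. ennreal (exp (- max 0 s) ^ e 0) * D (Suc m - max 1 n) (\<lambda>k. e (max 1 n + k)) \<partial>Geo \<theta> \<partial>exponential_law \<theta>)"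
    proof (intro nn_integral_cong)
      fix s :: real and n :: nat
      have "monomial (Suc m) e (V (case_nat s (fst x), case_nat n (snd x))) =
          exp (- max 0 s) ^ e 0 * monomial (Suc m - max 1 n) (\<lambda>k. e (max 1 n + k)) (V x)" for x
      proof -
        have "V (case_nat s (fst x), case_nat n (snd x))
            = compound_coord (case_nat (max 0 s) (\<lambda>i. max 0 (fst x i))) (case_nat (max 1 n) (\<lambda>i. max 1 (snd x i)))"
          unfolding V_def by (auto intro!: arg_cong2[where f = compound_coord] split: nat.split)
        then show ?thesis
          by (simp only:) (subst monomial_compound_coord_Cons, auto simp: V_def split_beta)
      qed
      then show "(\<integral>\<^sup>+ x. ennreal (monomial (Suc m) e (V (case_nat s (fst x), case_nat n (snd x)))) \<partial>Q)
          = ennreal (exp (- max 0 s) ^ e 0) * D (Suc m - max 1 n) (\<lambda>k. e (max 1 n + k))"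
        unfolding D_def using V monomial_bounds[OF V_cube]
        by (subst nn_integral_cmult[symmetric]) (simp_all add: ennreal_mult)
    qed
    also have "\<dots> = (\<integral>\<^sup>+ s. ennreal (exp (- max 0 s) ^ e 0) * (\<integral>\<^sup>+ n. D (Suc m - max 1 n) (\<lambda>k. e (max 1 n + k)) \<partial>Geo \<theta>) \<partial>exponential_law \<theta>)"
      by (simp add: nn_integral_cmult)
    also have "\<dots> = ennreal (a (e 0)) * (\<integral>\<^sup>+ n. D (Suc m - max 1 n) (\<lambda>k. e (max 1 n + k)) \<partial>Geo \<theta>)"
      by (subst nn_integral_multc) (simp_all add: a)
    also have "(\<integral>\<^sup>+ n. D (Suc m - max 1 n) (\<lambda>k. e (max 1 n + k)) \<partial>Geo \<theta>) = G m (\<lambda>k. e (Suc k))"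
      by (simp add: Geo_def G_def)
    finally show ?thesis .
  qed
  \<comment> \<open>One Bernoulli trial: with probability \<open>\<theta>\<close> the cluster ends,
    otherwise the next gap is 0, contributes the factor 1, and the situation is the same with one
    exponent less.\<close>
  have G_rec: "G m e = ennreal \<theta> * D m e + ennreal (1 - \<theta>) * G (m - 1) (\<lambda>k. e (Suc k))" for m e
  proof -
    have "G m e = (\<integral>\<^sup>+ b. (if b then D m e else \<integral>\<^sup>+ j. D (m - Suc j) (\<lambda>k. e (Suc j + k)) \<partial>geometric_pmf \<theta>) \<partial>bernoulli_pmf \<theta>)"
      unfolding G_def using th
      by (subst geometric_bind_pmf_unfold)
        (auto simp: nn_integral_bind_pmf intro!: nn_integral_cong split: if_splits)
    also have "\<dots> = ennreal \<theta> * D m e + ennreal (1 - \<theta>) * (\<integral>\<^sup>+ j. D (m - Suc j) (\<lambda>k. e (Suc j + k)) \<partial>geometric_pmf \<theta>)"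
      using th by (simp add: mult.commute)
    finally show ?thesis by (simp add: G_def)
  qed
  have D_0: "D 0 e = 1" for e
    by (simp add: D_def monomial_def Q.emeasure_space_1)
  have G_eq: "G m e = ennreal (\<Prod>i<m. 1 - \<theta> + \<theta> * a (e i))" for m e
  proof (induction m arbitrary: e)
    case 0
    then show ?case
      by (simp add: G_def D_0 measure_pmf.emeasure_space_1[simplified])
  next
    case (Suc m)
    have nn: "0 \<le> (\<Prod>i<m. 1 - \<theta> + \<theta> * a (e (Suc i)))" using th a(1) by (intro prod_nonneg) simp
    have "G (Suc m) e = ennreal (\<theta> * (a (e 0) * (\<Prod>i<m. 1 - \<theta> + \<theta> * a (e (Suc i)))) + (1 - \<theta>) * (\<Prod>i<m. 1 - \<theta> + \<theta> * a (e (Suc i))))"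
      unfolding G_rec[of "Suc m"] D_Suc using th a(1) nn
      by (simp add: Suc.IH ennreal_mult[symmetric] ennreal_plus[symmetric] del: ennreal_plus)
    also have "\<theta> * (a (e 0) * (\<Prod>i<m. 1 - \<theta> + \<theta> * a (e (Suc i)))) + (1 - \<theta>) * (\<Prod>i<m. 1 - \<theta> + \<theta> * a (e (Suc i)))
        = (\<Prod>i<Suc m. 1 - \<theta> + \<theta> * a (e i))"
      unfolding prod.lessThan_Suc_shift by (simp add: algebra_simps)
    finally show ?case .
  qed
  have "(\<integral>\<^sup>+ \<omega>. ennreal (monomial (Suc m) e (V \<omega>)) \<partial>Q) = ennreal (a (e 0) * (\<Prod>i<m. 1 - \<theta> + \<theta> * a (e (Suc i))))"
    using D_Suc[of m e] a(1) th by (simp add: D_def G_eq ennreal_mult prod_nonneg)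
  then show "(\<integral>\<omega>. monomial (Suc m) e (V \<omega>) \<partial>Q) = a (e 0) * (\<Prod>i<m. 1 - \<theta> + \<theta> * a (e (Suc i)))"
    using monomial_bounds[OF V_cube] V a(1) th
    by (subst integral_eq_nn_integral) (auto simp: prod_nonneg)
qed

proposition converges_in_law_CPPP:
  fixes M :: "nat \<Rightarrow> 'a measure" and U :: "nat \<Rightarrow> 'a \<Rightarrow> nat \<Rightarrow> real"
  assumes th: "0 < \<theta>" "\<theta> \<le> 1"
    and prob: "\<And>n. prob_space (M n)"
    and N: "\<And>n. N n \<in> measurable (M n) (borel_of vague_topology)"
    and U: "\<And>n. U n \<in> borel_measurable (M n)" "\<And>n \<omega>. \<omega> \<in> space (M n) \<Longrightarrow> U n \<omega> \<in> unit_cube"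
    and U_null: "\<And>n. AE \<omega> in M n. cumprod (U n \<omega>) \<longlonglongrightarrow> 0"
    and N_eq: "\<And>n. AE \<omega> in M n. N n \<omega> = points_of (cumprod (U n \<omega>))"
    and moments: "\<And>m e. (\<lambda>n. \<integral>\<omega>. monomial (Suc m) e (U n \<omega>) \<partial>M n)
      \<longlonglongrightarrow> \<theta> / (\<theta> + real (e 0)) * (\<Prod>i<m. 1 - \<theta> + \<theta> * (\<theta> / (\<theta> + real (e (Suc i)))))"
  shows "converges_in_law M N (CPPP \<theta> (Geo \<theta>))"
proof -
  define Q where "Q = PiM UNIV (\<lambda>_ :: nat. exponential_law \<theta>) \<Otimes>\<^sub>M PiM UNIV (\<lambda>_ :: nat. measure_pmf (Geo \<theta>))"
  define V :: "(nat \<Rightarrow> real) \<times> (nat \<Rightarrow> nat) \<Rightarrow> nat \<Rightarrow> real"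
    where "V = (\<lambda>(W, X). compound_coord (\<lambda>i. max 0 (W i)) (\<lambda>i. max 1 (X i)))"
  note * = compound_moments[OF th, folded Q_def V_def]
  interpret Q: prob_space Q by (rule *)
  have V_cube: "V \<omega> \<in> unit_cube" for \<omega>
    by (auto simp: V_def split_beta intro!: compound_coord_unit_cube)
  have mom: "(\<lambda>n. \<integral>\<omega>. monomial m e (U n \<omega>) \<partial>M n) \<longlonglongrightarrow> (\<integral>\<omega>. monomial m e (V \<omega>) \<partial>Q)" for m e
  proof (cases m)
    case 0
    then show ?thesis using prob by (simp add: monomial_def prob_space.prob_space Q.prob_space)
  qed (use moments *(3) in simp)
  define r where "r = 1 - \<theta> + \<theta> * (\<theta> / (\<theta> + 1))"
  have "\<theta> * (\<theta> / (\<theta> + 1)) < \<theta> * 1" using th by (intro mult_strict_left_mono) auto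
  then have r: "0 \<le> r" "r < 1" using th by (simp_all add: r_def)
  have "(\<lambda>k. \<theta> / (\<theta> + 1) * r ^ k) \<longlonglongrightarrow> \<theta> / (\<theta> + 1) * 0"
    using r by (intro tendsto_mult_left LIMSEQ_power_zero) simp
  then have "(\<lambda>k. \<integral>\<omega>. monomial (Suc k) (\<lambda>_. 1) (V \<omega>) \<partial>Q) \<longlonglongrightarrow> 0"
    by (simp add: *(3) r_def)
  then have V_null: "AE \<omega> in Q. cumprod (V \<omega>) \<longlonglongrightarrow> 0"
    using *(2) V_cube by (intro Q.cumprod_null_AE) (simp_all add: LIMSEQ_imp_Suc)
  interpret A: sequence_space "exponential_law \<theta>"
    using prob_space_exponential_law[OF th(1)] by (simp add: sequence_space_def product_prob_space_def product_sigma_finite_def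
      product_prob_space_axioms_def prob_space_imp_sigma_finite)
  interpret B: sequence_space "measure_pmf (Geo \<theta>)"
    by (simp add: sequence_space_def product_prob_space_def product_sigma_finite_def
      product_prob_space_axioms_def prob_space_imp_sigma_finite measure_pmf.prob_space_axioms)
  interpret P: pair_prob_space "PiM UNIV (\<lambda>_ :: nat. exponential_law \<theta>)" "PiM UNIV (\<lambda>_ :: nat. measure_pmf (Geo \<theta>))" ..
  have [measurable]: "(\<lambda>\<omega>. fst \<omega> i) \<in> borel_measurable Q" for i
    unfolding Q_def by measurable
  have [measurable]: "(\<lambda>\<omega>. snd \<omega> i) \<in> measurable Q (count_space UNIV)" for i
    unfolding Q_def by measurable
  have W_pos: "AE \<omega> in Q. \<forall>i. 0 \<le> fst \<omega> i"
  proof -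
    have "AE W in PiM UNIV (\<lambda>_ :: nat. exponential_law \<theta>). \<forall>i. 0 \<le> W i"
      unfolding AE_all_countable using AE_exponential_law prob_space_exponential_law[OF th(1)]
      by (intro allI AE_PiM_component) auto
    then show ?thesis
      unfolding Q_def by (intro P.AE_pair_measure) auto
  qed
  have X_pos: "AE \<omega> in Q. \<forall>i. 1 \<le> snd \<omega> i"
  proof -
    have "AE X in PiM UNIV (\<lambda>_ :: nat. measure_pmf (Geo \<theta>)). \<forall>i. 1 \<le> X i"
      unfolding AE_all_countable
      by (intro allI AE_PiM_component) (auto simp: AE_measure_pmf_iff Geo_def measure_pmf.prob_space_axioms)
    then show ?thesis
      unfolding Q_def by (intro P.AE_pair_measure) auto
  qed
  define R where "R = (\<lambda>(W, X). as_point_measure (dirac_sum UNIV X (renewal_times W)))"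
  have Rm: "R \<in> measurable Q (borel_of vague_topology)"
    unfolding R_def split_beta renewal_times_def by (rule measurable_as_point_measure) measurable
  have R_eq: "AE \<omega> in Q. R \<omega> = points_of (cumprod (V \<omega>))"
    using V_null W_pos X_pos
  proof eventually_elim
    case (elim \<omega>)
    obtain W X where \<omega>: "\<omega> = (W, X)" by (cases \<omega>)
    have V: "V \<omega> = compound_coord W X" using elim(2,3) by (simp add: V_def \<omega> max_def)
    have "points_of (cumprod (V \<omega>)) = dirac_sum UNIV (\<lambda>_. 1) (\<lambda>k. renewal_times W (cluster_index X k))"
      by (simp add: points_of_def V cumprod_compound_coord)
    also have "\<dots> = dirac_sum UNIV X (renewal_times W)"
      using elim(3) by (intro dirac_sum_clusters) (simp add: \<omega>)
    finally have **: "points_of (cumprod (V \<omega>)) = dirac_sum UNIV X (renewal_times W)" .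
    have "points_of (cumprod (V \<omega>)) \<in> point_measures"
      by (intro points_of_point_measures cumprod_null_seqs V_cube elim(1))
    then show ?case unfolding ** by (simp add: R_def as_point_measure_def \<omega>)
  qed
  show ?thesis
    unfolding CPPP_def R_def[symmetric] Q_def[symmetric]
    by (rule converges_in_lawI[OF prob Q.prob_space_axioms N Rm U *(2) V_cube U_null V_null N_eq R_eq mom])
qed

section \<open>Return times in measure preserving systems\<close>

locale measure_preserving = prob_space M for M :: "'a measure" +
  fixes T :: "'a \<Rightarrow> 'a"
  assumes T_measurable [measurable]: "T \<in> measurable M M"
    and T_invariant: "distr M M T = M"
begin

lemma T_space: "x \<in> space M \<Longrightarrow> T x \<in> space M"
  using T_measurable by (rule measurable_space)

lemma T_pow_measurable [measurable]: "(\<lambda>x. (T ^^ n) x) \<in> measurable M M"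
  by (induction n) simp_all

lemma T_pow_space: "x \<in> space M \<Longrightarrow> (T ^^ n) x \<in> space M"
  using T_pow_measurable by (rule measurable_space)

lemma integral_T:
  fixes f :: "'a \<Rightarrow> real"
  assumes "f \<in> borel_measurable M"
  shows "(\<integral>x. f (T x) \<partial>M) = (\<integral>x. f x \<partial>M)"
  using integral_distr[OF T_measurable assms] by (simp add: T_invariant)

lemma AE_T:
  assumes "AE x in M. P x"
  shows "AE x in M. P (T x)"
proof -
  have "AE x in distr M M T. P x" unfolding T_invariant by (rule assms)
  then show ?thesis using T_measurable by (rule AE_distrD[rotated])
qed

lemma AE_T_pow:
  assumes "AE x in M. P x"
  shows "AE x in M. P ((T ^^ n) x)"
proof (induction n)
  case (Suc n)
  have "AE x in M. P ((T ^^ n) (T x))" using AE_T[OF Suc.IH] .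
  then show ?case by (simp add: funpow_swap1)
qed (use assms in simp)

definition hits :: "'a set \<Rightarrow> 'a \<Rightarrow> bool" where
  "hits B x \<longleftrightarrow> (\<exists>n\<ge>1. (T ^^ n) x \<in> B)"

definition ret :: "'a set \<Rightarrow> 'a \<Rightarrow> nat" where
  "ret B x = (LEAST n. 1 \<le> n \<and> (T ^^ n) x \<in> B)"

definition next_hit :: "'a set \<Rightarrow> 'a \<Rightarrow> 'a" where
  "next_hit B x = (T ^^ ret B x) x"

lemma ret_hits: "hits B x \<Longrightarrow> 1 \<le> ret B x \<and> next_hit B x \<in> B"
  unfolding hits_def ret_def next_hit_def by (rule LeastI_ex) auto

lemma ret_le: "1 \<le> n \<Longrightarrow> (T ^^ n) x \<in> B \<Longrightarrow> ret B x \<le> n"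
  unfolding ret_def by (rule Least_le) simp

lemma hits_step: "hits B x \<longleftrightarrow> T x \<in> B \<or> hits B (T x)"
proof
  assume "hits B x"
  then obtain n where n: "1 \<le> n" "(T ^^ n) x \<in> B" by (auto simp: hits_def)
  show "T x \<in> B \<or> hits B (T x)"
  proof (cases "n = 1")
    case False
    then obtain m where "n = Suc m" "1 \<le> m" using n(1) by (cases n) auto
    then have "(T ^^ m) (T x) \<in> B" using n(2) by (simp add: funpow_swap1)
    then show ?thesis using \<open>1 \<le> m\<close> by (auto simp: hits_def)
  qed (use n in simp)
next
  assume "T x \<in> B \<or> hits B (T x)"
  then show "hits B x"
  proof
    assume "hits B (T x)"
    then obtain m where "1 \<le> m" "(T ^^ m) (T x) \<in> B" by (auto simp: hits_def)
    then have "(T ^^ Suc m) x \<in> B" by (simp add: funpow_swap1)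
    then show ?thesis unfolding hits_def by (intro exI[of _ "Suc m"]) simp
  qed (auto simp: hits_def intro: exI[of _ 1])
qed

lemma ret_1: "T x \<in> B \<Longrightarrow> ret B x = 1"
  unfolding ret_def by (intro Least_equality) auto

lemma ret_Suc:
  assumes "T x \<notin> B" "hits B (T x)"
  shows "ret B x = Suc (ret B (T x))"
proof -
  have "ret B x \<le> Suc (ret B (T x))"
    using ret_hits[OF assms(2)] by (intro ret_le) (simp_all add: next_hit_def funpow_swap1)
  moreover have "Suc (ret B (T x)) \<le> ret B x"
  proof -
    have h: "hits B x" using assms hits_step by blast
    have "ret B x \<noteq> 1" using ret_hits[OF h] assms(1) by (auto simp: next_hit_def)
    then obtain m where m: "ret B x = Suc m" "1 \<le> m" using ret_hits[OF h] by (cases "ret B x") auto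
    then have "(T ^^ m) (T x) \<in> B" using ret_hits[OF h] by (simp add: next_hit_def funpow_swap1)
    then show ?thesis using ret_le m by simp
  qed
  ultimately show ?thesis by simp
qed

lemma next_hit_1: "T x \<in> B \<Longrightarrow> next_hit B x = T x"
  by (simp add: next_hit_def ret_1)

lemma next_hit_Suc: "T x \<notin> B \<Longrightarrow> hits B (T x) \<Longrightarrow> next_hit B x = next_hit B (T x)"
  by (simp add: next_hit_def ret_Suc funpow_swap1)

lemma hits_measurable [measurable]:
  assumes [measurable]: "B \<in> sets M"
  shows "Measurable.pred M (hits B)"
  unfolding hits_def[abs_def] by measurable

lemma ret_measurable [measurable]:
  assumes [measurable]: "B \<in> sets M"
  shows "ret B \<in> measurable M (count_space UNIV)"
  unfolding ret_def[abs_def] by measurable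

lemma next_hit_measurable [measurable]:
  assumes [measurable]: "B \<in> sets M"
  shows "next_hit B \<in> measurable M M"
  unfolding next_hit_def[abs_def]
  by (rule measurable_compose_countable[where f = "\<lambda>n x. (T ^^ n) x"]) measurable

lemma next_hit_space: "x \<in> space M \<Longrightarrow> next_hit B x \<in> space M"
  unfolding next_hit_def by (rule T_pow_space)

text \<open>With \<open>\<psi> = g\<close> on \<open>B\<close> and \<open>\<psi> = \<phi>\<close> off \<open>B\<close> one has \<open>\<phi> = q \<cdot> (\<psi> \<circ> T)\<close>; invariance does the rest.\<close>

lemma hitting_identity:
  fixes g :: "'a \<Rightarrow> real"
  assumes B [measurable]: "B \<in> sets M" and g [measurable]: "g \<in> borel_measurable M"
    and bound: "\<And>x. x \<in> space M \<Longrightarrow> \<bar>g x\<bar> \<le> C" and q: "0 \<le> q" "q \<le> 1"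
  defines "\<phi> \<equiv> \<lambda>x. if hits B x then q ^ ret B x * g (next_hit B x) else 0"
  shows "(1 - q) * (\<integral>x. \<phi> x \<partial>M) = q * ((\<integral>x. indicator B x * g x \<partial>M) - (\<integral>x. indicator B x * \<phi> x \<partial>M))"
proof -
  define \<psi> where "\<psi> x = indicator B x * g x + (\<phi> x - indicator B x * \<phi> x)" for x
  have C: "0 \<le> C" using bound not_empty by (meson abs_ge_zero equals0I order_trans)
  have [measurable]: "\<phi> \<in> borel_measurable M" unfolding \<phi>_def by measurable
  have \<phi>_bound: "\<bar>\<phi> x\<bar> \<le> C" if "x \<in> space M" for x
  proof -
    have "q ^ ret B x * \<bar>g (next_hit B x)\<bar> \<le> 1 * C"
      using q bound[OF next_hit_space[OF that]] by (intro mult_mono power_le_one) auto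
    then show ?thesis using C q by (auto simp: \<phi>_def abs_mult)
  qed
  have int: "integrable M \<phi>" "integrable M (\<lambda>x. indicator B x * \<phi> x)" "integrable M (\<lambda>x. indicator B x * g x)"
    using bound \<phi>_bound C
    by (auto intro!: integrable_const_bound[of _ C] AE_I2 split: split_indicator)
  have "\<phi> x = q * \<psi> (T x)" for x
  proof (cases "T x \<in> B")
    case True
    then have "hits B x" using hits_step by blast
    then show ?thesis using True by (simp add: \<phi>_def \<psi>_def ret_1 next_hit_1)
  next
    case False
    then have "hits B x \<longleftrightarrow> hits B (T x)" using hits_step by blast
    then show ?thesis using False by (simp add: \<phi>_def \<psi>_def ret_Suc next_hit_Suc)
  qed
  then have "(\<integral>x. \<phi> x \<partial>M) = q * (\<integral>x. \<psi> (T x) \<partial>M)" by simp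
  also have "(\<integral>x. \<psi> (T x) \<partial>M) = (\<integral>x. \<psi> x \<partial>M)"
    by (rule integral_T) (unfold \<psi>_def, measurable)
  also have "(\<integral>x. \<psi> x \<partial>M) = (\<integral>x. indicator B x * g x \<partial>M) + ((\<integral>x. \<phi> x \<partial>M) - (\<integral>x. indicator B x * \<phi> x \<partial>M))"
    unfolding \<psi>_def using int by simp
  finally show ?thesis by (simp add: algebra_simps)
qed

text \<open>Poincare recurrence, from \<open>hitting_identity\<close> with \<open>q = 1\<close> and
  \<open>g = 1\<close>: the left side vanishes, so the points of \<open>B\<close> that never return
  have measure 0.\<close>

lemma AE_hits:
  assumes B [measurable]: "B \<in> sets M"
  shows "AE x in M. x \<in> B \<longrightarrow> hits B x"
proof -
  have "(\<integral>x. indicator B x * (1::real) \<partial>M) = (\<integral>x. indicator B x * (if hits B x then 1 else 0) \<partial>M)"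
    using hitting_identity[OF B, of "\<lambda>_. 1" 1 1] by (simp cong: if_cong)
  then have "(\<integral>x. indicator B x - indicator B x * (if hits B x then 1 else (0::real)) \<partial>M) = 0"
    by (subst Bochner_Integration.integral_diff)
      (auto intro!: integrable_const_bound[of _ 1] split: split_indicator)
  then have "AE x in M. indicator B x - indicator B x * (if hits B x then 1 else (0::real)) = 0"
    by (subst (asm) integral_nonneg_eq_0_iff_AE)
      (auto intro!: integrable_const_bound[of _ 2] split: split_indicator)
  then show ?thesis by eventually_elim (auto split: split_indicator_asm if_splits)
qed

text \<open>For bounded \<open>f\<close> this is \<open>hitting_identity\<close> at
  \<open>q = 1\<close>; the general case follows by truncating at \<open>n\<close> and monotone
  convergence. In other words, the first return map preserves the measure restricted to
  \<open>B\<close>.\<close>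

lemma next_hit_invariant:
  assumes B [measurable]: "B \<in> sets M" and f [measurable]: "f \<in> borel_measurable M"
  shows "(\<integral>\<^sup>+ x. indicator B x * f (next_hit B x) \<partial>M) = (\<integral>\<^sup>+ x. indicator B x * f x \<partial>M)"
proof -
  have bounded: "(\<integral>\<^sup>+ x. indicator B x * min (f (next_hit B x)) (of_nat n) \<partial>M)
      = (\<integral>\<^sup>+ x. indicator B x * min (f x) (of_nat n) \<partial>M)" for n
  proof -
    define g where "g x = enn2real (min (f x) (of_nat n))" for x
    have g: "ennreal (g x) = min (f x) (of_nat n)" for x
      unfolding g_def by (intro ennreal_enn2real) (simp add: min_less_iff_disj of_nat_less_top)
    have gn: "0 \<le> g x" "g x \<le> real n" for x
    proof -
      show "0 \<le> g x" by (simp add: g_def)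
      have "ennreal (g x) \<le> ennreal (real n)"
        unfolding g ennreal_of_nat_eq_real_of_nat[symmetric] by (rule min.cobounded2)
      then show "g x \<le> real n" by simp
    qed
    have [measurable]: "g \<in> borel_measurable M" unfolding g_def by measurable
    have eq: "(\<integral>x. indicator B x * g x \<partial>M) = (\<integral>x. indicator B x * (if hits B x then g (next_hit B x) else 0) \<partial>M)"
      using hitting_identity[OF B, of g "real n" 1] gn by (simp cong: if_cong)
    have "(\<integral>\<^sup>+ x. indicator B x * min (f (next_hit B x)) (of_nat n) \<partial>M)
        = (\<integral>\<^sup>+ x. ennreal (indicator B x * (if hits B x then g (next_hit B x) else 0)) \<partial>M)"
      using AE_hits[OF B] by (intro nn_integral_cong_AE, elim eventually_mono) (auto simp: g split: split_indicator)
    also have "\<dots> = ennreal (\<integral>x. indicator B x * (if hits B x then g (next_hit B x) else 0) \<partial>M)"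
      using gn by (intro nn_integral_eq_integral integrable_const_bound[of _ "real n"]) (auto split: split_indicator)
    also have "\<dots> = ennreal (\<integral>x. indicator B x * g x \<partial>M)" by (simp only: eq)
    also have "\<dots> = (\<integral>\<^sup>+ x. ennreal (indicator B x * g x) \<partial>M)"
      using gn by (intro nn_integral_eq_integral[symmetric] integrable_const_bound[of _ "real n"]) (auto split: split_indicator)
    also have "\<dots> = (\<integral>\<^sup>+ x. indicator B x * min (f x) (of_nat n) \<partial>M)"
      by (intro nn_integral_cong) (auto simp: g split: split_indicator)
    finally show ?thesis .
  qed
  have sup: "(SUP n. min z (of_nat n)) = z" for z :: ennreal
  proof (cases z)
    case (real r)
    obtain n :: nat where "r \<le> real n" using real_arch_simple by blast
    then have "min z (of_nat n) = z" using real by (simp add: min_def ennreal_of_nat_eq_real_of_nat)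
    then have "z \<le> (SUP n. min z (of_nat n))" by (metis SUP_upper UNIV_I)
    then show ?thesis by (intro antisym SUP_least) auto
  next
    case top
    then show ?thesis by (simp add: min_def top_unique ennreal_SUP_of_nat_eq_top)
  qed
  have SUP: "(\<integral>\<^sup>+ x. indicator B x * F x \<partial>M) = (SUP n. \<integral>\<^sup>+ x. indicator B x * min (F x) (of_nat n) \<partial>M)"
    if [measurable]: "F \<in> borel_measurable M" for F :: "'a \<Rightarrow> ennreal"
  proof (subst nn_integral_monotone_convergence_SUP[symmetric])
    show "incseq (\<lambda>n x. indicator B x * min (F x) (of_nat n :: ennreal))"
      by (auto simp: incseq_def le_fun_def intro!: mult_left_mono min.mono)
    show "(\<integral>\<^sup>+ x. indicator B x * F x \<partial>M) = (\<integral>\<^sup>+ x. (SUP n. indicator B x * min (F x) (of_nat n)) \<partial>M)"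
      by (intro nn_integral_cong) (simp add: SUP_mult_left_ennreal[symmetric] sup)
  qed measurable
  show ?thesis by (subst (1 2) SUP) (simp_all add: bounded)
qed

text \<open>One half of Kac's formula. The waiting time capped at \<open>N\<close> is integrable and
  obeys the recursion \<open>step\<close>. Integrating it, with the invariance of the measure and
  \<open>\<rho> N \<le> \<rho> (Suc N)\<close>, bounds the integral of \<open>\<rho> N\<close> over
  \<open>B\<close> by 1.\<close>

lemma kac_le:
  assumes B [measurable]: "B \<in> sets M"
  shows "(\<integral>\<^sup>+ x. indicator B x * of_nat (ret B x) \<partial>M) \<le> 1"
proof -
  define \<rho> where "\<rho> N x = (if hits B x then min N (ret B x) else N)" for N x
  have [measurable]: "\<rho> N \<in> measurable M (count_space UNIV)" for N
    unfolding \<rho>_def by measurable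
  have step: "real (\<rho> (Suc N) x) = 1 + (real (\<rho> N (T x)) - indicator B (T x) * real (\<rho> N (T x)))" for N x
  proof (cases "T x \<in> B")
    case True
    then show ?thesis using hits_step[of B x] by (simp add: \<rho>_def ret_1)
  next
    case False
    then have "hits B x \<longleftrightarrow> hits B (T x)" using hits_step by blast
    then show ?thesis using False by (simp add: \<rho>_def ret_Suc)
  qed
  have le: "\<rho> N x \<le> N" for N x by (simp add: \<rho>_def)
  have int: "integrable M (\<lambda>x. real (\<rho> N x))" "integrable M (\<lambda>x. indicator B x * real (\<rho> N x))" for N
    using le by (auto intro!: integrable_const_bound[of _ "real N"] split: split_indicator)
  have "(\<integral>x. indicator B x * real (\<rho> N x) \<partial>M) \<le> 1" for N
  proof -
    have "(\<integral>x. real (\<rho> (Suc N) x) \<partial>M)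
        = (\<integral>x. (\<lambda>y. 1 + (real (\<rho> N y) - indicator B y * real (\<rho> N y))) (T x) \<partial>M)"
      by (simp add: step)
    also have "\<dots> = (\<integral>y. 1 + (real (\<rho> N y) - indicator B y * real (\<rho> N y)) \<partial>M)"
      by (rule integral_T) measurable
    also have "\<dots> = 1 + ((\<integral>y. real (\<rho> N y) \<partial>M) - (\<integral>y. indicator B y * real (\<rho> N y) \<partial>M))"
      using int by (simp add: prob_space)
    finally have "(\<integral>x. real (\<rho> (Suc N) x) \<partial>M) = \<dots>" .
    moreover have "(\<integral>x. real (\<rho> N x) \<partial>M) \<le> (\<integral>x. real (\<rho> (Suc N) x) \<partial>M)"
      using int by (intro integral_mono) (auto simp: \<rho>_def)
    ultimately show ?thesis by linarith
  qed
  then have *: "(\<integral>\<^sup>+ x. ennreal (indicator B x * real (\<rho> N x)) \<partial>M) \<le> 1" for N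
    using int by (subst nn_integral_eq_integral) (auto split: split_indicator)
  have "(\<integral>\<^sup>+ x. indicator B x * of_nat (ret B x) \<partial>M)
      \<le> (\<integral>\<^sup>+ x. (SUP N. ennreal (indicator B x * real (\<rho> N x))) \<partial>M)"
  proof (rule nn_integral_mono_AE)
    show "AE x in M. indicator B x * of_nat (ret B x) \<le> (SUP N. ennreal (indicator B x * real (\<rho> N x)))"
      using AE_hits[OF B]
    proof eventually_elim
      case (elim x)
      show ?case
      proof (cases "x \<in> B")
        case True
        then show ?thesis using elim
          by (intro SUP_upper2[of "ret B x"]) (auto simp: \<rho>_def ennreal_of_nat_eq_real_of_nat)
      qed simp
    qed
  qed
  also have "\<dots> = (SUP N. \<integral>\<^sup>+ x. ennreal (indicator B x * real (\<rho> N x)) \<partial>M)"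
  proof (rule nn_integral_monotone_convergence_SUP)
    show "incseq (\<lambda>N x. ennreal (indicator B x * real (\<rho> N x)))"
      by (auto simp: incseq_def le_fun_def \<rho>_def intro!: ennreal_leI mult_left_mono)
  qed measurable
  also have "\<dots> \<le> 1" by (rule SUP_least) (rule *)
  finally show ?thesis .
qed

text \<open>\<open>hit_laplace p B [s\<^sub>1, \<dots>, s\<^sub>m]\<close> is the product of the \<open>p ^ (s\<^sub>i * g\<^sub>i)\<close> over the first \<open>m\<close> gaps \<open>g\<^sub>i\<close> between
  visits to \<open>B\<close>.\<close>

fun hit_laplace :: "real \<Rightarrow> 'a set \<Rightarrow> nat list \<Rightarrow> 'a \<Rightarrow> real" where
  "hit_laplace p B [] x = 1"
| "hit_laplace p B (s # ss) x =
     (if hits B x then (p ^ s) ^ ret B x * hit_laplace p B ss (next_hit B x) else 0)"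

lemma hit_laplace_measurable [measurable]:
  assumes [measurable]: "B \<in> sets M"
  shows "hit_laplace p B ss \<in> borel_measurable M"
proof (induction ss)
  case (Cons s ss)
  note [measurable] = Cons.IH
  have "hit_laplace p B (s # ss) =
      (\<lambda>x. if hits B x then (p ^ s) ^ ret B x * hit_laplace p B ss (next_hit B x) else 0)"
    by (simp add: fun_eq_iff)
  also have "\<dots> \<in> borel_measurable M" by measurable
  finally show ?case .
next
  case Nil
  have "hit_laplace p B [] = (\<lambda>_. 1)" by (simp add: fun_eq_iff)
  then show ?case by simp
qed

lemma hit_laplace_bounds:
  assumes p: "0 \<le> p" "p \<le> 1"
  shows "0 \<le> hit_laplace p B ss x" "hit_laplace p B ss x \<le> 1"
proof (induction ss arbitrary: x)
  case (Cons s ss)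
  { case 1 show ?case using p Cons(1) by simp }
  { case 2
    have "(p ^ s) ^ ret B x * hit_laplace p B ss (next_hit B x) \<le> 1 * 1"
      using p Cons by (intro mult_mono power_le_one zero_le_power) auto
    then show ?case by simp }
qed simp_all

text \<open>The prelimit relation between hitting and return moments: for
  \<open>p = exp (- prob B)\<close> and small \<open>prob B\<close> the factor
  \<open>1 - p ^ s\<close> behaves like \<open>s * prob B\<close>, so division by
  \<open>prob B\<close> leads to the limit equation.\<close>

lemma hit_laplace_identity:
  assumes B: "B \<in> sets M" and p: "0 \<le> p" "p \<le> 1"
  shows "(1 - p ^ s) * (\<integral>x. hit_laplace p B (s # ss) x \<partial>M) = p ^ s *
    ((\<integral>x. indicator B x * hit_laplace p B ss x \<partial>M) - (\<integral>x. indicator B x * hit_laplace p B (s # ss) x \<partial>M))"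
  using hitting_identity[OF B hit_laplace_measurable[OF B], of p ss 1 "p ^ s"] hit_laplace_bounds[OF p] p
  by (simp add: power_le_one)

text \<open>A step that does not enter \<open>B\<close> shortens the first gap by 1 and leaves the
  others alone, so the two values differ by the factor \<open>p ^ s\<close>.\<close>

lemma hit_laplace_T:
  assumes "T x \<notin> B" and p: "0 \<le> p" "p \<le> 1"
  shows "\<bar>hit_laplace p B ss (T x) - hit_laplace p B ss x\<bar> \<le> 1 - p ^ (case ss of [] \<Rightarrow> 0 | s # _ \<Rightarrow> s)"
proof (cases ss)
  case (Cons s ss')
  have "hits B x \<longleftrightarrow> hits B (T x)" using assms(1) hits_step by blast
  then have "hit_laplace p B ss x = p ^ s * hit_laplace p B ss (T x)"
    using assms(1) by (simp add: Cons ret_Suc next_hit_Suc)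
  then have "hit_laplace p B ss (T x) - hit_laplace p B ss x = (1 - p ^ s) * hit_laplace p B ss (T x)"
    by (simp add: algebra_simps)
  moreover have "(1 - p ^ s) * hit_laplace p B ss (T x) \<le> (1 - p ^ s) * 1"
    using p hit_laplace_bounds[OF p] by (intro mult_left_mono) (auto simp: power_le_one)
  moreover have "0 \<le> (1 - p ^ s) * hit_laplace p B ss (T x)"
    using p hit_laplace_bounds(1)[OF p] by (intro mult_nonneg_nonneg) (auto simp: power_le_one)
  ultimately show ?thesis by (simp add: Cons)
qed simp

lemma hit_laplace_T_pow:
  assumes "\<And>j. 1 \<le> j \<Longrightarrow> j \<le> n \<Longrightarrow> (T ^^ j) x \<notin> B"
  shows "hit_laplace p B (s # ss) x = (p ^ s) ^ n * hit_laplace p B (s # ss) ((T ^^ n) x)"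
  using assms
proof (induction n)
  case (Suc n)
  let ?y = "(T ^^ n) x"
  have "T ?y \<notin> B" using Suc.prems[of "Suc n"] by simp
  moreover from this have "hits B ?y \<longleftrightarrow> hits B (T ?y)" using hits_step by blast
  ultimately have "hit_laplace p B (s # ss) ?y = p ^ s * hit_laplace p B (s # ss) (T ?y)"
    by (simp add: ret_Suc next_hit_Suc)
  then show ?case using Suc by simp
qed simp

lemma tendsto_exp_ratio:
  assumes e: "\<And>n. 0 < e n" "e \<longlonglongrightarrow> 0" and s: "0 < s"
  shows "(\<lambda>n. e n * exp (- e n) ^ s / (1 - exp (- e n) ^ s)) \<longlonglongrightarrow> 1 / real s"
proof -
  have p: "exp (- e n) ^ s = exp (- (e n * real s))" for n
    by (simp add: exp_of_nat_mult[symmetric] mult.commute)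
  have d: "((\<lambda>h::real. (exp h - 1) / h) \<longlongrightarrow> 1) (at 0)"
    using DERIV_exp[of "0::real"] by (simp add: DERIV_def)
  have "filterlim (\<lambda>n. - (e n * real s)) (at 0) sequentially"
    using e s tendsto_minus[OF tendsto_mult_right[OF e(2), of "real s"]]
    by (auto simp: filterlim_at intro!: always_eventually) (metis less_irrefl)
  from filterlim_compose[OF d this]
  have "(\<lambda>n. (exp (- (e n * real s)) - 1) / (- (e n * real s))) \<longlonglongrightarrow> 1" .
  then have "(\<lambda>n. exp (- (e n * real s)) / (real s * ((exp (- (e n * real s)) - 1) / (- (e n * real s)))))
      \<longlonglongrightarrow> exp (- (0 * real s)) / (real s * 1)"
    using s by (intro tendsto_intros e) auto
  moreover have "exp (- (e n * real s)) / (real s * ((exp (- (e n * real s)) - 1) / (- (e n * real s))))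
      = e n * exp (- e n) ^ s / (1 - exp (- e n) ^ s)" for n
    unfolding p using s e(1)[of n] by (simp add: divide_simps) (simp add: algebra_simps)
  ultimately show ?thesis by simp
qed

text \<open>If the processes started in \<open>B n\<close> look, up to a fraction \<open>1 - \<theta>\<close> of immediate returns, like the
  process started from the invariant measure, the hitting identity turns this into equations which determine
  all mixed moments.\<close>

proposition hit_laplace_limits:
  assumes B [measurable]: "\<And>n. B n \<in> sets M" and pos: "\<And>n. 0 < prob (B n)"
    and null: "(\<lambda>n. prob (B n)) \<longlonglongrightarrow> 0" and th: "0 < \<theta>" "\<theta> \<le> 1"
  defines "a \<equiv> \<lambda>ss n. \<integral>x. hit_laplace (exp (- prob (B n))) (B n) ss x \<partial>M"
    and "b \<equiv> \<lambda>ss n. (\<integral>x. indicator (B n) x * hit_laplace (exp (- prob (B n))) (B n) ss x \<partial>M) / prob (B n)"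
    and "\<beta> \<equiv> \<lambda>s. 1 - \<theta> + \<theta> * (\<theta> / (\<theta> + real s))"
  assumes H: "\<And>s ss. (\<lambda>n. b (s # ss) n - ((1 - \<theta>) * b ss n + \<theta> * a (s # ss) n)) \<longlonglongrightarrow> 0"
  shows "b ss \<longlonglongrightarrow> (\<Prod>s\<leftarrow>ss. \<beta> s)" and "a (s # ss) \<longlonglongrightarrow> \<theta> / (\<theta> + real s) * (\<Prod>s\<leftarrow>ss. \<beta> s)"
proof -
  \<comment> \<open>The coefficient of \<open>b ss - b (s # ss)\<close> after solving the hitting
    identity for \<open>a (s # ss)\<close>; it tends to \<open>1 / s\<close>.\<close>
  define c where "c s n = prob (B n) * exp (- prob (B n)) ^ s / (1 - exp (- prob (B n)) ^ s)" for s :: nat and n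
  have c_pos: "0 < c s n" if "0 < s" for s n
  proof -
    have "exp (- prob (B n)) ^ s < 1"
      using pos[of n] that by (simp add: power_less_one_iff)
    then show ?thesis using pos[of n] by (simp add: c_def)
  qed
  have c_lim: "c s \<longlonglongrightarrow> 1 / real s" if "0 < s" for s
    unfolding c_def by (rule tendsto_exp_ratio[OF pos null that])
  have ab: "a (s # ss) n = c s n * (b ss n - b (s # ss) n)" if "0 < s" for s ss n
  proof -
    let ?p = "exp (- prob (B n)) ^ s"
    have p: "0 < 1 - ?p" using pos[of n] that by (simp add: power_less_one_iff)
    have "(1 - ?p) * a (s # ss) n = ?p * (prob (B n) * b ss n - prob (B n) * b (s # ss) n)"
      using hit_laplace_identity[OF B[of n], of "exp (- prob (B n))" s ss] pos[of n]
      by (simp add: a_def b_def del: hit_laplace.simps)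
    then have "a (s # ss) n = ?p * (prob (B n) * b ss n - prob (B n) * b (s # ss) n) / (1 - ?p)"
      using p by (simp add: field_simps)
    also have "\<dots> = c s n * (b ss n - b (s # ss) n)" by (simp add: c_def algebra_simps)
    finally show ?thesis .
  qed
  \<comment> \<open>At \<open>s = 0\<close> the left side of the identity vanishes: it says nothing
    about \<open>a\<close>, but identifies \<open>b (0 # ss)\<close> with
    \<open>b ss\<close>.\<close>
  have b0: "b (0 # ss) n = b ss n" for ss n
  proof -
    have "(\<integral>x. indicator (B n) x * hit_laplace (exp (- prob (B n))) (B n) ss x \<partial>M)
        = (\<integral>x. indicator (B n) x * hit_laplace (exp (- prob (B n))) (B n) (0 # ss) x \<partial>M)"
      using hit_laplace_identity[OF B[of n], of "exp (- prob (B n))" 0 ss] by (simp del: hit_laplace.simps)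
    then show ?thesis by (simp add: b_def del: hit_laplace.simps)
  qed
  \<comment> \<open>Inserting \<open>a\<close> from the identity into \<open>H\<close> leaves a
    linear equation for \<open>b (s # ss)\<close> with coefficient
    \<open>1 + \<theta> * c s n\<close>.\<close>
  have step: "b (s # ss) \<longlonglongrightarrow> \<beta> s * L" if L: "b ss \<longlonglongrightarrow> L" for s ss L
  proof (cases "s = 0")
    case True
    then have "b (s # ss) = b ss" by (simp add: b0 fun_eq_iff)
    moreover have "\<beta> s = 1" using True th by (simp add: \<beta>_def)
    ultimately show ?thesis using L by simp
  next
    case False
    then have s: "0 < s" by simp
    have ne: "1 + \<theta> * c s n \<noteq> 0" for n using th c_pos[OF s, of n] by (smt (verit) mult_pos_pos)
    have ne': "1 + \<theta> * (1 / real s) \<noteq> 0" using th s by (simp add: add_pos_pos divide_simps)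
    define r where "r n = b (s # ss) n - ((1 - \<theta>) * b ss n + \<theta> * a (s # ss) n)" for n
    have "(1 + \<theta> * c s n) * b (s # ss) n = (1 - \<theta> + \<theta> * c s n) * b ss n + r n" for n
      unfolding r_def ab[OF s] by (simp add: algebra_simps)
    then have "b (s # ss) n = ((1 - \<theta> + \<theta> * c s n) * b ss n + r n) / (1 + \<theta> * c s n)" for n
      using ne[of n] by (simp add: field_simps)
    then have "b (s # ss) = (\<lambda>n. ((1 - \<theta> + \<theta> * c s n) * b ss n + r n) / (1 + \<theta> * c s n))" by auto
    also have "\<dots> \<longlonglongrightarrow> ((1 - \<theta> + \<theta> * (1 / real s)) * L + 0) / (1 + \<theta> * (1 / real s))"
      using ne' H[of s ss, folded r_def] by (intro tendsto_intros c_lim[OF s] L)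
    also have "((1 - \<theta> + \<theta> * (1 / real s)) * L + 0) / (1 + \<theta> * (1 / real s)) = \<beta> s * L"
    proof -
      have "\<theta> + real s \<noteq> 0" "1 + \<theta> / real s = (\<theta> + real s) / real s" using th s by (auto simp: field_simps)
      moreover have "1 - \<theta> + \<theta> / real s = (real s - \<theta> * real s + \<theta>) / real s"
        using s by (simp add: field_simps)
      moreover have "\<beta> s = (real s - \<theta> * real s + \<theta>) / (\<theta> + real s)"
        using \<open>\<theta> + real s \<noteq> 0\<close> unfolding \<beta>_def by (simp add: divide_simps) (simp add: algebra_simps)
      ultimately have "(1 - \<theta> + \<theta> / real s) / (1 + \<theta> / real s) = \<beta> s"
        using s by simp
      then show ?thesis by (metis add.right_neutral mult.commute mult.left_neutral times_divide_eq_right)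
    qed
    finally show ?thesis .
  qed
  have b_lim: "b ss \<longlonglongrightarrow> (\<Prod>s\<leftarrow>ss. \<beta> s)" for ss
  proof (induction ss)
    case Nil
    have "b [] n = 1" for n using pos[of n] by (simp add: b_def)
    then show ?case by (simp add: fun_eq_iff)
  next
    case (Cons s ss)
    then show ?case using step[OF Cons.IH] by simp
  qed
  then show "b ss \<longlonglongrightarrow> (\<Prod>s\<leftarrow>ss. \<beta> s)" .
  let ?L = "\<Prod>s\<leftarrow>ss. \<beta> s"
  show "a (s # ss) \<longlonglongrightarrow> \<theta> / (\<theta> + real s) * ?L"
  proof (cases "s = 0")
    case True
    \<comment> \<open>In this case \<open>a\<close> is recovered from \<open>H\<close>, by division
      by \<open>\<theta>\<close>.\<close>
    have "(\<lambda>n. ((b (s # ss) n - (1 - \<theta>) * b ss n) - (b (s # ss) n - ((1 - \<theta>) * b ss n + \<theta> * a (s # ss) n))) / \<theta>)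
        \<longlonglongrightarrow> ((\<beta> s * ?L - (1 - \<theta>) * ?L) - 0) / \<theta>"
      using th by (intro tendsto_intros H step[OF b_lim] b_lim) auto
    then show ?thesis using True th by (simp add: \<beta>_def algebra_simps)
  next
    case False
    then have s: "0 < s" by simp
    have "(\<lambda>n. c s n * (b ss n - b (s # ss) n)) \<longlonglongrightarrow> 1 / real s * (?L - \<beta> s * ?L)"
      by (intro tendsto_intros c_lim[OF s] step[OF b_lim] b_lim)
    moreover have "1 / real s * (?L - \<beta> s * ?L) = \<theta> / (\<theta> + real s) * ?L"
    proof -
      have "\<theta> + real s \<noteq> 0" using th by linarith
      then have "1 - \<beta> s = \<theta> * real s / (\<theta> + real s)"
        unfolding \<beta>_def by (simp add: divide_simps) (simp add: algebra_simps)
      then have "(1 - \<beta> s) / real s = \<theta> / (\<theta> + real s)"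
        using s by simp
      then show ?thesis by (metis (no_types, lifting) left_diff_distrib mult.commute mult.left_neutral times_divide_eq_left times_divide_eq_right)
    qed
    moreover have "a (s # ss) = (\<lambda>n. c s n * (b ss n - b (s # ss) n))"
      using ab[OF s] by (simp add: fun_eq_iff)
    ultimately show ?thesis by (simp only:)
  qed
qed

end

section \<open>Asymptotically invariant functions in ergodic systems\<close>

locale ergodic_system = measure_preserving +
  assumes ergodic: "\<And>E. E \<in> sets M \<Longrightarrow> T -` E \<inter> space M = E \<Longrightarrow> emeasure M E = 0 \<or> emeasure M (space M - E) = 0"
begin

text \<open>Ergodicity is assumed for strictly invariant sets, while \<open>k\<close> is invariant
  only almost everywhere. The set of points whose orbit eventually stays in \<open>{m < k}\<close>
  is strictly invariant and agrees almost everywhere with \<open>{m < k}\<close>; so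
  \<open>k\<close> lies almost surely on one side of its mean, and hence equals it.\<close>

lemma AE_constant:
  fixes k :: "'a \<Rightarrow> real"
  assumes int: "integrable M k" and inv: "AE x in M. k (T x) = k x"
  shows "AE x in M. k x = (\<integral>x. k x \<partial>M)"
proof -
  define m where "m = (\<integral>x. k x \<partial>M)"
  have [measurable]: "k \<in> borel_measurable M" using int by simp
  define E where "E = {x \<in> space M. \<exists>N. \<forall>j\<ge>N. m < k ((T ^^ j) x)}"
  have E_sets: "E \<in> sets M" unfolding E_def by measurable
  have "(\<exists>N. \<forall>j\<ge>N. m < k ((T ^^ j) (T x))) \<longleftrightarrow> (\<exists>N. \<forall>j\<ge>N. m < k ((T ^^ j) x))" for x
  proof -
    have "(\<exists>N. \<forall>j\<ge>N. m < k ((T ^^ j) x)) \<longleftrightarrow> (\<forall>\<^sub>F j in sequentially. m < k ((T ^^ j) x))"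
      by (simp add: eventually_sequentially)
    also have "\<dots> \<longleftrightarrow> (\<forall>\<^sub>F j in sequentially. m < k ((T ^^ (j + 1)) x))"
      by (rule eventually_sequentially_seg[symmetric])
    also have "\<dots> \<longleftrightarrow> (\<exists>N. \<forall>j\<ge>N. m < k ((T ^^ j) (T x)))"
      by (simp add: eventually_sequentially funpow_swap1)
    finally show ?thesis by simp
  qed
  then have "T -` E \<inter> space M = E" by (auto simp: E_def T_space)
  then have "emeasure M E = 0 \<or> emeasure M (space M - E) = 0" by (rule ergodic[OF E_sets])
  moreover have E_iff: "AE x in M. x \<in> E \<longleftrightarrow> m < k x"
  proof -
    have "AE x in M. \<forall>j. k (T ((T ^^ j) x)) = k ((T ^^ j) x)"
      unfolding AE_all_countable using AE_T_pow[OF inv] by blast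
    then show ?thesis
    proof (rule AE_mp, intro AE_I2 impI)
      fix x assume x: "x \<in> space M" "\<forall>j. k (T ((T ^^ j) x)) = k ((T ^^ j) x)"
      then have "k ((T ^^ j) x) = k x" for j by (induction j) auto
      then show "x \<in> E \<longleftrightarrow> m < k x" using x(1) by (auto simp: E_def)
    qed
  qed
  ultimately consider "AE x in M. k x \<le> m" | "AE x in M. m < k x"
  proof (elim disjE)
    assume "emeasure M E = 0"
    then have "AE x in M. x \<notin> E" using E_sets by (intro AE_not_in null_setsI)
    with E_iff have "AE x in M. k x \<le> m" by eventually_elim auto
    then show ?thesis using that by blast
  next
    assume "emeasure M (space M - E) = 0"
    then have "AE x in M. x \<notin> space M - E" using E_sets by (intro AE_not_in null_setsI) auto
    with E_iff AE_space have "AE x in M. m < k x" by eventually_elim auto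
    then show ?thesis using that by blast
  qed
  then show ?thesis
  proof cases
    case 1
    have "(\<integral>x. m - k x \<partial>M) = 0" using int by (simp add: m_def prob_space)
    then have "AE x in M. m - k x = 0"
      using 1 int by (subst (asm) integral_nonneg_eq_0_iff_AE) auto
    then show ?thesis by eventually_elim (simp add: m_def)
  next
    case 2
    have "(\<integral>x. k x - m \<partial>M) = 0" using int by (simp add: m_def prob_space)
    then have "AE x in M. k x - m = 0"
      using 2 int by (subst (asm) integral_nonneg_eq_0_iff_AE) (auto elim: eventually_mono)
    then show ?thesis by (simp add: m_def)
  qed
qed

text \<open>The obstructions to decorrelation from \<open>v\<close> at scale \<open>N\<close>. That
  there are none for some \<open>N\<close> is a bound uniform over all functions with values in
  \<open>[0,1]\<close>, which is what a sequence of functions varying with \<open>n\<close>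
  requires.\<close>

definition almost_invariant :: "('a \<Rightarrow> real) \<Rightarrow> real \<Rightarrow> nat \<Rightarrow> ('a \<Rightarrow> real) set" where
  "almost_invariant v e N = {k \<in> borel_measurable M. (\<forall>x\<in>space M. 0 \<le> k x \<and> k x \<le> 1) \<and>
     e \<le> (\<integral>x. k x * v x \<partial>M) \<and> (\<integral>x. \<bar>k (T x) - k x\<bar> \<partial>M) \<le> 1 / real (Suc N)}"

text \<open>Elements of almost minimal norm of these decreasing convex sets form a Cauchy sequence in mean
  square, and the limit is invariant, hence constant.\<close>

lemma almost_invariant_empty:
  assumes v: "integrable M v" "(\<integral>x. v x \<partial>M) = 0" and e: "0 < e"
  shows "\<exists>N. almost_invariant v e N = {}"
proof (rule ccontr)
  assume "\<not> ?thesis"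
  then have ne: "almost_invariant v e N \<noteq> {}" for N by blast
  note [measurable] = borel_measurable_integrable[OF v(1)]
  define \<delta> where "\<delta> N = (INF k\<in>almost_invariant v e N. \<integral>x. (k x)\<^sup>2 \<partial>M)" for N
  have bdd: "bdd_below ((\<lambda>k. \<integral>x. (k x)\<^sup>2 \<partial>M) ` almost_invariant v e N)" for N
    by (rule bdd_belowI2[of _ 0]) simp
  have "\<exists>k\<in>almost_invariant v e N. (\<integral>x. (k x)\<^sup>2 \<partial>M) < \<delta> N + 1 / real (Suc N)" for N
  proof -
    have "\<delta> N < \<delta> N + 1 / real (Suc N)" by simp
    then show ?thesis unfolding \<delta>_def by (subst (asm) cINF_less_iff[OF ne bdd]) simp
  qed
  then obtain k where k: "\<And>N. k N \<in> almost_invariant v e N"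
    and k_min: "\<And>N. (\<integral>x. (k N x)\<^sup>2 \<partial>M) < \<delta> N + 1 / real (Suc N)" by metis
  have km [measurable]: "k N \<in> borel_measurable M" for N
    using k[of N] by (simp add: almost_invariant_def)
  have kb: "0 \<le> k N x" "k N x \<le> 1" if "x \<in> space M" for N x
    using k[of N] that by (auto simp: almost_invariant_def)
  have sub: "almost_invariant v e i \<subseteq> almost_invariant v e N" if "N \<le> i" for N i
  proof -
    have "1 / real (Suc i) \<le> 1 / real (Suc N)" using that by (simp add: field_simps)
    then show ?thesis by (auto simp: almost_invariant_def intro: order_trans simp del: of_nat_Suc)
  qed
  have kint: "integrable M (k N)" for N
    using kb by (intro integrable_const_bound[of _ 1]) auto
  have sq: "integrable M (\<lambda>x. (f x)\<^sup>2)" if "f \<in> borel_measurable M" "\<And>x. x \<in> space M \<Longrightarrow> \<bar>f x\<bar> \<le> 1" for f :: "'a \<Rightarrow> real"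
    using that by (intro integrable_const_bound[of _ 1]) (auto simp: abs_square_le_1)
  have \<delta>_mono: "\<delta> N \<le> \<delta> i" if "N \<le> i" for N i
    unfolding \<delta>_def using ne bdd sub[OF that] by (intro cINF_superset_mono) auto
  have \<delta>_le: "\<delta> N \<le> 1" for N
  proof -
    have "\<delta> N \<le> (\<integral>x. (k N x)\<^sup>2 \<partial>M)" unfolding \<delta>_def by (rule cINF_lower[OF bdd k])
    also have "\<dots> \<le> (\<integral>x. 1 \<partial>M)"
      using kb by (intro integral_mono sq) (auto simp: power_le_one)
    finally show ?thesis by (simp add: prob_space)
  qed
  have "incseq \<delta>" using \<delta>_mono by (auto simp: incseq_def)
  then obtain L where L: "\<delta> \<longlonglongrightarrow> L" "\<And>i. \<delta> i \<le> L"
    using incseq_convergent[of \<delta> 1] \<delta>_le by auto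
  \<comment> \<open>The midpoint of two members is again a member, so its mean square is at least
    \<open>\<delta> N\<close>; the parallelogram law then bounds the distance.\<close>
  have close: "(\<integral>x. (k i x - k j x)\<^sup>2 \<partial>M) \<le> 4 * (L - \<delta> N) + 4 / real (Suc N)" if "N \<le> i" "N \<le> j" for N i j
  proof -
    define m where "m x = (k i x + k j x) / 2" for x
    have mm [measurable]: "m \<in> borel_measurable M" unfolding m_def by measurable
    have mb: "0 \<le> m x \<and> m x \<le> 1" if "x \<in> space M" for x
      using kb[OF that, of i] kb[OF that, of j] by (simp add: m_def)
    have kv: "integrable M (\<lambda>x. k n x * v x)" for n
      using kb by (intro Bochner_Integration.integrable_bound[OF v(1)])
        (auto simp: abs_mult intro!: AE_I2 mult_left_le_one_le)
    have "(\<integral>x. m x * v x \<partial>M) = ((\<integral>x. k i x * v x \<partial>M) + (\<integral>x. k j x * v x \<partial>M)) / 2"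
    proof -
      have "(\<integral>x. m x * v x \<partial>M) = (\<integral>x. (k i x * v x + k j x * v x) / 2 \<partial>M)"
        by (simp add: m_def distrib_right)
      then show ?thesis using kv by simp
    qed
    moreover have "e \<le> (\<integral>x. k i x * v x \<partial>M)" "e \<le> (\<integral>x. k j x * v x \<partial>M)"
      using k[of i] k[of j] by (auto simp: almost_invariant_def)
    ultimately have mv: "e \<le> (\<integral>x. m x * v x \<partial>M)" by simp
    have dint: "integrable M (\<lambda>x. \<bar>f (T x) - f x\<bar>)" if "f \<in> borel_measurable M" "\<And>x. x \<in> space M \<Longrightarrow> 0 \<le> f x \<and> f x \<le> 1" for f :: "'a \<Rightarrow> real"
    proof (rule integrable_const_bound)
      have "norm \<bar>f (T x) - f x\<bar> \<le> 1" if "x \<in> space M" for x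
        using \<open>\<And>x. x \<in> space M \<Longrightarrow> 0 \<le> f x \<and> f x \<le> 1\<close>[OF that] \<open>\<And>x. x \<in> space M \<Longrightarrow> 0 \<le> f x \<and> f x \<le> 1\<close>[OF T_space[OF that]]
        by (simp add: abs_le_iff)
      then show "AE x in M. norm \<bar>f (T x) - f x\<bar> \<le> 1" by (rule AE_I2)
    qed (use that(1) in measurable)
    have "(\<integral>x. \<bar>m (T x) - m x\<bar> \<partial>M) \<le> (\<integral>x. (\<bar>k i (T x) - k i x\<bar> + \<bar>k j (T x) - k j x\<bar>) / 2 \<partial>M)"
    proof (rule integral_mono)
      show "\<bar>m (T x) - m x\<bar> \<le> (\<bar>k i (T x) - k i x\<bar> + \<bar>k j (T x) - k j x\<bar>) / 2" for x
      proof -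
        have "m (T x) - m x = ((k i (T x) - k i x) + (k j (T x) - k j x)) / 2"
          by (simp add: m_def field_simps)
        then show ?thesis
          by (simp only: abs_divide abs_numeral) (intro divide_right_mono abs_triangle_ineq, simp)
      qed
    qed (use dint[OF mm mb] dint[OF km] kb in auto)
    also have "\<dots> = ((\<integral>x. \<bar>k i (T x) - k i x\<bar> \<partial>M) + (\<integral>x. \<bar>k j (T x) - k j x\<bar> \<partial>M)) / 2"
      using dint[OF km] kb by simp
    also have "\<dots> \<le> 1 / real (Suc N)"
    proof -
      have "(\<integral>x. \<bar>k n (T x) - k n x\<bar> \<partial>M) \<le> 1 / real (Suc N)" if "N \<le> n" for n
        using subsetD[OF sub[OF that] k] by (simp add: almost_invariant_def)
      from this[OF that(1)] this[OF that(2)] show ?thesis by simp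
    qed
    finally have "m \<in> almost_invariant v e N"
      using mm mb mv by (simp add: almost_invariant_def del: of_nat_Suc)
    then have mN: "\<delta> N \<le> (\<integral>x. (m x)\<^sup>2 \<partial>M)"
      unfolding \<delta>_def by (rule cINF_lower[OF bdd])
    have "(k i x - k j x)\<^sup>2 = 2 * (k i x)\<^sup>2 + 2 * (k j x)\<^sup>2 - 4 * (m x)\<^sup>2" for x
      unfolding m_def by (simp add: power2_eq_square field_simps)
    then have "(\<integral>x. (k i x - k j x)\<^sup>2 \<partial>M) = 2 * (\<integral>x. (k i x)\<^sup>2 \<partial>M) + 2 * (\<integral>x. (k j x)\<^sup>2 \<partial>M) - 4 * (\<integral>x. (m x)\<^sup>2 \<partial>M)"
      using sq[OF km] sq[OF mm] kb mb by simp
    moreover have "1 / real (Suc i) \<le> 1 / real (Suc N)" "1 / real (Suc j) \<le> 1 / real (Suc N)"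
      using that by (simp_all add: field_simps)
    ultimately show ?thesis using k_min[of i] k_min[of j] L(2)[of i] L(2)[of j] mN
      by (simp del: of_nat_Suc)
  qed
  have cauchy: "\<exists>N. \<forall>i\<ge>N. \<forall>j\<ge>N. (\<integral>x. norm (k i x - k j x) \<partial>M) < d" if d: "0 < d" for d
  proof -
    have "(\<lambda>N. 4 * (L - \<delta> N) + 4 * inverse (real (Suc N))) \<longlonglongrightarrow> 4 * (L - L) + 4 * 0"
      by (intro tendsto_intros L LIMSEQ_inverse_real_of_nat)
    then have "\<forall>\<^sub>F N in sequentially. 4 * (L - \<delta> N) + 4 * inverse (real (Suc N)) < d\<^sup>2"
      by (rule order_tendstoD) (use d in simp)
    then obtain N where N: "4 * (L - \<delta> N) + 4 / real (Suc N) < d\<^sup>2"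
      by (auto simp: eventually_sequentially divide_inverse)
    have "(\<integral>x. norm (k i x - k j x) \<partial>M) < d" if ij: "N \<le> i" "N \<le> j" for i j
    proof -
      have si: "integrable M (\<lambda>x. (k i x - k j x)\<^sup>2)"
      proof (rule sq)
        show "\<bar>k i x - k j x\<bar> \<le> 1" if "x \<in> space M" for x
          using kb[OF that, of i] kb[OF that, of j] by (simp add: abs_le_iff)
      qed measurable
      have "(\<integral>x. norm (k i x - k j x) \<partial>M) \<le> (\<integral>x. d / 2 + (k i x - k j x)\<^sup>2 / (2 * d) \<partial>M)"
      proof (rule integral_mono)
        \<comment> \<open>Expanding the square of \<open>|k i x - k j x| - d\<close>: closeness in
          mean square gives closeness in mean.\<close>
        show "norm (k i x - k j x) \<le> d / 2 + (k i x - k j x)\<^sup>2 / (2 * d)" for x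
          using zero_le_power2[of "\<bar>k i x - k j x\<bar> - d"] d
          by (simp add: power2_eq_square field_simps)
      qed (use kint si in auto)
      also have "\<dots> = d / 2 + (\<integral>x. (k i x - k j x)\<^sup>2 \<partial>M) / (2 * d)"
        using si by (simp add: prob_space)
      also have "\<dots> < d / 2 + d\<^sup>2 / (2 * d)"
        using close[OF ij] N d by (intro add_strict_left_mono divide_strict_right_mono) auto
      also have "\<dots> = d" using d by (simp add: power2_eq_square)
      finally show ?thesis .
    qed
    then show ?thesis by blast
  qed
  obtain r where r: "strict_mono r" and AE_cauchy: "AE x in M. Cauchy (\<lambda>i. k (r i) x)"
    by (rule cauchy_L1_AE_cauchy_subseq[of M k, OF kint cauchy])
  define f where "f x = lim (\<lambda>i. k (r i) x)" for x
  have fm [measurable]: "f \<in> borel_measurable M" unfolding f_def by measurable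
  have lim: "AE x in M. (\<lambda>i. k (r i) x) \<longlonglongrightarrow> f x"
    using AE_cauchy by eventually_elim (simp add: f_def Cauchy_convergent_iff convergent_LIMSEQ_iff)
  have fb: "AE x in M. 0 \<le> f x \<and> f x \<le> 1"
    using lim AE_space
  proof eventually_elim
    case (elim x)
    show ?case
      using LIMSEQ_le_const[OF elim(1), of 0] LIMSEQ_le_const2[OF elim(1), of 1] kb[OF elim(2)] by blast
  qed
  have fint: "integrable M f"
    by (rule integrable_const_bound[of _ 1]) (use fb in \<open>auto elim: eventually_mono\<close>)
  have "(\<lambda>i. \<integral>x. k (r i) x * v x \<partial>M) \<longlonglongrightarrow> (\<integral>x. f x * v x \<partial>M)"
  proof (rule integral_dominated_convergence[where w = "\<lambda>x. \<bar>v x\<bar>"])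
    show "AE x in M. (\<lambda>i. k (r i) x * v x) \<longlonglongrightarrow> f x * v x"
      using lim by eventually_elim (intro tendsto_intros)
    show "AE x in M. norm (k (r i) x * v x) \<le> \<bar>v x\<bar>" for i
      using kb by (intro AE_I2) (auto simp: abs_mult intro!: mult_left_le_one_le)
  qed (use v in auto)
  moreover have "e \<le> (\<integral>x. k n x * v x \<partial>M)" for n using k[of n] by (auto simp: almost_invariant_def)
  ultimately have ev: "e \<le> (\<integral>x. f x * v x \<partial>M)" by (auto intro: LIMSEQ_le_const)
  have "(\<lambda>i. \<integral>x. \<bar>k (r i) (T x) - k (r i) x\<bar> \<partial>M) \<longlonglongrightarrow> (\<integral>x. \<bar>f (T x) - f x\<bar> \<partial>M)"
  proof (rule integral_dominated_convergence[where w = "\<lambda>x. 1"])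
    show "AE x in M. (\<lambda>i. \<bar>k (r i) (T x) - k (r i) x\<bar>) \<longlonglongrightarrow> \<bar>f (T x) - f x\<bar>"
      using lim AE_T[OF lim] by eventually_elim (intro tendsto_intros)
    have "norm \<bar>k (r i) (T x) - k (r i) x\<bar> \<le> 1" if "x \<in> space M" for x i
      using kb[OF that, of "r i"] kb[OF T_space[OF that], of "r i"] by (simp add: abs_le_iff)
    then show "AE x in M. norm \<bar>k (r i) (T x) - k (r i) x\<bar> \<le> 1" for i by (intro AE_I2)
  qed auto
  moreover have "(\<lambda>i. \<integral>x. \<bar>k (r i) (T x) - k (r i) x\<bar> \<partial>M) \<longlonglongrightarrow> 0"
  proof (rule tendsto_sandwich[of "\<lambda>_. 0" _ _ "\<lambda>i. inverse (real (Suc (r i)))"])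
    show "(\<lambda>i. inverse (real (Suc (r i)))) \<longlonglongrightarrow> 0"
      using LIMSEQ_subseq_LIMSEQ[OF LIMSEQ_inverse_real_of_nat r] by (simp add: comp_def)
    show "\<forall>\<^sub>F i in sequentially. (\<integral>x. \<bar>k (r i) (T x) - k (r i) x\<bar> \<partial>M) \<le> inverse (real (Suc (r i)))"
      using k by (auto simp: almost_invariant_def divide_inverse simp del: of_nat_Suc)
  qed auto
  ultimately have "(\<integral>x. \<bar>f (T x) - f x\<bar> \<partial>M) = 0" by (rule LIMSEQ_unique)
  moreover have "integrable M (\<lambda>x. \<bar>f (T x) - f x\<bar>)"
  proof (rule integrable_const_bound)
    show "AE x in M. norm \<bar>f (T x) - f x\<bar> \<le> 1"
      using fb AE_T[OF fb] by eventually_elim (simp add: abs_le_iff)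
  qed measurable
  ultimately have "AE x in M. f (T x) = f x"
    by (subst (asm) integral_nonneg_eq_0_iff_AE) auto
  from AE_constant[OF fint this] have "(\<integral>x. f x * v x \<partial>M) = (\<integral>x. (\<integral>y. f y \<partial>M) * v x \<partial>M)"
    by (intro integral_cong_AE) (auto elim: eventually_mono)
  also have "\<dots> = 0" using v by simp
  finally show False using ev e by simp
qed

text \<open>Subtracting the mean of \<open>u\<close> reduces the claim to densities of mean 0. For
  these \<open>almost_invariant_empty\<close> applies, since \<open>inv\<close> brings
  \<open>F n\<close> below every scale of almost invariance; the two signs of the density give both
  inequalities.\<close>

theorem asymptotic_independence:
  assumes F [measurable]: "\<And>n. F n \<in> borel_measurable M"
    and b: "\<And>n x. x \<in> space M \<Longrightarrow> 0 \<le> F n x \<and> F n x \<le> 1"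
    and inv: "(\<lambda>n. \<integral>x. \<bar>F n (T x) - F n x\<bar> \<partial>M) \<longlonglongrightarrow> 0"
    and u: "integrable M (u :: 'a \<Rightarrow> real)"
  shows "(\<lambda>n. (\<integral>x. F n x * u x \<partial>M) - (\<integral>x. F n x \<partial>M) * (\<integral>x. u x \<partial>M)) \<longlonglongrightarrow> 0"
proof -
  have freq: "\<forall>\<^sub>F n in sequentially. (\<integral>x. F n x * v x \<partial>M) < e"
    if v: "integrable M v" "(\<integral>x. v x \<partial>M) = 0" and e: "0 < e" for v :: "'a \<Rightarrow> real" and e
  proof -
    obtain N where N: "almost_invariant v e N = {}" using almost_invariant_empty[OF v e] by blast
    have "\<forall>\<^sub>F n in sequentially. (\<integral>x. \<bar>F n (T x) - F n x\<bar> \<partial>M) < 1 / real (Suc N)"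
      using inv by (rule order_tendstoD) simp
    then show ?thesis
    proof eventually_elim
      case (elim n)
      have "F n \<notin> almost_invariant v e N" using N by blast
      then show ?case using elim b F by (auto simp: almost_invariant_def simp del: of_nat_Suc)
    qed
  qed
  define v where "v x = u x - (\<integral>y. u y \<partial>M)" for x
  have v: "integrable M v" "(\<integral>x. v x \<partial>M) = 0"
    unfolding v_def using u by (auto simp: prob_space)
  have v': "integrable M (\<lambda>x. - v x)" "(\<integral>x. - v x \<partial>M) = 0" using v by auto
  have "(\<lambda>n. \<integral>x. F n x * v x \<partial>M) \<longlonglongrightarrow> 0"
    unfolding tendsto_iff dist_real_def
  proof (intro allI impI)
    fix e :: real assume e: "0 < e"
    show "\<forall>\<^sub>F n in sequentially. \<bar>(\<integral>x. F n x * v x \<partial>M) - 0\<bar> < e"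
      using freq[OF v e] freq[OF v' e] by eventually_elim (simp add: abs_less_iff)
  qed
  moreover have "(\<integral>x. F n x * v x \<partial>M) = (\<integral>x. F n x * u x \<partial>M) - (\<integral>x. F n x \<partial>M) * (\<integral>x. u x \<partial>M)" for n
  proof -
    have "integrable M (F n)" using b by (intro integrable_const_bound[of _ 1]) auto
    moreover have "integrable M (\<lambda>x. F n x * u x)"
      using b u by (intro Bochner_Integration.integrable_bound[OF u])
        (auto simp: abs_mult intro!: AE_I2 mult_left_le_one_le)
    ultimately show ?thesis by (simp add: v_def right_diff_distrib)
  qed
  ultimately show ?thesis by simp
qed

text \<open>Recurrence puts almost all of \<open>B\<close> into the set of points with infinitely
  many visits; this set is strictly invariant and has positive measure, so by ergodicity its
  complement is null.\<close>

lemma AE_infinitely_often: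
  assumes B [measurable]: "B \<in> sets M" and pos: "0 < emeasure M B"
  shows "AE x in M. \<forall>N. \<exists>n\<ge>N. (T ^^ n) x \<in> B"
proof -
  define E where "E = {x \<in> space M. \<forall>N. \<exists>n\<ge>N. (T ^^ n) x \<in> B}"
  have E_sets [measurable]: "E \<in> sets M" unfolding E_def by measurable
  have "(\<forall>N. \<exists>n\<ge>N. (T ^^ n) (T x) \<in> B) \<longleftrightarrow> (\<forall>N. \<exists>n\<ge>N. (T ^^ n) x \<in> B)" for x
  proof -
    have "(\<forall>N. \<exists>n\<ge>N. (T ^^ n) x \<in> B) \<longleftrightarrow> \<not> (\<forall>\<^sub>F n in sequentially. (T ^^ n) x \<notin> B)"
      by (auto simp: eventually_sequentially)
    also have "\<dots> \<longleftrightarrow> \<not> (\<forall>\<^sub>F n in sequentially. (T ^^ (n + 1)) x \<notin> B)"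
      using eventually_sequentially_seg[of "\<lambda>n. (T ^^ n) x \<notin> B" 1] by simp
    also have "\<dots> \<longleftrightarrow> (\<forall>N. \<exists>n\<ge>N. (T ^^ n) (T x) \<in> B)"
      by (auto simp: eventually_sequentially funpow_swap1)
    finally show ?thesis by simp
  qed
  then have "T -` E \<inter> space M = E" by (auto simp: E_def T_space)
  then have "emeasure M E = 0 \<or> emeasure M (space M - E) = 0" by (rule ergodic[OF E_sets])
  moreover have "emeasure M B \<le> emeasure M E"
  proof (rule emeasure_mono_AE)
    have "AE x in M. \<forall>n. (T ^^ n) x \<in> B \<longrightarrow> hits B ((T ^^ n) x)"
      unfolding AE_all_countable using AE_T_pow[OF AE_hits[OF B]] by blast
    then show "AE x in M. x \<in> B \<longrightarrow> x \<in> E"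
    proof (rule AE_mp, intro AE_I2 impI)
      fix x assume x: "x \<in> space M" "\<forall>n. (T ^^ n) x \<in> B \<longrightarrow> hits B ((T ^^ n) x)" "x \<in> B"
      have "\<exists>n\<ge>N. (T ^^ n) x \<in> B" for N
      proof (induction N)
        case 0
        show ?case using x(3) by (intro exI[of _ 0]) simp
      next
        case (Suc N)
        then obtain n where n: "N \<le> n" "(T ^^ n) x \<in> B" by blast
        then obtain m where "1 \<le> m" "(T ^^ m) ((T ^^ n) x) \<in> B" using x(2) by (auto simp: hits_def)
        then show ?case using n(1) by (intro exI[of _ "m + n"]) (simp add: funpow_add)
      qed
      then show "x \<in> E" using x(1) by (simp add: E_def)
    qed
  qed (rule E_sets)
  ultimately have "emeasure M (space M - E) = 0" using pos by auto
  then have "AE x in M. x \<notin> space M - E" by (intro AE_not_in null_setsI) auto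
  with AE_space show ?thesis by eventually_elim (auto simp: E_def)
qed

lemma AE_hits_always:
  assumes "B \<in> sets M" "0 < emeasure M B"
  shows "AE x in M. \<forall>k. hits B ((next_hit B ^^ k) x)"
  using AE_infinitely_often[OF assms]
proof eventually_elim
  case (elim x)
  have "hits B ((T ^^ j) x)" for j
  proof -
    obtain n where n: "Suc j \<le> n" "(T ^^ n) x \<in> B" using elim by blast
    then have "(T ^^ (n - j)) ((T ^^ j) x) \<in> B"
      by (simp flip: funpow_add[THEN fun_cong, unfolded comp_def])
    then show ?thesis using n(1) unfolding hits_def by (intro exI[of _ "n - j"]) simp
  qed
  moreover have "\<exists>j. (next_hit B ^^ k) x = (T ^^ j) x" for k
  proof (induction k)
    case 0
    show ?case by (rule exI[of _ 0]) simp
  next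
    case (Suc k)
    then obtain j where "(next_hit B ^^ k) x = (T ^^ j) x" by blast
    then have "(next_hit B ^^ Suc k) x = (T ^^ (ret B ((T ^^ j) x) + j)) x"
      by (simp add: next_hit_def funpow_add)
    then show ?case by blast
  qed
  ultimately show ?case by metis
qed

text \<open>The value 0 stands for an infinite gap; almost surely it does not occur when
  \<open>B\<close> has positive measure (\<open>AE_hits_always\<close>).\<close>

definition gap_coord :: "real \<Rightarrow> 'a set \<Rightarrow> 'a \<Rightarrow> nat \<Rightarrow> real" where
  "gap_coord \<epsilon> B x k = (if hits B ((next_hit B ^^ k) x) then exp (- \<epsilon> * real (ret B ((next_hit B ^^ k) x))) else 0)"

lemma gap_coord_measurable:
  assumes [measurable]: "B \<in> sets M"
  shows "gap_coord \<epsilon> B \<in> borel_measurable M"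
  unfolding gap_coord_def[abs_def]
  by (rule measurable_coordinatewise_then_product) measurable

lemma gap_coord_unit_cube: "0 \<le> \<epsilon> \<Longrightarrow> gap_coord \<epsilon> B x \<in> unit_cube"
  by (auto simp: gap_coord_def unit_cube_def)

lemma monomial_gap_coord:
  assumes "\<forall>k. hits B ((next_hit B ^^ k) x)"
  shows "monomial m e (gap_coord \<epsilon> B x) = hit_laplace (exp (- \<epsilon>)) B (map e [0..<m]) x"
  using assms
proof (induction m arbitrary: e x)
  case (Suc m)
  have h: "hits B x" using Suc.prems[rule_format, of 0] by simp
  have h': "\<forall>k. hits B ((next_hit B ^^ k) (next_hit B x))"
  proof
    fix k show "hits B ((next_hit B ^^ k) (next_hit B x))"
      using Suc.prems[rule_format, of "Suc k"] by (simp add: funpow_swap1)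
  qed
  have 1: "gap_coord \<epsilon> B x (Suc i) = gap_coord \<epsilon> B (next_hit B x) i" for i
    by (simp add: gap_coord_def funpow_swap1)
  have "monomial (Suc m) e (gap_coord \<epsilon> B x) = gap_coord \<epsilon> B x 0 ^ e 0 * monomial m (\<lambda>i. e (Suc i)) (gap_coord \<epsilon> B (next_hit B x))"
    unfolding monomial_def prod.lessThan_Suc_shift by (simp add: 1)
  also have "gap_coord \<epsilon> B x 0 ^ e 0 = (exp (- \<epsilon>) ^ e 0) ^ ret B x"
    using h by (simp add: gap_coord_def exp_of_nat_mult[symmetric] power_mult[symmetric] mult.commute mult.left_commute)
  also have "map e [0..<Suc m] = e 0 # map (\<lambda>i. e (Suc i)) [0..<m]"
    by (simp add: upt_conv_Cons map_Suc_upt[symmetric] comp_def del: upt_Suc)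
  then have "(exp (- \<epsilon>) ^ e 0) ^ ret B x * monomial m (\<lambda>i. e (Suc i)) (gap_coord \<epsilon> B (next_hit B x))
      = hit_laplace (exp (- \<epsilon>)) B (map e [0..<Suc m]) x"
    using h by (simp add: Suc.IH[OF h'] del: upt_Suc)
  finally show ?case .
qed (simp add: monomial_def)

lemma cumprod_gap_coord:
  assumes "\<forall>k. hits B ((next_hit B ^^ k) x)"
  shows "cumprod (gap_coord \<epsilon> B x) k = exp (- \<epsilon> * real (\<Sum>i\<le>k. ret B ((next_hit B ^^ i) x)))"
  using assms by (simp add: cumprod_def gap_coord_def exp_sum[symmetric] sum_distrib_left)

lemma cumprod_gap_coord_null:
  assumes h: "\<forall>k. hits B ((next_hit B ^^ k) x)" and e: "0 < \<epsilon>"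
  shows "cumprod (gap_coord \<epsilon> B x) \<longlonglongrightarrow> 0"
proof (rule tendsto_sandwich[of "\<lambda>_. 0" _ _ "\<lambda>k. exp (- \<epsilon>) ^ k"])
  show "(\<lambda>k. exp (- \<epsilon>) ^ k) \<longlonglongrightarrow> 0" using e by (intro LIMSEQ_power_zero) simp
  have "cumprod (gap_coord \<epsilon> B x) k \<le> exp (- \<epsilon>) ^ k" for k
  proof -
    have "(\<Sum>i\<le>k. 1) \<le> (\<Sum>i\<le>k. ret B ((next_hit B ^^ i) x))"
      using h ret_hits by (intro sum_mono) simp
    then have "real k \<le> real (\<Sum>i\<le>k. ret B ((next_hit B ^^ i) x))" by (simp del: of_nat_sum)
    then show ?thesis
      unfolding cumprod_gap_coord[OF h] exp_of_nat_mult[symmetric] using e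
      by (simp add: mult.commute del: of_nat_sum)
  qed
  then show "\<forall>\<^sub>F k in sequentially. cumprod (gap_coord \<epsilon> B x) k \<le> exp (- \<epsilon>) ^ k" by simp
qed (use h in \<open>auto simp: cumprod_gap_coord\<close>)

end

section \<open>Entry times of the shift\<close>

lemma Inf_enat_Collect: "Inf {enat n | n. P n} = (if \<exists>n. P n then enat (LEAST n. P n) else \<infinity>)"
proof (cases "\<exists>n. P n")
  case True
  have "Inf {enat n | n. P n} = enat (LEAST n. P n)"
  proof (rule antisym)
    show "Inf {enat n | n. P n} \<le> enat (LEAST n. P n)"
      using LeastI_ex[OF True] by (intro Inf_lower) auto
    show "enat (LEAST n. P n) \<le> Inf {enat n | n. P n}"
      by (intro Inf_greatest) (auto intro: Least_le)
  qed
  then show ?thesis using True by simp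
next
  case False
  then have "{enat n | n. P n} = {}" by blast
  then show ?thesis using False by (simp add: top_enat_def)
qed

lemma hit_time_Suc: "hit_time B (Suc k) y =
   (if \<exists>n. hit_time B k y < enat n \<and> (shift ^^ n) y \<in> B
    then enat (LEAST n. hit_time B k y < enat n \<and> (shift ^^ n) y \<in> B) else \<infinity>)"
  unfolding hit_time.simps by (rule Inf_enat_Collect)

lemma le_hit_time: "enat k \<le> hit_time B k y"
proof (induction k)
  case (Suc k)
  show ?case
  proof (cases "\<exists>n. hit_time B k y < enat n \<and> (shift ^^ n) y \<in> B")
    case True
    then have "hit_time B k y < hit_time B (Suc k) y"
      unfolding hit_time_Suc using LeastI_ex[OF True] by simp
    with Suc have "enat k < hit_time B (Suc k) y" by (rule le_less_trans)
    then show ?thesis by (metis Suc_ile_eq)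
  qed (simp only: hit_time_Suc if_False, simp)
qed (simp add: zero_enat_def)

locale shift_system = ergodic_system M shift for M :: "(nat \<Rightarrow> 'v) measure"
begin

lemma hit_time_measurable:
  assumes [measurable]: "B \<in> sets M"
  shows "hit_time B k \<in> measurable M (count_space UNIV)"
proof (induction k)
  case (Suc k)
  note [measurable] = Suc
  show ?case unfolding hit_time_Suc[abs_def] by measurable
qed simp

text \<open>Local finiteness holds for every \<open>y\<close>, because the \<open>k\<close>-th entry
  time is at least \<open>k\<close>: at most \<open>a / prob B\<close> points lie up to time
  \<open>a\<close>.\<close>

lemma N_id_measurable:
  assumes B [measurable]: "B \<in> sets M" and pos: "0 < prob B"
  shows "N_id M B \<in> measurable M (borel_of vague_topology)"
proof (rule measurable_point_process)
  fix y
  show "N_id M B y \<in> point_measures"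
    unfolding point_measures_def
  proof (intro CollectI conjI ballI impI)
    fix C assume C: "C \<in> sets half_line" "bounded C"
    obtain a where a: "\<And>t. t \<in> C \<Longrightarrow> t \<le> a"
      using C(2) by (metis bounded_real abs_le_iff)
    let ?K = "{k \<in> {k. 1 \<le> k \<and> hit_time B k y < \<infinity>}. prob B * real (the_enat (hit_time B k y)) \<in> C}"
    have "real k \<le> a / prob B" if "k \<in> ?K" for k
    proof -
      obtain n where n: "hit_time B k y = enat n" using \<open>k \<in> ?K\<close> by auto
      have "prob B * real n \<le> a" using that a n by simp
      moreover have "k \<le> n" using le_hit_time[of k B y] n by simp
      ultimately show ?thesis using pos
        using order_trans[OF mult_left_mono[of "real k" "real n" "prob B"]]
        by (simp add: pos_le_divide_eq mult.commute)
    qed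
    then have "?K \<subseteq> {k. real k \<le> a / prob B}" by blast
    also have "\<dots> \<subseteq> {..nat \<lceil>a / prob B\<rceil>}" by (auto simp: nat_le_iff le_nat_iff le_ceiling_iff)
    finally have "finite ?K" by (rule finite_subset) simp
    then show "emeasure (N_id M B y) C \<in> range of_nat"
      unfolding N_id_def by (subst emeasure_dirac_sum_card[OF C(1)]) auto
  qed (simp add: N_id_def)
next
  fix t :: real
  note [measurable] = hit_time_measurable[OF B]
  have "emeasure (N_id M B y) {0..t} = (\<Sum>k. if 1 \<le> k \<and> hit_time B k y < \<infinity> \<and>
      prob B * real (the_enat (hit_time B k y)) \<le> t then 1 else 0)" for y
  proof -
    have "emeasure (N_id M B y) {0..t} = (\<integral>\<^sup>+ k. (if 1 \<le> k \<and> hit_time B k y < \<infinity> \<and>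
        prob B * real (the_enat (hit_time B k y)) \<le> t then 1 else 0) \<partial>count_space UNIV)"
      unfolding N_id_def emeasure_dirac_sum[OF atLeastAtMost_half_line]
      by (subst nn_integral_count_space_indicator) (auto intro!: nn_integral_cong split: split_indicator)
    then show ?thesis by (simp only: nn_integral_count_space_nat)
  qed
  then show "(\<lambda>y. emeasure (N_id M B y) {0..t}) \<in> borel_measurable M" by simp
qed

lemma hit_time_eq_sum:
  assumes h: "\<forall>k. hits B ((next_hit B ^^ k) y)"
  shows "hit_time B k y = enat (\<Sum>i<k. ret B ((next_hit B ^^ i) y))
     \<and> (next_hit B ^^ k) y = (shift ^^ (\<Sum>i<k. ret B ((next_hit B ^^ i) y))) y"
proof (induction k)
  case (Suc k)
  let ?s = "\<Sum>i<k. ret B ((next_hit B ^^ i) y)" and ?z = "(next_hit B ^^ k) y"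
  have hz: "hits B ?z" using h by simp
  have shift_add: "(shift ^^ (n + ?s)) y = (shift ^^ n) ?z" for n
    using Suc by (simp add: funpow_add)
  have P: "hit_time B k y < enat n \<and> (shift ^^ n) y \<in> B \<longleftrightarrow> ?s < n \<and> (shift ^^ (n - ?s)) ?z \<in> B" for n
    using Suc shift_add[of "n - ?s"] by (cases "?s < n") auto
  have "(LEAST n. ?s < n \<and> (shift ^^ (n - ?s)) ?z \<in> B) = ret B ?z + ?s"
  proof (rule Least_equality)
    show "?s < ret B ?z + ?s \<and> (shift ^^ (ret B ?z + ?s - ?s)) ?z \<in> B"
      using ret_hits[OF hz] by (simp add: next_hit_def)
    show "ret B ?z + ?s \<le> n" if "?s < n \<and> (shift ^^ (n - ?s)) ?z \<in> B" for n
    proof -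
      have "ret B ?z \<le> n - ?s" using that by (intro ret_le) auto
      then show ?thesis using that by linarith
    qed
  qed
  moreover have "\<exists>n. ?s < n \<and> (shift ^^ (n - ?s)) ?z \<in> B"
    using ret_hits[OF hz] by (intro exI[of _ "ret B ?z + ?s"]) (simp add: next_hit_def)
  ultimately have "hit_time B (Suc k) y = enat (ret B ?z + ?s)"
    unfolding hit_time_Suc P by simp
  moreover have "(next_hit B ^^ Suc k) y = (shift ^^ (ret B ?z + ?s)) y"
    unfolding shift_add by (simp add: next_hit_def)
  ultimately show ?case by (simp add: add.commute)
qed (simp add: zero_enat_def)

lemma N_id_eq_points_of:
  assumes h: "\<forall>k. hits B ((next_hit B ^^ k) y)"
  shows "N_id M B y = points_of (cumprod (gap_coord (prob B) B y))"
proof (rule measure_eqI)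
  fix A assume "A \<in> sets (N_id M B y)"
  then have A: "A \<in> sets half_line" by (simp add: N_id_def)
  let ?p = "\<lambda>k. prob B * real (\<Sum>i\<le>k. ret B ((next_hit B ^^ i) y))"
  \<comment> \<open>Entry times are numbered from 1 and gap coordinates from 0, hence the reindexing
    along \<open>Suc\<close>.\<close>
  have I: "{k. 1 \<le> k \<and> hit_time B k y < \<infinity>} = range Suc"
  proof -
    have "hit_time B k y < \<infinity>" for k using hit_time_eq_sum[OF h, of k] by simp
    then show ?thesis by (auto simp: image_iff Suc_le_eq dest: gr0_implies_Suc)
  qed
  have "emeasure (N_id M B y) A
      = (\<integral>\<^sup>+ k. indicator A (prob B * real (the_enat (hit_time B k y))) \<partial>count_space (range Suc))"
    unfolding N_id_def I emeasure_dirac_sum[OF A] by simp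
  also have "\<dots> = (\<integral>\<^sup>+ k. indicator A (prob B * real (the_enat (hit_time B (Suc k) y))) \<partial>count_space UNIV)"
    by (rule nn_integral_bij_count_space[symmetric]) (simp add: bij_betw_def)
  also have "\<dots> = (\<integral>\<^sup>+ k. indicator A (?p k) \<partial>count_space UNIV)"
  proof -
    have "the_enat (hit_time B (Suc k) y) = (\<Sum>i\<le>k. ret B ((next_hit B ^^ i) y))" for k
      using hit_time_eq_sum[OF h, of "Suc k"] by (simp only: lessThan_Suc_atMost the_enat.simps)
    then show ?thesis by (simp only:)
  qed
  also have "\<dots> = emeasure (points_of (cumprod (gap_coord (prob B) B y))) A"
    by (simp add: points_of_def cumprod_gap_coord[OF h] emeasure_dirac_sum[OF A])
  finally show "emeasure (N_id M B y) A = emeasure (points_of (cumprod (gap_coord (prob B) B y))) A" .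
qed (simp add: N_id_def points_of_def)

end

section \<open>The Borel sets of a topological Markov shift\<close>

lemma mem_cylinder_map:
  "y \<in> cylinder A (map x [0..<n]) \<longleftrightarrow> y \<in> tms A \<and> (\<forall>i<n. y i = x i)"
  by (auto simp: cylinder_def)

lemma cylinder_Nil [simp]: "cylinder A [] = tms A"
  by (simp add: cylinder_def)

lemma cylinder_subset: "cylinder A w \<subseteq> tms A"
  by (auto simp: cylinder_def)

lemma shift_dist_le:
  assumes eta: "0 < \<eta>" "\<eta> < 1" and eq: "\<forall>i<n. x i = y i"
  shows "shift_dist \<eta> x y \<le> \<eta> ^ n"
proof (cases "x = y")
  case False
  then have "\<exists>i. x i \<noteq> y i" by auto
  then have "x (LEAST i. x i \<noteq> y i) \<noteq> y (LEAST i. x i \<noteq> y i)" by (rule LeastI_ex)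
  then have "n \<le> (LEAST i. x i \<noteq> y i)" using eq by (meson not_less)
  then show ?thesis using eta False by (simp add: shift_dist_def power_decreasing)
qed (use eta in \<open>simp add: shift_dist_def\<close>)

lemma shift_dist_less_imp:
  assumes eta: "0 < \<eta>" "\<eta> < 1" and d: "shift_dist \<eta> x y < \<eta> ^ n" and i: "i < n"
  shows "x i = y i"
proof (rule ccontr)
  assume ne: "x i \<noteq> y i"
  then have "(LEAST i. x i \<noteq> y i) \<le> i" by (rule Least_le)
  then have "\<eta> ^ n \<le> \<eta> ^ (LEAST i. x i \<noteq> y i)" using eta i by (intro power_decreasing) auto
  moreover have "x \<noteq> y" using ne by auto
  ultimately show False using d by (simp add: shift_dist_def)
qed

lemma openin_shift_topology:
  assumes eta: "0 < \<eta>" "\<eta> < 1"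
  shows "openin (shift_topology \<eta> A) U \<longleftrightarrow> U \<subseteq> tms A \<and> (\<forall>x\<in>U. \<exists>n. cylinder A (map x [0..<n]) \<subseteq> U)"
proof -
  interpret Metric_space "tms A" "shift_dist \<eta>" by (rule Metric_space_tms[OF eta])
  have "(\<exists>r>0. mball x r \<subseteq> U) \<longleftrightarrow> (\<exists>n. cylinder A (map x [0..<n]) \<subseteq> U)" if x: "x \<in> tms A" for x
  proof
    assume "\<exists>r>0. mball x r \<subseteq> U"
    then obtain r where r: "0 < r" "mball x r \<subseteq> U" by blast
    obtain n where n: "\<eta> ^ n < r" using real_arch_pow_inv[OF r(1) eta(2)] by blast
    have "cylinder A (map x [0..<n]) \<subseteq> mball x r"
    proof
      fix y assume "y \<in> cylinder A (map x [0..<n])"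
      then have y: "y \<in> tms A" "\<forall>i<n. x i = y i" by (auto simp: mem_cylinder_map)
      show "y \<in> mball x r" using le_less_trans[OF shift_dist_le[OF eta y(2)] n] x y(1) by simp
    qed
    then show "\<exists>n. cylinder A (map x [0..<n]) \<subseteq> U" using r(2) by blast
  next
    assume "\<exists>n. cylinder A (map x [0..<n]) \<subseteq> U"
    then obtain n where n: "cylinder A (map x [0..<n]) \<subseteq> U" by blast
    have "mball x (\<eta> ^ n) \<subseteq> cylinder A (map x [0..<n])"
      using shift_dist_less_imp[OF eta] by (fastforce simp: mem_cylinder_map in_mball)
    then show "\<exists>r>0. mball x r \<subseteq> U" using n eta by (intro exI[of _ "\<eta> ^ n"]) auto
  qed
  then show ?thesis unfolding shift_topology_def openin_mtopology by blast
qed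

lemma topspace_shift_topology:
  assumes eta: "0 < \<eta>" "\<eta> < 1"
  shows "topspace (shift_topology \<eta> A) = tms A"
proof -
  interpret Metric_space "tms A" "shift_dist \<eta>" by (rule Metric_space_tms[OF eta])
  show ?thesis by (simp add: shift_topology_def)
qed

lemma openin_cylinder:
  assumes eta: "0 < \<eta>" "\<eta> < 1"
  shows "openin (shift_topology \<eta> A) (cylinder A w)"
  unfolding openin_shift_topology[OF eta]
proof (intro conjI ballI cylinder_subset)
  fix x assume "x \<in> cylinder A w"
  then have "cylinder A (map x [0..<length w]) \<subseteq> cylinder A w" by (auto simp: cylinder_def)
  then show "\<exists>n. cylinder A (map x [0..<n]) \<subseteq> cylinder A w" by blast
qed

text \<open>A countable alphabet has countably many words, so every open set is a countable union of
  cylinders.\<close>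

lemma sets_borel_of_shift:
  fixes A :: "'v::countable \<Rightarrow> 'v \<Rightarrow> bool"
  assumes eta: "0 < \<eta>" "\<eta> < 1"
  shows "sets (borel_of (shift_topology \<eta> A)) = sigma_sets (tms A) (range (cylinder A))"
proof -
  let ?S = "sigma_sets (tms A) (range (cylinder A))"
  have "U \<in> ?S" if U: "openin (shift_topology \<eta> A) U" for U
  proof -
    have "x \<in> \<Union> (cylinder A ` {w. cylinder A w \<subseteq> U})" if x: "x \<in> U" for x
    proof -
      obtain n where "cylinder A (map x [0..<n]) \<subseteq> U"
        using U x openin_shift_topology[OF eta] by blast
      moreover have "x \<in> cylinder A (map x [0..<n])"
        using U x openin_shift_topology[OF eta] by (auto simp: mem_cylinder_map)
      ultimately show ?thesis by blast
    qed
    then have eq: "U = \<Union> (cylinder A ` {w. cylinder A w \<subseteq> U})" by blast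
    interpret sigma_algebra "tms A" ?S
      by (rule sigma_algebra_sigma_sets) (use cylinder_subset in blast)
    have "countable {w. cylinder A w \<subseteq> U}" by simp
    then have "(\<Union>w\<in>{w. cylinder A w \<subseteq> U}. cylinder A w) \<in> ?S"
      by (rule countable_UN'') auto
    then show ?thesis using eq by metis
  qed
  moreover have "range (cylinder A) \<subseteq> sigma_sets (tms A) {U. openin (shift_topology \<eta> A) U}"
    using openin_cylinder[OF eta] by blast
  ultimately show ?thesis
    unfolding sets_borel_of topspace_shift_topology[OF eta]
    by (intro antisym sigma_sets_mono) auto
qed

section \<open>Words and concatenation\<close>

definition admissible :: "('v \<Rightarrow> 'v \<Rightarrow> bool) \<Rightarrow> 'v list \<Rightarrow> bool" where
  "admissible A w \<longleftrightarrow> (\<forall>i. Suc i < length w \<longrightarrow> A (w ! i) (w ! Suc i))"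

definition cat :: "'v list \<Rightarrow> (nat \<Rightarrow> 'v) \<Rightarrow> nat \<Rightarrow> 'v" where
  "cat w z i = (if i < length w then w ! i else z (i - length w))"

lemma shift_pow: "(shift ^^ n) x i = x (n + i)"
  by (induction n arbitrary: i) (simp_all add: shift_def)

lemma shift_pow_tms: "x \<in> tms A \<Longrightarrow> (shift ^^ n) x \<in> tms A"
  by (simp add: tms_def shift_pow)

lemma shift_pow_cat: "(shift ^^ length w) (cat w z) = z"
  by (simp add: fun_eq_iff shift_pow cat_def)

lemma cat_Cons: "cat (v # w) z = cat [v] (cat w z)"
  by (auto simp: fun_eq_iff cat_def nth_Cons split: nat.split)

lemma cat_0: "w \<noteq> [] \<Longrightarrow> cat w z 0 = hd w"
  by (simp add: cat_def hd_conv_nth)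

lemma shift_cat_Cons: "shift (cat (v # w) z) = cat w z"
  by (simp add: fun_eq_iff cat_def shift_def)

lemma cat_tms:
  assumes "w \<noteq> []" "admissible A w" "A (last w) (z 0)" "z \<in> tms A"
  shows "cat w z \<in> tms A"
proof -
  have "A (cat w z i) (cat w z (Suc i))" for i
  proof -
    consider "Suc i < length w" | "Suc i = length w" | "length w \<le> i" by linarith
    then show ?thesis
    proof cases
      case 1
      then show ?thesis using assms(2) by (simp add: cat_def admissible_def)
    next
      case 2
      then have "i = length w - 1" by simp
      then show ?thesis using assms 2 by (simp add: cat_def last_conv_nth)
    next
      case 3
      then show ?thesis using assms(4) by (simp add: cat_def tms_def Suc_diff_le)
    qed
  qed
  then show ?thesis by (simp add: tms_def)
qed

lemma cat_cylinder: "cat w z \<in> tms A \<Longrightarrow> cat w z \<in> cylinder A w"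
  by (simp add: cylinder_def cat_def)

lemma cylinder_cat: "y \<in> cylinder A w \<Longrightarrow> y = cat w ((shift ^^ length w) y)"
  by (auto simp: fun_eq_iff cylinder_def cat_def shift_pow)

lemma admissible_map: "x \<in> tms A \<Longrightarrow> admissible A (map x [0..<n])"
  by (auto simp: admissible_def tms_def nth_append)

lemma admissible_Cons: "admissible A (v # w) \<Longrightarrow> admissible A w \<and> (w \<noteq> [] \<longrightarrow> A v (hd w))"
  by (cases w) (fastforce simp: admissible_def)+

text \<open>The path starts at the last symbol of \<open>w\<close>, and its endpoint is left out of
  the new word, so that the word can be continued by any point beginning with
  \<open>p n\<close>.\<close>

lemma admissible_path:
  assumes w: "w \<noteq> []" "admissible A w" and p: "p 0 = last w" "\<And>i. i < n \<Longrightarrow> A (p i) (p (Suc i))" "1 \<le> n"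
  obtains w' where "w' \<noteq> []" "admissible A w'" "A (last w') (p n)" "length w \<le> length w'" "cylinder A w' \<subseteq> cylinder A w"
proof
  let ?w = "w @ map p [1..<n]"
  show "?w \<noteq> []" "length w \<le> length ?w" using w by auto
  have nth: "?w ! (length w + i) = p (Suc i)" if "Suc i < n" for i
    using that by (simp add: nth_append)
  have last: "?w ! (length w - 1 + i) = p i" if "i < n" for i
  proof (cases i)
    case 0
    then show ?thesis using w(1) p(1) by (simp add: nth_append last_conv_nth)
  next
    case (Suc j)
    then have "length w - 1 + i = length w + j" using w(1) by (cases w) auto
    then show ?thesis using nth[of j] that by (simp only: Suc)
  qed
  have len: "length ?w = length w - 1 + n" using w(1) p(3) by (cases w) auto
  show "admissible A ?w"
    unfolding admissible_def
  proof (intro allI impI)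
    fix i assume i: "Suc i < length ?w"
    show "A (?w ! i) (?w ! Suc i)"
    proof (cases "Suc i < length w")
      case True
      then show ?thesis using w(2) by (simp add: nth_append admissible_def)
    next
      case False
      then obtain j where j: "i = length w - 1 + j" by (metis add.commute le_add_diff_inverse2 not_less Suc_eq_plus1 le_diff_conv)
      then have "Suc j < n" using i len by linarith
      then show ?thesis using last[of j] last[of "Suc j"] p(2)[of j] j by simp
    qed
  qed
  have "last ?w = p (n - 1)"
    unfolding last_conv_nth[OF \<open>?w \<noteq> []\<close>] len using last[of "n - 1"] p(3) by simp
  then show "A (last ?w) (p n)" using p(2)[of "n - 1"] p(3) by simp
  show "cylinder A ?w \<subseteq> cylinder A w"
    by (auto simp: cylinder_def nth_append)
qed

section \<open>The conformal measure\<close>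

locale rpf_shift =
  fixes A :: "'v :: countable \<Rightarrow> 'v \<Rightarrow> bool" and \<eta> :: real
    and \<phi> h :: "(nat \<Rightarrow> 'v) \<Rightarrow> real" and \<nu> \<mu> :: "(nat \<Rightarrow> 'v) measure"
  assumes eta: "0 < \<eta>" "\<eta> < 1"
    and mixing: "topologically_mixing A"
    and potential: "\<phi> \<in> borel_measurable (borel_of (shift_topology \<eta> A))"
    and walters: "walters_condition A \<phi>"
    and rpf: "RPF_measure \<eta> A \<phi> h \<nu> \<mu>"
    and non_atomic: "y \<in> tms A \<Longrightarrow> emeasure \<mu> {y} = 0"
begin

abbreviation "lam \<equiv> gurevich_eigenvalue A \<phi>"

lemma lam_pos: "0 < lam" by (simp add: gurevich_eigenvalue_def)

lemma sets_nu: "sets \<nu> = sigma_sets (tms A) (range (cylinder A))"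
  using rpf sets_borel_of_shift[OF eta, of A] by (simp add: RPF_measure_def)

lemma space_nu [simp]: "space \<nu> = tms A"
proof -
  have "sets \<nu> = sets (borel_of (shift_topology \<eta> A))" using rpf by (simp add: RPF_measure_def)
  then show ?thesis by (metis sets_eq_imp_space_eq space_borel_of topspace_shift_topology[OF eta])
qed

lemma cylinder_sets [measurable]: "cylinder A w \<in> sets \<nu>"
  unfolding sets_nu by auto

lemma mu_eq: "\<mu> = density \<nu> (\<lambda>x. ennreal (h x))"
  using rpf by (simp add: RPF_measure_def)

lemma sets_mu [measurable_cong]: "sets \<mu> = sets \<nu>" by (simp add: mu_eq)

lemma space_mu [simp]: "space \<mu> = tms A" by (simp add: mu_eq)

lemma h_pos: "x \<in> tms A \<Longrightarrow> 0 < h x"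
  using rpf by (simp add: RPF_measure_def)

lemma borel_of_eq: "borel_measurable (borel_of (shift_topology \<eta> A)) = borel_measurable \<nu>"
  using rpf by (intro measurable_cong_sets) (simp_all add: RPF_measure_def)

lemma h_measurable [measurable]: "h \<in> borel_measurable \<nu>"
  using rpf borel_measurable_borel_of[of "shift_topology \<eta> A" h] by (simp add: RPF_measure_def borel_of_eq)

lemma phi_measurable [measurable]: "\<phi> \<in> borel_measurable \<nu>"
  using potential by (simp add: borel_of_eq)

lemma coordinate_measurable [measurable]: "(\<lambda>y. y i) \<in> measurable \<nu> (count_space UNIV)"
proof (subst measurable_count_space_eq2_countable)
  show "(\<lambda>y. y i) \<in> space \<nu> \<rightarrow> UNIV \<and> (\<forall>v\<in>UNIV. (\<lambda>y. y i) -` {v} \<inter> space \<nu> \<in> sets \<nu>)"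
  proof (intro conjI ballI)
    fix v
    have "(\<lambda>y. y i) -` {v} \<inter> space \<nu> = (\<Union>w\<in>{w. length w = Suc i \<and> w ! i = v}. cylinder A w)"
    proof safe
      fix y assume "y \<in> space \<nu>" "v = y i"
      then have "y \<in> cylinder A (map y [0..<Suc i])" by (simp add: mem_cylinder_map del: upt_Suc)
      then show "y \<in> (\<Union>w\<in>{w. length w = Suc i \<and> w ! i = y i}. cylinder A w)"
        by (intro UN_I[of "map y [0..<Suc i]"]) (simp_all del: upt_Suc)
    qed (auto simp: cylinder_def)
    also have "\<dots> \<in> sets \<nu>" by (intro sets.countable_UN') auto
    finally show "(\<lambda>y. y i) -` {v} \<inter> space \<nu> \<in> sets \<nu>" .
  qed simp
qed

lemma measurable_into_nu:
  assumes "\<And>x. x \<in> space M \<Longrightarrow> f x \<in> tms A" and "\<And>i. (\<lambda>x. f x i) \<in> measurable M (count_space UNIV)"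
  shows "f \<in> measurable M \<nu>"
proof (rule measurable_sigma_sets[OF sets_nu])
  show "range (cylinder A) \<subseteq> Pow (tms A)" using cylinder_subset by blast
  show "f \<in> space M \<rightarrow> tms A" using assms(1) by blast
  fix U assume "U \<in> range (cylinder A)"
  then obtain w where U: "U = cylinder A w" by blast
  note [measurable] = assms(2)
  have "f -` U \<inter> space M = {x \<in> space M. \<forall>i<length w. f x i = w ! i}"
    using assms(1) by (auto simp: U cylinder_def)
  also have "\<dots> \<in> sets M" by measurable
  finally show "f -` U \<inter> space M \<in> sets M" .
qed

lemma shift_pow_measurable_nu [measurable]: "(\<lambda>y. (shift ^^ n) y) \<in> measurable \<nu> \<nu>"
  by (rule measurable_into_nu) (simp_all add: shift_pow_tms shift_pow)

lemma cat_measurable: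
  fixes f :: "(nat \<Rightarrow> 'v) \<Rightarrow> ennreal"
  assumes w: "w \<noteq> []" "admissible A w" and f [measurable]: "f \<in> borel_measurable \<nu>"
  shows "(\<lambda>z. if A (last w) (z 0) then f (cat w z) else 0) \<in> borel_measurable \<nu>"
proof (cases "\<exists>x. x \<in> tms A")
  case True
  then obtain x where x: "x \<in> tms A" by blast
  define c where "c z = (if A (last w) (z 0) then cat w z else x)" for z
  have [measurable]: "c \<in> measurable \<nu> \<nu>"
  proof (rule measurable_into_nu)
    show "c z \<in> tms A" if "z \<in> space \<nu>" for z
      using that x cat_tms[OF w] by (simp add: c_def)
    show "(\<lambda>z. c z i) \<in> measurable \<nu> (count_space UNIV)" for i
      unfolding c_def cat_def by (cases "i < length w") (simp_all add: if_distrib[of "\<lambda>z. z i"] cong: if_cong)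
  qed
  have "(\<lambda>z. if A (last w) (z 0) then f (cat w z) else 0) = (\<lambda>z. if A (last w) (z 0) then f (c z) else 0)"
    by (auto simp: c_def)
  also have "\<dots> \<in> borel_measurable \<nu>" by measurable
  finally show ?thesis .
next
  case False
  then have "space \<nu> = {}" by simp
  then show ?thesis by (intro measurableI) simp_all
qed

text \<open>A point \<open>z\<close> has at most one preimage under the shift in
  \<open>cylinder A [v]\<close>, namely \<open>cat [v] z\<close>, so the transfer operator applied
  to a function supported there consists of a single term.\<close>

lemma conformal_step:
  assumes [measurable]: "f \<in> borel_measurable \<nu>"
  shows "ennreal lam * (\<integral>\<^sup>+ y. f y * indicator (cylinder A [v]) y \<partial>\<nu>) =
    (\<integral>\<^sup>+ z. (if A v (z 0) then ennreal (exp (\<phi> (cat [v] z))) * f (cat [v] z) else 0) \<partial>\<nu>)"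
proof -
  have "ennreal lam * (\<integral>\<^sup>+ y. f y * indicator (cylinder A [v]) y \<partial>\<nu>)
      = (\<integral>\<^sup>+ z. transfer_op A \<phi> (\<lambda>y. f y * indicator (cylinder A [v]) y) z \<partial>\<nu>)"
    using rpf by (simp add: RPF_measure_def)
  also have "\<dots> = (\<integral>\<^sup>+ z. (if A v (z 0) then ennreal (exp (\<phi> (cat [v] z))) * f (cat [v] z) else 0) \<partial>\<nu>)"
  proof (rule nn_integral_cong)
    fix z assume "z \<in> space \<nu>"
    then have z: "z \<in> tms A" by simp
    let ?g = "\<lambda>y. ennreal (exp (\<phi> y)) * (f y * indicator (cylinder A [v]) y)"
    have "transfer_op A \<phi> (\<lambda>y. f y * indicator (cylinder A [v]) y) z
        = infsum ?g (if A v (z 0) then {cat [v] z} else {})"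
      unfolding transfer_op_def
    proof (rule infsum_cong_neutral)
      fix y assume y: "y \<in> {y \<in> tms A. shift y = z} - (if A v (z 0) then {cat [v] z} else {})"
      have "y \<notin> cylinder A [v]"
      proof
        assume c: "y \<in> cylinder A [v]"
        then have "y = cat [v] z" using cylinder_cat[OF c] y by simp
        moreover have "A v (z 0)" using y c by (auto simp: cylinder_def tms_def shift_def)
        ultimately show False using y by simp
      qed
      then show "?g y = 0" by simp
    next
      fix y assume y: "y \<in> (if A v (z 0) then {cat [v] z} else {}) - {y \<in> tms A. shift y = z}"
      then have "cat [v] z \<in> tms A" "shift (cat [v] z) = z"
        using cat_tms[of "[v]" A z] z shift_pow_cat[of "[v]" z] by (auto simp: admissible_def split: if_splits)
      then show "?g y = 0" using y by (auto split: if_splits)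
    qed simp
    also have "\<dots> = (if A v (z 0) then ennreal (exp (\<phi> (cat [v] z))) * f (cat [v] z) else 0)"
    proof (cases "A v (z 0)")
      case True
      then have "cat [v] z \<in> cylinder A [v]"
        using z by (intro cat_cylinder cat_tms) (auto simp: admissible_def)
      then show ?thesis using True by simp
    qed simp
    finally show "transfer_op A \<phi> (\<lambda>y. f y * indicator (cylinder A [v]) y) z
        = (if A v (z 0) then ennreal (exp (\<phi> (cat [v] z))) * f (cat [v] z) else 0)" .
  qed
  finally show ?thesis .
qed

lemma birkhoff_Suc: "birkhoff \<phi> (Suc n) x = \<phi> x + birkhoff \<phi> n (shift x)"
  unfolding birkhoff_def by (simp only: sum.lessThan_Suc_shift funpow_Suc_right) (simp add: comp_def)

lemma birkhoff_measurable [measurable]: "birkhoff \<phi> n \<in> borel_measurable \<nu>"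
  unfolding birkhoff_def[abs_def] by measurable

text \<open>The Jacobian with respect to \<open>\<nu>\<close> of the inverse branch
  \<open>z \<mapsto> cat w z\<close> of the iterated shift.\<close>

definition weight :: "'v list \<Rightarrow> (nat \<Rightarrow> 'v) \<Rightarrow> real" where
  "weight w z = exp (birkhoff \<phi> (length w) (cat w z)) / lam ^ length w"

lemma weight_pos: "0 < weight w z" using lam_pos by (simp add: weight_def)

lemma weight_Cons: "weight (v # w) z = exp (\<phi> (cat (v # w) z)) / lam * weight w z"
  by (simp add: weight_def birkhoff_Suc shift_cat_Cons exp_add)

text \<open>Change of variables along the inverse branch given by \<open>w\<close>, obtained by
  peeling off one symbol at a time with \<open>conformal_step\<close>; the weights multiply by
  \<open>weight_Cons\<close>.\<close>

theorem conformal: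
  assumes "w \<noteq> []" "admissible A w" "f \<in> borel_measurable \<nu>"
  shows "(\<integral>\<^sup>+ y. f y * indicator (cylinder A w) y \<partial>\<nu>) =
    (\<integral>\<^sup>+ z. (if A (last w) (z 0) then ennreal (weight w z) * f (cat w z) else 0) \<partial>\<nu>)"
  using assms
proof (induction w arbitrary: f)
  case (Cons v w)
  note [measurable] = Cons.prems(3)
  define F where "F z = (if A v (z 0) then ennreal (exp (\<phi> (cat [v] z)) / lam) * f (cat [v] z) else 0)" for z
  have Fm: "F \<in> borel_measurable \<nu>"
    unfolding F_def using cat_measurable[of "[v]" "\<lambda>y. ennreal (exp (\<phi> y) / lam) * f y"]
    by (simp add: admissible_def)
  have step: "(\<integral>\<^sup>+ y. g y * indicator (cylinder A [v]) y \<partial>\<nu>) =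
      (\<integral>\<^sup>+ z. (if A v (z 0) then ennreal (exp (\<phi> (cat [v] z)) / lam) * g (cat [v] z) else 0) \<partial>\<nu>)"
    if g [measurable]: "g \<in> borel_measurable \<nu>" for g
  proof -
    have m: "(\<lambda>z. if A v (z 0) then ennreal (exp (\<phi> (cat [v] z))) * g (cat [v] z) else 0) \<in> borel_measurable \<nu>"
      using cat_measurable[of "[v]" "\<lambda>y. ennreal (exp (\<phi> y)) * g y"] by (simp add: admissible_def)
    have "(\<integral>\<^sup>+ y. g y * indicator (cylinder A [v]) y \<partial>\<nu>)
        = ennreal (1 / lam) * (ennreal lam * (\<integral>\<^sup>+ y. g y * indicator (cylinder A [v]) y \<partial>\<nu>))"
      using lam_pos by (simp add: mult.assoc[symmetric] ennreal_mult[symmetric])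
    also have "\<dots> = (\<integral>\<^sup>+ z. ennreal (1 / lam) * (if A v (z 0) then ennreal (exp (\<phi> (cat [v] z))) * g (cat [v] z) else 0) \<partial>\<nu>)"
      unfolding conformal_step[OF g] by (rule nn_integral_cmult[symmetric, OF m])
    also have "\<dots> = (\<integral>\<^sup>+ z. (if A v (z 0) then ennreal (exp (\<phi> (cat [v] z)) / lam) * g (cat [v] z) else 0) \<partial>\<nu>)"
      using lam_pos by (intro nn_integral_cong) (simp add: mult.assoc[symmetric] ennreal_mult[symmetric])
    finally show ?thesis .
  qed
  show ?case
  proof (cases "w = []")
    case True
    then show ?thesis using step[OF Cons.prems(3)] by (simp add: weight_def birkhoff_def cong: if_cong)
  next
    case False
    have w: "admissible A w" "A v (hd w)" using admissible_Cons[OF Cons.prems(2)] False by auto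
    have "(\<integral>\<^sup>+ y. f y * indicator (cylinder A (v # w)) y \<partial>\<nu>)
        = (\<integral>\<^sup>+ y. (f y * indicator (cylinder A (v # w)) y) * indicator (cylinder A [v]) y \<partial>\<nu>)"
      by (intro nn_integral_cong) (auto simp: cylinder_def split: split_indicator)
    also have "\<dots> = (\<integral>\<^sup>+ z. (if A v (z 0) then ennreal (exp (\<phi> (cat [v] z)) / lam) * (f (cat [v] z) * indicator (cylinder A (v # w)) (cat [v] z)) else 0) \<partial>\<nu>)"
      by (rule step) measurable
    also have "\<dots> = (\<integral>\<^sup>+ z. F z * indicator (cylinder A w) z \<partial>\<nu>)"
    proof (rule nn_integral_cong)
      fix z assume "z \<in> space \<nu>"
      then have "cat [v] z \<in> cylinder A (v # w) \<longleftrightarrow> z \<in> cylinder A w" if "A v (z 0)"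
        using cat_tms[of "[v]" A z] that by (auto simp: cylinder_def admissible_def cat_def nth_Cons All_less_Suc2 split: nat.split)
      then show "(if A v (z 0) then ennreal (exp (\<phi> (cat [v] z)) / lam) * (f (cat [v] z) * indicator (cylinder A (v # w)) (cat [v] z)) else 0)
          = F z * indicator (cylinder A w) z"
        by (auto simp: F_def mult.assoc split: split_indicator)
    qed
    also have "\<dots> = (\<integral>\<^sup>+ z. (if A (last w) (z 0) then ennreal (weight w z) * F (cat w z) else 0) \<partial>\<nu>)"
      by (rule Cons.IH[OF False w(1) Fm])
    also have "\<dots> = (\<integral>\<^sup>+ z. (if A (last (v # w)) (z 0) then ennreal (weight (v # w) z) * f (cat (v # w) z) else 0) \<partial>\<nu>)"
    proof (rule nn_integral_cong)
      fix z
      have "ennreal (weight w z) * F (cat w z) = ennreal (weight (v # w) z) * f (cat (v # w) z)"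
        using w(2) weight_pos[of w z] lam_pos
        by (simp add: F_def cat_0[OF False] cat_Cons[symmetric] weight_Cons mult.assoc[symmetric]
            ennreal_mult[symmetric] mult.commute)
      then show "(if A (last w) (z 0) then ennreal (weight w z) * F (cat w z) else 0)
          = (if A (last (v # w)) (z 0) then ennreal (weight (v # w) z) * f (cat (v # w) z) else 0)"
        using False by simp
    qed
    finally show ?thesis .
  qed
qed simp

text \<open>Meaningful for \<open>k \<ge> 1\<close>, where Walters' condition gives finiteness; at 0
  an infinite value would be converted to 0.\<close>

definition W :: "nat \<Rightarrow> real" where "W k = enn2real (walters_var A \<phi> k)"

lemma W_tendsto: "W \<longlonglongrightarrow> 0"
proof -
  have "(\<lambda>k. enn2real (walters_var A \<phi> k)) \<longlonglongrightarrow> enn2real 0"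
    using walters by (intro tendsto_enn2real) (auto simp: walters_condition_def)
  then show ?thesis by (simp add: W_def[abs_def])
qed

lemma birkhoff_distortion:
  assumes k: "1 \<le> k" "1 \<le> n" and xy: "x \<in> tms A" "y \<in> tms A" "\<forall>i<n + k. x i = y i"
  shows "\<bar>birkhoff \<phi> n x - birkhoff \<phi> n y\<bar> \<le> W k"
proof -
  have "ennreal \<bar>birkhoff \<phi> n x - birkhoff \<phi> n y\<bar> \<le> variation A (n + k) (birkhoff \<phi> n)"
    unfolding variation_def using xy by (intro SUP_upper2[of "(x, y)"]) auto
  also have "\<dots> \<le> walters_var A \<phi> k"
    unfolding walters_var_def using k by (intro SUP_upper) simp
  finally have "ennreal \<bar>birkhoff \<phi> n x - birkhoff \<phi> n y\<bar> \<le> walters_var A \<phi> k" .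
  moreover have "walters_var A \<phi> k < \<infinity>" using walters k by (simp add: walters_condition_def)
  ultimately have "enn2real (ennreal \<bar>birkhoff \<phi> n x - birkhoff \<phi> n y\<bar>) \<le> W k"
    unfolding W_def by (intro enn2real_mono) auto
  then show ?thesis by simp
qed

lemma weight_distortion:
  assumes w: "w \<noteq> []" "admissible A w" and k: "1 \<le> k"
    and z: "z \<in> tms A" "z' \<in> tms A" "\<forall>i<k. z i = z' i" "A (last w) (z 0)"
  shows "weight w z \<le> exp (W k) * weight w z'"
proof -
  have "z 0 = z' 0" using z(3) k by simp
  then have "cat w z \<in> tms A" "cat w z' \<in> tms A" using cat_tms[OF w] z by auto
  then have "\<bar>birkhoff \<phi> (length w) (cat w z) - birkhoff \<phi> (length w) (cat w z')\<bar> \<le> W k"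
    using w z(3) by (intro birkhoff_distortion k) (auto simp: cat_def Suc_le_eq)
  then have "exp (birkhoff \<phi> (length w) (cat w z)) \<le> exp (W k) * exp (birkhoff \<phi> (length w) (cat w z'))"
    unfolding exp_add[symmetric] by simp
  then show ?thesis using lam_pos by (simp add: weight_def divide_right_mono)
qed

definition determined :: "nat \<Rightarrow> (nat \<Rightarrow> 'v) set \<Rightarrow> bool" where
  "determined n Q \<longleftrightarrow> Q \<subseteq> tms A \<and> (\<forall>y\<in>Q. \<forall>y'\<in>tms A. (\<forall>i<n. y i = y' i) \<longrightarrow> y' \<in> Q)"

lemma determined_cylinder: "y \<in> Q \<Longrightarrow> determined n Q \<Longrightarrow> cylinder A (map y [0..<n]) \<subseteq> Q"
  unfolding determined_def by (auto simp: mem_cylinder_map)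

lemma determined_sets:
  assumes Q: "determined n Q"
  shows "Q \<in> sets \<nu>"
proof -
  have "Q = (\<Union>w\<in>{w. cylinder A w \<subseteq> Q}. cylinder A w)"
  proof safe
    fix y assume y: "y \<in> Q"
    then have "y \<in> cylinder A (map y [0..<n])" using Q by (auto simp: determined_def mem_cylinder_map)
    then show "y \<in> (\<Union>w\<in>{w. cylinder A w \<subseteq> Q}. cylinder A w)"
      using determined_cylinder[OF y Q] by blast
  qed blast
  also have "\<dots> \<in> sets \<nu>" by (intro sets.countable_UN') (auto intro: countableI_type)
  finally show ?thesis .
qed

text \<open>Bounded distortion: seen from a set \<open>D\<close> of points with the same first \<open>k\<close> symbols, the image under
  \<open>shift ^^ N\<close> of the conformal measure on a union of cylinders of length \<open>N\<close> is comparable to a multiple of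
  the conformal measure.\<close>

lemma distortion:
  assumes N: "1 \<le> N" and Q: "determined N Q" and k: "1 \<le> k"
    and D [measurable]: "D \<in> sets \<nu>" and D_k: "\<And>z z' i. z \<in> D \<Longrightarrow> z' \<in> D \<Longrightarrow> i < k \<Longrightarrow> z i = z' i"
  obtains c :: ennreal where
    "\<And>g :: (nat \<Rightarrow> 'v) \<Rightarrow> ennreal. g \<in> borel_measurable \<nu> \<Longrightarrow> (\<integral>\<^sup>+ y. indicator Q y * (g ((shift ^^ N) y) * indicator D ((shift ^^ N) y)) \<partial>\<nu>)
       \<le> ennreal (exp (W k)) * (c * (\<integral>\<^sup>+ z. g z * indicator D z \<partial>\<nu>))"
    "\<And>g :: (nat \<Rightarrow> 'v) \<Rightarrow> ennreal. g \<in> borel_measurable \<nu> \<Longrightarrow> c * (\<integral>\<^sup>+ z. g z * indicator D z \<partial>\<nu>)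
       \<le> ennreal (exp (W k)) * (\<integral>\<^sup>+ y. indicator Q y * (g ((shift ^^ N) y) * indicator D ((shift ^^ N) y)) \<partial>\<nu>)"
proof (cases "D = {}")
  case False
  then obtain z0 where z0: "z0 \<in> D" by blast
  have DA: "D \<subseteq> tms A" using sets.sets_into_space[OF D] by simp
  \<comment> \<open>\<open>P\<close> collects the branches that make up \<open>Q\<close> over
    \<open>D\<close>; whether a word can be followed by a point of \<open>D\<close> does not depend
    on the point, as all of them share the symbol \<open>z0 0\<close>. The constant \<open>c\<close>
    is the total weight of these branches at the reference point \<open>z0\<close>.\<close>
  define P where "P = {w. length w = N \<and> admissible A w \<and> A (last w) (z0 0) \<and> cylinder A w \<subseteq> Q}"
  define c where "c = (\<integral>\<^sup>+ w. ennreal (weight w z0) \<partial>count_space P)"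
  note [measurable] = determined_sets[OF Q]
  have main: "(\<integral>\<^sup>+ y. indicator Q y * (g ((shift ^^ N) y) * indicator D ((shift ^^ N) y)) \<partial>\<nu>)
      = (\<integral>\<^sup>+ w. \<integral>\<^sup>+ z. ennreal (weight w z) * (g z * indicator D z) \<partial>\<nu> \<partial>count_space P)"
    if [measurable]: "g \<in> borel_measurable \<nu>" for g :: "(nat \<Rightarrow> 'v) \<Rightarrow> ennreal"
  proof -
    have "(\<integral>\<^sup>+ y. indicator Q y * (g ((shift ^^ N) y) * indicator D ((shift ^^ N) y)) \<partial>\<nu>)
        = (\<integral>\<^sup>+ y. \<integral>\<^sup>+ w. (g ((shift ^^ N) y) * indicator D ((shift ^^ N) y)) * indicator (cylinder A w) y \<partial>count_space P \<partial>\<nu>)"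
    proof (rule nn_integral_cong)
      fix y assume "y \<in> space \<nu>"
      then have y: "y \<in> tms A" by simp
      show "indicator Q y * (g ((shift ^^ N) y) * indicator D ((shift ^^ N) y))
          = (\<integral>\<^sup>+ w. (g ((shift ^^ N) y) * indicator D ((shift ^^ N) y)) * indicator (cylinder A w) y \<partial>count_space P)"
      proof (cases "y \<in> Q \<and> (shift ^^ N) y \<in> D")
        case True
        let ?w = "map y [0..<N]"
        have "(shift ^^ N) y 0 = z0 0" using D_k[of "(shift ^^ N) y" z0 0] True z0 k by simp
        then have last: "A (last ?w) (z0 0)"
          using y N by (simp add: shift_pow last_map tms_def) (metis Suc_pred' less_eq_Suc_le One_nat_def)
        have wP: "?w \<in> P"
          using last admissible_map[OF y, of N] determined_cylinder[OF _ Q, of y] True by (simp add: P_def)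
        have "indicator (cylinder A w) y = (indicator {?w} w :: ennreal)" if "w \<in> P" for w
        proof -
          have "y \<in> cylinder A w \<longleftrightarrow> w = ?w"
            using that y by (auto simp: P_def cylinder_def list_eq_iff_nth_eq)
          then show ?thesis by (simp only: indicator_def singleton_iff mem_Collect_eq)
        qed
        then have "(\<integral>\<^sup>+ w. (g ((shift ^^ N) y) * indicator D ((shift ^^ N) y)) * indicator (cylinder A w) y \<partial>count_space P)
            = (\<integral>\<^sup>+ w. (g ((shift ^^ N) y) * indicator D ((shift ^^ N) y)) * indicator {?w} w \<partial>count_space P)"
          by (intro nn_integral_cong) simp
        also have "\<dots> = g ((shift ^^ N) y)"
          using True wP by (simp add: nn_integral_indicator_singleton)
        finally show ?thesis using True by simp
      next
        case False
        have "(g ((shift ^^ N) y) * indicator D ((shift ^^ N) y)) * indicator (cylinder A w) y = 0" if "w \<in> P" for w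
          using False that by (auto simp: P_def split: split_indicator)
        then have "(\<integral>\<^sup>+ w. (g ((shift ^^ N) y) * indicator D ((shift ^^ N) y)) * indicator (cylinder A w) y \<partial>count_space P)
            = (\<integral>\<^sup>+ w. 0 \<partial>count_space P)" by (intro nn_integral_cong) simp
        then show ?thesis using False by (auto split: split_indicator)
      qed
    qed
    also have "\<dots> = (\<integral>\<^sup>+ w. \<integral>\<^sup>+ y. (g ((shift ^^ N) y) * indicator D ((shift ^^ N) y)) * indicator (cylinder A w) y \<partial>\<nu> \<partial>count_space P)"
      by (rule nn_integral_count_space_nn_integral) (auto intro: countableI_type)
    also have "\<dots> = (\<integral>\<^sup>+ w. \<integral>\<^sup>+ z. ennreal (weight w z) * (g z * indicator D z) \<partial>\<nu> \<partial>count_space P)"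
    proof (rule nn_integral_cong)
      fix w assume "w \<in> space (count_space P)"
      then have w: "length w = N" "admissible A w" "A (last w) (z0 0)" "w \<noteq> []" using N by (auto simp: P_def)
      have "(\<integral>\<^sup>+ y. (g ((shift ^^ N) y) * indicator D ((shift ^^ N) y)) * indicator (cylinder A w) y \<partial>\<nu>)
          = (\<integral>\<^sup>+ z. (if A (last w) (z 0) then ennreal (weight w z) * (g ((shift ^^ N) (cat w z)) * indicator D ((shift ^^ N) (cat w z))) else 0) \<partial>\<nu>)"
        by (rule conformal) (use w in \<open>simp_all, measurable\<close>)
      also have "\<dots> = (\<integral>\<^sup>+ z. ennreal (weight w z) * (g z * indicator D z) \<partial>\<nu>)"
      proof (rule nn_integral_cong)
        fix z
        have "A (last w) (z 0)" if "z \<in> D" using D_k[OF that z0, of 0] k w(3) by simp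
        then show "(if A (last w) (z 0) then ennreal (weight w z) * (g ((shift ^^ N) (cat w z)) * indicator D ((shift ^^ N) (cat w z))) else 0)
            = ennreal (weight w z) * (g z * indicator D z)"
          using shift_pow_cat[of w z] w(1) by (auto split: split_indicator)
      qed
      finally show "(\<integral>\<^sup>+ y. (g ((shift ^^ N) y) * indicator D ((shift ^^ N) y)) * indicator (cylinder A w) y \<partial>\<nu>)
          = (\<integral>\<^sup>+ z. ennreal (weight w z) * (g z * indicator D z) \<partial>\<nu>)" .
    qed
    finally show ?thesis .
  qed
  have dist: "weight w z \<le> exp (W k) * weight w z0" "weight w z0 \<le> exp (W k) * weight w z"
    if "w \<in> P" "z \<in> D" for w z
  proof -
    have w: "w \<noteq> []" "admissible A w" "A (last w) (z0 0)" using that N by (auto simp: P_def)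
    have "A (last w) (z 0)" using D_k[OF that(2) z0, of 0] k w(3) by simp
    then show "weight w z \<le> exp (W k) * weight w z0" "weight w z0 \<le> exp (W k) * weight w z"
      using weight_distortion[OF w(1,2) k] D_k that(2) z0 DA w(3) by blast+
  qed
  have weighted: "c * (\<integral>\<^sup>+ z. g z * indicator D z \<partial>\<nu>) = (\<integral>\<^sup>+ w. \<integral>\<^sup>+ z. ennreal (weight w z0) * (g z * indicator D z) \<partial>\<nu> \<partial>count_space P)"
    if [measurable]: "g \<in> borel_measurable \<nu>" for g :: "(nat \<Rightarrow> 'v) \<Rightarrow> ennreal"
    unfolding c_def by (simp add: nn_integral_cmult nn_integral_multc)
  show ?thesis
  proof (rule that)
    fix g :: "(nat \<Rightarrow> 'v) \<Rightarrow> ennreal" assume g [measurable]: "g \<in> borel_measurable \<nu>"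
    have "(\<integral>\<^sup>+ w. \<integral>\<^sup>+ z. ennreal (weight w z) * (g z * indicator D z) \<partial>\<nu> \<partial>count_space P)
        \<le> (\<integral>\<^sup>+ w. ennreal (exp (W k)) * (\<integral>\<^sup>+ z. ennreal (weight w z0) * (g z * indicator D z) \<partial>\<nu>) \<partial>count_space P)"
    proof (rule nn_integral_mono)
      fix w assume w: "w \<in> space (count_space P)"
      have "(\<integral>\<^sup>+ z. ennreal (weight w z) * (g z * indicator D z) \<partial>\<nu>)
          \<le> (\<integral>\<^sup>+ z. ennreal (exp (W k)) * (ennreal (weight w z0) * (g z * indicator D z)) \<partial>\<nu>)"
        using dist(1) w weight_pos[of w z0]
        by (intro nn_integral_mono) (auto simp: mult.assoc[symmetric] ennreal_mult[symmetric]
            intro!: mult_right_mono ennreal_leI split: split_indicator)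
      then show "(\<integral>\<^sup>+ z. ennreal (weight w z) * (g z * indicator D z) \<partial>\<nu>)
          \<le> ennreal (exp (W k)) * (\<integral>\<^sup>+ z. ennreal (weight w z0) * (g z * indicator D z) \<partial>\<nu>)"
        by (simp add: nn_integral_cmult)
    qed
    then show "(\<integral>\<^sup>+ y. indicator Q y * (g ((shift ^^ N) y) * indicator D ((shift ^^ N) y)) \<partial>\<nu>)
       \<le> ennreal (exp (W k)) * (c * (\<integral>\<^sup>+ z. g z * indicator D z \<partial>\<nu>))"
      unfolding main[OF g] weighted[OF g] by (simp add: nn_integral_cmult)
    \<comment> \<open>Nothing is known about \<open>\<phi>\<close> at sequences outside the shift
      space, so measurability of \<open>weight w\<close> is obtained after restriction to
      \<open>D\<close>, where \<open>cat w z\<close> is a point of the shift space.\<close>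
    have wm: "(\<lambda>z. ennreal (weight w z) * (g z * indicator D z)) \<in> borel_measurable \<nu>" if "w \<in> P" for w
    proof -
      have w: "w \<noteq> []" "admissible A w" "A (last w) (z0 0)" using that N by (auto simp: P_def)
      have "A (last w) (z 0)" if "z \<in> D" for z using D_k[OF that z0, of 0] k w(3) by simp
      then have "(\<lambda>z. ennreal (weight w z) * (g z * indicator D z))
          = (\<lambda>z. (if A (last w) (z 0) then ennreal (exp (birkhoff \<phi> (length w) (cat w z)) / lam ^ length w) else 0) * (g z * indicator D z))"
        by (auto simp: weight_def fun_eq_iff split: split_indicator)
      moreover have [measurable]: "(\<lambda>z. if A (last w) (z 0) then ennreal (exp (birkhoff \<phi> (length w) (cat w z)) / lam ^ length w) else 0) \<in> borel_measurable \<nu>"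
        by (rule cat_measurable[OF w(1,2), of "\<lambda>y. ennreal (exp (birkhoff \<phi> (length w) y) / lam ^ length w)"]) measurable
      ultimately show ?thesis by simp
    qed
    have "(\<integral>\<^sup>+ w. \<integral>\<^sup>+ z. ennreal (weight w z0) * (g z * indicator D z) \<partial>\<nu> \<partial>count_space P)
        \<le> (\<integral>\<^sup>+ w. ennreal (exp (W k)) * (\<integral>\<^sup>+ z. ennreal (weight w z) * (g z * indicator D z) \<partial>\<nu>) \<partial>count_space P)"
    proof (rule nn_integral_mono)
      fix w assume w: "w \<in> space (count_space P)"
      have "(\<integral>\<^sup>+ z. ennreal (weight w z0) * (g z * indicator D z) \<partial>\<nu>)
          \<le> (\<integral>\<^sup>+ z. ennreal (exp (W k)) * (ennreal (weight w z) * (g z * indicator D z)) \<partial>\<nu>)"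
        using dist(2) w less_imp_le[OF weight_pos]
        by (intro nn_integral_mono) (auto simp: mult.assoc[symmetric] ennreal_mult[symmetric]
            intro!: mult_right_mono ennreal_leI split: split_indicator)
      then show "(\<integral>\<^sup>+ z. ennreal (weight w z0) * (g z * indicator D z) \<partial>\<nu>)
          \<le> ennreal (exp (W k)) * (\<integral>\<^sup>+ z. ennreal (weight w z) * (g z * indicator D z) \<partial>\<nu>)"
        using wm w by (simp add: nn_integral_cmult)
    qed
    then show "c * (\<integral>\<^sup>+ z. g z * indicator D z \<partial>\<nu>)
       \<le> ennreal (exp (W k)) * (\<integral>\<^sup>+ y. indicator Q y * (g ((shift ^^ N) y) * indicator D ((shift ^^ N) y)) \<partial>\<nu>)"
      unfolding main[OF g] weighted[OF g] by (simp add: nn_integral_cmult)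
  qed
next
  case True
  show ?thesis by (rule that[of 0]) (simp_all add: True)
qed

section \<open>Positivity of the conformal measure and lower bounds for the eigenfunction\<close>

lemma nu_finite: "w \<noteq> [] \<Longrightarrow> emeasure \<nu> (cylinder A w) < \<infinity>"
  using rpf by (simp add: RPF_measure_def)

lemma return_word:
  assumes "w \<noteq> []" "admissible A w"
  obtains w' where "w' \<noteq> []" "admissible A w'" "A (last w') v" "cylinder A w' \<subseteq> cylinder A w"
proof -
  obtain N where "\<forall>n\<ge>N. \<exists>p :: nat \<Rightarrow> 'v. p 0 = last w \<and> p n = v \<and> (\<forall>i<n. A (p i) (p (Suc i)))"
    using mixing unfolding topologically_mixing_def by blast
  then obtain p :: "nat \<Rightarrow> 'v" where p: "p 0 = last w" "p (Suc N) = v" "\<And>i. i < Suc N \<Longrightarrow> A (p i) (p (Suc i))"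
    by (metis le_SucI order_refl)
  obtain w' where "w' \<noteq> []" "admissible A w'" "A (last w') (p (Suc N))" "cylinder A w' \<subseteq> cylinder A w"
    by (rule admissible_path[where p = p and n = "Suc N", OF assms p(1) p(3)]) auto
  then show ?thesis using that p(2) by blast
qed

text \<open>Some cylinder of length 1 has positive measure, for otherwise \<open>\<nu>\<close> would
  vanish and \<open>h\<close> could not have integral 1. Mixing connects \<open>w\<close> to its
  symbol, and \<open>conformal\<close> with a positive weight carries the positivity back.\<close>

lemma nu_pos:
  assumes w: "w \<noteq> []" "admissible A w"
  shows "0 < emeasure \<nu> (cylinder A w)"
proof -
  have "\<exists>v. 0 < emeasure \<nu> (cylinder A [v])"
  proof (rule ccontr)
    assume "\<nexists>v. 0 < emeasure \<nu> (cylinder A [v])"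
    then have "cylinder A [v] \<in> null_sets \<nu>" for v by (auto simp: null_sets_def)
    then have "(\<Union>v. cylinder A [v]) \<in> null_sets \<nu>" by (intro null_sets_UN') (auto intro: countableI_type)
    moreover have "tms A = (\<Union>v. cylinder A [v])" by (auto simp: cylinder_def)
    ultimately have "emeasure \<nu> (space \<nu>) = 0" by auto
    then have "AE x in \<nu>. ennreal (h x) = 0" by (intro AE_I[of _ _ "space \<nu>"]) (blast, simp, rule sets.top)
    then have "(\<integral>\<^sup>+ x. ennreal (h x) \<partial>\<nu>) = 0" by (subst nn_integral_0_iff_AE) simp_all
    then show False using rpf by (simp add: RPF_measure_def)
  qed
  then obtain v where v: "0 < emeasure \<nu> (cylinder A [v])" by blast
  obtain w' where w': "w' \<noteq> []" "admissible A w'" "A (last w') v" "cylinder A w' \<subseteq> cylinder A w"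
    by (rule return_word[OF w])
  have "emeasure \<nu> (cylinder A w') = (\<integral>\<^sup>+ z. (if A (last w') (z 0) then ennreal (weight w' z) * 1 else 0) \<partial>\<nu>)"
    using conformal[OF w'(1,2), of "\<lambda>_. 1"] by simp
  moreover have "(\<integral>\<^sup>+ z. (if A (last w') (z 0) then ennreal (weight w' z) * 1 else 0) \<partial>\<nu>) \<noteq> 0"
  proof
    assume 0: "(\<integral>\<^sup>+ z. (if A (last w') (z 0) then ennreal (weight w' z) * 1 else 0) \<partial>\<nu>) = 0"
    have "(\<lambda>z. if A (last w') (z 0) then ennreal (exp (birkhoff \<phi> (length w') (cat w' z)) / lam ^ length w') else 0) \<in> borel_measurable \<nu>"
      by (rule cat_measurable[OF w'(1,2), of "\<lambda>y. ennreal (exp (birkhoff \<phi> (length w') y) / lam ^ length w')"]) measurable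
    then have "AE z in \<nu>. (if A (last w') (z 0) then ennreal (weight w' z) * 1 else 0) = 0"
      using 0 by (subst (asm) nn_integral_0_iff_AE) (simp_all add: weight_def cong: if_cong)
    moreover have wn: "ennreal (weight w' z) \<noteq> 0" for z using weight_pos[of w' z] by simp
    ultimately have "AE z in \<nu>. z \<notin> cylinder A [v]"
      by (elim eventually_mono) (use w'(3) wn in \<open>auto simp: cylinder_def\<close>)
    then have "emeasure \<nu> (cylinder A [v]) = 0"
      by (subst (asm) AE_iff_measurable[OF cylinder_sets[of "[v]"]]) (auto simp: cylinder_def)
    then show False using v by simp
  qed
  ultimately have "0 < emeasure \<nu> (cylinder A w')" by (simp add: zero_less_iff_neq_zero)
  also have "\<dots> \<le> emeasure \<nu> (cylinder A w)" by (rule emeasure_mono[OF w'(4)]) simp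
  finally show ?thesis .
qed

text \<open>The eigenvalue equation writes \<open>lam * h z\<close> as a sum of positive terms over
  the preimages of \<open>z\<close>; a single term is kept at each step.\<close>

lemma h_ge_weight:
  assumes "w \<noteq> []" "admissible A w" "A (last w) (z 0)" "z \<in> tms A"
  shows "weight w z * h (cat w z) \<le> h z"
  using assms
proof (induction w)
  case (Cons v w)
  have step: "exp (\<phi> (cat [v] z)) / lam * h (cat [v] z) \<le> h z" if z: "A v (z 0)" "z \<in> tms A" for z
  proof -
    let ?g = "\<lambda>y. ennreal (exp (\<phi> y)) * ennreal (h y)"
    have c: "cat [v] z \<in> tms A" using z by (intro cat_tms) (auto simp: admissible_def)
    then have "cat [v] z \<in> {y \<in> tms A. shift y = z}" using shift_pow_cat[of "[v]" z] by simp
    then have "?g (cat [v] z) \<le> infsum ?g {y \<in> tms A. shift y = z}"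
      by (subst nonneg_infsum_complete) (auto intro!: SUP_upper2[of "{cat [v] z}"])
    also have "\<dots> = ennreal (lam * h z)"
      using rpf z(2) by (simp add: RPF_measure_def transfer_op_def)
    finally have "exp (\<phi> (cat [v] z)) * h (cat [v] z) \<le> lam * h z"
      using h_pos[OF c] h_pos[OF z(2)] lam_pos by (simp add: ennreal_mult[symmetric])
    then show ?thesis using lam_pos by (simp add: field_simps)
  qed
  show ?case
  proof (cases "w = []")
    case True
    then show ?thesis using step[of z] Cons.prems by (simp add: weight_def birkhoff_def)
  next
    case False
    have w: "admissible A w" "A v (hd w)" using admissible_Cons[OF Cons.prems(2)] False by auto
    have l: "A (last w) (z 0)" using Cons.prems(3) False by simp
    have c: "cat w z \<in> tms A" by (rule cat_tms[OF False w(1) l Cons.prems(4)])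
    have "weight (v # w) z * h (cat (v # w) z) = weight w z * (exp (\<phi> (cat [v] (cat w z))) / lam * h (cat [v] (cat w z)))"
      by (simp add: weight_Cons cat_Cons[of v w])
    also have "\<dots> \<le> weight w z * h (cat w z)"
      using step[of "cat w z"] c w(2) weight_pos[of w z] cat_0[OF False] by (intro mult_left_mono) auto
    also have "\<dots> \<le> h z" by (rule Cons.IH[OF False w(1) l Cons.prems(4)])
    finally show ?thesis .
  qed
qed simp

lemma h_continuous:
  assumes x: "x \<in> tms A" and e: "0 < e"
  obtains n where "\<And>y. y \<in> cylinder A (map x [0..<n]) \<Longrightarrow> \<bar>h y - h x\<bar> < e"
proof -
  have "openin (shift_topology \<eta> A) {y \<in> topspace (shift_topology \<eta> A). h y \<in> {h x - e<..<h x + e}}"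
    using rpf by (intro openin_continuous_map_preimage[where Y = euclideanreal]) (auto simp: RPF_measure_def)
  then obtain n where n: "cylinder A (map x [0..<n]) \<subseteq> {y \<in> topspace (shift_topology \<eta> A). h y \<in> {h x - e<..<h x + e}}"
    unfolding openin_shift_topology[OF eta] using x e by (auto simp: topspace_shift_topology[OF eta])
  have "\<bar>h y - h x\<bar> < e" if "y \<in> cylinder A (map x [0..<n])" for y
  proof -
    have "h y \<in> {h x - e<..<h x + e}" using n that by blast
    then show ?thesis by auto
  qed
  then show ?thesis using that by blast
qed

text \<open>The cylinder of \<open>x 0\<close> need not be compact, so continuity of
  \<open>h\<close> alone does not suffice. A fixed word \<open>w\<close> leads from a neighbourhood
  of \<open>x\<close> on which \<open>h > h x / 2\<close> to any point beginning with
  \<open>x 0\<close>; \<open>h_ge_weight\<close> then bounds \<open>h z\<close> from below, and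
  bounded distortion makes the weight of \<open>w\<close> uniform in \<open>z\<close>.\<close>

lemma h_lower_bound:
  assumes x: "x \<in> tms A"
  obtains c where "0 < c" "\<And>z. z \<in> cylinder A [x 0] \<Longrightarrow> c \<le> h z"
proof -
  obtain n where n: "\<And>y. y \<in> cylinder A (map x [0..<n]) \<Longrightarrow> \<bar>h y - h x\<bar> < h x / 2"
    using h_continuous[OF x, of "h x / 2"] h_pos[OF x] by auto
  have "map x [0..<Suc n] \<noteq> []" by simp
  from return_word[OF this admissible_map[OF x], of "x 0"]
  obtain w where w: "w \<noteq> []" "admissible A w" "A (last w) (x 0)" "cylinder A w \<subseteq> cylinder A (map x [0..<Suc n])" .
  have "exp (- W 1) * weight w x * (h x / 2) \<le> h z" if "z \<in> cylinder A [x 0]" for z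
  proof -
    have z: "z \<in> tms A" "z 0 = x 0" using that by (auto simp: cylinder_def)
    have c: "cat w z \<in> tms A" using cat_tms[OF w(1,2)] w(3) z by simp
    have "cat w z \<in> cylinder A (map x [0..<n])"
      using subsetD[OF w(4) cat_cylinder[OF c]] by (auto simp: mem_cylinder_map simp del: upt_Suc)
    then have "\<bar>h (cat w z) - h x\<bar> < h x / 2" by (rule n)
    then have hz: "h x / 2 \<le> h (cat w z)" by linarith
    have "weight w x \<le> exp (W 1) * weight w z"
      using x z w by (intro weight_distortion) auto
    then have "exp (- W 1) * weight w x \<le> exp (- W 1) * (exp (W 1) * weight w z)" by simp
    then have "exp (- W 1) * weight w x \<le> weight w z" by (simp add: mult.assoc[symmetric] exp_add[symmetric])
    then have "exp (- W 1) * weight w x * (h x / 2) \<le> weight w z * h (cat w z)"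
      using hz h_pos[OF x] weight_pos[of w z] by (intro mult_mono) auto
    also have "\<dots> \<le> h z" using h_ge_weight[OF w(1,2)] w(3) z by simp
    finally show ?thesis .
  qed
  then show ?thesis
    using that[of "exp (- W 1) * weight w x * (h x / 2)"] weight_pos[of w x] h_pos[OF x] by simp
qed

lemma nn_integral_mu:
  "f \<in> borel_measurable \<nu> \<Longrightarrow> (\<integral>\<^sup>+ x. f x \<partial>\<mu>) = (\<integral>\<^sup>+ x. ennreal (h x) * f x \<partial>\<nu>)"
  unfolding mu_eq by (rule nn_integral_density) simp_all

lemma AE_mu_iff: "(AE y in \<mu>. P y) \<longleftrightarrow> (AE y in \<nu>. P y)"
proof -
  have "(AE y in \<mu>. P y) \<longleftrightarrow> (AE y in \<nu>. 0 < ennreal (h y) \<longrightarrow> P y)"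
    unfolding mu_eq by (rule AE_density) simp
  also have "\<dots> \<longleftrightarrow> (AE y in \<nu>. P y)" using h_pos by (intro AE_cong) simp
  finally show ?thesis .
qed

end

section \<open>Cylinders around a point\<close>

lemma ennreal_le_divide:
  assumes "0 < m" "c * ennreal m \<le> Y"
  shows "c \<le> ennreal (1 / m) * Y"
proof -
  have "c = ennreal (1 / m) * (c * ennreal m)"
    using assms(1) by (simp add: mult.left_commute[of _ c] ennreal_mult[symmetric])
  also have "\<dots> \<le> ennreal (1 / m) * Y" by (rule mult_left_mono[OF assms(2)]) simp
  finally show ?thesis .
qed

locale rpf_point = rpf_shift A \<eta> \<phi> h \<nu> \<mu> for A :: "'v :: countable \<Rightarrow> 'v \<Rightarrow> bool" and \<eta> \<phi> h \<nu> \<mu> +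
  fixes x :: "nat \<Rightarrow> 'v"
  assumes x: "x \<in> tms A"
begin

sublocale shift_system \<mu>
proof -
  have "prob_space \<mu>" "shift_invariant \<mu>" "shift_ergodic \<mu>" using rpf unfolding RPF_measure_def by blast+
  then show "shift_system \<mu>"
    unfolding shift_system_def ergodic_system_def ergodic_system_axioms_def
      measure_preserving_def measure_preserving_axioms_def shift_invariant_def shift_ergodic_def by blast
qed

abbreviation "base \<equiv> cylinder A [x 0]"
abbreviation "Bx n \<equiv> cylinder A (map x [0..<n])"
abbreviation "m0 \<equiv> measure \<nu> base"

lemma mem_base: "y \<in> base \<longleftrightarrow> y \<in> tms A \<and> y 0 = x 0"
  by (auto simp: cylinder_def)

lemma base_eq: "base = Bx 1" by simp

lemma x_Bx: "x \<in> Bx n" using x by (simp add: mem_cylinder_map)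

lemma Bx_mono: "n \<le> m \<Longrightarrow> Bx m \<subseteq> Bx n"
  by (auto simp: mem_cylinder_map)

lemma Bx_base: "1 \<le> n \<Longrightarrow> Bx n \<subseteq> base"
  unfolding base_eq by (rule Bx_mono)

lemma Bx_mu [measurable]: "Bx n \<in> sets \<mu>" by (simp add: sets_mu)

lemma base_mu [measurable]: "base \<in> sets \<mu>" by (simp add: sets_mu)

lemma determined_Bx: "n \<le> m \<Longrightarrow> determined m (Bx n)"
  by (auto simp: determined_def mem_cylinder_map)

lemma emeasure_base: "emeasure \<nu> base = ennreal m0" "0 < m0"
proof -
  have "emeasure \<nu> base < \<infinity>" "0 < emeasure \<nu> base"
    using nu_finite[of "[x 0]"] nu_pos[of "[x 0]"] by (auto simp: admissible_def)
  then show eq: "emeasure \<nu> base = ennreal m0" by (intro emeasure_eq_ennreal_measure) simp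
  show "0 < m0" using \<open>0 < emeasure \<nu> base\<close> unfolding eq by simp
qed

lemma base_fmeasurable:
  assumes "E \<in> sets \<nu>" "E \<subseteq> base"
  shows "E \<in> fmeasurable \<nu>"
proof -
  have "emeasure \<nu> E \<le> emeasure \<nu> base" by (rule emeasure_mono[OF assms(2) cylinder_sets])
  also have "\<dots> < \<infinity>" by (rule nu_finite) simp
  finally show ?thesis using assms(1) by (intro fmeasurableI)
qed

lemma emeasure_nu:
  assumes "E \<in> sets \<nu>" "E \<subseteq> base"
  shows "emeasure \<nu> E = ennreal (measure \<nu> E)"
  using base_fmeasurable[OF assms] by (intro emeasure_eq_ennreal_measure) (simp add: fmeasurable_def less_top)

lemma nu_Bx_pos: "1 \<le> n \<Longrightarrow> 0 < measure \<nu> (Bx n)"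
proof -
  assume n: "1 \<le> n"
  have "0 < emeasure \<nu> (Bx n)" using n by (intro nu_pos admissible_map x) simp
  then show ?thesis using emeasure_nu[of "Bx n"] Bx_base[OF n] by simp
qed

lemma nu_mono: "E \<in> sets \<nu> \<Longrightarrow> F \<in> sets \<nu> \<Longrightarrow> E \<subseteq> F \<Longrightarrow> F \<subseteq> base \<Longrightarrow> measure \<nu> E \<le> measure \<nu> F"
  by (rule measure_mono_fmeasurable[OF _ _ base_fmeasurable])

lemma W_nonneg: "0 \<le> W k" by (simp add: W_def)

lemma base_agree: "z \<in> base \<Longrightarrow> z' \<in> base \<Longrightarrow> i < 1 \<Longrightarrow> z i = z' i"
  by (simp add: mem_base)

text \<open>Comparison constant for measures seen from \<open>base\<close>: each of the two bounds
  in \<open>distortion\<close> costs \<open>exp (W 1)\<close>, and normalizing by the mass of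
  \<open>base\<close> gives \<open>1 / m0\<close>.\<close>

definition K :: real where "K = exp (2 * W 1) / m0"

lemma K_pos: "0 < K" using emeasure_base(2) by (simp add: K_def)

lemma hit_set_sets [measurable]: "Q \<in> sets \<nu> \<Longrightarrow> E \<in> sets \<nu> \<Longrightarrow> {y \<in> Q. (shift ^^ N) y \<in> E} \<in> sets \<nu>"
proof -
  assume [measurable]: "Q \<in> sets \<nu>" "E \<in> sets \<nu>"
  have "{y \<in> Q. (shift ^^ N) y \<in> E} = {y \<in> space \<nu>. y \<in> Q \<and> (shift ^^ N) y \<in> E}"
    using sets.sets_into_space[of Q \<nu>] by auto
  also have "\<dots> \<in> sets \<nu>" by measurable
  finally show ?thesis .
qed

lemma emeasure_hit_set:
  assumes [measurable]: "Q \<in> sets \<nu>" "E \<in> sets \<nu>"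
  shows "emeasure \<nu> {y \<in> Q. (shift ^^ N) y \<in> E} = (\<integral>\<^sup>+ y. indicator Q y * (1 * indicator E ((shift ^^ N) y)) \<partial>\<nu>)"
proof -
  have "emeasure \<nu> {y \<in> Q. (shift ^^ N) y \<in> E} = (\<integral>\<^sup>+ y. indicator {y \<in> Q. (shift ^^ N) y \<in> E} y \<partial>\<nu>)"
    by (rule nn_integral_indicator[symmetric]) measurable
  also have "\<dots> = (\<integral>\<^sup>+ y. indicator Q y * (1 * indicator E ((shift ^^ N) y)) \<partial>\<nu>)"
    by (intro nn_integral_cong) (simp split: split_indicator)
  finally show ?thesis .
qed

text \<open>The constant \<open>c\<close> of \<open>distortion\<close> is eliminated by testing with
  \<open>g = 1\<close>, which compares \<open>c * m0\<close> with the measure of the points of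
  \<open>Q\<close> that are in \<open>base\<close> at time \<open>N\<close>.\<close>

lemma base_distortion:
  assumes N: "1 \<le> N" and Q: "determined N Q"
  shows "g \<in> borel_measurable \<nu> \<Longrightarrow> (\<integral>\<^sup>+ y. indicator Q y * (g ((shift ^^ N) y) * indicator base ((shift ^^ N) y)) \<partial>\<nu>)
      \<le> ennreal K * (emeasure \<nu> {y \<in> Q. (shift ^^ N) y \<in> base} * (\<integral>\<^sup>+ z. g z * indicator base z \<partial>\<nu>))"
    and "E \<in> sets \<nu> \<Longrightarrow> E \<subseteq> base \<Longrightarrow> emeasure \<nu> {y \<in> Q. (shift ^^ N) y \<in> base} * emeasure \<nu> E
      \<le> ennreal (exp (2 * W 1) * m0) * emeasure \<nu> {y \<in> Q. (shift ^^ N) y \<in> E}"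
proof -
  note [measurable] = determined_sets[OF Q]
  obtain c :: ennreal where
    c1: "\<And>g. g \<in> borel_measurable \<nu> \<Longrightarrow> (\<integral>\<^sup>+ y. indicator Q y * (g ((shift ^^ N) y) * indicator base ((shift ^^ N) y)) \<partial>\<nu>)
       \<le> ennreal (exp (W 1)) * (c * (\<integral>\<^sup>+ z. g z * indicator base z \<partial>\<nu>))" and
    c2: "\<And>g. g \<in> borel_measurable \<nu> \<Longrightarrow> c * (\<integral>\<^sup>+ z. g z * indicator base z \<partial>\<nu>)
       \<le> ennreal (exp (W 1)) * (\<integral>\<^sup>+ y. indicator Q y * (g ((shift ^^ N) y) * indicator base ((shift ^^ N) y)) \<partial>\<nu>)"
    by (rule distortion[of N Q 1 base])
      (rule N, rule Q, simp, simp, erule (2) base_agree, rule that, assumption+)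
  have e2: "exp (2 * W 1) = exp (W 1) * exp (W 1)" by (simp add: exp_add[symmetric])
  let ?V = "\<lambda>E. emeasure \<nu> {y \<in> Q. (shift ^^ N) y \<in> E}"
  have "c * ennreal m0 \<le> ennreal (exp (W 1)) * ?V base"
    using c2[of "\<lambda>_. 1"] by (simp add: emeasure_hit_set emeasure_base(1)[symmetric])
  then have c: "c \<le> ennreal (1 / m0) * (ennreal (exp (W 1)) * ?V base)"
    by (rule ennreal_le_divide[OF emeasure_base(2)])
  { assume g: "g \<in> borel_measurable \<nu>"
    have "(\<integral>\<^sup>+ y. indicator Q y * (g ((shift ^^ N) y) * indicator base ((shift ^^ N) y)) \<partial>\<nu>)
        \<le> ennreal (exp (W 1)) * ((ennreal (1 / m0) * (ennreal (exp (W 1)) * ?V base)) * (\<integral>\<^sup>+ z. g z * indicator base z \<partial>\<nu>))"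
      by (rule order_trans[OF c1[OF g]]) (intro mult_left_mono mult_right_mono c, simp_all)
    also have "\<dots> = ennreal (exp (W 1) * (1 / m0) * exp (W 1)) * (?V base * (\<integral>\<^sup>+ z. g z * indicator base z \<partial>\<nu>))"
    proof -
      have "ennreal (exp (W 1) * (1 / m0) * exp (W 1)) = ennreal (exp (W 1)) * ennreal (1 / m0) * ennreal (exp (W 1))"
        using emeasure_base(2) by (simp only: ennreal_mult exp_ge_zero mult_nonneg_nonneg zero_le_divide_1_iff less_imp_le)
      then show ?thesis by (simp only: mult_ac)
    qed
    also have "exp (W 1) * (1 / m0) * exp (W 1) = K" unfolding K_def e2 by simp
    finally show "(\<integral>\<^sup>+ y. indicator Q y * (g ((shift ^^ N) y) * indicator base ((shift ^^ N) y)) \<partial>\<nu>)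
      \<le> ennreal K * (?V base * (\<integral>\<^sup>+ z. g z * indicator base z \<partial>\<nu>))" . }
  { assume E [measurable]: "E \<in> sets \<nu>" and sub: "E \<subseteq> base"
    have ind: "indicator E z * indicator base z = (indicator E z :: ennreal)" for z
      using sub by (auto split: split_indicator)
    have "?V base \<le> ennreal (exp (W 1)) * (c * ennreal m0)"
      using c1[of "\<lambda>_. 1"] by (simp add: emeasure_hit_set emeasure_base(1)[symmetric])
    then have "?V base * emeasure \<nu> E \<le> ennreal (exp (W 1)) * (c * ennreal m0) * emeasure \<nu> E"
      by (rule mult_right_mono) simp
    also have "\<dots> = ennreal (exp (W 1) * m0) * (c * emeasure \<nu> E)"
      using emeasure_base(2) by (simp add: ennreal_mult mult.assoc mult.left_commute mult.commute)
    also have "c * emeasure \<nu> E \<le> ennreal (exp (W 1)) * ?V E"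
      using c2[of "indicator E"] by (simp add: emeasure_hit_set ind)
    also have "ennreal (exp (W 1) * m0) * (ennreal (exp (W 1)) * ?V E) = ennreal (exp (2 * W 1) * m0) * ?V E"
      using emeasure_base(2) unfolding e2
      by (simp add: mult.assoc[symmetric] ennreal_mult[symmetric]) (simp add: mult.commute mult.left_commute)
    finally show "?V base * emeasure \<nu> E \<le> ennreal (exp (2 * W 1) * m0) * ?V E"
      by (simp add: mult_left_mono) }
qed

lemma Bx_Suc_eq: "x j = x 0 \<Longrightarrow> {y \<in> Bx j. (shift ^^ j) y \<in> base} = Bx (Suc j)"
  by (auto simp: mem_cylinder_map mem_base shift_pow shift_pow_tms less_Suc_eq simp del: upt_Suc)

text \<open>If \<open>x j = x 0\<close>, then \<open>Bx (Suc j)\<close> consists of the points of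
  \<open>Bx j\<close> that are in \<open>base\<close> at time \<open>j\<close>, so
  \<open>base_distortion\<close> applies to \<open>Bx j\<close>. For \<open>j = 0\<close> there is
  no word to read and the claim reduces to \<open>1 \<le> K * m0\<close>.\<close>

lemma cylinder_upper:
  assumes j: "x j = x 0" and g [measurable]: "g \<in> borel_measurable \<nu>"
  shows "(\<integral>\<^sup>+ y. indicator (Bx (Suc j)) y * g ((shift ^^ j) y) \<partial>\<nu>)
    \<le> ennreal K * (emeasure \<nu> (Bx (Suc j)) * (\<integral>\<^sup>+ z. g z * indicator base z \<partial>\<nu>))"
proof (cases "j = 0")
  case False
  then have "(\<integral>\<^sup>+ y. indicator (Bx j) y * (g ((shift ^^ j) y) * indicator base ((shift ^^ j) y)) \<partial>\<nu>)
      \<le> ennreal K * (emeasure \<nu> (Bx (Suc j)) * (\<integral>\<^sup>+ z. g z * indicator base z \<partial>\<nu>))"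
    using base_distortion(1)[of j "Bx j" g] determined_Bx[of j j] by (simp only: Bx_Suc_eq[OF j] g)
  moreover have "(\<integral>\<^sup>+ y. indicator (Bx (Suc j)) y * g ((shift ^^ j) y) \<partial>\<nu>)
      = (\<integral>\<^sup>+ y. indicator (Bx j) y * (g ((shift ^^ j) y) * indicator base ((shift ^^ j) y)) \<partial>\<nu>)"
  proof (intro nn_integral_cong)
    fix y
    have "y \<in> Bx (Suc j) \<longleftrightarrow> y \<in> Bx j \<and> (shift ^^ j) y \<in> base" using Bx_Suc_eq[OF j] by blast
    then show "indicator (Bx (Suc j)) y * g ((shift ^^ j) y)
        = indicator (Bx j) y * (g ((shift ^^ j) y) * indicator base ((shift ^^ j) y))"
      by (simp split: split_indicator del: upt_Suc)
  qed
  ultimately show ?thesis by simp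
next
  case True
  have "1 \<le> K * m0" using emeasure_base(2) W_nonneg[of 1] by (simp add: K_def)
  then have "1 \<le> ennreal K * emeasure \<nu> (Bx (Suc 0))"
    using K_pos by (simp add: emeasure_base(1) ennreal_mult[symmetric])
  then have "1 * (\<integral>\<^sup>+ z. g z * indicator base z \<partial>\<nu>)
      \<le> ennreal K * emeasure \<nu> (Bx (Suc 0)) * (\<integral>\<^sup>+ z. g z * indicator base z \<partial>\<nu>)"
    by (rule mult_right_mono) simp
  then show ?thesis by (simp add: True mult.assoc mult.commute[of "indicator base _"])
qed

lemma cylinder_lower:
  assumes j: "x j = x 0" and E [measurable]: "E \<in> sets \<nu>" and sub: "E \<subseteq> base"
  shows "measure \<nu> (Bx (Suc j)) * measure \<nu> E \<le> exp (2 * W 1) * m0 * measure \<nu> {y \<in> Bx (Suc j). (shift ^^ j) y \<in> E}"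
proof (cases "j = 0")
  case False
  have eq: "{y \<in> Bx j. (shift ^^ j) y \<in> E} = {y \<in> Bx (Suc j). (shift ^^ j) y \<in> E}"
    using sub Bx_Suc_eq[OF j] by blast
  have "emeasure \<nu> (Bx (Suc j)) * emeasure \<nu> E \<le> ennreal (exp (2 * W 1) * m0) * emeasure \<nu> {y \<in> Bx (Suc j). (shift ^^ j) y \<in> E}"
    using base_distortion(2)[of j "Bx j" E] determined_Bx[of j j] False by (simp only: Bx_Suc_eq[OF j] eq E sub)
  moreover have "{y \<in> Bx (Suc j). (shift ^^ j) y \<in> E} \<subseteq> base" using Bx_base[of "Suc j"] by auto
  ultimately have "ennreal (measure \<nu> (Bx (Suc j)) * measure \<nu> E)
      \<le> ennreal (exp (2 * W 1) * m0 * measure \<nu> {y \<in> Bx (Suc j). (shift ^^ j) y \<in> E})"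
    using sub Bx_base[of "Suc j"] by (simp add: emeasure_nu ennreal_mult del: upt_Suc)
  then show ?thesis by (subst (asm) ennreal_le_iff) simp_all
next
  case True
  have "{y \<in> base. y \<in> E} = E" using sub by blast
  moreover have "m0 * measure \<nu> E * 1 \<le> m0 * measure \<nu> E * exp (2 * W 1)"
    using W_nonneg[of 1] by (intro mult_left_mono) auto
  ultimately show ?thesis by (simp add: True mult.commute mult.left_commute)
qed

lemma nu_singleton: "measure \<nu> {y} = 0"
proof (cases "y \<in> tms A")
  case True
  have "AE z in \<mu>. z \<noteq> y"
  proof (rule AE_I[of _ _ "{y}"])
    have "{y} = (\<Inter>n. cylinder A (map y [0..<n]))"
    proof -
      have "z = y" if "\<And>n. z \<in> cylinder A (map y [0..<n])" for z
        using that[of "Suc _"] by (auto simp: mem_cylinder_map simp del: upt_Suc)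
      then show ?thesis using True by (auto simp: mem_cylinder_map)
    qed
    also have "\<dots> \<in> sets \<mu>" by (intro sets.countable_INT') (auto simp: sets_mu)
    finally show "{y} \<in> sets \<mu>" .
  qed (use non_atomic[OF True] in auto)
  then have "AE z in \<nu>. z \<noteq> y" by (simp add: AE_mu_iff)
  then have "emeasure \<nu> {z \<in> space \<nu>. z = y} = 0" by (intro emeasure_eq_0_AE)
  moreover have "{z \<in> space \<nu>. z = y} = {y}" using True by auto
  ultimately show ?thesis by (simp add: measure_def)
next
  case False
  then have "{y} \<notin> sets \<nu>" using sets.sets_into_space[of "{y}" \<nu>] by auto
  then show ?thesis by (rule measure_notin_sets)
qed

lemma nu_Bx_tendsto: "(\<lambda>n. measure \<nu> (Bx n)) \<longlonglongrightarrow> 0"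
proof -
  have "(\<lambda>n. measure \<nu> (Bx (Suc n))) \<longlonglongrightarrow> measure \<nu> (\<Inter>n. Bx (Suc n))"
  proof (rule Lim_measure_decseq)
    show "range (\<lambda>n. Bx (Suc n)) \<subseteq> sets \<nu>" by (auto simp del: upt_Suc)
    show "decseq (\<lambda>n. Bx (Suc n))" using Bx_mono by (auto simp: decseq_def simp del: upt_Suc)
    show "emeasure \<nu> (Bx (Suc n)) \<noteq> \<infinity>" for n using nu_finite[of "map x [0..<Suc n]"] by (simp del: upt_Suc)
  qed
  also have "(\<Inter>n. Bx (Suc n)) = {x}"
    using x by (auto simp: mem_cylinder_map simp del: upt_Suc) (metis ext lessI)
  finally show ?thesis by (simp add: nu_singleton LIMSEQ_imp_Suc del: upt_Suc)
qed

text \<open>Two points of \<open>base\<close> that separate at the earliest possible time have not returned to \<open>base\<close> before. So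
  every block of \<open>x\<close> between consecutive visits to \<open>base\<close> misses one of the two, which costs a fixed
  proportion of the measure.\<close>

lemma return_contraction:
  obtains \<rho> where "0 < \<rho>" "\<rho> < 1"
    "\<And>j j'. j < j' \<Longrightarrow> x j = x 0 \<Longrightarrow> x j' = x 0 \<Longrightarrow> (\<And>i. j < i \<Longrightarrow> i < j' \<Longrightarrow> x i \<noteq> x 0)
      \<Longrightarrow> measure \<nu> (Bx (Suc j')) \<le> \<rho> * measure \<nu> (Bx (Suc j))"
proof -
  define P where "P l \<longleftrightarrow> (\<exists>y\<in>base. \<exists>y'\<in>base. y l \<noteq> y' l)" for l
  have "\<exists>l. P l"
  proof (rule ccontr)
    assume "\<nexists>l. P l"
    then have "y = x" if "y \<in> base" for y
      using that x by (auto simp: P_def mem_base fun_eq_iff)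
    then have "base \<subseteq> {x}" by blast
    moreover have "x \<in> base" using x by (simp add: mem_base)
    ultimately have "base = {x}" by blast
    then show False using emeasure_base(2) nu_singleton[of x] by simp
  qed
  define l where "l = (LEAST l. P l)"
  have "P l" unfolding l_def using \<open>\<exists>l. P l\<close> by (rule LeastI_ex)
  then obtain y y' where y: "y \<in> base" "y' \<in> base" "y l \<noteq> y' l" by (auto simp: P_def)
  have agree: "z i = z' i" if "z \<in> base" "z' \<in> base" "i < l" for z z' i
    using not_less_Least[of i P] that by (auto simp: l_def P_def)
  \<comment> \<open>A return of \<open>z\<close> at time \<open>i < l\<close> would be shared by
    \<open>y\<close> and \<open>y'\<close>; their images lie in \<open>base\<close> and separate
    already at \<open>l - i\<close>, against the minimality of \<open>l\<close>.\<close>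
  have no_return: "z i \<noteq> x 0" if z: "z \<in> base" and i: "1 \<le> i" "i < l" for z i
  proof
    assume "z i = x 0"
    then have "y i = x 0" "y' i = x 0" using agree[OF z y(1) i(2)] agree[OF z y(2) i(2)] by simp_all
    then have "(shift ^^ i) y \<in> base" "(shift ^^ i) y' \<in> base"
      using y by (simp_all add: mem_base shift_pow shift_pow_tms)
    from agree[OF this, of "l - i"] show False using y(3) i by (simp add: shift_pow)
  qed
  define P1 where "P1 = cylinder A (map y [0..<Suc l])"
  define P2 where "P2 = cylinder A (map y' [0..<Suc l])"
  have P12_sets: "P1 \<in> sets \<nu>" "P2 \<in> sets \<nu>" by (simp_all add: P1_def P2_def del: upt_Suc)
  have P12: "P1 \<subseteq> base" "P2 \<subseteq> base"
    using y by (auto simp: P1_def P2_def mem_cylinder_map mem_base simp del: upt_Suc)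
  define \<delta> where "\<delta> = min (measure \<nu> P1) (measure \<nu> P2)"
  have "0 < emeasure \<nu> P1" "0 < emeasure \<nu> P2"
    unfolding P1_def P2_def using y by (auto intro!: nu_pos admissible_map simp: mem_base simp del: upt_Suc)
  then have \<delta>: "0 < \<delta>" using emeasure_nu P12 P12_sets by (simp add: \<delta>_def)
  define k where "k = 1 / (exp (2 * W 1) * m0)"
  have k: "0 < k" using emeasure_base(2) by (simp add: k_def)
  show ?thesis
  \<comment> \<open>The maximum with \<open>1 / 2\<close> keeps the factor positive.\<close>
  proof (rule that[of "max (1 / 2) (1 - k * \<delta>)"])
    show "0 < max (1 / 2) (1 - k * \<delta>)" "max (1 / 2) (1 - k * \<delta>) < 1" using k \<delta> by auto
    fix j j' assume jj: "j < j'" "x j = x 0" "x j' = x 0" and between: "\<And>i. j < i \<Longrightarrow> i < j' \<Longrightarrow> x i \<noteq> x 0"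
    define E where "E = {z \<in> base. \<forall>i<Suc (j' - j). z i = x (j + i)}"
    have Tjx: "(shift ^^ j) x \<in> base" using x jj by (simp add: mem_base shift_pow shift_pow_tms)
    have "l \<le> j' - j"
    proof (rule ccontr)
      assume "\<not> l \<le> j' - j"
      then have "(shift ^^ j) x (j' - j) \<noteq> x 0" using jj(1) by (intro no_return[OF Tjx]) auto
      then show False using jj by (simp add: shift_pow)
    qed
    \<comment> \<open>The block is long enough to prescribe the symbol at \<open>l\<close>, in which
      \<open>P1\<close> and \<open>P2\<close> differ.\<close>
    then have sub: "E \<inter> P1 = {} \<or> E \<inter> P2 = {}"
      using y(3) by (auto simp: E_def P1_def P2_def mem_cylinder_map less_Suc_eq_le simp del: upt_Suc)
    have [measurable]: "E \<in> sets \<nu>"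
    proof -
      have "E = {z \<in> space \<nu>. z \<in> base \<and> (\<forall>i<Suc (j' - j). z i = x (j + i))}" by (auto simp: E_def mem_base)
      also have "\<dots> \<in> sets \<nu>" by measurable
      finally show ?thesis .
    qed
    have rest: "\<delta> \<le> measure \<nu> (base - E)"
      using sub
    proof
      assume "E \<inter> P1 = {}"
      then have "measure \<nu> P1 \<le> measure \<nu> (base - E)" using P12 P12_sets by (intro nu_mono) auto
      then show ?thesis by (simp add: \<delta>_def)
    next
      assume "E \<inter> P2 = {}"
      then have "measure \<nu> P2 \<le> measure \<nu> (base - E)" using P12 P12_sets by (intro nu_mono) auto
      then show ?thesis by (simp add: \<delta>_def)
    qed
    let ?R = "{y \<in> Bx (Suc j). (shift ^^ j) y \<in> base - E}"
    have R_sets: "?R \<in> sets \<nu>" by (intro hit_set_sets) (simp_all del: upt_Suc)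
    have "?R \<subseteq> Bx (Suc j)" by blast
    moreover have "Bx (Suc j') \<subseteq> Bx (Suc j) - ?R"
    proof
      fix z assume z: "z \<in> Bx (Suc j')"
      then have "z \<in> Bx (Suc j)" using Bx_mono[of "Suc j" "Suc j'"] jj(1) by (auto simp del: upt_Suc)
      moreover have "(shift ^^ j) z i = x (j + i)" if "i < Suc (j' - j)" for i
        using z that jj(1) by (simp add: mem_cylinder_map shift_pow del: upt_Suc)
      ultimately show "z \<in> Bx (Suc j) - ?R"
        by (auto simp: E_def simp del: upt_Suc)
    qed
    ultimately have "measure \<nu> (Bx (Suc j')) \<le> measure \<nu> (Bx (Suc j) - ?R)"
      using R_sets Bx_base[of "Suc j"] by (intro nu_mono) (auto simp del: upt_Suc)
    also have "\<dots> = measure \<nu> (Bx (Suc j)) - measure \<nu> ?R"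
      using R_sets \<open>?R \<subseteq> Bx (Suc j)\<close> nu_finite[of "map x [0..<Suc j]"]
      by (intro measure_Diff) (auto simp del: upt_Suc)
    also have "\<dots> \<le> measure \<nu> (Bx (Suc j)) - k * (measure \<nu> (Bx (Suc j)) * measure \<nu> (base - E))"
      using cylinder_lower[OF jj(2), of "base - E"] emeasure_base(2)
      by (simp add: k_def pos_divide_le_eq mult.commute del: upt_Suc)
    also have "\<dots> \<le> measure \<nu> (Bx (Suc j)) - k * (measure \<nu> (Bx (Suc j)) * \<delta>)"
      using rest k by (intro diff_left_mono mult_left_mono) auto
    also have "\<dots> = (1 - k * \<delta>) * measure \<nu> (Bx (Suc j))" by (simp add: algebra_simps)
    also have "\<dots> \<le> max (1 / 2) (1 - k * \<delta>) * measure \<nu> (Bx (Suc j))"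
      by (intro mult_right_mono) auto
    finally show "measure \<nu> (Bx (Suc j')) \<le> max (1 / 2) (1 - k * \<delta>) * measure \<nu> (Bx (Suc j))" .
  qed
qed

text \<open>By \<open>h_lower_bound\<close> the density \<open>h\<close> stays away from 0 on
  \<open>base\<close>; bounds for \<open>\<mu>\<close>, such as Kac's, thus pass to
  \<open>\<nu>\<close> there.\<close>

lemma nn_integral_base_le:
  obtains c where "0 < c" "\<And>f. f \<in> borel_measurable \<nu> \<Longrightarrow>
    (\<integral>\<^sup>+ z. f z * indicator base z \<partial>\<nu>) \<le> ennreal c * (\<integral>\<^sup>+ z. f z * indicator base z \<partial>\<mu>)"
proof -
  obtain c where c: "0 < c" "\<And>z. z \<in> base \<Longrightarrow> c \<le> h z" using h_lower_bound[OF x] by blast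
  show ?thesis
  proof (rule that[of "1 / c"])
    fix f :: "(nat \<Rightarrow> 'v) \<Rightarrow> ennreal" assume [measurable]: "f \<in> borel_measurable \<nu>"
    have "(\<integral>\<^sup>+ z. f z * indicator base z \<partial>\<nu>) * ennreal c \<le> (\<integral>\<^sup>+ z. ennreal (h z) * (f z * indicator base z) \<partial>\<nu>)"
    proof (subst nn_integral_multc[symmetric], measurable, rule nn_integral_mono)
      fix z
      show "f z * indicator base z * ennreal c \<le> ennreal (h z) * (f z * indicator base z)"
      proof (cases "z \<in> base")
        case True
        then show ?thesis using c(2)[OF True]
          by (simp add: mult.commute[of "ennreal (h z)"]) (intro mult_left_mono ennreal_leI, simp_all)
      qed simp
    qed
    also have "\<dots> = (\<integral>\<^sup>+ z. f z * indicator base z \<partial>\<mu>)" by (rule nn_integral_mu[symmetric]) measurable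
    finally show "(\<integral>\<^sup>+ z. f z * indicator base z \<partial>\<nu>) \<le> ennreal (1 / c) * (\<integral>\<^sup>+ z. f z * indicator base z \<partial>\<mu>)"
      by (rule ennreal_le_divide[OF c(1)])
  qed (use c in simp)
qed

text \<open>The time of return number \<open>q + 1\<close> to \<open>base\<close>. Each return takes
  at least one step, so the \<open>q\<close> returns beyond the first one outlast \<open>q\<close>
  further symbols.\<close>

definition nth_return :: "nat \<Rightarrow> (nat \<Rightarrow> 'v) \<Rightarrow> nat" where
  "nth_return q z = (\<Sum>i\<le>q. ret base ((next_hit base ^^ i) z))"

lemma nth_return_measurable [measurable]: "nth_return q \<in> measurable \<nu> (count_space UNIV)"
proof -
  have "nth_return q \<in> measurable \<mu> (count_space UNIV)"
    unfolding nth_return_def[abs_def] by measurable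
  then show ?thesis by (simp add: measurable_cong_sets[OF sets_mu refl])
qed

text \<open>With respect to \<open>\<mu>\<close> all return times in the sum have the same integral
  over \<open>base\<close>, since the first return map preserves the restricted measure, and Kac's
  bound makes it at most 1.\<close>

lemma nth_return_integral:
  "(\<integral>\<^sup>+ z. of_nat (nth_return q z) * indicator base z \<partial>\<nu>) < \<infinity>"
proof -
  obtain c where c: "0 < c" "\<And>f. f \<in> borel_measurable \<nu> \<Longrightarrow>
    (\<integral>\<^sup>+ z. f z * indicator base z \<partial>\<nu>) \<le> ennreal c * (\<integral>\<^sup>+ z. f z * indicator base z \<partial>\<mu>)"
    using nn_integral_base_le by blast
  have inv: "(\<integral>\<^sup>+ z. indicator base z * of_nat (ret base ((next_hit base ^^ i) z)) \<partial>\<mu>) \<le> 1" for i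
  proof (induction i)
    case 0
    show ?case using kac_le[OF base_mu] by simp
  next
    case (Suc i)
    have "(\<integral>\<^sup>+ z. indicator base z * of_nat (ret base ((next_hit base ^^ Suc i) z)) \<partial>\<mu>)
        = (\<integral>\<^sup>+ z. indicator base z * of_nat (ret base ((next_hit base ^^ i) (next_hit base z))) \<partial>\<mu>)"
      by (simp add: funpow_swap1)
    also have "\<dots> = (\<integral>\<^sup>+ z. indicator base z * of_nat (ret base ((next_hit base ^^ i) z)) \<partial>\<mu>)"
      by (rule next_hit_invariant[OF base_mu]) measurable
    finally show ?case using Suc.IH by simp
  qed
  have "(\<integral>\<^sup>+ z. of_nat (nth_return q z) * indicator base z \<partial>\<mu>)
      = (\<Sum>i\<le>q. \<integral>\<^sup>+ z. indicator base z * of_nat (ret base ((next_hit base ^^ i) z)) \<partial>\<mu>)"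
    by (subst nn_integral_sum[symmetric]) (auto simp: nth_return_def sum_distrib_left mult.commute)
  also have "\<dots> \<le> (\<Sum>i\<le>q. 1)" by (intro sum_mono inv)
  finally have "(\<integral>\<^sup>+ z. of_nat (nth_return q z) * indicator base z \<partial>\<mu>) \<le> of_nat (Suc q)" by simp
  then have "ennreal c * (\<integral>\<^sup>+ z. of_nat (nth_return q z) * indicator base z \<partial>\<mu>) \<le> ennreal c * of_nat (Suc q)"
    by (rule mult_left_mono) simp
  also have "\<dots> < \<infinity>" by (simp add: ennreal_mult_less_top of_nat_less_top del: of_nat_Suc)
  finally show ?thesis using c(2)[of "\<lambda>z. of_nat (nth_return q z)"] by (simp add: order_le_less_trans)
qed

section \<open>Summability along the visits of \<open>x\<close> to \<open>base\<close>\<close>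

definition rec_weight :: "nat \<Rightarrow> real" where
  "rec_weight j = (if x j = x 0 then measure \<nu> (Bx (Suc j)) else 0)"

definition last_visit :: "nat \<Rightarrow> nat" where
  "last_visit n = (GREATEST i. i < n \<and> x i = x 0)"

lemma last_visit:
  assumes "1 \<le> n"
  shows "last_visit n < n" "x (last_visit n) = x 0" "last_visit n < i \<Longrightarrow> i < n \<Longrightarrow> x i \<noteq> x 0"
proof -
  have *: "last_visit n < n \<and> x (last_visit n) = x 0"
    unfolding last_visit_def by (rule GreatestI_nat[of _ 0 n]) (use assms in auto)
  show "last_visit n < n" "x (last_visit n) = x 0" using * by auto
  assume i: "last_visit n < i" "i < n"
  show "x i \<noteq> x 0"
  proof
    assume "x i = x 0"
    then have "i \<le> last_visit n"
      unfolding last_visit_def by (rule_tac Greatest_le_nat[of _ i n]) (use i in auto)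
    then show False using i by simp
  qed
qed

lemma last_visit_1: "last_visit 1 = 0"
  using last_visit(1)[of 1] by simp

lemma last_visit_Suc: "1 \<le> n \<Longrightarrow> last_visit (Suc n) = (if x n = x 0 then n else last_visit n)"
  unfolding last_visit_def[of "Suc n"]
  by (rule Greatest_equality) (use last_visit[of n] in \<open>auto simp: less_Suc_eq intro: leI split: if_splits\<close>)

lemma rec_weight_nonneg: "0 \<le> rec_weight j" by (simp add: rec_weight_def)

text \<open>The contraction between consecutive visits bounds the first series geometrically. The
  second one also involves the lengths of the gaps, which may be unbounded; they are paid for by the
  integrable return time to \<open>base\<close>.\<close>

lemma rec_weight_summable: "summable rec_weight" "summable (\<lambda>j. real j * rec_weight j)"
proof -
  obtain \<rho> where \<rho>: "0 < \<rho>" "\<rho> < 1" and contr: "\<And>j j'. j < j' \<Longrightarrow> x j = x 0 \<Longrightarrow> x j' = x 0 \<Longrightarrow> (\<And>i. j < i \<Longrightarrow> i < j' \<Longrightarrow> x i \<noteq> x 0)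
      \<Longrightarrow> measure \<nu> (Bx (Suc j')) \<le> \<rho> * measure \<nu> (Bx (Suc j))"
    using return_contraction by blast
  define t where "t n = rec_weight (last_visit n)" for n
  have t_nonneg: "0 \<le> t n" for n by (simp add: t_def rec_weight_nonneg)
  have contr': "rec_weight n \<le> \<rho> * t n" if "1 \<le> n" "x n = x 0" for n
    using contr[OF last_visit(1)[OF that(1)] last_visit(2)[OF that(1)] that(2)] last_visit(2,3)[OF that(1)] that(2)
    by (simp add: t_def rec_weight_def del: upt_Suc)
  have t_Suc: "t (Suc n) = (if x n = x 0 then rec_weight n else t n)" if "1 \<le> n" for n
    using last_visit_Suc[OF that] by (simp add: t_def)
  have zero: "rec_weight n = 0" if "x n \<noteq> x 0" for n using that by (simp add: rec_weight_def)
  have t1: "t 1 = rec_weight 0" by (simp add: t_def last_visit_1[simplified])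
  define I where "I = enn2real (\<integral>\<^sup>+ z. of_nat (nth_return 0 z) * indicator base z \<partial>\<nu>)"
  have I: "(\<integral>\<^sup>+ z. of_nat (nth_return 0 z) * indicator base z \<partial>\<nu>) = ennreal I"
    unfolding I_def using nth_return_integral[of 0] by simp
  have I0: "0 \<le> I" by (simp add: I_def)
  \<comment> \<open>From time \<open>last_visit n\<close> on, every point of
    \<open>Bx (Suc n)\<close> needs at least \<open>n - last_visit n\<close> steps to its next visit
    to \<open>base\<close>. So the gap is below the return time, whose integral is controlled by
    \<open>cylinder_upper\<close>.\<close>
  have gap: "real (n - last_visit n) * rec_weight n \<le> K * I * t n" if n: "1 \<le> n" "x n = x 0" for n
  proof -
    let ?l = "last_visit n"
    have "of_nat (n - ?l) * emeasure \<nu> (Bx (Suc n)) = (\<integral>\<^sup>+ y. of_nat (n - ?l) * indicator (Bx (Suc n)) y \<partial>\<nu>)"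
      by (subst nn_integral_cmult) (simp_all del: upt_Suc)
    also have "\<dots> \<le> (\<integral>\<^sup>+ y. indicator (Bx (Suc ?l)) y * of_nat (nth_return 0 ((shift ^^ ?l) y)) \<partial>\<nu>)"
    proof (rule nn_integral_mono)
      fix y
      show "of_nat (n - ?l) * indicator (Bx (Suc n)) y \<le> (indicator (Bx (Suc ?l)) y * of_nat (nth_return 0 ((shift ^^ ?l) y)) :: ennreal)"
      proof (cases "y \<in> Bx (Suc n)")
        case True
        let ?z = "(shift ^^ ?l) y"
        have yx: "y i = x i" if "i \<le> n" for i using True that by (simp add: mem_cylinder_map del: upt_Suc)
        have yt: "y \<in> tms A" using True by (simp add: mem_cylinder_map del: upt_Suc)
        have "hits base ?z"
          unfolding hits_def using last_visit(1)[OF n(1)] n(2) yx[of n] yt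
          by (intro exI[of _ "n - ?l"]) (simp add: mem_base shift_pow shift_pow_tms)
        then have r: "1 \<le> ret base ?z" "next_hit base ?z \<in> base" using ret_hits by blast+
        have "n - ?l \<le> ret base ?z"
        proof (rule ccontr)
          assume "\<not> n - ?l \<le> ret base ?z"
          then have "ret base ?z + ?l < n" by linarith
          then have "x (ret base ?z + ?l) \<noteq> x 0" using r(1) by (intro last_visit(3)[OF n(1)]) auto
          moreover have "y (ret base ?z + ?l) = x 0"
            using r(2) by (simp add: next_hit_def mem_base shift_pow add.commute)
          ultimately show False using yx[of "ret base ?z + ?l"] \<open>ret base ?z + ?l < n\<close> by simp
        qed
        moreover have "y \<in> Bx (Suc ?l)" using True Bx_mono[of "Suc ?l" "Suc n"] last_visit(1)[OF n(1)] by (auto simp del: upt_Suc)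
        ultimately show ?thesis using True by (simp add: nth_return_def del: upt_Suc)
      qed simp
    qed
    also have "\<dots> \<le> ennreal K * (emeasure \<nu> (Bx (Suc ?l)) * ennreal I)"
      unfolding I[symmetric] by (rule cylinder_upper[OF last_visit(2)[OF n(1)]]) measurable
    finally have "ennreal (real (n - ?l) * measure \<nu> (Bx (Suc n))) \<le> ennreal (K * (measure \<nu> (Bx (Suc ?l)) * I))"
      using Bx_base[of "Suc n"] Bx_base[of "Suc ?l"] K_pos I0
      by (simp add: emeasure_nu ennreal_mult ennreal_of_nat_eq_real_of_nat del: upt_Suc)
    then have "real (n - ?l) * measure \<nu> (Bx (Suc n)) \<le> K * (measure \<nu> (Bx (Suc ?l)) * I)"
      using K_pos I0 by (subst (asm) ennreal_le_iff) auto
    then show ?thesis using n(2) last_visit(2)[OF n(1)] by (simp add: t_def rec_weight_def mult.commute mult.left_commute del: upt_Suc)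
  qed
  \<comment> \<open>The added term \<open>\<rho> * t (Suc n)\<close> makes the sum telescope: at a
    visit the left side changes by the new weight minus \<open>\<rho>\<close> times the previous
    one, which is at most 0 by \<open>contr'\<close>.\<close>
  have sum1: "(1 - \<rho>) * (\<Sum>j<Suc n. rec_weight j) + \<rho> * t (Suc n) \<le> rec_weight 0" for n
  proof (induction n)
    case 0
    then show ?case using t1 by (simp add: algebra_simps)
  next
    case (Suc n)
    show ?case
    proof (cases "x (Suc n) = x 0")
      case True
      then show ?thesis using Suc contr'[of "Suc n"] t_Suc[of "Suc n"] by (simp add: algebra_simps)
    next
      case False
      then show ?thesis using Suc zero[of "Suc n"] t_Suc[of "Suc n"] by simp
    qed
  qed
  have b1: "(\<Sum>j<n. rec_weight j) \<le> rec_weight 0 / (1 - \<rho>)" for n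
  proof -
    have "(\<Sum>j<n. rec_weight j) \<le> (\<Sum>j<Suc n. rec_weight j)" using rec_weight_nonneg by simp
    also have "\<dots> \<le> rec_weight 0 / (1 - \<rho>)"
    proof (subst pos_le_divide_eq)
      have "0 \<le> \<rho> * t (Suc n)" using \<rho> t_nonneg by simp
      then show "(\<Sum>j<Suc n. rec_weight j) * (1 - \<rho>) \<le> rec_weight 0"
        using sum1[of n] unfolding mult.commute[of _ "1 - \<rho>"] by linarith
    qed (use \<rho> in simp)
    finally show ?thesis .
  qed
  then show "summable rec_weight"
    using rec_weight_nonneg by (intro summableI_nonneg_bounded) auto
  define C where "C = K * I"
  have C: "0 \<le> C" using K_pos I0 by (simp add: C_def)
  \<comment> \<open>The same telescoping with times: at a visit the time splits into that of the
    previous visit, treated by \<open>contr'\<close>, and the gap, which \<open>gap\<close> charges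
    to the sum of the weights.\<close>
  have sum2: "(1 - \<rho>) * (\<Sum>j<Suc n. real j * rec_weight j) + \<rho> * (real (last_visit (Suc n)) * t (Suc n))
      \<le> C * ((\<Sum>j<Suc n. rec_weight j) - t (Suc n))" for n
  proof (induction n)
    case 0
    then show ?case using t1 last_visit_1 by simp
  next
    case (Suc n)
    let ?n = "Suc n"
    show ?case
    proof (cases "x ?n = x 0")
      case True
      have l: "last_visit ?n < ?n" by (rule last_visit(1)) simp
      have "real ?n * rec_weight ?n = real (last_visit ?n) * rec_weight ?n + real (?n - last_visit ?n) * rec_weight ?n"
        using l by (simp add: of_nat_diff algebra_simps)
      also have "\<dots> \<le> real (last_visit ?n) * (\<rho> * t ?n) + C * t ?n"
        using contr'[of ?n] gap[of ?n] True by (intro add_mono mult_left_mono) (auto simp: C_def)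
      finally have "real ?n * rec_weight ?n \<le> \<rho> * (real (last_visit ?n) * t ?n) + C * t ?n" by (simp add: mult.left_commute)
      then show ?thesis using Suc True t_Suc[of ?n] last_visit_Suc[of ?n]
        by (simp add: algebra_simps)
    next
      case False
      then show ?thesis using Suc zero[of ?n] t_Suc[of ?n] last_visit_Suc[of ?n] by simp
    qed
  qed
  have "(\<Sum>j<n. real j * rec_weight j) \<le> C * (rec_weight 0 / (1 - \<rho>)) / (1 - \<rho>)" for n
  proof -
    have "(1 - \<rho>) * (\<Sum>j<Suc n. real j * rec_weight j) \<le> C * ((\<Sum>j<Suc n. rec_weight j) - t (Suc n))"
    proof -
      have "0 \<le> \<rho> * (real (last_visit (Suc n)) * t (Suc n))" using \<rho> t_nonneg by simp
      then show ?thesis using sum2[of n] by linarith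
    qed
    also have "\<dots> \<le> C * (rec_weight 0 / (1 - \<rho>))"
      using b1[of "Suc n"] t_nonneg[of "Suc n"] C by (intro mult_left_mono) auto
    finally have "(\<Sum>j<Suc n. real j * rec_weight j) \<le> C * (rec_weight 0 / (1 - \<rho>)) / (1 - \<rho>)"
      using \<rho> by (subst pos_le_divide_eq) (auto simp: mult.commute simp del: sum.lessThan_Suc)
    moreover have "(\<Sum>j<n. real j * rec_weight j) \<le> (\<Sum>j<Suc n. real j * rec_weight j)"
      using rec_weight_nonneg by simp
    ultimately show ?thesis by linarith
  qed
  then show "summable (\<lambda>j. real j * rec_weight j)"
    using rec_weight_nonneg by (intro summableI_nonneg_bounded) auto
qed

end

section \<open>Loss of memory at the first return after the initial word\<close>

context rpf_point
begin

lemma prob_tms [simp]: "prob (tms A) = 1"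
  using prob_space by simp

lemma mu_Bx_pos: "0 < prob (Bx n)"
proof (cases "n = 0")
  case True
  then show ?thesis using prob_space by simp
next
  case False
  have "emeasure \<mu> (Bx n) \<noteq> 0"
  proof
    assume "emeasure \<mu> (Bx n) = 0"
    then have "AE y in \<mu>. y \<notin> Bx n" by (intro AE_not_in null_setsI) simp_all
    then have "AE y in \<nu>. y \<notin> Bx n" by (simp add: AE_mu_iff)
    then have "emeasure \<nu> {y \<in> space \<nu>. y \<in> Bx n} = 0" by (intro emeasure_eq_0_AE) simp
    moreover have "{y \<in> space \<nu>. y \<in> Bx n} = Bx n" using cylinder_subset by auto
    ultimately show False using nu_Bx_pos[of n] False by (simp add: measure_def)
  qed
  then show ?thesis by (simp add: emeasure_eq_measure zero_less_measure_iff)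
qed

lemma mu_base_pos: "0 < emeasure \<mu> base"
  using mu_Bx_pos[of 1] by (simp add: emeasure_eq_measure)

lemma AE_visits: "AE y in \<nu>. \<forall>N. \<exists>n\<ge>N. y n = x 0"
proof -
  have "AE y in \<mu>. \<forall>N. \<exists>n\<ge>N. y n = x 0"
    using AE_infinitely_often[OF base_mu mu_base_pos]
    by eventually_elim (auto simp: mem_base shift_pow)
  then show ?thesis by (simp add: AE_mu_iff)
qed

definition tau :: "nat \<Rightarrow> (nat \<Rightarrow> 'v) \<Rightarrow> nat" where
  "tau m y = (LEAST j. m \<le> j \<and> y j = x 0)"

definition stopped :: "nat \<Rightarrow> (nat \<Rightarrow> 'v) \<Rightarrow> nat \<Rightarrow> 'v" where
  "stopped m y = (shift ^^ tau m y) y"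

lemma tau:
  assumes "\<forall>N. \<exists>n\<ge>N. y n = x 0"
  shows "m \<le> tau m y" "y (tau m y) = x 0"
proof -
  have "m \<le> tau m y \<and> y (tau m y) = x 0"
    unfolding tau_def by (rule LeastI_ex) (use assms in blast)
  then show "m \<le> tau m y" "y (tau m y) = x 0" by auto
qed

lemma tau_le: "m \<le> j \<Longrightarrow> y j = x 0 \<Longrightarrow> tau m y \<le> j"
  unfolding tau_def by (rule Least_le) simp

lemma tau_measurable [measurable]: "tau m \<in> measurable \<nu> (count_space UNIV)"
  unfolding tau_def[abs_def] by measurable

lemma stopped_measurable [measurable]: "stopped m \<in> measurable \<nu> \<nu>"
  unfolding stopped_def[abs_def]
  by (rule measurable_compose_countable[where f = "\<lambda>n x. (shift ^^ n) x"]) measurable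

text \<open>Stopping at time \<open>N\<close> within \<open>Q\<close> is a condition on the first
  \<open>N\<close> symbols and on the symbol at time \<open>N\<close>; the latter is part of landing
  in \<open>D\<close>. So \<open>distortion\<close> applies for each \<open>N\<close>, and the
  constants add up over \<open>N\<close>.\<close>

lemma stopped_distortion:
  assumes m: "1 \<le> m" and Q: "determined m Q" and k: "1 \<le> k"
    and D [measurable]: "D \<in> sets \<nu>" and D_base: "D \<subseteq> base"
    and D_k: "\<And>z z' i. z \<in> D \<Longrightarrow> z' \<in> D \<Longrightarrow> i < k \<Longrightarrow> z i = z' i"
  obtains c :: ennreal where
    "\<And>g :: (nat \<Rightarrow> 'v) \<Rightarrow> ennreal. g \<in> borel_measurable \<nu> \<Longrightarrow>
      (\<integral>\<^sup>+ y. indicator Q y * (g (stopped m y) * indicator D (stopped m y)) \<partial>\<nu>)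
       \<le> ennreal (exp (W k)) * (c * (\<integral>\<^sup>+ z. g z * indicator D z \<partial>\<nu>))"
    "\<And>g :: (nat \<Rightarrow> 'v) \<Rightarrow> ennreal. g \<in> borel_measurable \<nu> \<Longrightarrow> c * (\<integral>\<^sup>+ z. g z * indicator D z \<partial>\<nu>)
       \<le> ennreal (exp (W k)) * (\<integral>\<^sup>+ y. indicator Q y * (g (stopped m y) * indicator D (stopped m y)) \<partial>\<nu>)"
proof -
  define R where "R N = {y \<in> Q. \<forall>i. m \<le> i \<and> i < N \<longrightarrow> y i \<noteq> x 0}" for N
  have R: "determined N (R N)" if "m \<le> N" for N
    unfolding determined_def
  proof (intro conjI ballI impI)
    show "R N \<subseteq> tms A" using Q by (auto simp: R_def determined_def)
    fix y y' assume y: "y \<in> R N" "y' \<in> tms A" "\<forall>i<N. y i = y' i"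
    then have "y' \<in> Q" using Q that unfolding determined_def R_def by auto
    then show "y' \<in> R N" using y by (auto simp: R_def)
  qed
  let ?J = "\<lambda>g N. \<integral>\<^sup>+ y. indicator (R N) y * (g ((shift ^^ N) y) * indicator D ((shift ^^ N) y)) \<partial>\<nu>"
  define P where "P N c \<longleftrightarrow> (\<forall>g\<in>borel_measurable \<nu>.
      ?J g N \<le> ennreal (exp (W k)) * (c * (\<integral>\<^sup>+ z. g z * indicator D z \<partial>\<nu>)) \<and>
      c * (\<integral>\<^sup>+ z. g z * indicator D z \<partial>\<nu>) \<le> ennreal (exp (W k)) * ?J g N)" for N c
  have "\<exists>c. m \<le> N \<longrightarrow> P N c" for N
  proof (cases "m \<le> N")
    case True
    then have N: "1 \<le> N" using m by simp
    show ?thesis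
      by (rule distortion[of N "R N" k D]) (rule N, rule R[OF True], rule k, rule D, erule (2) D_k, unfold P_def, blast)
  qed simp
  then obtain c where "\<And>N. m \<le> N \<longrightarrow> P N (c N)" by metis
  then have c: "?J g N \<le> ennreal (exp (W k)) * (c N * (\<integral>\<^sup>+ z. g z * indicator D z \<partial>\<nu>)) \<and>
      c N * (\<integral>\<^sup>+ z. g z * indicator D z \<partial>\<nu>) \<le> ennreal (exp (W k)) * ?J g N"
    if "m \<le> N" "g \<in> borel_measurable \<nu>" for N g
    using that by (simp add: P_def)
  have main: "(\<integral>\<^sup>+ y. indicator Q y * (g (stopped m y) * indicator D (stopped m y)) \<partial>\<nu>) = (\<Sum>N. ?J g (N + m))"
    if [measurable]: "g \<in> borel_measurable \<nu>" for g :: "(nat \<Rightarrow> 'v) \<Rightarrow> ennreal"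
  proof -
    have [measurable]: "R (N + m) \<in> sets \<nu>" for N by (rule determined_sets[OF R]) simp
    have "(\<integral>\<^sup>+ y. indicator Q y * (g (stopped m y) * indicator D (stopped m y)) \<partial>\<nu>)
        = (\<integral>\<^sup>+ y. (\<Sum>N. indicator (R (N + m)) y * (g ((shift ^^ (N + m)) y) * indicator D ((shift ^^ (N + m)) y))) \<partial>\<nu>)"
    proof (rule nn_integral_cong_AE)
      show "AE y in \<nu>. indicator Q y * (g (stopped m y) * indicator D (stopped m y))
        = (\<Sum>N. indicator (R (N + m)) y * (g ((shift ^^ (N + m)) y) * indicator D ((shift ^^ (N + m)) y)))"
        using AE_visits
      proof eventually_elim
        case (elim y)
        note t = tau[OF elim, of m]
        let ?t = "tau m y - m"
        have zero: "indicator (R (N + m)) y * (g ((shift ^^ (N + m)) y) * indicator D ((shift ^^ (N + m)) y)) = 0"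
          if "N \<notin> {?t}" for N
        proof (cases "N < ?t")
          case True
          then have "N + m < tau m y" by linarith
          then have "y (N + m) \<noteq> x 0" using tau_le[of m "N + m" y] by auto
          then have "(shift ^^ (N + m)) y \<notin> D" using D_base by (auto simp: mem_base shift_pow)
          then show ?thesis by simp
        next
          case False
          then have "tau m y < N + m" using that t(1) by simp
          then have "y \<notin> R (N + m)" using t by (auto simp: R_def)
          then show ?thesis by simp
        qed
        have "y \<in> R (tau m y) \<longleftrightarrow> y \<in> Q" using tau_le[of m _ y] by (fastforce simp: R_def)
        moreover have "(\<Sum>N. indicator (R (N + m)) y * (g ((shift ^^ (N + m)) y) * indicator D ((shift ^^ (N + m)) y)))
            = (\<Sum>N\<in>{?t}. indicator (R (N + m)) y * (g ((shift ^^ (N + m)) y) * indicator D ((shift ^^ (N + m)) y)))"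
          by (rule suminf_finite) (simp, rule zero)
        ultimately show ?case using t(1) by (simp add: stopped_def split: split_indicator)
      qed
    qed
    also have "\<dots> = (\<Sum>N. ?J g (N + m))" by (rule nn_integral_suminf) measurable
    finally show ?thesis .
  qed
  show ?thesis
  proof (rule that[of "\<Sum>N. c (N + m)"])
    fix g :: "(nat \<Rightarrow> 'v) \<Rightarrow> ennreal" assume g: "g \<in> borel_measurable \<nu>"
    have "(\<Sum>N. ?J g (N + m)) \<le> (\<Sum>N. ennreal (exp (W k)) * (c (N + m) * (\<integral>\<^sup>+ z. g z * indicator D z \<partial>\<nu>)))"
      using c[OF _ g] by (intro suminf_le) auto
    then show "(\<integral>\<^sup>+ y. indicator Q y * (g (stopped m y) * indicator D (stopped m y)) \<partial>\<nu>)
       \<le> ennreal (exp (W k)) * ((\<Sum>N. c (N + m)) * (\<integral>\<^sup>+ z. g z * indicator D z \<partial>\<nu>))"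
      by (simp add: main[OF g])
    have "(\<Sum>N. c (N + m) * (\<integral>\<^sup>+ z. g z * indicator D z \<partial>\<nu>)) \<le> (\<Sum>N. ennreal (exp (W k)) * ?J g (N + m))"
      using c[OF _ g] by (intro suminf_le) auto
    then show "(\<Sum>N. c (N + m)) * (\<integral>\<^sup>+ z. g z * indicator D z \<partial>\<nu>)
       \<le> ennreal (exp (W k)) * (\<integral>\<^sup>+ y. indicator Q y * (g (stopped m y) * indicator D (stopped m y)) \<partial>\<nu>)"
      by (simp add: main[OF g])
  qed
qed

lemma emeasure_stopped_set:
  assumes [measurable]: "Q \<in> sets \<nu>" "E \<in> sets \<nu>"
  shows "emeasure \<nu> {y \<in> Q. stopped m y \<in> E} = (\<integral>\<^sup>+ y. indicator Q y * (1 * indicator E (stopped m y)) \<partial>\<nu>)"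
    and "{y \<in> Q. stopped m y \<in> E} \<in> sets \<nu>"
proof -
  have "{y \<in> Q. stopped m y \<in> E} = {y \<in> space \<nu>. y \<in> Q \<and> stopped m y \<in> E}"
    using sets.sets_into_space[of Q \<nu>] by auto
  also have "\<dots> \<in> sets \<nu>" by measurable
  finally show s: "{y \<in> Q. stopped m y \<in> E} \<in> sets \<nu>" .
  have "emeasure \<nu> {y \<in> Q. stopped m y \<in> E} = (\<integral>\<^sup>+ y. indicator {y \<in> Q. stopped m y \<in> E} y \<partial>\<nu>)"
    by (rule nn_integral_indicator[symmetric, OF s])
  also have "\<dots> = (\<integral>\<^sup>+ y. indicator Q y * (1 * indicator E (stopped m y)) \<partial>\<nu>)"
    by (intro nn_integral_cong) (simp split: split_indicator)
  finally show "emeasure \<nu> {y \<in> Q. stopped m y \<in> E} = (\<integral>\<^sup>+ y. indicator Q y * (1 * indicator E (stopped m y)) \<partial>\<nu>)" .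
qed

lemma stopped_set_le:
  assumes m: "1 \<le> m" and Q: "determined m Q" and E [measurable]: "E \<in> sets \<nu>" and sub: "E \<subseteq> base"
  shows "emeasure \<nu> {y \<in> Q. stopped m y \<in> E} \<le> ennreal K * (emeasure \<nu> Q * emeasure \<nu> E)"
proof -
  note [measurable] = determined_sets[OF Q]
  obtain c :: ennreal where
    c1: "\<And>g. g \<in> borel_measurable \<nu> \<Longrightarrow> (\<integral>\<^sup>+ y. indicator Q y * (g (stopped m y) * indicator base (stopped m y)) \<partial>\<nu>)
       \<le> ennreal (exp (W 1)) * (c * (\<integral>\<^sup>+ z. g z * indicator base z \<partial>\<nu>))" and
    c2: "\<And>g. g \<in> borel_measurable \<nu> \<Longrightarrow> c * (\<integral>\<^sup>+ z. g z * indicator base z \<partial>\<nu>)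
       \<le> ennreal (exp (W 1)) * (\<integral>\<^sup>+ y. indicator Q y * (g (stopped m y) * indicator base (stopped m y)) \<partial>\<nu>)"
    by (rule stopped_distortion[of m Q 1 base])
      (rule m, rule Q, simp, simp, simp, erule (2) base_agree, rule that, assumption+)
  have "c * ennreal m0 \<le> ennreal (exp (W 1)) * emeasure \<nu> {y \<in> Q. stopped m y \<in> base}"
    using c2[of "\<lambda>_. 1"] by (simp add: emeasure_stopped_set emeasure_base(1)[symmetric])
  also have "\<dots> \<le> ennreal (exp (W 1)) * emeasure \<nu> Q" by (intro mult_left_mono emeasure_mono) auto
  finally have c: "c \<le> ennreal (1 / m0) * (ennreal (exp (W 1)) * emeasure \<nu> Q)"
    by (rule ennreal_le_divide[OF emeasure_base(2)])
  have ind: "indicator E z * indicator base z = (indicator E z :: ennreal)" for z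
    using sub by (auto split: split_indicator)
  have "emeasure \<nu> {y \<in> Q. stopped m y \<in> E} \<le> ennreal (exp (W 1)) * (c * emeasure \<nu> E)"
    using c1[of "indicator E"] by (simp add: emeasure_stopped_set ind)
  also have "\<dots> \<le> ennreal (exp (W 1)) * ((ennreal (1 / m0) * (ennreal (exp (W 1)) * emeasure \<nu> Q)) * emeasure \<nu> E)"
    by (intro mult_left_mono mult_right_mono c) simp_all
  also have "\<dots> = ennreal K * (emeasure \<nu> Q * emeasure \<nu> E)"
  proof -
    have "K = exp (W 1) * (1 / m0) * exp (W 1)" unfolding K_def by (simp add: exp_add[symmetric])
    then have "ennreal K = ennreal (exp (W 1)) * ennreal (1 / m0) * ennreal (exp (W 1))"
      using emeasure_base(2) by (simp only: ennreal_mult exp_ge_zero mult_nonneg_nonneg zero_le_divide_1_iff less_imp_le)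
    then show ?thesis by (simp only: mult_ac)
  qed
  finally show ?thesis .
qed

text \<open>At the stopping time the law has a density which is nearly constant on the finitely many
  \<open>k\<close>-cylinders that carry most of the mass, so asymptotically invariant functions have
  almost the same integral as under the invariant measure.\<close>

lemma stopped_upper:
  fixes G :: "nat \<Rightarrow> (nat \<Rightarrow> 'v) \<Rightarrow> real"
  assumes G [measurable]: "\<And>n. G n \<in> borel_measurable \<nu>"
    and G01: "\<And>n y. 0 \<le> G n y \<and> G n y \<le> 1"
    and inv: "(\<lambda>n. \<integral>y. \<bar>G n (shift y) - G n y\<bar> \<partial>\<mu>) \<longlonglongrightarrow> 0"
    and e: "0 < e"
  shows "\<forall>\<^sub>F n in sequentially. \<forall>m Q. 1 \<le> m \<longrightarrow> determined m Q \<longrightarrow> Q \<subseteq> base \<longrightarrow>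
    (\<integral>\<^sup>+ y. indicator Q y * ennreal (G n (stopped m y)) \<partial>\<nu>) \<le> ennreal (measure \<nu> Q * ((\<integral>y. G n y \<partial>\<mu>) + e))"
proof -
  \<comment> \<open>Three units of \<open>d\<close> come from
    \<open>(1 + d) * (a + d) \<le> a + 3 * d\<close> for \<open>a\<close> and \<open>d\<close> at
    most 1, and \<open>K\<close> units from the part of \<open>base\<close> outside the chosen
    cylinders.\<close>
  define d where "d = min 1 (e / (3 + K))"
  have d: "0 < d" "d \<le> 1" using e K_pos by (auto simp: d_def)
  have "(3 + K) * d \<le> (3 + K) * (e / (3 + K))" using K_pos by (intro mult_left_mono) (auto simp: d_def)
  then have dK: "(3 + K) * d \<le> e" using K_pos by simp
  have "(\<lambda>k. exp (2 * W k)) \<longlonglongrightarrow> exp (2 * 0)" by (intro tendsto_intros W_tendsto)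
  then have "\<forall>\<^sub>F k in sequentially. exp (2 * W k) < 1 + d" by (rule order_tendstoD) (use d in simp)
  then have "\<forall>\<^sub>F k in sequentially. exp (2 * W k) < 1 + d \<and> 1 \<le> k"
    using eventually_ge_at_top[of "1::nat"] by eventually_elim simp
  then obtain k where k: "exp (2 * W k) < 1 + d" "1 \<le> k" by (auto simp: eventually_sequentially)
  \<comment> \<open>The alphabet may be infinite, so words of length \<open>k\<close> are enumerated
    and those with code below \<open>J\<close> are kept.\<close>
  define R where "R J = {z \<in> base. to_nat (map z [0..<k]) < J}" for J
  define D where "D w = {z \<in> base. map z [0..<k] = w}" for w
  have word_sets: "{z \<in> base. P (map z [0..<k])} \<in> sets \<nu>" for P
  proof (rule determined_sets[of k], unfold determined_def, intro conjI ballI impI)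
    fix y y' assume y: "y \<in> {z \<in> base. P (map z [0..<k])}" "y' \<in> tms A" "\<forall>i<k. y i = y' i"
    then have eq: "map y' [0..<k] = map y [0..<k]" by auto
    have "y' \<in> base" using y k(2) by (simp add: mem_base)
    then show "y' \<in> {z \<in> base. P (map z [0..<k])}" unfolding mem_Collect_eq eq using y(1) by blast
  qed (auto simp: mem_base)
  have D_sets [measurable]: "D w \<in> sets \<nu>" for w
    unfolding D_def by (rule word_sets)
  have D_base: "D w \<subseteq> base" for w by (auto simp: D_def)
  have R_sets [measurable]: "R J \<in> sets \<nu>" for J
    unfolding R_def by (rule word_sets)
  have R_Un: "(\<Union>J. R J) = base" by (auto simp: R_def)
  have R_base: "R J \<subseteq> base" for J by (auto simp: R_def)
  have "(\<lambda>J. measure \<nu> (R J)) \<longlonglongrightarrow> measure \<nu> (\<Union>J. R J)"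
  proof (rule Lim_measure_incseq)
    show "incseq R" by (auto simp: incseq_def R_def)
    show "emeasure \<nu> (\<Union>J. R J) \<noteq> \<infinity>"
      unfolding R_Un emeasure_base(1) by simp
    show "range R \<subseteq> sets \<nu>" using R_sets by blast
  qed
  then have "\<forall>\<^sub>F J in sequentially. m0 - d < measure \<nu> (R J)" 
    unfolding R_Un by (rule order_tendstoD) (use d in simp)
  then obtain J where J: "m0 - d < measure \<nu> (R J)" by (auto simp: eventually_sequentially)
  have rest: "measure \<nu> (base - R J) \<le> d"
  proof -
    have "measure \<nu> (base - R J) = m0 - measure \<nu> (R J)"
      by (rule measure_Diff[OF _ cylinder_sets R_sets R_base]) (simp add: emeasure_base(1))
    then show ?thesis using J by simp
  qed
  define I where "I = {w :: 'v list. to_nat w < J}"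
  have I: "finite I"
  proof -
    have "I = to_nat -` {..<J}" by (auto simp: I_def)
    then show ?thesis by (simp add: finite_vimageI)
  qed
  obtain c where c: "0 < c" "\<And>z. z \<in> base \<Longrightarrow> c \<le> h z" using h_lower_bound[OF x] by blast
  have piece: "\<forall>\<^sub>F n in sequentially. (\<integral>\<^sup>+ z. ennreal (G n z) * indicator (D w) z \<partial>\<nu>)
      \<le> ennreal ((\<integral>y. G n y \<partial>\<mu>) + d) * emeasure \<nu> (D w)" for w
  proof -
    \<comment> \<open>Dividing by \<open>h\<close> turns integrals with respect to
      \<open>\<mu>\<close> into integrals over \<open>D w\<close> with respect to
      \<open>\<nu>\<close>. The lower bound of \<open>h\<close> on \<open>base\<close> makes
      \<open>u\<close> bounded, so that \<open>asymptotic_independence\<close> applies.\<close>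
    define u where "u z = indicator (D w) z / h z" for z
    have [measurable]: "u \<in> borel_measurable \<nu>" unfolding u_def by measurable
    have u: "0 \<le> u z" "u z \<le> 1 / c" if "z \<in> tms A" for z
      using c h_pos[OF that] D_base[of w] by (auto simp: u_def frac_le split: split_indicator)
    have uint: "integrable \<mu> u"
    proof (rule integrable_const_bound)
      show "AE z in \<mu>. norm (u z) \<le> 1 / c" using u by (intro AE_I2) simp
    qed measurable
    have hu: "h z * u z = indicator (D w) z" if "z \<in> tms A" for z
      using h_pos[OF that] by (simp add: u_def)
    have int: "(\<integral>\<^sup>+ z. ennreal (f z * u z) \<partial>\<mu>) = (\<integral>\<^sup>+ z. ennreal (f z) * indicator (D w) z \<partial>\<nu>)"
      if [measurable]: "f \<in> borel_measurable \<nu>" and f: "\<And>z. 0 \<le> f z" for f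
    proof -
      have "(\<integral>\<^sup>+ z. ennreal (f z * u z) \<partial>\<mu>) = (\<integral>\<^sup>+ z. ennreal (h z) * ennreal (f z * u z) \<partial>\<nu>)"
        by (rule nn_integral_mu) measurable
      also have "\<dots> = (\<integral>\<^sup>+ z. ennreal (f z) * indicator (D w) z \<partial>\<nu>)"
      proof (rule nn_integral_cong)
        fix z assume "z \<in> space \<nu>"
        then have z: "z \<in> tms A" by simp
        have "ennreal (h z) * ennreal (f z * u z) = ennreal (f z * (h z * u z))"
          using h_pos[OF z] f[of z] u(1)[OF z] by (simp add: ennreal_mult[symmetric] mult.left_commute)
        then show "ennreal (h z) * ennreal (f z * u z) = ennreal (f z) * indicator (D w) z"
          unfolding hu[OF z] by (simp split: split_indicator)
      qed
      finally show ?thesis .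
    qed
    have D_nu: "emeasure \<nu> (D w) = ennreal (measure \<nu> (D w))" by (rule emeasure_nu[OF D_sets D_base])
    have "(\<integral>\<^sup>+ z. ennreal (u z) \<partial>\<mu>) = ennreal (measure \<nu> (D w))"
      using int[of "\<lambda>_. 1"] D_nu by simp
    then have u_eq: "(\<integral>z. u z \<partial>\<mu>) = measure \<nu> (D w)"
      using u by (subst integral_eq_nn_integral) (measurable, auto intro!: AE_I2)
    have G_eq: "(\<integral>\<^sup>+ z. ennreal (G n z) * indicator (D w) z \<partial>\<nu>) = ennreal (\<integral>z. G n z * u z \<partial>\<mu>)" for n
    proof -
      have "integrable \<mu> (\<lambda>z. G n z * u z)"
      proof (rule Bochner_Integration.integrable_bound[OF uint])
        show "AE z in \<mu>. norm (G n z * u z) \<le> norm (u z)"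
          using u G01 by (intro AE_I2) (simp add: abs_mult mult_left_le_one_le)
      qed measurable
      then have "(\<integral>\<^sup>+ z. ennreal (G n z * u z) \<partial>\<mu>) = ennreal (\<integral>z. G n z * u z \<partial>\<mu>)"
        using u G01 by (intro nn_integral_eq_integral AE_I2) auto
      then show ?thesis using int[of "G n"] G01 by simp
    qed
    show ?thesis
    proof (cases "measure \<nu> (D w) = 0")
      case True
      then have "AE z in \<nu>. z \<notin> D w" using D_nu by (intro AE_not_in null_setsI) auto
      then have "(\<integral>\<^sup>+ z. ennreal (G n z) * indicator (D w) z \<partial>\<nu>) = 0" for n
        by (subst nn_integral_0_iff_AE) (auto elim: eventually_mono)
      then show ?thesis by simp
    next
      case False
      have "(\<lambda>n. (\<integral>z. G n z * u z \<partial>\<mu>) - (\<integral>z. G n z \<partial>\<mu>) * (\<integral>z. u z \<partial>\<mu>)) \<longlonglongrightarrow> 0"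
        by (rule asymptotic_independence[OF _ _ inv uint]) (measurable, use G01 in simp)
      then have "\<forall>\<^sub>F n in sequentially. (\<integral>z. G n z * u z \<partial>\<mu>) - (\<integral>z. G n z \<partial>\<mu>) * (\<integral>z. u z \<partial>\<mu>) < d * measure \<nu> (D w)"
        by (rule order_tendstoD) (use d False in \<open>simp add: zero_less_measure_iff\<close>)
      then show ?thesis
      proof eventually_elim
        case (elim n)
        have a0: "0 \<le> (\<integral>y. G n y \<partial>\<mu>) + d" using G01 d(1) by simp
        have "(\<integral>z. G n z * u z \<partial>\<mu>) \<le> ((\<integral>y. G n y \<partial>\<mu>) + d) * measure \<nu> (D w)"
          using elim unfolding u_eq distrib_right by linarith
        then show ?case
          unfolding G_eq D_nu ennreal_mult[OF a0 measure_nonneg, symmetric] by (rule ennreal_leI)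
      qed
    qed
  qed
  have "\<forall>\<^sub>F n in sequentially. \<forall>w\<in>I. (\<integral>\<^sup>+ z. ennreal (G n z) * indicator (D w) z \<partial>\<nu>)
      \<le> ennreal ((\<integral>y. G n y \<partial>\<mu>) + d) * emeasure \<nu> (D w)"
    using I piece by (intro eventually_ball_finite) auto
  then show ?thesis
  \<comment> \<open>The threshold for \<open>n\<close> depends on \<open>G\<close> and
    \<open>e\<close> but not on \<open>m\<close> and \<open>Q\<close>, so later \<open>Q\<close> may
    vary with \<open>n\<close>.\<close>
  proof (eventually_elim, intro allI impI)
    fix n m Q
    assume pc: "\<forall>w\<in>I. (\<integral>\<^sup>+ z. ennreal (G n z) * indicator (D w) z \<partial>\<nu>)
      \<le> ennreal ((\<integral>y. G n y \<partial>\<mu>) + d) * emeasure \<nu> (D w)"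
      and m: "1 \<le> m" and Q: "determined m Q" and Q_base: "Q \<subseteq> base"
    note [measurable] = determined_sets[OF Q]
    let ?a = "\<integral>y. G n y \<partial>\<mu>"
    have a: "0 \<le> ?a" "?a \<le> 1"
    proof -
      show "0 \<le> ?a" using G01 by simp
      have "?a \<le> (\<integral>y. 1 \<partial>\<mu>)"
        using G01 by (intro integral_mono integrable_const_bound[of _ 1]) (simp_all, measurable)
      then show "?a \<le> 1" by (simp add: prob_space)
    qed
    let ?V = "\<lambda>E. emeasure \<nu> {y \<in> Q. stopped m y \<in> E}"
    let ?X = "\<lambda>E. \<integral>\<^sup>+ y. indicator Q y * (ennreal (G n (stopped m y)) * indicator E (stopped m y)) \<partial>\<nu>"
    have X_D: "?X (D w) \<le> ennreal ((1 + d) * (?a + d)) * ?V (D w)" if w: "w \<in> I" for w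
    proof -
      obtain c :: ennreal where
        c1: "\<And>g :: (nat \<Rightarrow> 'v) \<Rightarrow> ennreal. g \<in> borel_measurable \<nu> \<Longrightarrow> (\<integral>\<^sup>+ y. indicator Q y * (g (stopped m y) * indicator (D w) (stopped m y)) \<partial>\<nu>)
           \<le> ennreal (exp (W k)) * (c * (\<integral>\<^sup>+ z. g z * indicator (D w) z \<partial>\<nu>))" and
        c2: "\<And>g :: (nat \<Rightarrow> 'v) \<Rightarrow> ennreal. g \<in> borel_measurable \<nu> \<Longrightarrow> c * (\<integral>\<^sup>+ z. g z * indicator (D w) z \<partial>\<nu>)
           \<le> ennreal (exp (W k)) * (\<integral>\<^sup>+ y. indicator Q y * (g (stopped m y) * indicator (D w) (stopped m y)) \<partial>\<nu>)"
      proof (rule stopped_distortion[OF m Q k(2) D_sets[of w] D_base[of w]])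
        fix z z' i assume "z \<in> D w" "z' \<in> D w" "i < k"
        then show "z i = z' i" by (auto simp: D_def map_eq_conv dest!: bspec[of _ _ i])
      qed (rule that, assumption+)
      have "?X (D w) \<le> ennreal (exp (W k)) * (c * (\<integral>\<^sup>+ z. ennreal (G n z) * indicator (D w) z \<partial>\<nu>))"
        by (rule c1) measurable
      also have "\<dots> \<le> ennreal (exp (W k)) * (c * (ennreal (?a + d) * emeasure \<nu> (D w)))"
        using pc w by (intro mult_left_mono) auto
      also have "\<dots> = ennreal (exp (W k)) * ennreal (?a + d) * (c * emeasure \<nu> (D w))"
        by (simp only: mult_ac)
      also have "\<dots> \<le> ennreal (exp (W k)) * ennreal (?a + d) * (ennreal (exp (W k)) * ?V (D w))"
        using c2[of "\<lambda>_. 1"] by (intro mult_left_mono) (simp_all add: emeasure_stopped_set)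
      also have "\<dots> = ennreal (exp (2 * W k) * (?a + d)) * ?V (D w)"
      proof -
        have "exp (2 * W k) = exp (W k) * exp (W k)" by (simp add: exp_add[symmetric])
        then have "ennreal (exp (2 * W k) * (?a + d)) = ennreal (exp (W k)) * ennreal (exp (W k)) * ennreal (?a + d)"
          using a d by (simp only: ennreal_mult exp_ge_zero mult_nonneg_nonneg add_nonneg_nonneg less_imp_le)
        then show ?thesis by (simp only: mult_ac)
      qed
      also have "\<dots> \<le> ennreal ((1 + d) * (?a + d)) * ?V (D w)"
        using k(1) a d by (intro mult_right_mono ennreal_leI) auto
      finally show ?thesis .
    qed
    have split: "indicator Q y * ennreal (G n (stopped m y)) =
        (\<Sum>w\<in>I. indicator Q y * (ennreal (G n (stopped m y)) * indicator (D w) (stopped m y)))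
        + indicator Q y * (ennreal (G n (stopped m y)) * indicator (base - R J) (stopped m y))"
      if "stopped m y \<in> base" for y
    proof -
      let ?w = "map (stopped m y) [0..<k]"
      have ind: "indicator (D w) (stopped m y) = (if w = ?w then 1 else 0 :: ennreal)" for w
        using that by (auto simp: D_def indicator_def)
      have "(\<Sum>w\<in>I. indicator (D w) (stopped m y)) = (if ?w \<in> I then 1 else 0 :: ennreal)"
        unfolding ind using I by simp
      moreover have "indicator (base - R J) (stopped m y) = (if ?w \<in> I then 0 else 1 :: ennreal)"
        using that by (auto simp: R_def I_def indicator_def)
      ultimately have "(\<Sum>w\<in>I. indicator (D w) (stopped m y)) + indicator (base - R J) (stopped m y) = (1 :: ennreal)"
        by simp
      then have "indicator Q y * ennreal (G n (stopped m y)) = indicator Q y * (ennreal (G n (stopped m y)) *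
          ((\<Sum>w\<in>I. indicator (D w) (stopped m y)) + indicator (base - R J) (stopped m y)))" by simp
      then show ?thesis by (simp only: distrib_left sum_distrib_left)
    qed
    have "(\<integral>\<^sup>+ y. indicator Q y * ennreal (G n (stopped m y)) \<partial>\<nu>) = (\<integral>\<^sup>+ y.
        (\<Sum>w\<in>I. indicator Q y * (ennreal (G n (stopped m y)) * indicator (D w) (stopped m y)))
        + indicator Q y * (ennreal (G n (stopped m y)) * indicator (base - R J) (stopped m y)) \<partial>\<nu>)"
    proof (rule nn_integral_cong_AE)
      have "AE y in \<nu>. y \<in> tms A \<longrightarrow> stopped m y \<in> base"
        using AE_visits by eventually_elim (simp add: stopped_def mem_base shift_pow shift_pow_tms tau)
      then show "AE y in \<nu>. indicator Q y * ennreal (G n (stopped m y)) =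
        (\<Sum>w\<in>I. indicator Q y * (ennreal (G n (stopped m y)) * indicator (D w) (stopped m y)))
        + indicator Q y * (ennreal (G n (stopped m y)) * indicator (base - R J) (stopped m y))"
      proof eventually_elim
        case (elim y)
        show ?case
        proof (cases "y \<in> Q")
          case True
          then show ?thesis using elim Q by (intro split) (auto simp: determined_def)
        qed simp
      qed
    qed
    also have "\<dots> = (\<Sum>w\<in>I. ?X (D w)) + ?X (base - R J)"
      by (subst nn_integral_add) (simp_all add: nn_integral_sum)
    also have "(\<Sum>w\<in>I. ?X (D w)) \<le> ennreal ((1 + d) * (?a + d)) * emeasure \<nu> Q"
    proof -
      have "(\<Sum>w\<in>I. ?X (D w)) \<le> (\<Sum>w\<in>I. ennreal ((1 + d) * (?a + d)) * ?V (D w))"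
        by (intro sum_mono X_D)
      also have "\<dots> = ennreal ((1 + d) * (?a + d)) * (\<Sum>w\<in>I. ?V (D w))" by (rule sum_distrib_left[symmetric])
      also have "(\<Sum>w\<in>I. ?V (D w)) = emeasure \<nu> (\<Union>w\<in>I. {y \<in> Q. stopped m y \<in> D w})"
      proof (rule sum_emeasure)
        show "(\<lambda>w. {y \<in> Q. stopped m y \<in> D w}) ` I \<subseteq> sets \<nu>"
          using emeasure_stopped_set(2)[OF determined_sets[OF Q] D_sets] by blast
      qed (use I in \<open>auto simp: disjoint_family_on_def D_def\<close>)
      also have "\<dots> \<le> emeasure \<nu> Q" by (intro emeasure_mono) auto
      finally show ?thesis by (simp add: mult_left_mono)
    qed
    also have "?X (base - R J) \<le> ?V (base - R J)"
      using G01 by (subst emeasure_stopped_set) (auto intro!: nn_integral_mono split: split_indicator simp: ennreal_le_1)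
    also have "?V (base - R J) \<le> ennreal K * (emeasure \<nu> Q * emeasure \<nu> (base - R J))"
      by (rule stopped_set_le[OF m Q]) auto
    also have "\<dots> \<le> ennreal K * (emeasure \<nu> Q * ennreal d)"
      using rest by (intro mult_left_mono) (auto simp: emeasure_nu intro!: ennreal_leI)
    also have "ennreal ((1 + d) * (?a + d)) * emeasure \<nu> Q + ennreal K * (emeasure \<nu> Q * ennreal d)
        = ennreal ((1 + d) * (?a + d) * measure \<nu> Q + K * (measure \<nu> Q * d))"
      using emeasure_nu[OF _ Q_base] a d K_pos by (simp add: ennreal_mult[symmetric] ennreal_plus[symmetric] del: ennreal_plus)
    also have "\<dots> \<le> ennreal (measure \<nu> Q * (?a + e))"
    proof (rule ennreal_leI)
      have "(1 + d) * (?a + d) = ?a + (?a * d + d + d * d)" by (simp add: algebra_simps)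
      also have "\<dots> \<le> ?a + (1 * d + d + 1 * d)" using a d by (intro add_left_mono add_mono mult_right_mono) auto
      finally have "(1 + d) * (?a + d) + K * d \<le> ?a + e" using dK by (simp add: algebra_simps)
      then have "measure \<nu> Q * ((1 + d) * (?a + d) + K * d) \<le> measure \<nu> Q * (?a + e)" by (rule mult_left_mono) simp
      then show "(1 + d) * (?a + d) * measure \<nu> Q + K * (measure \<nu> Q * d) \<le> measure \<nu> Q * (?a + e)"
        by (simp add: algebra_simps)
    qed
    finally show "(\<integral>\<^sup>+ y. indicator Q y * ennreal (G n (stopped m y)) \<partial>\<nu>) \<le> ennreal (measure \<nu> Q * (?a + e))"
      by (simp add: add_mono)
  qed
qed

text \<open>The exceptional points: visits to \<open>Bx n\<close> up to the stopping time would
  spoil the comparison of the Laplace transforms at \<open>y\<close> and at the stopped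
  point.\<close>

definition early :: "nat \<Rightarrow> nat \<Rightarrow> (nat \<Rightarrow> 'v) set \<Rightarrow> (nat \<Rightarrow> 'v) set" where
  "early n m Q = {y \<in> Q. \<exists>j. 1 \<le> j \<and> j \<le> tau m y \<and> (shift ^^ j) y \<in> Bx n}"

lemma early_sets [measurable]:
  assumes [measurable]: "Q \<in> sets \<nu>"
  shows "early n m Q \<in> sets \<nu>"
proof -
  have "early n m Q = {y \<in> space \<nu>. y \<in> Q \<and> (\<exists>j. 1 \<le> j \<and> j \<le> tau m y \<and> (shift ^^ j) y \<in> Bx n)}"
    using sets.sets_into_space[of Q \<nu>] by (auto simp: early_def)
  also have "\<dots> \<in> sets \<nu>" by measurable
  finally show ?thesis .
qed

text \<open>For \<open>j < n\<close> the overlap is empty unless \<open>x j = x 0\<close>; otherwise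
  the word up to \<open>j\<close> is followed by a copy of \<open>Bx n\<close>, which costs at most
  \<open>K\<close> times the product of the measures. For \<open>j \<ge> n\<close> the first word is
  complete before the second one starts.\<close>

lemma overlap_le:
  assumes n: "1 \<le> n" and j: "1 \<le> j"
  shows "measure \<nu> {y \<in> Bx n. (shift ^^ j) y \<in> Bx n}
    \<le> K * (if j < n then rec_weight j else measure \<nu> (Bx n)) * measure \<nu> (Bx n)"
proof -
  let ?S = "{y \<in> Bx n. (shift ^^ j) y \<in> Bx n}"
  have S: "?S \<in> sets \<nu>" "?S \<subseteq> base" using Bx_base[OF n] by auto
  have ind: "indicator (Bx n) z * indicator base z = (indicator (Bx n) z :: ennreal)" for z
    using Bx_base[OF n] by (auto split: split_indicator)
  have conv: ?thesis if "emeasure \<nu> ?S \<le> ennreal K * (ennreal r * emeasure \<nu> (Bx n))"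
    "(if j < n then rec_weight j else measure \<nu> (Bx n)) = r" "0 \<le> r" for r
  proof -
    have "ennreal (measure \<nu> ?S) \<le> ennreal (K * (r * measure \<nu> (Bx n)))"
      using that(1,3) K_pos S Bx_base[OF n] by (simp add: emeasure_nu ennreal_mult)
    then show ?thesis using that(2,3) K_pos by (subst (asm) ennreal_le_iff) (auto simp: mult.assoc)
  qed
  show ?thesis
  proof (cases "j < n")
    case True
    show ?thesis
    proof (cases "x j = x 0")
      case xj: True
      have "?S \<subseteq> {y \<in> Bx (Suc j). (shift ^^ j) y \<in> Bx n}"
        using Bx_mono[of "Suc j" n] True by (auto simp del: upt_Suc)
      then have "emeasure \<nu> ?S \<le> emeasure \<nu> {y \<in> Bx (Suc j). (shift ^^ j) y \<in> Bx n}"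
        by (intro emeasure_mono hit_set_sets) (simp_all del: upt_Suc)
      also have "\<dots> = (\<integral>\<^sup>+ y. indicator (Bx (Suc j)) y * indicator (Bx n) ((shift ^^ j) y) \<partial>\<nu>)"
        by (subst emeasure_hit_set) (simp_all del: upt_Suc)
      also have "\<dots> \<le> ennreal K * (emeasure \<nu> (Bx (Suc j)) * emeasure \<nu> (Bx n))"
        using cylinder_upper[OF xj, of "indicator (Bx n)"] by (simp add: ind del: upt_Suc)
      finally show ?thesis
        using True xj Bx_base[of "Suc j"] by (intro conv[of "rec_weight j"])
          (auto simp: rec_weight_def emeasure_nu simp del: upt_Suc)
    next
      case False
      have "y \<notin> ?S" for y
      proof
        assume y: "y \<in> ?S"
        then have "(shift ^^ j) y \<in> base" using Bx_base[OF n] by blast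
        then have "y j = x 0" by (simp add: mem_base shift_pow)
        then show False using y True False by (simp add: mem_cylinder_map)
      qed
      then have "?S = {}" by blast
      then show ?thesis unfolding \<open>?S = {}\<close> using rec_weight_nonneg K_pos by simp
    qed
  next
    case False
    have "emeasure \<nu> ?S \<le> ennreal K * (emeasure \<nu> {y \<in> Bx n. (shift ^^ j) y \<in> base} * emeasure \<nu> (Bx n))"
      using base_distortion(1)[OF j determined_Bx, of n "indicator (Bx n)"] False
      by (simp add: emeasure_hit_set ind)
    also have "\<dots> \<le> ennreal K * (ennreal (measure \<nu> (Bx n)) * emeasure \<nu> (Bx n))"
      unfolding emeasure_nu[OF cylinder_sets Bx_base[OF n], symmetric]
      by (intro mult_left_mono mult_right_mono emeasure_mono) auto
    finally show ?thesis using False by (intro conv) auto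
  qed
qed

text \<open>Visits at times up to \<open>J\<close> are excluded for large \<open>n\<close> by
  \<open>star\<close>, those strictly between \<open>J\<close> and \<open>n\<close> cost a tail of
  the series of \<open>rec_weight\<close>, and the \<open>q\<close> times from \<open>n\<close> on
  cost a multiple of \<open>measure \<nu> (Bx n)\<close> each. A later visit that is not after
  \<open>tau\<close> must occur at \<open>tau\<close> itself, as \<open>Bx n\<close> lies in
  \<open>base\<close>.\<close>

lemma early_small:
  assumes Q: "\<And>n. determined (n + q) (Q n)" "\<And>n. Q n \<subseteq> Bx n"
    and star: "\<And>j. 1 \<le> j \<Longrightarrow> \<forall>\<^sub>F n in sequentially. \<forall>y\<in>Q n. (shift ^^ j) y \<notin> Bx n"
  shows "(\<lambda>n. measure \<nu> (early n (n + q) (Q n)) / measure \<nu> (Bx n)) \<longlonglongrightarrow> 0"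
proof (rule LIMSEQ_I)
  fix e :: real assume e: "0 < e"
  have "\<exists>N. \<forall>m\<ge>N. \<forall>n. norm (sum rec_weight {m..<n}) < e / (2 * K)"
    using rec_weight_summable(1) e K_pos unfolding summable_Cauchy by simp
  then obtain J where J: "\<And>n. sum rec_weight {Suc J..<n} < e / (2 * K)"
    by (metis abs_le_D1 le_SucI order_refl real_norm_def abs_less_iff)
  have ev1: "\<forall>\<^sub>F n in sequentially. \<forall>j\<in>{1..J}. \<forall>y\<in>Q n. (shift ^^ j) y \<notin> Bx n"
    using star by (intro eventually_ball_finite) auto
  have "(\<lambda>n. (real q + 1) * K * measure \<nu> (Bx n)) \<longlonglongrightarrow> (real q + 1) * K * 0"
    by (intro tendsto_intros nu_Bx_tendsto)
  then have ev2: "\<forall>\<^sub>F n in sequentially. (real q + 1) * K * measure \<nu> (Bx n) < e / 2"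
    by (rule order_tendstoD) (use e in simp)
  have "\<forall>\<^sub>F n in sequentially. norm (measure \<nu> (early n (n + q) (Q n)) / measure \<nu> (Bx n) - 0) < e"
    using ev1 ev2 eventually_ge_at_top[of "1::nat"]
  proof eventually_elim
    case (elim n)
    let ?m = "measure \<nu> (Bx n)"
    let ?O = "\<lambda>j. {y \<in> Bx n. (shift ^^ j) y \<in> Bx n}"
    let ?S = "{y \<in> Q n. stopped (n + q) y \<in> Bx n}"
    note [measurable] = determined_sets[OF Q(1)[of n]]
    have S_sets: "?S \<in> sets \<nu>" by (rule emeasure_stopped_set(2)) auto
    have base: "Bx n \<subseteq> base" "Q n \<subseteq> base" using Bx_base[OF elim(3)] Q(2)[of n] by auto
    have AE: "AE y in \<nu>. y \<in> early n (n + q) (Q n) \<longrightarrow> y \<in> (\<Union>j\<in>{Suc J..<n + q}. ?O j) \<union> ?S"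
      using AE_visits
    proof (eventually_elim, intro impI)
      fix y assume vis: "\<forall>N. \<exists>n\<ge>N. y n = x 0" and "y \<in> early n (n + q) (Q n)"
      then obtain j where j: "1 \<le> j" "j \<le> tau (n + q) y" "(shift ^^ j) y \<in> Bx n" and y: "y \<in> Q n"
        by (auto simp: early_def)
      have "J < j" using elim(1) j y by (meson atLeastAtMost_iff not_less)
      show "y \<in> (\<Union>j\<in>{Suc J..<n + q}. ?O j) \<union> ?S"
      proof (cases "j < n + q")
        case True
        then show ?thesis using \<open>J < j\<close> j y Q(2)[of n] by auto
      next
        case False
        have "y j = x 0" using j(3) base(1) by (auto simp: mem_base shift_pow)
        then have "tau (n + q) y \<le> j" using False by (intro tau_le) auto
        then have "stopped (n + q) y = (shift ^^ j) y" using j(2) by (simp add: stopped_def)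
        then show ?thesis using j y by simp
      qed
    qed
    have "emeasure \<nu> (early n (n + q) (Q n)) \<le> emeasure \<nu> ((\<Union>j\<in>{Suc J..<n + q}. ?O j) \<union> ?S)"
      by (rule emeasure_mono_AE[OF AE]) (use S_sets in auto)
    moreover have "early n (n + q) (Q n) \<subseteq> base" "(\<Union>j\<in>{Suc J..<n + q}. ?O j) \<union> ?S \<subseteq> base"
      using base by (auto simp: early_def)
    ultimately have "measure \<nu> (early n (n + q) (Q n)) \<le> measure \<nu> ((\<Union>j\<in>{Suc J..<n + q}. ?O j) \<union> ?S)"
      using S_sets by (simp add: emeasure_nu)
    also have "\<dots> \<le> measure \<nu> (\<Union>j\<in>{Suc J..<n + q}. ?O j) + measure \<nu> ?S"
      using S_sets by (intro measure_Un_le) auto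
    also have "measure \<nu> (\<Union>j\<in>{Suc J..<n + q}. ?O j) \<le> (\<Sum>j\<in>{Suc J..<n + q}. measure \<nu> (?O j))"
      by (intro measure_UNION_le) auto
    also have "\<dots> \<le> (\<Sum>j\<in>{Suc J..<n + q}. K * (if j < n then rec_weight j else ?m) * ?m)"
      using elim(3) by (intro sum_mono overlap_le) auto
    also have "\<dots> = K * (\<Sum>j\<in>{Suc J..<n + q}. if j < n then rec_weight j else ?m) * ?m"
      by (simp add: sum_distrib_left sum_distrib_right)
    also have "(\<Sum>j\<in>{Suc J..<n + q}. if j < n then rec_weight j else ?m) \<le> sum rec_weight {Suc J..<n} + real q * ?m"
    proof -
      have "(\<Sum>j\<in>{Suc J..<n + q}. if j < n then rec_weight j else ?m)
          \<le> (\<Sum>j\<in>{Suc J..<n} \<union> {n..<n + q}. if j < n then rec_weight j else ?m)"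
        using rec_weight_nonneg by (intro sum_mono2) auto
      also have "\<dots> = (\<Sum>j\<in>{Suc J..<n}. if j < n then rec_weight j else ?m) + (\<Sum>j\<in>{n..<n + q}. if j < n then rec_weight j else ?m)"
        by (intro sum.union_disjoint) auto
      finally show ?thesis by simp
    qed
    also have "measure \<nu> ?S \<le> K * ?m * ?m"
    proof -
      have "emeasure \<nu> ?S \<le> ennreal K * (emeasure \<nu> (Q n) * emeasure \<nu> (Bx n))"
        using elim(3) base by (intro stopped_set_le Q) auto
      also have "\<dots> \<le> ennreal K * (emeasure \<nu> (Bx n) * emeasure \<nu> (Bx n))"
        using Q(2) by (intro mult_left_mono mult_right_mono emeasure_mono) auto
      finally have "ennreal (measure \<nu> ?S) \<le> ennreal (K * ?m * ?m)"
        using S_sets base K_pos by (subst (asm) (1 2 3) emeasure_nu) (auto simp: ennreal_mult mult.assoc)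
      then show ?thesis using K_pos by (subst (asm) ennreal_le_iff) auto
    qed
    finally have "measure \<nu> (early n (n + q) (Q n)) \<le> K * (sum rec_weight {Suc J..<n} + real q * ?m) * ?m + K * ?m * ?m"
      using K_pos by (simp add: mult_left_mono mult_right_mono)
    also have "\<dots> = (K * sum rec_weight {Suc J..<n} + (real q + 1) * K * ?m) * ?m"
      by (simp add: algebra_simps)
    also have "\<dots> < e * ?m"
    proof (rule mult_strict_right_mono)
      have "K * sum rec_weight {Suc J..<n} < e / 2" using J[of n] K_pos by (simp add: field_simps)
      then show "K * sum rec_weight {Suc J..<n} + (real q + 1) * K * ?m < e" using elim(2) by linarith
    qed (rule nu_Bx_pos[OF elim(3)])
    finally show ?case using nu_Bx_pos[OF elim(3)] by (simp add: pos_divide_less_eq)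
  qed
  then show "\<exists>no. \<forall>n\<ge>no. norm (measure \<nu> (early n (n + q) (Q n)) / measure \<nu> (Bx n) - 0) < e"
    by (simp add: eventually_sequentially)
qed

end

section \<open>Mean of the stopping time over the initial cylinder\<close>

context rpf_point
begin

lemma AE_hits_base: "AE y in \<nu>. \<forall>i k. hits base ((next_hit base ^^ k) ((shift ^^ i) y))"
proof -
  have "AE y in \<mu>. \<forall>i k. hits base ((next_hit base ^^ k) ((shift ^^ i) y))"
    unfolding AE_all_countable using AE_T_pow[OF AE_hits_always[OF base_mu mu_base_pos]]
    by (auto simp: AE_all_countable)
  then show ?thesis by (simp add: AE_mu_iff)
qed

text \<open>Before time \<open>n\<close> the point \<open>y\<close> reads the symbols of
  \<open>x\<close>, so its first return after \<open>last_visit n\<close> comes at time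
  \<open>n\<close> or later; each of the next \<open>q\<close> returns adds at least 1.\<close>

lemma tau_le_nth_return:
  assumes n: "1 \<le> n" and y: "y \<in> Bx n"
    and h: "\<forall>i k. hits base ((next_hit base ^^ k) ((shift ^^ i) y))"
  shows "tau (n + q) y \<le> last_visit n + nth_return q ((shift ^^ last_visit n) y)"
proof (rule tau_le)
  let ?l = "last_visit n"
  let ?z = "(shift ^^ ?l) y"
  have h': "\<forall>k. hits base ((next_hit base ^^ k) ?z)" using h by simp
  have "(next_hit base ^^ Suc q) ?z \<in> base"
    using ret_hits[OF h'[rule_format, of q]] by simp
  then have "(shift ^^ nth_return q ?z) ?z \<in> base"
    using hit_time_eq_sum[OF h', of "Suc q"] by (simp only: nth_return_def lessThan_Suc_atMost)
  then show "y (?l + nth_return q ?z) = x 0"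
    by (simp add: mem_base shift_pow)
  have r: "1 \<le> ret base ?z" "next_hit base ?z \<in> base" using ret_hits[OF h'[rule_format, of 0]] by simp_all
  have "n - ?l \<le> ret base ?z"
  proof (rule ccontr)
    assume "\<not> n - ?l \<le> ret base ?z"
    then have *: "?l + ret base ?z < n" by linarith
    have "x (?l + ret base ?z) \<noteq> x 0" by (rule last_visit(3)[OF n _ *]) (use r in simp)
    moreover have "y (?l + ret base ?z) = x 0" using r(2) by (simp add: next_hit_def mem_base shift_pow)
    ultimately show False using y * by (simp add: mem_cylinder_map)
  qed
  moreover have "ret base ?z + q \<le> nth_return q ?z"
  proof -
    have "(\<Sum>i<q. 1) \<le> (\<Sum>i<q. ret base ((next_hit base ^^ Suc i) ?z))"
      by (intro sum_mono) (use ret_hits[OF h'[rule_format]] in blast)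
    then show ?thesis
      unfolding nth_return_def lessThan_Suc_atMost[symmetric] sum.lessThan_Suc_shift by simp
  qed
  ultimately show "n + q \<le> ?l + nth_return q ?z" using last_visit(1)[OF n] by linarith
qed

text \<open>With \<open>l = last_visit n\<close>, the stopping time is at most \<open>l\<close> plus
  a return time counted from \<open>l\<close>. For large \<open>l\<close> both parts are controlled
  by the terms of the convergent series at \<open>l\<close>. If \<open>l\<close> stays small, as
  when \<open>x\<close> visits \<open>base\<close> only finitely often, smallness comes from
  \<open>Bx n\<close> shrinking to a null set.\<close>

lemma tau_small:
  assumes e: "0 < e"
  shows "\<forall>\<^sub>F n in sequentially. (\<integral>\<^sup>+ y. indicator (Bx n) y * of_nat (tau (n + q) y) \<partial>\<nu>) \<le> ennreal e"
proof -
  let ?g = "\<lambda>y. of_nat (nth_return q y) :: ennreal"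
  define I where "I = enn2real (\<integral>\<^sup>+ z. ?g z * indicator base z \<partial>\<nu>)"
  have I: "(\<integral>\<^sup>+ z. ?g z * indicator base z \<partial>\<nu>) = ennreal I"
    unfolding I_def using nth_return_integral[of q] by simp
  have I0: "0 \<le> I" by (simp add: I_def)
  have upper: "(\<integral>\<^sup>+ y. indicator (Bx (Suc j)) y * ?g ((shift ^^ j) y) \<partial>\<nu>) \<le> ennreal (K * rec_weight j * I)"
    if "x j = x 0" for j
    using cylinder_upper[OF that, of ?g] Bx_base[of "Suc j"] K_pos I0 that
    by (simp add: I emeasure_nu rec_weight_def ennreal_mult mult.assoc del: upt_Suc)
  have "(\<lambda>j. real j * rec_weight j) \<longlonglongrightarrow> 0" "rec_weight \<longlonglongrightarrow> 0"
    by (rule summable_LIMSEQ_zero[OF rec_weight_summable(2)], rule summable_LIMSEQ_zero[OF rec_weight_summable(1)])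
  then have "(\<lambda>j. real j * rec_weight j + K * rec_weight j * I) \<longlonglongrightarrow> 0 + K * 0 * I" by (intro tendsto_intros)
  then have "\<forall>\<^sub>F j in sequentially. real j * rec_weight j + K * rec_weight j * I < e"
    by (rule order_tendstoD) (use e in simp)
  then obtain J where J: "\<And>j. J \<le> j \<Longrightarrow> real j * rec_weight j + K * rec_weight j * I < e"
    by (auto simp: eventually_sequentially)
  \<comment> \<open>For a fixed visit \<open>j\<close> the integrand is integrable, and the measure
    with this density is continuous from above along \<open>Bx n\<close>.\<close>
  have shrink: "\<forall>\<^sub>F n in sequentially. (\<integral>\<^sup>+ y. indicator (Bx n) y * (indicator (Bx (Suc j)) y * ?g ((shift ^^ j) y)) \<partial>\<nu>) < ennreal (e / 2)"
    if j: "x j = x 0" for j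
  proof -
    define f where "f y = indicator (Bx (Suc j)) y * ?g ((shift ^^ j) y)" for y
    have fm [measurable]: "f \<in> borel_measurable \<nu>" unfolding f_def
      by (intro borel_measurable_times_ennreal borel_measurable_indicator cylinder_sets
          measurable_compose[OF shift_pow_measurable_nu, of "\<lambda>y. of_nat (nth_return q y)"]
          measurable_compose[OF nth_return_measurable, of of_nat]) simp_all
    have em: "emeasure (density \<nu> f) X = (\<integral>\<^sup>+ y. indicator X y * f y \<partial>\<nu>)" if "X \<in> sets \<nu>" for X
      using that by (subst emeasure_density) (simp_all add: mult.commute)
    have fin: "(\<integral>\<^sup>+ y. f y \<partial>\<nu>) < \<infinity>"
      using upper[OF j] unfolding f_def by (rule le_less_trans) simp
    have "(\<lambda>n. emeasure (density \<nu> f) (Bx (Suc n))) \<longlonglongrightarrow> emeasure (density \<nu> f) (\<Inter>n. Bx (Suc n))"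
    proof (rule Lim_emeasure_decseq)
      show "range (\<lambda>n. Bx (Suc n)) \<subseteq> sets (density \<nu> f)" by (auto simp del: upt_Suc)
      show "decseq (\<lambda>n. Bx (Suc n))" using Bx_mono by (auto simp: decseq_def simp del: upt_Suc)
      fix n
      have "(\<integral>\<^sup>+ y. indicator (Bx (Suc n)) y * f y \<partial>\<nu>) \<le> (\<integral>\<^sup>+ y. f y \<partial>\<nu>)"
        by (intro nn_integral_mono) (simp split: split_indicator)
      also note fin
      finally show "emeasure (density \<nu> f) (Bx (Suc n)) \<noteq> \<infinity>"
        by (simp add: em less_top[symmetric] del: upt_Suc)
    qed
    moreover have "emeasure (density \<nu> f) (\<Inter>n. Bx (Suc n)) = 0"
    proof -
      have "(\<Inter>n. Bx (Suc n)) \<in> sets \<nu>" by (intro sets.countable_INT') (auto simp del: upt_Suc)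
      moreover have "emeasure \<nu> (\<Inter>n. Bx (Suc n)) = 0"
      proof -
        have "emeasure \<nu> (\<Inter>n. Bx (Suc n)) \<le> ennreal (measure \<nu> (Bx (Suc n)))" for n
          using emeasure_mono[of "\<Inter>n. Bx (Suc n)" "Bx (Suc n)" \<nu>] Bx_base[of "Suc n"]
          by (auto simp: emeasure_nu[symmetric] simp del: upt_Suc)
        moreover have "(\<lambda>n. ennreal (measure \<nu> (Bx (Suc n)))) \<longlonglongrightarrow> ennreal 0"
          by (intro tendsto_ennrealI LIMSEQ_Suc nu_Bx_tendsto)
        ultimately have "emeasure \<nu> (\<Inter>n. Bx (Suc n)) \<le> ennreal 0" by (intro LIMSEQ_le_const) auto
        then show ?thesis by simp
      qed
      ultimately have "(\<Inter>n. Bx (Suc n)) \<in> null_sets \<nu>" by (simp add: null_sets_def del: upt_Suc)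
      then have "(\<Inter>n. Bx (Suc n)) \<in> null_sets (density \<nu> f)"
        using absolutely_continuousI_density[OF fm] unfolding absolutely_continuous_def by blast
      then show ?thesis by (simp add: null_sets_def del: upt_Suc)
    qed
    ultimately have "(\<lambda>n. emeasure (density \<nu> f) (Bx n)) \<longlonglongrightarrow> 0" by (simp add: LIMSEQ_imp_Suc del: upt_Suc)
    then have "\<forall>\<^sub>F n in sequentially. emeasure (density \<nu> f) (Bx n) < ennreal (e / 2)"
      by (rule order_tendstoD) (use e in simp)
    then show ?thesis by (simp add: em f_def)
  qed
  have "\<forall>\<^sub>F n in sequentially. \<forall>j\<in>{j. j < J \<and> x j = x 0}.
      (\<integral>\<^sup>+ y. indicator (Bx n) y * (indicator (Bx (Suc j)) y * ?g ((shift ^^ j) y)) \<partial>\<nu>) < ennreal (e / 2)"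
    using shrink by (intro eventually_ball_finite) auto
  moreover have "\<forall>\<^sub>F n in sequentially. real J * measure \<nu> (Bx n) < e / 2"
  proof -
    have "(\<lambda>n. real J * measure \<nu> (Bx n)) \<longlonglongrightarrow> real J * 0" by (intro tendsto_intros nu_Bx_tendsto)
    then show ?thesis by (rule order_tendstoD) (use e in simp)
  qed
  ultimately show ?thesis using eventually_ge_at_top[of "1::nat"]
  proof eventually_elim
    case (elim n)
    let ?l = "last_visit n"
    have l: "?l < n" "x ?l = x 0" using last_visit[OF elim(3)] by auto
    have sub: "Bx n \<subseteq> Bx (Suc ?l)" using l by (intro Bx_mono) simp
    have "(\<integral>\<^sup>+ y. indicator (Bx n) y * of_nat (tau (n + q) y) \<partial>\<nu>)
        \<le> (\<integral>\<^sup>+ y. of_nat ?l * indicator (Bx n) y + indicator (Bx n) y * (indicator (Bx (Suc ?l)) y * ?g ((shift ^^ ?l) y)) \<partial>\<nu>)"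
    proof (rule nn_integral_mono_AE)
      show "AE y in \<nu>. indicator (Bx n) y * of_nat (tau (n + q) y)
          \<le> (of_nat ?l * indicator (Bx n) y + indicator (Bx n) y * (indicator (Bx (Suc ?l)) y * ?g ((shift ^^ ?l) y)) :: ennreal)"
        using AE_hits_base
      proof eventually_elim
        case (elim y)
        show ?case
        proof (cases "y \<in> Bx n")
          case True
          have "of_nat (tau (n + q) y) \<le> (of_nat (?l + nth_return q ((shift ^^ ?l) y)) :: ennreal)"
            using tau_le_nth_return[OF \<open>1 \<le> n\<close> True elim] by (rule of_nat_mono)
          then show ?thesis using True subsetD[OF sub True] by (simp del: upt_Suc)
        qed simp
      qed
    qed
    also have "\<dots> = of_nat ?l * emeasure \<nu> (Bx n) + (\<integral>\<^sup>+ y. indicator (Bx n) y * (indicator (Bx (Suc ?l)) y * ?g ((shift ^^ ?l) y)) \<partial>\<nu>)"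
      by (subst nn_integral_add) (simp_all add: nn_integral_cmult del: upt_Suc)
    also have "of_nat ?l * emeasure \<nu> (Bx n) = ennreal (real ?l * measure \<nu> (Bx n))"
      using Bx_base[OF elim(3)] by (simp add: emeasure_nu ennreal_mult ennreal_of_nat_eq_real_of_nat)
    also have "\<dots> + (\<integral>\<^sup>+ y. indicator (Bx n) y * (indicator (Bx (Suc ?l)) y * ?g ((shift ^^ ?l) y)) \<partial>\<nu>) \<le> ennreal e"
    proof (cases "?l < J")
      case True
      have "real ?l * measure \<nu> (Bx n) \<le> real J * measure \<nu> (Bx n)" using True by (intro mult_right_mono) auto
      then have "ennreal (real ?l * measure \<nu> (Bx n)) \<le> ennreal (e / 2)" using elim(2) by (intro ennreal_leI) linarith
      moreover have "(\<integral>\<^sup>+ y. indicator (Bx n) y * (indicator (Bx (Suc ?l)) y * ?g ((shift ^^ ?l) y)) \<partial>\<nu>) \<le> ennreal (e / 2)"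
        using elim(1) True l(2) by (simp add: less_imp_le del: upt_Suc)
      ultimately have "ennreal (real ?l * measure \<nu> (Bx n)) + (\<integral>\<^sup>+ y. indicator (Bx n) y * (indicator (Bx (Suc ?l)) y * ?g ((shift ^^ ?l) y)) \<partial>\<nu>)
          \<le> ennreal (e / 2) + ennreal (e / 2)" by (rule add_mono)
      also have "\<dots> = ennreal e" using e by (simp add: ennreal_plus[symmetric] del: ennreal_plus)
      finally show ?thesis .
    next
      case False
      have "measure \<nu> (Bx n) \<le> rec_weight ?l"
        using sub l(2) Bx_base[of "Suc ?l"] by (auto simp: rec_weight_def simp del: upt_Suc intro!: nu_mono)
      then have "ennreal (real ?l * measure \<nu> (Bx n)) \<le> ennreal (real ?l * rec_weight ?l)"
        by (intro ennreal_leI mult_left_mono) auto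
      moreover have "(\<integral>\<^sup>+ y. indicator (Bx n) y * (indicator (Bx (Suc ?l)) y * ?g ((shift ^^ ?l) y)) \<partial>\<nu>)
          \<le> (\<integral>\<^sup>+ y. indicator (Bx (Suc ?l)) y * ?g ((shift ^^ ?l) y) \<partial>\<nu>)"
        by (intro nn_integral_mono) (simp split: split_indicator)
      then have "(\<integral>\<^sup>+ y. indicator (Bx n) y * (indicator (Bx (Suc ?l)) y * ?g ((shift ^^ ?l) y)) \<partial>\<nu>) \<le> ennreal (K * rec_weight ?l * I)"
        using upper[OF l(2)] by (rule order_trans)
      ultimately have "ennreal (real ?l * measure \<nu> (Bx n)) + (\<integral>\<^sup>+ y. indicator (Bx n) y * (indicator (Bx (Suc ?l)) y * ?g ((shift ^^ ?l) y)) \<partial>\<nu>)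
          \<le> ennreal (real ?l * rec_weight ?l) + ennreal (K * rec_weight ?l * I)" by (rule add_mono)
      also have "\<dots> = ennreal (real ?l * rec_weight ?l + K * rec_weight ?l * I)"
        using K_pos I0 rec_weight_nonneg by (intro ennreal_plus[symmetric]) auto
      also have "\<dots> \<le> ennreal e" using J[of ?l] False by (intro ennreal_leI) simp
      finally show ?thesis .
    qed
    finally show ?case .
  qed
qed

section \<open>Comparison of the measures on small cylinders\<close>

lemma cylinder_Int_tms [simp]: "cylinder A w \<inter> tms A = cylinder A w"
  using cylinder_subset by blast

lemma integrable_nu:
  fixes f :: "(nat \<Rightarrow> 'v) \<Rightarrow> real"
  assumes [measurable]: "f \<in> borel_measurable \<nu>" "E \<in> sets \<nu>" and "E \<subseteq> base"
    and b: "\<And>y. y \<in> E \<Longrightarrow> \<bar>f y\<bar> \<le> C"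
  shows "integrable \<nu> (\<lambda>y. indicator E y * f y)"
proof (rule Bochner_Integration.integrable_bound)
  show "integrable \<nu> (\<lambda>y. C * indicator E y)"
    using base_fmeasurable[OF assms(2,3)] by (intro integrable_mult_right integrable_real_indicator)
      (auto simp: fmeasurable_def)
  show "AE y in \<nu>. norm (indicator E y * f y) \<le> norm (C * indicator E y)"
    using order_trans[OF b abs_ge_self] by (intro AE_I2) (auto split: split_indicator)
qed measurable

lemma measure_comparison:
  fixes G :: "nat \<Rightarrow> (nat \<Rightarrow> 'v) \<Rightarrow> real"
  assumes G [measurable]: "\<And>n. G n \<in> borel_measurable \<nu>" and G01: "\<And>n y. 0 \<le> G n y \<and> G n y \<le> 1"
  shows "(\<lambda>n. ((\<integral>y. indicator (Bx n) y * G n y \<partial>\<mu>) - h x * (\<integral>y. indicator (Bx n) y * G n y \<partial>\<nu>)) / measure \<nu> (Bx n)) \<longlonglongrightarrow> 0"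
proof (rule LIMSEQ_I)
  fix e :: real assume e: "0 < e"
  obtain N where N: "\<And>y. y \<in> Bx N \<Longrightarrow> \<bar>h y - h x\<bar> < e / 2" using h_continuous[OF x, of "e / 2"] e by auto
  have "norm (((\<integral>y. indicator (Bx n) y * G n y \<partial>\<mu>) - h x * (\<integral>y. indicator (Bx n) y * G n y \<partial>\<nu>)) / measure \<nu> (Bx n) - 0) < e"
    if n: "max 1 N \<le> n" for n
  proof -
    have base: "Bx n \<subseteq> base" using n by (intro Bx_base) simp
    have hd: "\<bar>h y - h x\<bar> < e / 2" if "y \<in> Bx n" for y using N[of y] that Bx_mono[of N n] n by auto
    have i1: "integrable \<nu> (\<lambda>y. indicator (Bx n) y * (h y * G n y))"
    proof (rule integrable_nu[OF _ _ base])
      fix y assume y: "y \<in> Bx n"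
      have "\<bar>h y * G n y\<bar> \<le> \<bar>h y\<bar> * 1" using G01[of n y] unfolding abs_mult by (intro mult_left_mono) auto
      then show "\<bar>h y * G n y\<bar> \<le> \<bar>h x\<bar> + e / 2" using hd[OF y] by linarith
    qed measurable
    have i2: "integrable \<nu> (\<lambda>y. indicator (Bx n) y * G n y)"
      using G01 by (intro integrable_nu[OF _ _ base, of _ 1]) auto
    have i3: "integrable \<nu> (\<lambda>y. e / 2 * indicator (Bx n) y)"
      using integrable_nu[OF _ cylinder_sets base, of "\<lambda>_. e / 2" "e / 2"] e by (simp add: mult.commute)
    have "(\<integral>y. indicator (Bx n) y * G n y \<partial>\<mu>) = (\<integral>y. h y * (indicator (Bx n) y * G n y) \<partial>\<nu>)"
      unfolding mu_eq by (subst integral_density) (use h_pos in \<open>auto intro!: AE_I2 less_imp_le\<close>)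
    also have "\<dots> = (\<integral>y. indicator (Bx n) y * (h y * G n y) \<partial>\<nu>)" by (simp only: mult.left_commute)
    finally have "(\<integral>y. indicator (Bx n) y * G n y \<partial>\<mu>) - h x * (\<integral>y. indicator (Bx n) y * G n y \<partial>\<nu>)
        = (\<integral>y. indicator (Bx n) y * (h y * G n y) - h x * (indicator (Bx n) y * G n y) \<partial>\<nu>)"
      using i1 i2 by simp
    also have "\<bar>\<dots>\<bar> \<le> (\<integral>y. e / 2 * indicator (Bx n) y \<partial>\<nu>)"
    proof (rule order_trans[OF integral_abs_bound], rule integral_mono)
      fix y
      show "\<bar>indicator (Bx n) y * (h y * G n y) - h x * (indicator (Bx n) y * G n y)\<bar> \<le> e / 2 * indicator (Bx n) y"
      proof (cases "y \<in> Bx n")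
        case True
        have "\<bar>(h y - h x) * G n y\<bar> \<le> e / 2 * 1"
          unfolding abs_mult using hd[OF True] G01[of n y] e by (intro mult_mono) auto
        then show ?thesis using True by (simp add: left_diff_distrib)
      qed simp
    qed (use i1 i2 i3 in auto)
    also have "\<dots> = e / 2 * measure \<nu> (Bx n)" by simp
    also have "\<dots> < e * measure \<nu> (Bx n)"
      using e nu_Bx_pos[of n] n by (intro mult_strict_right_mono) auto
    finally show ?thesis using nu_Bx_pos[of n] n by (simp add: pos_divide_less_eq)
  qed
  then show "\<exists>no. \<forall>n\<ge>no. norm (((\<integral>y. indicator (Bx n) y * G n y \<partial>\<mu>) - h x * (\<integral>y. indicator (Bx n) y * G n y \<partial>\<nu>)) / measure \<nu> (Bx n) - 0) < e"
    by blast
qed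

lemma measure_ratio: "(\<lambda>n. prob (Bx n) / measure \<nu> (Bx n)) \<longlonglongrightarrow> h x"
proof -
  have "(\<lambda>n. (prob (Bx n) - h x * measure \<nu> (Bx n)) / measure \<nu> (Bx n)) \<longlonglongrightarrow> 0"
    using measure_comparison[of "\<lambda>_ _. 1"] by simp
  then have "(\<lambda>n. (prob (Bx n) - h x * measure \<nu> (Bx n)) / measure \<nu> (Bx n) + h x) \<longlonglongrightarrow> 0 + h x"
    by (intro tendsto_intros)
  moreover have "\<forall>\<^sub>F n in sequentially. (prob (Bx n) - h x * measure \<nu> (Bx n)) / measure \<nu> (Bx n) + h x
      = prob (Bx n) / measure \<nu> (Bx n)"
    using eventually_ge_at_top[of "1::nat"]
    by eventually_elim (use nu_Bx_pos in \<open>force simp: diff_divide_distrib\<close>)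
  ultimately show ?thesis by (auto intro: Lim_transform_eventually)
qed

lemma mu_Bx_tendsto: "(\<lambda>n. prob (Bx n)) \<longlonglongrightarrow> 0"
proof -
  have "(\<lambda>n. prob (Bx n) / measure \<nu> (Bx n) * measure \<nu> (Bx n)) \<longlonglongrightarrow> h x * 0"
    by (intro tendsto_intros measure_ratio nu_Bx_tendsto)
  moreover have "\<forall>\<^sub>F n in sequentially. prob (Bx n) / measure \<nu> (Bx n) * measure \<nu> (Bx n) = prob (Bx n)"
    using eventually_ge_at_top[of "1::nat"] by eventually_elim (use nu_Bx_pos in force)
  ultimately show ?thesis by (auto intro: Lim_transform_eventually)
qed

text \<open>The constant \<open>h x\<close> cancels on conditioning. Return moments may therefore be
  computed with \<open>\<nu>\<close>, for which conformality is available.\<close>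

lemma conditional_comparison:
  fixes G :: "nat \<Rightarrow> (nat \<Rightarrow> 'v) \<Rightarrow> real"
  assumes G: "\<And>n. G n \<in> borel_measurable \<nu>" and G01: "\<And>n y. 0 \<le> G n y \<and> G n y \<le> 1"
  shows "(\<lambda>n. (\<integral>y. indicator (Bx n) y * G n y \<partial>\<mu>) / prob (Bx n) - (\<integral>y. indicator (Bx n) y * G n y \<partial>\<nu>) / measure \<nu> (Bx n)) \<longlonglongrightarrow> 0"
proof -
  define r where "r n = prob (Bx n) / measure \<nu> (Bx n)" for n
  define a where "a n = (\<integral>y. indicator (Bx n) y * G n y \<partial>\<mu>)" for n
  define b where "b n = (\<integral>y. indicator (Bx n) y * G n y \<partial>\<nu>)" for n
  define \<beta> where "\<beta> n = b n / measure \<nu> (Bx n)" for n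
  have r: "r \<longlonglongrightarrow> h x" unfolding r_def by (rule measure_ratio)
  have d: "(\<lambda>n. (a n - h x * b n) / measure \<nu> (Bx n)) \<longlonglongrightarrow> 0"
    unfolding a_def b_def by (rule measure_comparison[OF G G01])
  have b01: "\<bar>\<beta> n\<bar> \<le> 1" if n: "1 \<le> n" for n
  proof -
    note [measurable] = G
    have "0 \<le> b n" unfolding b_def using G01 by (intro integral_nonneg_AE AE_I2) auto
    moreover have "b n \<le> (\<integral>y. indicator (Bx n) y * 1 \<partial>\<nu>)"
      unfolding b_def using G01 Bx_base[OF n] by (intro integral_mono integrable_nu[of _ _ 1]) (auto split: split_indicator)
    ultimately show ?thesis using nu_Bx_pos[OF n] by (simp add: \<beta>_def)
  qed
  have "(\<lambda>n. \<beta> n * (r n - h x)) \<longlonglongrightarrow> 0"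
  proof (rule Lim_null_comparison)
    show "\<forall>\<^sub>F n in sequentially. norm (\<beta> n * (r n - h x)) \<le> \<bar>r n - h x\<bar>"
      using eventually_ge_at_top[of "1::nat"]
      by eventually_elim (simp add: abs_mult b01 mult_left_le_one_le)
    show "(\<lambda>n. \<bar>r n - h x\<bar>) \<longlonglongrightarrow> 0" using r by (simp add: LIM_zero tendsto_rabs_zero)
  qed
  then have "(\<lambda>n. ((a n - h x * b n) / measure \<nu> (Bx n) - \<beta> n * (r n - h x)) / r n) \<longlonglongrightarrow> (0 - 0) / h x"
    using h_pos[OF x] by (intro tendsto_intros d r) auto
  moreover have "\<forall>\<^sub>F n in sequentially. ((a n - h x * b n) / measure \<nu> (Bx n) - \<beta> n * (r n - h x)) / r n
      = a n / prob (Bx n) - b n / measure \<nu> (Bx n)"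
    using eventually_ge_at_top[of "1::nat"]
  proof eventually_elim
    case (elim n)
    have m: "0 < measure \<nu> (Bx n)" by (rule nu_Bx_pos[OF elim])
    have "(a n - h x * b n) / measure \<nu> (Bx n) - \<beta> n * (r n - h x) = a n / measure \<nu> (Bx n) - \<beta> n * r n"
      by (simp add: \<beta>_def diff_divide_distrib algebra_simps)
    also have "\<dots> / r n = a n / prob (Bx n) - \<beta> n"
      using m mu_Bx_pos[of n] by (simp add: r_def field_simps)
    finally show ?case by (simp add: \<beta>_def)
  qed
  ultimately show ?thesis unfolding a_def b_def by (auto intro: Lim_transform_eventually)
qed

section \<open>Decoupling\<close>

abbreviation "rate n \<equiv> exp (- prob (Bx n))"

lemma rate_bounds: "0 \<le> rate n" "rate n \<le> 1" by simp_all

lemma rate_power: "1 - rate n ^ s \<le> real s * prob (Bx n)"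
proof -
  have "rate n ^ s = exp (- (real s * prob (Bx n)))" by (simp add: exp_of_nat_mult[symmetric])
  then show ?thesis using exp_ge_add_one_self[of "- (real s * prob (Bx n))"] by simp
qed

lemma hit_laplace_nu [measurable]: "hit_laplace p (Bx n) ss \<in> borel_measurable \<nu>"
  using hit_laplace_measurable[OF Bx_mu, of p n ss] by (simp add: measurable_cong_sets[OF sets_mu refl])

text \<open>Unless the step enters \<open>Bx n\<close>, which has probability
  \<open>prob (Bx n)\<close>, the value changes by at most \<open>1 - rate n ^ s\<close>, hence by
  at most \<open>s * prob (Bx n)\<close>.\<close>

lemma hit_laplace_invariant:
  "(\<lambda>n. \<integral>y. \<bar>hit_laplace (rate n) (Bx n) (s # ss) (shift y) - hit_laplace (rate n) (Bx n) (s # ss) y\<bar> \<partial>\<mu>) \<longlonglongrightarrow> 0"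
proof (rule tendsto_sandwich[of "\<lambda>_. 0" _ _ "\<lambda>n. (real s + 1) * prob (Bx n)"])
  let ?F = "\<lambda>n. hit_laplace (rate n) (Bx n) (s # ss)"
  have "(\<integral>y. \<bar>?F n (shift y) - ?F n y\<bar> \<partial>\<mu>) \<le> (real s + 1) * prob (Bx n)" for n
  proof -
    have "(\<integral>y. \<bar>?F n (shift y) - ?F n y\<bar> \<partial>\<mu>) \<le> (\<integral>y. real s * prob (Bx n) + indicator (Bx n) (shift y) \<partial>\<mu>)"
    proof (rule integral_mono')
      show "integrable \<mu> (\<lambda>y. real s * prob (Bx n) + indicator (Bx n) (shift y))"
        by (intro integrable_const_bound[of _ "real s * prob (Bx n) + 1"] AE_I2)
          (auto split: split_indicator)
      fix y
      show "\<bar>?F n (shift y) - ?F n y\<bar> \<le> real s * prob (Bx n) + indicator (Bx n) (shift y)"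
      proof (cases "shift y \<in> Bx n")
        case True
        have "\<bar>?F n (shift y) - ?F n y\<bar> \<le> 1"
          using hit_laplace_bounds[OF rate_bounds[of n], of "Bx n" "s # ss" y]
            hit_laplace_bounds[OF rate_bounds[of n], of "Bx n" "s # ss" "shift y"] by (simp only: abs_le_iff) linarith
        moreover have "0 \<le> real s * prob (Bx n)" by simp
        ultimately have "\<bar>?F n (shift y) - ?F n y\<bar> \<le> real s * prob (Bx n) + 1" by linarith
        then show ?thesis using True by (simp del: hit_laplace.simps)
      next
        case False
        then show ?thesis using hit_laplace_T[OF False rate_bounds[of n], of "s # ss"] rate_power[of n s]
          by (simp del: hit_laplace.simps)
      qed
    qed simp
    also have "\<dots> = real s * prob (Bx n) + (\<integral>y. indicator (Bx n) (shift y) \<partial>\<mu>)"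
      by (subst Bochner_Integration.integral_add) (auto intro!: integrable_const_bound[of _ 1] split: split_indicator)
    also have "(\<integral>y. indicator (Bx n) (shift y) \<partial>\<mu>) = (\<integral>y. indicator (Bx n) y \<partial>\<mu> :: real)"
      by (rule integral_T) measurable
    finally show ?thesis by (simp add: distrib_right del: hit_laplace.simps)
  qed
  then show "\<forall>\<^sub>F n in sequentially. (\<integral>y. \<bar>?F n (shift y) - ?F n y\<bar> \<partial>\<mu>) \<le> (real s + 1) * prob (Bx n)" by simp
  have "(\<lambda>n. (real s + 1) * prob (Bx n)) \<longlonglongrightarrow> (real s + 1) * 0" by (intro tendsto_intros mu_Bx_tendsto)
  then show "(\<lambda>n. (real s + 1) * prob (Bx n)) \<longlonglongrightarrow> 0" by simp
qed simp_all

text \<open>Without an early visit, the value at \<open>y\<close> is the value at the stopped point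
  times the power \<open>s * tau m y\<close> of \<open>rate n\<close>.\<close>

lemma hit_laplace_stopped:
  assumes "y \<in> Q" "y \<notin> early n m Q"
  shows "\<bar>hit_laplace (rate n) (Bx n) (s # ss) y - hit_laplace (rate n) (Bx n) (s # ss) (stopped m y)\<bar>
    \<le> real s * prob (Bx n) * real (tau m y)"
proof -
  let ?F = "hit_laplace (rate n) (Bx n) (s # ss)"
  have eq: "?F y = (rate n ^ s) ^ tau m y * ?F (stopped m y)"
    unfolding stopped_def using assms by (intro hit_laplace_T_pow) (auto simp: early_def)
  have p: "0 \<le> (rate n ^ s) ^ tau m y" "(rate n ^ s) ^ tau m y \<le> 1"
    using rate_bounds[of n] by (auto intro!: power_le_one zero_le_power)
  have "\<bar>?F y - ?F (stopped m y)\<bar> = (1 - (rate n ^ s) ^ tau m y) * ?F (stopped m y)"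
  proof -
    have "?F (stopped m y) - ?F y = (1 - (rate n ^ s) ^ tau m y) * ?F (stopped m y)"
      unfolding eq by (simp add: left_diff_distrib del: hit_laplace.simps)
    moreover have "0 \<le> (1 - (rate n ^ s) ^ tau m y) * ?F (stopped m y)"
      by (rule mult_nonneg_nonneg[OF _ hit_laplace_bounds(1)[OF rate_bounds]]) (use p in simp)
    ultimately show ?thesis by linarith
  qed
  also have "\<dots> \<le> (1 - (rate n ^ s) ^ tau m y) * 1"
    by (rule mult_left_mono[OF hit_laplace_bounds(2)[OF rate_bounds]]) (use p in simp)
  also have "\<dots> \<le> real s * prob (Bx n) * real (tau m y)"
    using rate_power[of n "s * tau m y"] by (simp add: power_mult[symmetric] mult_ac)
  finally show ?thesis .
qed

text \<open>Three errors enter: early visits, the time \<open>tau\<close> lost before stopping, and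
  the comparison at the stopped point. The hypotheses on \<open>G\<close> are preserved by passing
  to \<open>1 - G\<close>, so this upper bound also yields the lower one.\<close>

lemma decouple_upper:
  fixes G :: "nat \<Rightarrow> (nat \<Rightarrow> 'v) \<Rightarrow> real"
  assumes Q: "\<And>n. determined (n + q) (Q n)" "\<And>n. Q n \<subseteq> Bx n"
    and star: "\<And>j. 1 \<le> j \<Longrightarrow> \<forall>\<^sub>F n in sequentially. \<forall>y\<in>Q n. (shift ^^ j) y \<notin> Bx n"
    and G [measurable]: "\<And>n. G n \<in> borel_measurable \<nu>" and G01: "\<And>n y. 0 \<le> G n y \<and> G n y \<le> 1"
    and inv: "(\<lambda>n. \<integral>y. \<bar>G n (shift y) - G n y\<bar> \<partial>\<mu>) \<longlonglongrightarrow> 0"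
    and stop: "\<And>n y. y \<in> Q n \<Longrightarrow> y \<notin> early n (n + q) (Q n) \<Longrightarrow>
      \<bar>G n y - G n (stopped (n + q) y)\<bar> \<le> real s * prob (Bx n) * real (tau (n + q) y)"
    and e: "0 < e"
  shows "\<forall>\<^sub>F n in sequentially. (\<integral>y. indicator (Q n) y * G n y \<partial>\<nu>) / measure \<nu> (Bx n)
    \<le> measure \<nu> (Q n) / measure \<nu> (Bx n) * (\<integral>y. G n y \<partial>\<mu>) + e"
proof -
  \<comment> \<open>The factor \<open>h x + 1\<close> bounds
    \<open>prob (Bx n) / measure \<nu> (Bx n)\<close> for large \<open>n\<close>, and this ratio
    multiplies the integral of \<open>tau\<close>.\<close>
  define d where "d = e / (3 + real s * (h x + 1))"
  have hx: "0 < h x" by (rule h_pos[OF x])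
  have pos: "0 < 3 + real s * (h x + 1)" using hx by (simp add: add_pos_nonneg)
  have d: "0 < d" using e pos by (simp add: d_def)
  have d_sum: "d + d + real s * (h x + 1) * d \<le> e"
  proof -
    have "(3 + real s * (h x + 1)) * d = e" using pos by (simp add: d_def)
    then show ?thesis using d by (simp add: algebra_simps)
  qed
  have ev_early: "\<forall>\<^sub>F n in sequentially. measure \<nu> (early n (n + q) (Q n)) / measure \<nu> (Bx n) < d"
    by (rule order_tendstoD[OF early_small[OF Q star]]) (use d in auto)
  have ev_ratio: "\<forall>\<^sub>F n in sequentially. prob (Bx n) / measure \<nu> (Bx n) < h x + 1"
    by (rule order_tendstoD[OF measure_ratio]) simp
  show ?thesis
    using stopped_upper[OF G G01 inv d] ev_early ev_ratio tau_small[OF d, of q] eventually_ge_at_top[of "1::nat"]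
  proof eventually_elim
    case (elim n)
    let ?m = "n + q" and ?E = "early n (n + q) (Q n)"
    have m: "1 \<le> ?m" using elim(5) by simp
    note [measurable] = determined_sets[OF Q(1)[of n]]
    have base: "Q n \<subseteq> base" "?E \<subseteq> base" using Q(2)[of n] Bx_base[OF elim(5)] by (auto simp: early_def)
    have a0: "0 \<le> (\<integral>y. G n y \<partial>\<mu>)" using G01 by simp
    have "ennreal (\<integral>y. indicator (Q n) y * G n y \<partial>\<nu>) = (\<integral>\<^sup>+ y. ennreal (indicator (Q n) y * G n y) \<partial>\<nu>)"
      using G01 by (intro nn_integral_eq_integral[symmetric] integrable_nu[OF _ _ base(1), of _ 1] AE_I2) auto
    also have "\<dots> \<le> (\<integral>\<^sup>+ y. (indicator (Q n) y * ennreal (G n (stopped ?m y)) + indicator ?E y)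
        + ennreal (real s * prob (Bx n)) * (indicator (Bx n) y * of_nat (tau ?m y)) \<partial>\<nu>)"
    proof (rule nn_integral_mono)
      fix y assume "y \<in> space \<nu>"
      show "ennreal (indicator (Q n) y * G n y) \<le> (indicator (Q n) y * ennreal (G n (stopped ?m y)) + indicator ?E y)
        + ennreal (real s * prob (Bx n)) * (indicator (Bx n) y * of_nat (tau ?m y))"
      proof (cases "y \<in> Q n")
        case yQ: True
        show ?thesis
        proof (cases "y \<in> ?E")
          case True
          have "ennreal (G n y) \<le> 1" using G01 by (simp add: ennreal_le_1)
          then show ?thesis using yQ True by (simp add: add_increasing add_increasing2)
        next
          case False
          have "G n y \<le> G n (stopped ?m y) + real s * prob (Bx n) * real (tau ?m y)"
            using stop[OF yQ False] by linarith
          then have "ennreal (G n y) \<le> ennreal (G n (stopped ?m y) + real s * prob (Bx n) * real (tau ?m y))"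
            by (rule ennreal_leI)
          also have "\<dots> = ennreal (G n (stopped ?m y)) + ennreal (real s * prob (Bx n)) * of_nat (tau ?m y)"
            using G01 by (simp add: ennreal_plus ennreal_mult ennreal_of_nat_eq_real_of_nat)
          finally show ?thesis using yQ False subsetD[OF Q(2) yQ] by simp
        qed
      qed simp
    qed
    also have "\<dots> = (\<integral>\<^sup>+ y. indicator (Q n) y * ennreal (G n (stopped ?m y)) \<partial>\<nu>) + emeasure \<nu> ?E
        + ennreal (real s * prob (Bx n)) * (\<integral>\<^sup>+ y. indicator (Bx n) y * of_nat (tau ?m y) \<partial>\<nu>)"
      by (simp add: nn_integral_add nn_integral_cmult)
    also have "\<dots> \<le> ennreal (measure \<nu> (Q n) * ((\<integral>y. G n y \<partial>\<mu>) + d)) + ennreal (measure \<nu> ?E)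
        + ennreal (real s * prob (Bx n)) * ennreal d"
      using elim(1)[rule_format, OF m Q(1) base(1)] elim(4) base(2)
      by (intro add_mono mult_left_mono) (simp_all add: emeasure_nu)
    also have "\<dots> = ennreal (measure \<nu> (Q n) * ((\<integral>y. G n y \<partial>\<mu>) + d) + measure \<nu> ?E + real s * prob (Bx n) * d)"
      using a0 d by (simp add: ennreal_mult[symmetric] ennreal_plus[symmetric] del: ennreal_plus)
    finally have "(\<integral>y. indicator (Q n) y * G n y \<partial>\<nu>) \<le> measure \<nu> (Q n) * ((\<integral>y. G n y \<partial>\<mu>) + d) + measure \<nu> ?E + real s * prob (Bx n) * d"
      using a0 d by (subst (asm) ennreal_le_iff) auto
    then have "(\<integral>y. indicator (Q n) y * G n y \<partial>\<nu>) / measure \<nu> (Bx n)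
        \<le> (measure \<nu> (Q n) * ((\<integral>y. G n y \<partial>\<mu>) + d) + measure \<nu> ?E + real s * prob (Bx n) * d) / measure \<nu> (Bx n)"
      by (rule divide_right_mono) simp
    also have "\<dots> = measure \<nu> (Q n) / measure \<nu> (Bx n) * (\<integral>y. G n y \<partial>\<mu>) + (measure \<nu> (Q n) / measure \<nu> (Bx n) * d
        + measure \<nu> ?E / measure \<nu> (Bx n) + real s * (prob (Bx n) / measure \<nu> (Bx n)) * d)"
      by (simp add: add_divide_distrib distrib_left)
    also have "\<dots> \<le> measure \<nu> (Q n) / measure \<nu> (Bx n) * (\<integral>y. G n y \<partial>\<mu>) + (1 * d + d + real s * (h x + 1) * d)"
    proof (intro add_left_mono add_mono mult_right_mono)
      have "measure \<nu> (Q n) \<le> measure \<nu> (Bx n)" using Q(2)[of n] Bx_base[OF elim(5)] by (intro nu_mono) auto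
      then show "measure \<nu> (Q n) / measure \<nu> (Bx n) \<le> 1" using nu_Bx_pos[OF elim(5)] by simp
      show "real s * (prob (Bx n) / measure \<nu> (Bx n)) \<le> real s * (h x + 1)"
        using elim(3) by (intro mult_left_mono) auto
    qed (use elim(2) d in auto)
    also have "\<dots> \<le> measure \<nu> (Q n) / measure \<nu> (Bx n) * (\<integral>y. G n y \<partial>\<mu>) + e" using d_sum by simp
    finally show ?case .
  qed
qed

end

context rpf_point
begin

section \<open>Neighbourhoods of a periodic point\<close>

lemma birkhoff_add: "birkhoff \<phi> (m + n) y = birkhoff \<phi> m y + birkhoff \<phi> n ((shift ^^ m) y)"
proof (induction m arbitrary: y)
  case (Suc m)
  then show ?case by (simp add: birkhoff_Suc funpow_swap1)
qed (simp add: birkhoff_def)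

text \<open>For the prime period \<open>q\<close> this is \<open>1 - \<theta>\<close>, the limiting
  fraction of \<open>Bx n\<close> that follows \<open>x\<close> for one more period
  (\<open>loop_ratio\<close>).\<close>

definition loop_weight :: "nat \<Rightarrow> real" where "loop_weight q = weight (map x [0..<q]) x"

lemma loop_weight_eq:
  assumes "(shift ^^ q) x = x"
  shows "loop_weight q = exp (birkhoff \<phi> q x - real q * real_of_ereal (gurevich_pressure A \<phi>))"
proof -
  have "cat (map x [0..<q]) x = x"
    using cylinder_cat[OF x_Bx[of q]] assms by simp
  then show ?thesis
    by (simp add: loop_weight_def weight_def gurevich_eigenvalue_def exp_diff exp_of_nat_mult)
qed

lemma loop_pow: "(shift ^^ q) x = x \<Longrightarrow> (shift ^^ (k * q)) x = x"
  by (induction k) (simp_all add: funpow_add)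

lemma loop_weight_pow:
  assumes "(shift ^^ q) x = x"
  shows "loop_weight (k * q) = loop_weight q ^ k"
proof -
  have "birkhoff \<phi> (k * q) x = real k * birkhoff \<phi> q x"
  proof (induction k)
    case (Suc k)
    then show ?case by (simp add: birkhoff_add assms distrib_right)
  qed (simp add: birkhoff_def)
  then show ?thesis
    by (simp add: loop_weight_eq assms loop_pow[OF assms] exp_of_nat_mult[symmetric] right_diff_distrib)
qed

text \<open>Since \<open>x\<close> has period \<open>q\<close>, the points of
  \<open>Bx (n + q)\<close> are exactly the \<open>cat w z\<close> with \<open>w\<close> the first
  \<open>q\<close> symbols of \<open>x\<close> and \<open>z\<close> in \<open>Bx n\<close>; the rest
  is \<open>conformal\<close>.\<close>

lemma loop_integral:
  assumes per: "(shift ^^ q) x = x" and q: "1 \<le> q" and n: "1 \<le> n" and g [measurable]: "g \<in> borel_measurable \<nu>"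
  shows "(\<integral>\<^sup>+ y. indicator (Bx (n + q)) y * g ((shift ^^ q) y) \<partial>\<nu>)
    = (\<integral>\<^sup>+ z. indicator (Bx n) z * (ennreal (weight (map x [0..<q]) z) * g z) \<partial>\<nu>)"
proof -
  let ?w = "map x [0..<q]"
  let ?f = "\<lambda>y. indicator (Bx (n + q)) y * g ((shift ^^ q) y)"
  have w: "?w \<noteq> []" "admissible A ?w" using q admissible_map[OF x] by auto
  have xq: "x (q + i) = x i" for i using fun_cong[OF per, of i] by (simp add: shift_pow)
  have last: "last ?w = x (q - 1)" using q by (simp add: last_map)
  have edge: "A (x (q - 1)) (x 0)"
    using x q xq[of 0] unfolding tms_def by (metis (mono_tags, lifting) Suc_diff_1 add_0_right less_eq_Suc_le mem_Collect_eq One_nat_def)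
  have "(\<integral>\<^sup>+ y. ?f y \<partial>\<nu>) = (\<integral>\<^sup>+ y. ?f y * indicator (Bx q) y \<partial>\<nu>)"
    using Bx_mono[of q "n + q"] by (intro nn_integral_cong) (auto split: split_indicator)
  also have "\<dots> = (\<integral>\<^sup>+ z. (if A (last ?w) (z 0) then ennreal (weight ?w z) * ?f (cat ?w z) else 0) \<partial>\<nu>)"
    by (rule conformal[OF w]) measurable
  also have "\<dots> = (\<integral>\<^sup>+ z. indicator (Bx n) z * (ennreal (weight ?w z) * g z) \<partial>\<nu>)"
  proof (rule nn_integral_cong)
    fix z assume "z \<in> space \<nu>"
    then have z: "z \<in> tms A" by simp
    have sh: "(shift ^^ q) (cat ?w z) = z" using shift_pow_cat[of ?w z] by simp
    show "(if A (last ?w) (z 0) then ennreal (weight ?w z) * ?f (cat ?w z) else 0)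
        = indicator (Bx n) z * (ennreal (weight ?w z) * g z)"
    proof (cases "z \<in> Bx n")
      case True
      have "z 0 = x 0" using True n by (auto simp: mem_cylinder_map)
      then have A: "A (last ?w) (z 0)" using edge last by simp
      have "cat ?w z i = x i" if "i < n + q" for i
      proof (cases "i < q")
        case False
        then have "z (i - q) = x (i - q)" using True that by (simp add: mem_cylinder_map)
        then show ?thesis using xq[of "i - q"] False by (simp add: cat_def)
      qed (simp add: cat_def)
      then have "cat ?w z \<in> Bx (n + q)" using cat_tms[OF w A z] by (simp add: mem_cylinder_map)
      then show ?thesis using True A sh by simp
    next
      case False
      have "cat ?w z \<notin> Bx (n + q)"
      proof
        assume *: "cat ?w z \<in> Bx (n + q)"
        have "z i = x i" if "i < n" for i
        proof -
          have "cat ?w z (q + i) = x (q + i)" using * that by (simp add: mem_cylinder_map)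
          then show ?thesis by (simp add: cat_def xq)
        qed
        then show False using False z by (simp add: mem_cylinder_map)
      qed
      then show ?thesis using False by simp
    qed
  qed
  finally show ?thesis .
qed

text \<open>All \<open>z\<close> in \<open>Bx n\<close> agree with \<open>x\<close> on
  \<open>n\<close> symbols, so the weights at \<open>z\<close> and at \<open>x\<close> differ at
  most by the factor \<open>exp (W n)\<close>, which tends to 1.\<close>

lemma loop_bounds:
  fixes g :: "(nat \<Rightarrow> 'v) \<Rightarrow> real"
  assumes per: "(shift ^^ q) x = x" and q: "1 \<le> q" and n: "1 \<le> n" and g [measurable]: "g \<in> borel_measurable \<nu>"
    and g01: "\<And>y. 0 \<le> g y \<and> g y \<le> 1"
  defines "I \<equiv> \<integral>y. indicator (Bx n) y * g y \<partial>\<nu>" and "I' \<equiv> \<integral>y. indicator (Bx (n + q)) y * g ((shift ^^ q) y) \<partial>\<nu>"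
  shows "I' \<le> exp (W n) * loop_weight q * I" "loop_weight q * I \<le> exp (W n) * I'"
proof -
  let ?w = "map x [0..<q]"
  have w: "?w \<noteq> []" "admissible A ?w" using q admissible_map[OF x] by auto
  have xq: "x (q + i) = x i" for i using fun_cong[OF per, of i] by (simp add: shift_pow)
  have edge: "A (last ?w) (x 0)"
    using x q xq[of 0] unfolding tms_def by (simp add: last_map) (metis Suc_diff_1 add_0_right less_eq_Suc_le One_nat_def)
  have dist: "weight ?w z \<le> exp (W n) * loop_weight q" "loop_weight q \<le> exp (W n) * weight ?w z" if z: "z \<in> Bx n" for z
  proof -
    have *: "z \<in> tms A" "\<forall>i<n. z i = x i" using z by (auto simp: mem_cylinder_map)
    show "weight ?w z \<le> exp (W n) * loop_weight q"
      unfolding loop_weight_def using * n edge x by (intro weight_distortion[OF w n]) auto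
    show "loop_weight q \<le> exp (W n) * weight ?w z"
      unfolding loop_weight_def using * n edge x by (intro weight_distortion[OF w n]) auto
  qed
  have m: "0 < loop_weight q" unfolding loop_weight_def by (rule weight_pos)
  have eq: "(\<integral>\<^sup>+ y. indicator (Bx n) y * ennreal (g y) \<partial>\<nu>) = ennreal I"
  proof -
    have "(\<integral>\<^sup>+ y. ennreal (indicator (Bx n) y * g y) \<partial>\<nu>) = ennreal I"
      unfolding I_def using g01 Bx_base[OF n] by (intro nn_integral_eq_integral integrable_nu[of _ _ 1]) auto
    then show ?thesis using g01 by (simp add: ennreal_mult ennreal_indicator)
  qed
  have eq': "(\<integral>\<^sup>+ y. indicator (Bx (n + q)) y * ennreal (g ((shift ^^ q) y)) \<partial>\<nu>) = ennreal I'"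
  proof -
    have "(\<integral>\<^sup>+ y. ennreal (indicator (Bx (n + q)) y * g ((shift ^^ q) y)) \<partial>\<nu>) = ennreal I'"
      unfolding I'_def using g01 Bx_base[of "n + q"] n by (intro nn_integral_eq_integral integrable_nu[of _ _ 1]) auto
    then show ?thesis using g01 by (simp add: ennreal_mult ennreal_indicator)
  qed
  have I0: "0 \<le> I" "0 \<le> I'" unfolding I_def I'_def using g01 by (auto intro!: integral_nonneg_AE AE_I2)
  have L: "ennreal I' = (\<integral>\<^sup>+ z. indicator (Bx n) z * (ennreal (weight ?w z) * ennreal (g z)) \<partial>\<nu>)"
    unfolding eq'[symmetric] by (rule loop_integral[OF per q n]) measurable
  have "ennreal I' \<le> (\<integral>\<^sup>+ z. ennreal (exp (W n) * loop_weight q) * (indicator (Bx n) z * ennreal (g z)) \<partial>\<nu>)"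
    unfolding L using dist(1) by (intro nn_integral_mono) (auto split: split_indicator intro!: mult_right_mono ennreal_leI)
  also have "\<dots> = ennreal (exp (W n) * loop_weight q * I)"
    using m I0 by (simp add: nn_integral_cmult eq ennreal_mult)
  finally show "I' \<le> exp (W n) * loop_weight q * I" using m I0 by (subst (asm) ennreal_le_iff) auto
  have "ennreal (exp (- W n) * loop_weight q * I) = (\<integral>\<^sup>+ z. ennreal (exp (- W n) * loop_weight q) * (indicator (Bx n) z * ennreal (g z)) \<partial>\<nu>)"
    using m I0 by (simp add: nn_integral_cmult eq ennreal_mult)
  also have "\<dots> \<le> ennreal I'"
  proof -
    have "exp (- W n) * loop_weight q \<le> weight ?w z" if "z \<in> Bx n" for z
      using dist(2)[OF that] by (simp add: exp_minus field_simps)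
    then show ?thesis
      unfolding L by (intro nn_integral_mono) (auto split: split_indicator intro!: mult_right_mono ennreal_leI)
  qed
  finally have "exp (- W n) * loop_weight q * I \<le> I'" using I0 by (subst (asm) ennreal_le_iff) auto
  then show "loop_weight q * I \<le> exp (W n) * I'" by (simp add: exp_minus field_simps)
qed

text \<open>Otherwise the measures of the cylinders \<open>Bx (1 + Suc k * q)\<close> would stay
  above a positive constant although they shrink to a point of measure 0. This is what gives
  \<open>0 < \<theta>\<close>.\<close>

lemma loop_weight_less_1:
  assumes per: "(shift ^^ q) x = x" and q: "1 \<le> q"
  shows "loop_weight q < 1"
proof (rule ccontr)
  assume "\<not> loop_weight q < 1"
  then have u: "1 \<le> loop_weight q" by simp
  have "measure \<nu> (Bx 1) / exp (W 1) \<le> measure \<nu> (Bx (1 + Suc k * q))" for k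
  proof -
    have "loop_weight (Suc k * q) * (\<integral>y. indicator (Bx 1) y * 1 \<partial>\<nu>)
        \<le> exp (W 1) * (\<integral>y. indicator (Bx (1 + Suc k * q)) y * 1 \<partial>\<nu>)"
      using q by (intro loop_bounds(2)[OF loop_pow[OF per], of "Suc k" 1 "\<lambda>_. 1"]) auto
    then have "loop_weight q ^ Suc k * measure \<nu> (Bx 1) \<le> exp (W 1) * measure \<nu> (Bx (1 + Suc k * q))"
      unfolding loop_weight_pow[OF per] by simp
    moreover have "1 * measure \<nu> (Bx 1) \<le> loop_weight q ^ Suc k * measure \<nu> (Bx 1)"
      using u by (intro mult_right_mono one_le_power) auto
    ultimately show ?thesis by (simp add: field_simps)
  qed
  moreover have "(\<lambda>k. measure \<nu> (Bx (1 + Suc k * q))) \<longlonglongrightarrow> 0"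
  proof (rule LIMSEQ_subseq_LIMSEQ[OF nu_Bx_tendsto, unfolded comp_def])
    show "strict_mono (\<lambda>k. 1 + Suc k * q)" using q by (simp add: strict_mono_Suc_iff)
  qed
  ultimately have "measure \<nu> (Bx 1) / exp (W 1) \<le> 0" by (intro LIMSEQ_le_const) auto
  then show False using nu_Bx_pos[of 1] by (simp add: field_simps)
qed

lemma loop_limit:
  fixes G :: "nat \<Rightarrow> (nat \<Rightarrow> 'v) \<Rightarrow> real"
  assumes per: "(shift ^^ q) x = x" and q: "1 \<le> q" and G [measurable]: "\<And>n. G n \<in> borel_measurable \<nu>"
    and G01: "\<And>n y. 0 \<le> G n y \<and> G n y \<le> 1"
  shows "(\<lambda>n. ((\<integral>y. indicator (Bx (n + q)) y * G n ((shift ^^ q) y) \<partial>\<nu>)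
    - loop_weight q * (\<integral>y. indicator (Bx n) y * G n y \<partial>\<nu>)) / measure \<nu> (Bx n)) \<longlonglongrightarrow> 0"
proof (rule Lim_null_comparison)
  have "(\<lambda>n. (exp (W n) - 1) * (loop_weight q + 1)) \<longlonglongrightarrow> (exp 0 - 1) * (loop_weight q + 1)"
    by (intro tendsto_intros W_tendsto)
  then show "(\<lambda>n. (exp (W n) - 1) * (loop_weight q + 1)) \<longlonglongrightarrow> 0" by simp
  show "\<forall>\<^sub>F n in sequentially. norm (((\<integral>y. indicator (Bx (n + q)) y * G n ((shift ^^ q) y) \<partial>\<nu>)
      - loop_weight q * (\<integral>y. indicator (Bx n) y * G n y \<partial>\<nu>)) / measure \<nu> (Bx n)) \<le> (exp (W n) - 1) * (loop_weight q + 1)"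
    using eventually_ge_at_top[of "1::nat"]
  proof eventually_elim
    case (elim n)
    define I where "I = (\<integral>y. indicator (Bx n) y * G n y \<partial>\<nu>)"
    define I' where "I' = (\<integral>y. indicator (Bx (n + q)) y * G n ((shift ^^ q) y) \<partial>\<nu>)"
    have b: "I' \<le> exp (W n) * loop_weight q * I" "loop_weight q * I \<le> exp (W n) * I'"
      unfolding I_def I'_def by (rule loop_bounds[OF per q elim G G01])+
    have m: "0 < loop_weight q" unfolding loop_weight_def by (rule weight_pos)
    have E: "0 \<le> exp (W n) - 1" using W_nonneg by simp
    have base: "Bx n \<subseteq> base" "Bx (n + q) \<subseteq> base" using elim by (auto intro!: Bx_base)
    have i: "integrable \<nu> (\<lambda>y. indicator (Bx n) y * 1 :: real)" by (rule integrable_nu[OF _ _ base(1), of _ 1]) auto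
    have "I \<le> (\<integral>y. indicator (Bx n) y * 1 \<partial>\<nu>)"
      unfolding I_def using G01 base(1) by (intro integral_mono i integrable_nu[of _ _ 1]) (auto split: split_indicator)
    then have I: "I \<le> measure \<nu> (Bx n)" by simp
    have "I' \<le> (\<integral>y. indicator (Bx n) y * 1 \<partial>\<nu>)"
      unfolding I'_def using G01 base Bx_mono[of n "n + q"]
      by (intro integral_mono i integrable_nu[of _ _ 1]) (auto split: split_indicator)
    then have I': "I' \<le> measure \<nu> (Bx n)" by simp
    have "I' - loop_weight q * I \<le> (exp (W n) - 1) * (loop_weight q * I)"
      using b(1) by (simp add: algebra_simps)
    also have "\<dots> \<le> (exp (W n) - 1) * (loop_weight q * measure \<nu> (Bx n))"
      using I m E by (intro mult_left_mono) auto
    finally have 1: "I' - loop_weight q * I \<le> (exp (W n) - 1) * (loop_weight q * measure \<nu> (Bx n))" .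
    have "loop_weight q * I - I' \<le> (exp (W n) - 1) * I'"
      using b(2) by (simp add: algebra_simps)
    also have "\<dots> \<le> (exp (W n) - 1) * measure \<nu> (Bx n)"
      using I' E by (intro mult_left_mono) auto
    finally have 2: "loop_weight q * I - I' \<le> (exp (W n) - 1) * measure \<nu> (Bx n)" .
    have "0 \<le> (exp (W n) - 1) * measure \<nu> (Bx n)" "0 \<le> (exp (W n) - 1) * (loop_weight q * measure \<nu> (Bx n))"
      using E m by auto
    with 1 2 have "\<bar>I' - loop_weight q * I\<bar> \<le> (exp (W n) - 1) * (loop_weight q + 1) * measure \<nu> (Bx n)"
      unfolding abs_le_iff distrib_left distrib_right by (simp add: mult.assoc)
    then show ?case unfolding I_def[symmetric] I'_def[symmetric] using nu_Bx_pos[OF elim] by (simp add: pos_divide_le_eq)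
  qed
qed

lemma loop_ratio:
  assumes per: "(shift ^^ q) x = x" and q: "1 \<le> q"
  shows "(\<lambda>n. measure \<nu> (Bx (n + q)) / measure \<nu> (Bx n)) \<longlonglongrightarrow> loop_weight q"
proof -
  have "(\<lambda>n. (measure \<nu> (Bx (n + q)) - loop_weight q * measure \<nu> (Bx n)) / measure \<nu> (Bx n)) \<longlonglongrightarrow> 0"
    using loop_limit[OF per q, of "\<lambda>_ _. 1"] by simp
  then have "(\<lambda>n. (measure \<nu> (Bx (n + q)) - loop_weight q * measure \<nu> (Bx n)) / measure \<nu> (Bx n) + loop_weight q) \<longlonglongrightarrow> 0 + loop_weight q"
    by (intro tendsto_intros)
  moreover have "\<forall>\<^sub>F n in sequentially. (measure \<nu> (Bx (n + q)) - loop_weight q * measure \<nu> (Bx n)) / measure \<nu> (Bx n) + loop_weight q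
      = measure \<nu> (Bx (n + q)) / measure \<nu> (Bx n)"
    using eventually_ge_at_top[of "1::nat"]
    by eventually_elim (use nu_Bx_pos in \<open>force simp: diff_divide_distrib\<close>)
  ultimately show ?thesis by (auto intro: Lim_transform_eventually)
qed

text \<open>Agreement of \<open>x\<close> with its shift by \<open>j\<close> on one full period
  extends to all indices; then the shift by \<open>j mod q\<close> fixes \<open>x\<close>, and
  minimality of \<open>q\<close> forces \<open>j mod q = 0\<close>.\<close>

lemma prime_period_dvd:
  assumes p: "prime_period x q" and j: "\<And>i. i < q \<Longrightarrow> x (j + i) = x i"
  shows "q dvd j"
proof -
  have q: "1 \<le> q" "(shift ^^ q) x = x" using p by (auto simp: prime_period_def)
  have k: "x (k * q + i) = x i" for k i
    using fun_cong[OF loop_pow[OF q(2), of k], of i] by (simp add: shift_pow)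
  have mod: "x i = x (i mod q)" for i
    using k[of "i div q" "i mod q"] by simp
  have "x (j mod q + i) = x i" for i
  proof -
    have "x (j mod q + i) = x (j div q * q + (j mod q + i))" by (rule k[symmetric])
    also have "j div q * q + (j mod q + i) = i div q * q + (j + i mod q)"
      using div_mult_mod_eq[of j q] div_mult_mod_eq[of i q] by linarith
    also have "x \<dots> = x (j + i mod q)" by (rule k)
    also have "\<dots> = x (i mod q)" using q by (intro j) simp
    finally show ?thesis using mod[of i] by simp
  qed
  then have "(shift ^^ (j mod q)) x = x" by (simp add: fun_eq_iff shift_pow)
  moreover have "j mod q < q" using q by simp
  ultimately have "j mod q = 0" using p unfolding prime_period_def by (metis One_nat_def Suc_leI neq0_conv)
  then show ?thesis by (simp add: mod_eq_0_iff_dvd)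
qed

lemma escape_aperiodic:
  assumes "\<not> is_periodic x" "1 \<le> j"
  shows "\<forall>\<^sub>F n in sequentially. \<forall>y\<in>Bx n. (shift ^^ j) y \<notin> Bx n"
proof -
  obtain i where i: "x (j + i) \<noteq> x i"
    using assms by (auto simp: is_periodic_def fun_eq_iff shift_pow)
  show ?thesis
    using eventually_gt_at_top[of "j + i"]
  proof eventually_elim
    case (elim n)
    show ?case
    proof (intro ballI notI)
      fix y assume y: "y \<in> Bx n" "(shift ^^ j) y \<in> Bx n"
      have "y (j + i) = x (j + i)" using y(1) elim by (simp add: mem_cylinder_map)
      moreover have "y (j + i) = x i" using y(2) elim by (simp add: mem_cylinder_map shift_pow)
      ultimately show False using i by simp
    qed
  qed
qed

text \<open>Once \<open>n \<ge> j + q\<close>, a visit at time \<open>j\<close> makes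
  \<open>x\<close> agree with its shift by \<open>j\<close> on a full period, so \<open>q\<close>
  divides \<open>j\<close>. Then the copy of the word that starts at \<open>j\<close> continues
  \<open>x\<close> beyond \<open>n\<close>, up to \<open>n + q\<close>, which was excluded.\<close>

lemma escape_periodic:
  assumes p: "prime_period x q" and j: "1 \<le> j"
  shows "\<forall>\<^sub>F n in sequentially. \<forall>y\<in>Bx n - Bx (n + q). (shift ^^ j) y \<notin> Bx n"
  using eventually_ge_at_top[of "j + q"]
proof eventually_elim
  case (elim n)
  have per: "(shift ^^ q) x = x" using p by (simp add: prime_period_def)
  show ?case
  proof (intro ballI notI)
    fix y assume y: "y \<in> Bx n - Bx (n + q)" "(shift ^^ j) y \<in> Bx n"
    have y1: "y i = x i" if "i < n" for i using y that by (simp add: mem_cylinder_map)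
    have y2: "y (j + i) = x i" if "i < n" for i using y that by (simp add: mem_cylinder_map shift_pow)
    have "q dvd j"
    proof (rule prime_period_dvd[OF p])
      fix i assume "i < q"
      then show "x (j + i) = x i" using y1[of "j + i"] y2[of i] elim by simp
    qed
    then obtain k where k: "j = k * q" by (metis dvd_def mult.commute)
    have "q \<le> j" using k j by (cases k) auto
    have "y i = x i" if i: "i < n + q" for i
    proof (cases "i < n")
      case False
      then have "y (j + (i - j)) = x (i - j)" using i \<open>q \<le> j\<close> elim by (intro y2) linarith
      also have "x (i - j) = x (j + (i - j))"
        using fun_cong[OF loop_pow[OF per, of k], of "i - j"] by (simp add: shift_pow k)
      finally show ?thesis using False elim by simp
    qed (rule y1)
    then have "y \<in> Bx (n + q)" using y by (simp add: mem_cylinder_map)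
    then show False using y by simp
  qed
qed

text \<open>The first return happens exactly at time \<open>q\<close>: by
  \<open>prime_period_dvd\<close> an earlier return time would be a multiple of
  \<open>q\<close>.\<close>

lemma hit_laplace_loop:
  assumes p: "prime_period x q" and n: "q \<le> n" and y: "y \<in> Bx (n + q)"
  shows "hit_laplace r (Bx n) (s # ss) y = (r ^ s) ^ q * hit_laplace r (Bx n) ss ((shift ^^ q) y)"
proof -
  have q: "1 \<le> q" "(shift ^^ q) x = x" using p by (auto simp: prime_period_def)
  have yx: "y i = x i" if "i < n + q" for i using y that by (simp add: mem_cylinder_map)
  have yt: "y \<in> tms A" using y cylinder_subset by blast
  have hit: "(shift ^^ q) y \<in> Bx n"
  proof -
    have "(shift ^^ q) y i = x i" if "i < n" for i
      using yx[of "q + i"] that fun_cong[OF q(2), of i] by (simp add: shift_pow)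
    then show ?thesis using shift_pow_tms[OF yt] by (simp add: mem_cylinder_map)
  qed
  have no: "(shift ^^ j) y \<notin> Bx n" if j: "1 \<le> j" "j < q" for j
  proof
    assume *: "(shift ^^ j) y \<in> Bx n"
    have "q dvd j"
    proof (rule prime_period_dvd[OF p])
      fix i assume "i < q"
      then show "x (j + i) = x i" using yx[of "j + i"] * j n by (simp add: mem_cylinder_map shift_pow)
    qed
    then show False using j by (auto dest: dvd_imp_le)
  qed
  have h: "hits (Bx n) y" using q hit by (auto simp: hits_def)
  have "ret (Bx n) y = q"
  proof (rule antisym)
    show "ret (Bx n) y \<le> q" by (rule ret_le[OF q(1) hit])
    show "q \<le> ret (Bx n) y"
      using no[of "ret (Bx n) y"] ret_hits[OF h] by (fastforce simp: next_hit_def not_less[symmetric])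
  qed
  then show ?thesis using h by (simp add: next_hit_def)
qed

section \<open>The recursion for the Laplace transforms\<close>

text \<open>One statement for both cases: \<open>Q n\<close> is the part of \<open>Bx n\<close> that
  escapes, \<open>\<theta>\<close> its asymptotic share, and \<open>rest\<close> describes the
  immediate returns. An aperiodic point uses \<open>q = 0\<close> and \<open>Q n = Bx n\<close>, a
  periodic one \<open>Q n = Bx n - Bx (n + q)\<close>.\<close>

lemma recursion:
  assumes Q: "\<And>n. determined (n + q) (Q n)" "\<And>n. Q n \<subseteq> Bx n"
    and star: "\<And>j. 1 \<le> j \<Longrightarrow> \<forall>\<^sub>F n in sequentially. \<forall>y\<in>Q n. (shift ^^ j) y \<notin> Bx n"
    and ratio: "(\<lambda>n. measure \<nu> (Q n) / measure \<nu> (Bx n)) \<longlonglongrightarrow> \<theta>"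
    and rest: "(\<lambda>n. ((\<integral>y. indicator (Bx n - Q n) y * hit_laplace (rate n) (Bx n) (s # ss) y \<partial>\<nu>)
      - (1 - \<theta>) * (\<integral>y. indicator (Bx n) y * hit_laplace (rate n) (Bx n) ss y \<partial>\<nu>)) / measure \<nu> (Bx n)) \<longlonglongrightarrow> 0"
  shows "(\<lambda>n. (\<integral>y. indicator (Bx n) y * hit_laplace (rate n) (Bx n) (s # ss) y \<partial>\<mu>) / prob (Bx n)
    - ((1 - \<theta>) * ((\<integral>y. indicator (Bx n) y * hit_laplace (rate n) (Bx n) ss y \<partial>\<mu>) / prob (Bx n))
      + \<theta> * (\<integral>y. hit_laplace (rate n) (Bx n) (s # ss) y \<partial>\<mu>))) \<longlonglongrightarrow> 0"
proof -
  define F where "F ss n = hit_laplace (rate n) (Bx n) ss" for ss n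
  define G where "G n = F (s # ss) n" for n
  have F [measurable]: "F ss n \<in> borel_measurable \<nu>" for ss n unfolding F_def by (rule hit_laplace_nu)
  have F01: "0 \<le> F ss n y \<and> F ss n y \<le> 1" for ss n y
    unfolding F_def using hit_laplace_bounds[OF rate_bounds] by blast
  have G [measurable]: "G n \<in> borel_measurable \<nu>" and G01: "0 \<le> G n y \<and> G n y \<le> 1" for n y
    unfolding G_def using F F01 by blast+
  note Q_sets [measurable] = determined_sets[OF Q(1)]
  have Q_tms: "y \<in> tms A" if "y \<in> Q n" for y n using subsetD[OF Q(2) that] cylinder_subset by blast
  define a where "a n = (\<integral>y. G n y \<partial>\<mu>)" for n
  define c where "c n = (\<integral>y. indicator (Q n) y * G n y \<partial>\<nu>) / measure \<nu> (Bx n)" for n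
  define r where "r n = measure \<nu> (Q n) / measure \<nu> (Bx n)" for n
  define d where "d n = ((\<integral>y. indicator (Bx n - Q n) y * G n y \<partial>\<nu>)
      - (1 - \<theta>) * (\<integral>y. indicator (Bx n) y * F ss n y \<partial>\<nu>)) / measure \<nu> (Bx n)" for n
  define b where "b ss n = (\<integral>y. indicator (Bx n) y * F ss n y \<partial>\<mu>) / prob (Bx n)" for ss n
  define \<beta> where "\<beta> ss n = (\<integral>y. indicator (Bx n) y * F ss n y \<partial>\<nu>) / measure \<nu> (Bx n)" for ss n
  have Gmu: "integrable \<mu> (G n)" for n
    using G G01 by (intro integrable_const_bound[of _ 1]) (auto simp: measurable_cong_sets[OF sets_mu refl])
  have a01: "0 \<le> a n" "a n \<le> 1" for n
  proof -
    show "0 \<le> a n" unfolding a_def using G01 by simp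
    have "a n \<le> (\<integral>y. 1 \<partial>\<mu>)" unfolding a_def using G01 by (intro integral_mono Gmu) auto
    then show "a n \<le> 1" by (simp add: prob_space)
  qed
  have inv: "(\<lambda>n. \<integral>y. \<bar>G n (shift y) - G n y\<bar> \<partial>\<mu>) \<longlonglongrightarrow> 0"
    unfolding G_def F_def by (rule hit_laplace_invariant)
  have stop: "\<bar>G n y - G n (stopped (n + q) y)\<bar> \<le> real s * prob (Bx n) * real (tau (n + q) y)"
    if "y \<in> Q n" "y \<notin> early n (n + q) (Q n)" for n y
    unfolding G_def F_def by (rule hit_laplace_stopped[OF that])
  have "(\<lambda>n. c n - r n * a n) \<longlonglongrightarrow> 0"
  proof (rule LIMSEQ_I)
    fix e :: real assume e: "0 < e"
    have "\<forall>\<^sub>F n in sequentially. c n \<le> r n * a n + e / 2"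
      unfolding c_def r_def a_def
      by (rule decouple_upper[OF Q star G G01 inv stop]) (use e in auto)
    \<comment> \<open>The same bound for \<open>1 - G n\<close> supplies the lower estimate of
      \<open>c n\<close>.\<close>
    moreover have "\<forall>\<^sub>F n in sequentially. (\<integral>y. indicator (Q n) y * (1 - G n y) \<partial>\<nu>) / measure \<nu> (Bx n)
        \<le> r n * (\<integral>y. 1 - G n y \<partial>\<mu>) + e / 2"
      unfolding r_def
    proof (rule decouple_upper[OF Q star, where s = s])
      show "(\<lambda>n. \<integral>y. \<bar>(1 - G n (shift y)) - (1 - G n y)\<bar> \<partial>\<mu>) \<longlonglongrightarrow> 0"
        using inv by (simp add: abs_minus_commute)
      fix n y assume "y \<in> Q n" "y \<notin> early n (n + q) (Q n)"
      from stop[OF this] show "\<bar>(1 - G n y) - (1 - G n (stopped (n + q) y))\<bar> \<le> real s * prob (Bx n) * real (tau (n + q) y)"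
        by linarith
    qed (use e G01 in auto)
    ultimately have "\<forall>\<^sub>F n in sequentially. \<bar>c n - r n * a n\<bar> < e"
      using eventually_ge_at_top[of "1::nat"]
    proof eventually_elim
      case (elim n)
      have base: "Q n \<subseteq> base" using Q(2)[of n] Bx_base[OF elim(3)] by auto
      have i1: "integrable \<nu> (\<lambda>y. indicator (Q n) y * 1 :: real)" by (rule integrable_nu[OF _ _ base, of _ 1]) auto
      have i2: "integrable \<nu> (\<lambda>y. indicator (Q n) y * G n y)" using G01 by (intro integrable_nu[OF _ _ base, of _ 1]) auto
      have "(\<integral>y. indicator (Q n) y * (1 - G n y) \<partial>\<nu>) = (\<integral>y. indicator (Q n) y * 1 - indicator (Q n) y * G n y \<partial>\<nu>)"
        by (simp only: right_diff_distrib)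
      also have "\<dots> = (\<integral>y. indicator (Q n) y * 1 \<partial>\<nu>) - (\<integral>y. indicator (Q n) y * G n y \<partial>\<nu>)"
        by (rule Bochner_Integration.integral_diff[OF i1 i2])
      also have "(\<integral>y. indicator (Q n) y * 1 \<partial>\<nu>) = measure \<nu> (Q n)"
        using Q_tms by (auto intro!: arg_cong[where f = "measure \<nu>"])
      finally have "(\<integral>y. indicator (Q n) y * (1 - G n y) \<partial>\<nu>) / measure \<nu> (Bx n) = r n - c n"
        by (simp add: r_def c_def diff_divide_distrib)
      moreover have "(\<integral>y. 1 - G n y \<partial>\<mu>) = 1 - a n"
        unfolding a_def using Gmu by (simp add: prob_space)
      ultimately have "r n - c n \<le> r n * (1 - a n) + e / 2" using elim(2) by simp
      then have "r n * a n \<le> c n + e / 2" by (simp add: right_diff_distrib)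
      then show ?case using elim(1) e by linarith
    qed
    then show "\<exists>no. \<forall>n\<ge>no. norm (c n - r n * a n - 0) < e" by (simp add: eventually_sequentially)
  qed
  moreover have "(\<lambda>n. (r n - \<theta>) * a n) \<longlonglongrightarrow> 0"
  proof (rule Lim_null_comparison)
    show "\<forall>\<^sub>F n in sequentially. norm ((r n - \<theta>) * a n) \<le> \<bar>r n - \<theta>\<bar>"
      using a01 by (simp add: abs_mult mult_left_le)
    show "(\<lambda>n. \<bar>r n - \<theta>\<bar>) \<longlonglongrightarrow> 0" using ratio unfolding r_def by (simp add: LIM_zero tendsto_rabs_zero)
  qed
  moreover have "d \<longlonglongrightarrow> 0" unfolding d_def G_def F_def by (rule rest)
  moreover have cmp: "(\<lambda>n. b ss n - \<beta> ss n) \<longlonglongrightarrow> 0" for ss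
    unfolding b_def \<beta>_def by (rule conditional_comparison[OF F F01])
  ultimately have "(\<lambda>n. (c n - r n * a n) + (r n - \<theta>) * a n + d n + (b (s # ss) n - \<beta> (s # ss) n)
      - (1 - \<theta>) * (b ss n - \<beta> ss n)) \<longlonglongrightarrow> 0 + 0 + 0 + 0 - (1 - \<theta>) * 0"
    by (intro tendsto_intros)
  moreover have "\<forall>\<^sub>F n in sequentially. (c n - r n * a n) + (r n - \<theta>) * a n + d n + (b (s # ss) n - \<beta> (s # ss) n)
      - (1 - \<theta>) * (b ss n - \<beta> ss n) = b (s # ss) n - ((1 - \<theta>) * b ss n + \<theta> * a n)"
    using eventually_ge_at_top[of "1::nat"]
  proof eventually_elim
    case (elim n)
    have base: "Q n \<subseteq> base" "Bx n - Q n \<subseteq> base" using Q(2)[of n] Bx_base[OF elim] by auto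
    have "(\<integral>y. indicator (Bx n) y * G n y \<partial>\<nu>) = (\<integral>y. indicator (Q n) y * G n y + indicator (Bx n - Q n) y * G n y \<partial>\<nu>)"
      using Q(2)[of n] by (intro Bochner_Integration.integral_cong) (auto split: split_indicator)
    also have "\<dots> = (\<integral>y. indicator (Q n) y * G n y \<partial>\<nu>) + (\<integral>y. indicator (Bx n - Q n) y * G n y \<partial>\<nu>)"
      using G01 by (intro Bochner_Integration.integral_add integrable_nu[OF _ _ base(1), of _ 1] integrable_nu[OF _ _ base(2), of _ 1]) auto
    finally have "\<beta> (s # ss) n = c n + (\<integral>y. indicator (Bx n - Q n) y * G n y \<partial>\<nu>) / measure \<nu> (Bx n)"
      unfolding \<beta>_def c_def G_def[symmetric] by (simp add: add_divide_distrib)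
    moreover have "d n = (\<integral>y. indicator (Bx n - Q n) y * G n y \<partial>\<nu>) / measure \<nu> (Bx n) - (1 - \<theta>) * \<beta> ss n"
      by (simp add: d_def \<beta>_def diff_divide_distrib)
    ultimately have "\<beta> (s # ss) n = c n + d n + (1 - \<theta>) * \<beta> ss n" by simp
    then show ?case by (simp add: algebra_simps)
  qed
  ultimately have "(\<lambda>n. b (s # ss) n - ((1 - \<theta>) * b ss n + \<theta> * a n)) \<longlonglongrightarrow> 0"
    by (auto intro: Lim_transform_eventually)
  then show ?thesis unfolding b_def a_def G_def F_def .
qed

end

context rpf_point
begin

lemma recursion_aperiodic:
  assumes "\<not> is_periodic x"
  shows "(\<lambda>n. (\<integral>y. indicator (Bx n) y * hit_laplace (rate n) (Bx n) (s # ss) y \<partial>\<mu>) / prob (Bx n)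
    - ((1 - 1) * ((\<integral>y. indicator (Bx n) y * hit_laplace (rate n) (Bx n) ss y \<partial>\<mu>) / prob (Bx n))
      + 1 * (\<integral>y. hit_laplace (rate n) (Bx n) (s # ss) y \<partial>\<mu>))) \<longlonglongrightarrow> 0"
proof (rule recursion[of 0 Bx])
  have "\<forall>\<^sub>F n in sequentially. measure \<nu> (Bx n) / measure \<nu> (Bx n) = 1"
    using eventually_ge_at_top[of "1::nat"] by eventually_elim (use nu_Bx_pos in force)
  then show "(\<lambda>n. measure \<nu> (Bx n) / measure \<nu> (Bx n)) \<longlonglongrightarrow> 1" by (rule tendsto_eventually)
qed (use determined_Bx escape_aperiodic[OF assms] in simp_all)

lemma recursion_periodic:
  assumes p: "prime_period x q"
  defines "\<theta> \<equiv> 1 - loop_weight q"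
  shows "(\<lambda>n. (\<integral>y. indicator (Bx n) y * hit_laplace (rate n) (Bx n) (s # ss) y \<partial>\<mu>) / prob (Bx n)
    - ((1 - \<theta>) * ((\<integral>y. indicator (Bx n) y * hit_laplace (rate n) (Bx n) ss y \<partial>\<mu>) / prob (Bx n))
      + \<theta> * (\<integral>y. hit_laplace (rate n) (Bx n) (s # ss) y \<partial>\<mu>))) \<longlonglongrightarrow> 0"
proof (rule recursion[of q "\<lambda>n. Bx n - Bx (n + q)"])
  have per: "(shift ^^ q) x = x" and q: "1 \<le> q" using p by (auto simp: prime_period_def)
  let ?F = "\<lambda>ss n. hit_laplace (rate n) (Bx n) ss"
  define J where "J n = (\<integral>y. indicator (Bx (n + q)) y * ?F ss n ((shift ^^ q) y) \<partial>\<nu>)" for n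
  define I where "I n = (\<integral>y. indicator (Bx n) y * ?F ss n y \<partial>\<nu>)" for n
  have sub: "Bx (n + q) \<subseteq> Bx n" for n by (rule Bx_mono) simp
  have F01: "0 \<le> ?F ss n y" "?F ss n y \<le> 1" for n ss y by (rule hit_laplace_bounds[OF rate_bounds])+
  show "determined (n + q) (Bx n - Bx (n + q))" for n
    by (auto simp: determined_def mem_cylinder_map)
  show "Bx n - Bx (n + q) \<subseteq> Bx n" for n by blast
  show "\<forall>\<^sub>F n in sequentially. \<forall>y\<in>Bx n - Bx (n + q). (shift ^^ j) y \<notin> Bx n" if "1 \<le> j" for j
    by (rule escape_periodic[OF p that])
  have "(\<lambda>n. 1 - measure \<nu> (Bx (n + q)) / measure \<nu> (Bx n)) \<longlonglongrightarrow> \<theta>"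
    unfolding \<theta>_def by (intro tendsto_intros loop_ratio[OF per q])
  moreover have "\<forall>\<^sub>F n in sequentially. 1 - measure \<nu> (Bx (n + q)) / measure \<nu> (Bx n)
      = measure \<nu> (Bx n - Bx (n + q)) / measure \<nu> (Bx n)"
    using eventually_ge_at_top[of "1::nat"]
  proof eventually_elim
    case (elim n)
    have "measure \<nu> (Bx n - Bx (n + q)) = measure \<nu> (Bx n) - measure \<nu> (Bx (n + q))"
      using base_fmeasurable[OF cylinder_sets Bx_base[OF elim]] sub
      by (intro measure_Diff) (auto simp: fmeasurable_def)
    then show ?case using nu_Bx_pos[OF elim] by (simp add: field_simps)
  qed
  ultimately show "(\<lambda>n. measure \<nu> (Bx n - Bx (n + q)) / measure \<nu> (Bx n)) \<longlonglongrightarrow> \<theta>"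
    by (auto intro: Lim_transform_eventually)
  have "(\<lambda>n. (J n - loop_weight q * I n) / measure \<nu> (Bx n)) \<longlonglongrightarrow> 0"
    unfolding J_def I_def using F01 by (intro loop_limit per q conjI) auto
  \<comment> \<open>The first gap of an immediate return is \<open>q\<close>, and its rescaled
    length \<open>q * prob (Bx n)\<close> tends to 0, so its factor may be replaced by 1.\<close>
  moreover have "(\<lambda>n. ((rate n ^ s) ^ q - 1) * (J n / measure \<nu> (Bx n))) \<longlonglongrightarrow> 0"
  proof (rule Lim_null_comparison)
    have "(\<lambda>n. \<bar>(rate n ^ s) ^ q - 1\<bar>) \<longlonglongrightarrow> \<bar>(exp (- 0) ^ s) ^ q - 1\<bar>"
      by (intro tendsto_intros mu_Bx_tendsto)
    then show "(\<lambda>n. \<bar>(rate n ^ s) ^ q - 1\<bar>) \<longlonglongrightarrow> 0" by simp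
    show "\<forall>\<^sub>F n in sequentially. norm (((rate n ^ s) ^ q - 1) * (J n / measure \<nu> (Bx n))) \<le> \<bar>(rate n ^ s) ^ q - 1\<bar>"
      using eventually_ge_at_top[of "1::nat"]
    proof eventually_elim
      case (elim n)
      have "0 \<le> J n" unfolding J_def using F01 by (intro integral_nonneg_AE AE_I2) simp
      moreover have "J n \<le> (\<integral>y. indicator (Bx n) y * 1 \<partial>\<nu>)"
        unfolding J_def
      proof (rule integral_mono)
        show "integrable \<nu> (\<lambda>y. indicator (Bx (n + q)) y * ?F ss n ((shift ^^ q) y))"
          using F01 Bx_base[of "n + q"] elim by (intro integrable_nu[of _ _ 1]) simp_all
        show "integrable \<nu> (\<lambda>y. indicator (Bx n) y * 1 :: real)"
          using Bx_base[OF elim] by (intro integrable_nu[of _ _ 1]) simp_all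
        show "indicator (Bx (n + q)) y * ?F ss n ((shift ^^ q) y) \<le> indicator (Bx n) y * 1" for y
          using F01 subsetD[OF sub, of y n] by (simp split: split_indicator)
      qed
      ultimately have "\<bar>J n / measure \<nu> (Bx n)\<bar> \<le> 1" using nu_Bx_pos[OF elim] by simp
      then show ?case unfolding real_norm_def abs_mult by (intro mult_left_le) auto
    qed
  qed
  ultimately have "(\<lambda>n. (J n - loop_weight q * I n) / measure \<nu> (Bx n) + ((rate n ^ s) ^ q - 1) * (J n / measure \<nu> (Bx n))) \<longlonglongrightarrow> 0 + 0"
    by (intro tendsto_intros)
  moreover have "\<forall>\<^sub>F n in sequentially. (J n - loop_weight q * I n) / measure \<nu> (Bx n) + ((rate n ^ s) ^ q - 1) * (J n / measure \<nu> (Bx n))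
      = ((\<integral>y. indicator (Bx n - (Bx n - Bx (n + q))) y * ?F (s # ss) n y \<partial>\<nu>) - (1 - \<theta>) * I n) / measure \<nu> (Bx n)"
    using eventually_ge_at_top[of q]
  proof eventually_elim
    case (elim n)
    have "(\<integral>y. indicator (Bx n - (Bx n - Bx (n + q))) y * ?F (s # ss) n y \<partial>\<nu>)
        = (\<integral>y. (rate n ^ s) ^ q * (indicator (Bx (n + q)) y * ?F ss n ((shift ^^ q) y)) \<partial>\<nu>)"
      using sub[of n] hit_laplace_loop[OF p elim]
      by (intro Bochner_Integration.integral_cong) (auto split: split_indicator simp del: hit_laplace.simps)
    also have "\<dots> = (rate n ^ s) ^ q * J n"
      unfolding J_def by (rule integral_mult_right_zero)
    finally show ?case by (simp add: \<theta>_def add_divide_distrib[symmetric] left_diff_distrib del: hit_laplace.simps)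
  qed
  ultimately show "(\<lambda>n. ((\<integral>y. indicator (Bx n - (Bx n - Bx (n + q))) y * ?F (s # ss) n y \<partial>\<nu>)
      - (1 - \<theta>) * (\<integral>y. indicator (Bx n) y * ?F ss n y \<partial>\<nu>)) / measure \<nu> (Bx n)) \<longlonglongrightarrow> 0"
    unfolding I_def by (auto intro: Lim_transform_eventually)
qed

section \<open>Convergence in law\<close>

abbreviation "gaps n \<equiv> gap_coord (prob (Bx n)) (Bx n)"

lemma AE_hits_Bx: "AE y in \<mu>. \<forall>k. hits (Bx n) ((next_hit (Bx n) ^^ k) y)"
  using mu_Bx_pos[of n] by (intro AE_hits_always) (simp_all add: emeasure_eq_measure)

text \<open>Stated for any measure that inherits the almost sure properties of \<open>\<mu>\<close>,
  so that it serves \<open>\<mu>\<close> and the conditional measures alike.\<close>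

lemma gaps_properties:
  assumes sets: "sets M = sets \<mu>" and ac: "\<And>P. AE y in \<mu>. P y \<Longrightarrow> AE y in M. P y"
  shows "N_id \<mu> (Bx n) \<in> measurable M (borel_of vague_topology)"
    and "gaps n \<in> borel_measurable M" and "gaps n y \<in> unit_cube"
    and "AE y in M. cumprod (gaps n y) \<longlonglongrightarrow> 0"
    and "AE y in M. N_id \<mu> (Bx n) y = points_of (cumprod (gaps n y))"
    and "(\<integral>y. monomial m e (gaps n y) \<partial>M) = (\<integral>y. hit_laplace (rate n) (Bx n) (map e [0..<m]) y \<partial>M)"
proof -
  have hits: "AE y in M. \<forall>k. hits (Bx n) ((next_hit (Bx n) ^^ k) y)"
    by (rule ac[OF AE_hits_Bx])
  show "N_id \<mu> (Bx n) \<in> measurable M (borel_of vague_topology)"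
    using N_id_measurable[OF Bx_mu mu_Bx_pos] by (simp add: measurable_cong_sets[OF sets refl])
  show gm: "gaps n \<in> borel_measurable M"
    using gap_coord_measurable[OF Bx_mu] by (simp add: measurable_cong_sets[OF sets refl])
  show "gaps n y \<in> unit_cube" by (rule gap_coord_unit_cube) simp
  show "AE y in M. cumprod (gaps n y) \<longlonglongrightarrow> 0"
    using hits by eventually_elim (rule cumprod_gap_coord_null[OF _ mu_Bx_pos])
  show "AE y in M. N_id \<mu> (Bx n) y = points_of (cumprod (gaps n y))"
    using hits by eventually_elim (rule N_id_eq_points_of)
  have "hit_laplace (rate n) (Bx n) (map e [0..<m]) \<in> borel_measurable M"
    using hit_laplace_measurable[OF Bx_mu] by (simp add: measurable_cong_sets[OF sets refl])
  moreover have "(\<lambda>y. monomial m e (gaps n y)) \<in> borel_measurable M"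
    by (rule monomial_measurable[OF gm])
  ultimately show "(\<integral>y. monomial m e (gaps n y) \<partial>M) = (\<integral>y. hit_laplace (rate n) (Bx n) (map e [0..<m]) y \<partial>M)"
    using hits by (intro integral_cong_AE) (auto elim!: eventually_mono intro: monomial_gap_coord)
qed

lemma uniform_Bx:
  "prob_space (uniform_measure \<mu> (Bx n))"
  "AE y in \<mu>. P y \<Longrightarrow> AE y in uniform_measure \<mu> (Bx n). P y"
  "f \<in> borel_measurable \<mu> \<Longrightarrow> (\<integral>y. f y \<partial>uniform_measure \<mu> (Bx n)) = (\<integral>y. indicator (Bx n) y * f y \<partial>\<mu>) / prob (Bx n)"
  for f :: "(nat \<Rightarrow> 'v) \<Rightarrow> real"
proof -
  have pos: "emeasure \<mu> (Bx n) \<noteq> 0" using mu_Bx_pos[of n] by (simp add: emeasure_eq_measure)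
  show "prob_space (uniform_measure \<mu> (Bx n))" by (rule prob_space_uniform_measure[OF pos]) simp
  show "AE y in uniform_measure \<mu> (Bx n). P y" if "AE y in \<mu>. P y"
    by (rule AE_uniform_measureI[OF Bx_mu]) (use that in \<open>auto elim: eventually_mono\<close>)
  assume [measurable]: "f \<in> borel_measurable \<mu>"
  have "uniform_measure \<mu> (Bx n) = density \<mu> (\<lambda>y. ennreal (indicator (Bx n) y / prob (Bx n)))"
    unfolding uniform_measure_def using mu_Bx_pos[of n]
    by (intro density_cong) (auto simp: emeasure_eq_measure divide_ennreal[symmetric] ennreal_indicator)
  then show "(\<integral>y. f y \<partial>uniform_measure \<mu> (Bx n)) = (\<integral>y. indicator (Bx n) y * f y \<partial>\<mu>) / prob (Bx n)"
    by (simp add: integral_density mult.commute)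
qed

lemma prod_list_map_upt: "(\<Prod>s\<leftarrow>map e [0..<m]. f s) = (\<Prod>i<m. f (e i :: nat) :: real)"
  by (simp add: interv_sum_list_conv_sum_set_nat prod.list_conv_set_nth atLeast0LessThan)

context
  fixes \<theta> :: real
  assumes th: "0 < \<theta>" "\<theta> \<le> 1"
    and rec: "\<And>s ss. (\<lambda>n. (\<integral>y. indicator (Bx n) y * hit_laplace (rate n) (Bx n) (s # ss) y \<partial>\<mu>) / prob (Bx n)
      - ((1 - \<theta>) * ((\<integral>y. indicator (Bx n) y * hit_laplace (rate n) (Bx n) ss y \<partial>\<mu>) / prob (Bx n))
        + \<theta> * (\<integral>y. hit_laplace (rate n) (Bx n) (s # ss) y \<partial>\<mu>))) \<longlonglongrightarrow> 0"
begin

lemma converges_return_RPP: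
  assumes w: "prob_space w" "sets w = sets borel" "AE t in w. 0 \<le> t"
    and laplace: "laplace_nat w (\<lambda>j. 1 - \<theta> + \<theta> * (\<theta> / (\<theta> + real j)))"
  shows "converges_in_law (\<lambda>n. uniform_measure \<mu> (Bx n)) (\<lambda>n. N_id \<mu> (Bx n)) (RPP w)"
proof (rule converges_in_law_RPP[OF w laplace, where U = gaps])
  note props = gaps_properties[OF sets_uniform_measure uniform_Bx(2)]
  show "N_id \<mu> (Bx n) \<in> measurable (uniform_measure \<mu> (Bx n)) (borel_of vague_topology)" for n by (rule props(1))
  show "gaps n \<in> borel_measurable (uniform_measure \<mu> (Bx n))" for n by (rule props(2))
  show "gaps n y \<in> unit_cube" for n y by (rule props(3))
  show "AE y in uniform_measure \<mu> (Bx n). cumprod (gaps n y) \<longlonglongrightarrow> 0" for n by (rule props(4))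
  show "AE y in uniform_measure \<mu> (Bx n). N_id \<mu> (Bx n) y = points_of (cumprod (gaps n y))" for n by (rule props(5))
  show "(\<lambda>n. \<integral>y. monomial m e (gaps n y) \<partial>uniform_measure \<mu> (Bx n))
      \<longlonglongrightarrow> (\<Prod>i<m. 1 - \<theta> + \<theta> * (\<theta> / (\<theta> + real (e i))))" for m e
    using hit_laplace_limits(1)[OF Bx_mu mu_Bx_pos mu_Bx_tendsto th rec, of "map e [0..<m]"]
    by (simp only: props uniform_Bx(3) hit_laplace_measurable Bx_mu prod_list_map_upt)
  have "\<theta> * \<theta> < \<theta> * (\<theta> + 1)" using th by simp
  then show "1 - \<theta> + \<theta> * (\<theta> / (\<theta> + real 1)) < 1" using th by (simp add: field_simps)
qed (rule uniform_Bx(1))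

lemma hit_moments:
  "(\<lambda>n. \<integral>y. monomial (Suc m) e (gaps n y) \<partial>\<mu>)
    \<longlonglongrightarrow> \<theta> / (\<theta> + real (e 0)) * (\<Prod>i<m. 1 - \<theta> + \<theta> * (\<theta> / (\<theta> + real (e (Suc i)))))"
proof -
  have "map e [0..<Suc m] = e 0 # map (\<lambda>i. e (Suc i)) [0..<m]"
    by (simp add: map_upt_Suc del: upt_Suc)
  moreover have ac: "\<And>P. AE y in \<mu>. P y \<Longrightarrow> AE y in \<mu>. P y" .
  ultimately show ?thesis
    using hit_laplace_limits(2)[OF Bx_mu mu_Bx_pos mu_Bx_tendsto th rec, of "e 0" "map (\<lambda>i. e (Suc i)) [0..<m]"]
    by (simp only: gaps_properties(6)[of \<mu>, OF refl ac] prod_list_map_upt)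
qed

lemma converges_hit_CPPP: "converges_in_law (\<lambda>_. \<mu>) (\<lambda>n. N_id \<mu> (Bx n)) (CPPP \<theta> (Geo \<theta>))"
proof (rule converges_in_law_CPPP[OF th, where U = gaps])
  have ac: "\<And>P. AE y in \<mu>. P y \<Longrightarrow> AE y in \<mu>. P y" .
  note props = gaps_properties[of \<mu>, OF refl ac]
  show "N_id \<mu> (Bx n) \<in> measurable \<mu> (borel_of vague_topology)" for n by (rule props(1))
  show "gaps n \<in> borel_measurable \<mu>" for n by (rule props(2))
  show "gaps n y \<in> unit_cube" for n y by (rule props(3))
  show "AE y in \<mu>. cumprod (gaps n y) \<longlonglongrightarrow> 0" for n by (rule props(4))
  show "AE y in \<mu>. N_id \<mu> (Bx n) y = points_of (cumprod (gaps n y))" for n by (rule props(5))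
qed (rule prob_space_axioms hit_moments)+

end

text \<open>For \<open>\<theta> = 1\<close> the limiting hitting and return moments agree: every
  gap, the first included, contributes the factor \<open>1 / (1 + s)\<close> of the standard
  exponential law.\<close>

lemma converges_PPP:
  assumes np: "\<not> is_periodic x"
  shows "converges_in_law (\<lambda>_. \<mu>) (\<lambda>n. N_id \<mu> (Bx n)) (PPP 1)"
    and "converges_in_law (\<lambda>n. uniform_measure \<mu> (Bx n)) (\<lambda>n. N_id \<mu> (Bx n)) (PPP 1)"
proof -
  have l: "laplace_nat (exponential_law 1) (\<lambda>j. 1 - 1 + 1 * (1 / (1 + real j)))"
    using laplace_exponential_law[of 1] by simp
  have w: "prob_space (exponential_law 1)" "sets (exponential_law 1) = sets borel" "AE t in exponential_law 1. 0 \<le> t"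
    by (simp_all add: prob_space_exponential_law sets_exponential_law AE_exponential_law)
  show "converges_in_law (\<lambda>n. uniform_measure \<mu> (Bx n)) (\<lambda>n. N_id \<mu> (Bx n)) (PPP 1)"
    unfolding PPP_def by (rule converges_return_RPP[OF _ _ recursion_aperiodic[OF np] w l]) simp_all
  show "converges_in_law (\<lambda>_. \<mu>) (\<lambda>n. N_id \<mu> (Bx n)) (PPP 1)"
    unfolding PPP_def
  proof (rule converges_in_law_RPP[OF w l, where U = gaps])
    have ac: "\<And>P. AE y in \<mu>. P y \<Longrightarrow> AE y in \<mu>. P y" .
  note props = gaps_properties[of \<mu>, OF refl ac]
    show "N_id \<mu> (Bx n) \<in> measurable \<mu> (borel_of vague_topology)" for n by (rule props(1))
    show "gaps n \<in> borel_measurable \<mu>" for n by (rule props(2))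
    show "gaps n y \<in> unit_cube" for n y by (rule props(3))
    show "AE y in \<mu>. cumprod (gaps n y) \<longlonglongrightarrow> 0" for n by (rule props(4))
    show "AE y in \<mu>. N_id \<mu> (Bx n) y = points_of (cumprod (gaps n y))" for n by (rule props(5))
    show "(\<lambda>n. \<integral>y. monomial m e (gaps n y) \<partial>\<mu>) \<longlonglongrightarrow> (\<Prod>i<m. 1 - 1 + 1 * (1 / (1 + real (e i))))" for m e
    proof (cases m)
      case 0
      then show ?thesis by (simp add: monomial_def prob_space)
    next
      case (Suc k)
      then show ?thesis
        using hit_moments[OF _ _ recursion_aperiodic[OF np], of k e]
        by (simp add: prod.lessThan_Suc_shift del: prod.lessThan_Suc)
    qed
  qed (simp_all add: prob_space_axioms)
qed

lemma converges_periodic: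
  assumes p: "prime_period x q"
    and th: "\<theta> = 1 - exp (birkhoff \<phi> q x - real q * real_of_ereal (gurevich_pressure A \<phi>))"
  shows "converges_in_law (\<lambda>_. \<mu>) (\<lambda>n. N_id \<mu> (Bx n)) (CPPP \<theta> (Geo \<theta>))"
    and "converges_in_law (\<lambda>n. uniform_measure \<mu> (Bx n)) (\<lambda>n. N_id \<mu> (Bx n)) (RPP (W1_law \<theta>))"
proof -
  have per: "(shift ^^ q) x = x" "1 \<le> q" using p by (auto simp: prime_period_def)
  have eq: "\<theta> = 1 - loop_weight q" using th loop_weight_eq[OF per(1)] by simp
  then have th: "0 < \<theta>" "\<theta> \<le> 1"
    using loop_weight_less_1[OF per] by (simp_all add: loop_weight_def less_imp_le[OF weight_pos])
  show "converges_in_law (\<lambda>_. \<mu>) (\<lambda>n. N_id \<mu> (Bx n)) (CPPP \<theta> (Geo \<theta>))"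
    by (rule converges_hit_CPPP[OF th]) (use recursion_periodic[OF p] eq in simp)
  show "converges_in_law (\<lambda>n. uniform_measure \<mu> (Bx n)) (\<lambda>n. N_id \<mu> (Bx n)) (RPP (W1_law \<theta>))"
    by (rule converges_return_RPP[OF th _ W1_law_properties[OF th]]) (use recursion_periodic[OF p] eq in simp)
qed

end

theorem theorem3p1:
  fixes A :: "'v :: countable \<Rightarrow> 'v \<Rightarrow> bool"
    and \<eta> :: real
    and \<phi> h :: "(nat \<Rightarrow> 'v) \<Rightarrow> real"
    and \<nu> \<mu> :: "(nat \<Rightarrow> 'v) measure"
    and x :: "nat \<Rightarrow> 'v"
    and B :: "nat \<Rightarrow> (nat \<Rightarrow> 'v) set"
  assumes eta: "0 < \<eta>" "\<eta> < 1"
    and mixing: "topologically_mixing A"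
    and potential: "\<phi> \<in> borel_measurable (borel_of (shift_topology \<eta> A))"
    and walters: "walters_condition A \<phi>"
    and pressure: "gurevich_pressure A \<phi> < \<infinity>"
    and pos_rec: "positive_recurrent A \<phi>"
    and mu: "RPF_measure \<eta> A \<phi> h \<nu> \<mu>"
    and non_atomic: "\<And>y. y \<in> tms A \<Longrightarrow> emeasure \<mu> {y} = 0"
    and x: "x \<in> tms A"
    and B_def: "\<And>n. B n = cylinder A (map x [0..<n])"
  shows "(\<not> is_periodic x \<longrightarrow>
            converges_in_law (\<lambda>n. \<mu>) (\<lambda>n. N_id \<mu> (B n)) (PPP 1) \<and>
            converges_in_law (\<lambda>n. uniform_measure \<mu> (B n)) (\<lambda>n. N_id \<mu> (B n)) (PPP 1)) \<and>
         (\<forall>q \<theta>. prime_period x q \<longrightarrow>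
            \<theta> = 1 - exp (birkhoff \<phi> q x - real q * real_of_ereal (gurevich_pressure A \<phi>)) \<longrightarrow>
            converges_in_law (\<lambda>n. \<mu>) (\<lambda>n. N_id \<mu> (B n)) (CPPP \<theta> (Geo \<theta>)) \<and>
            converges_in_law (\<lambda>n. uniform_measure \<mu> (B n)) (\<lambda>n. N_id \<mu> (B n)) (RPP (W1_law \<theta>)))"
proof -
  interpret rpf_point A \<eta> \<phi> h \<nu> \<mu> x
    using eta mixing potential walters mu non_atomic x by unfold_locales
  show ?thesis
    unfolding B_def using converges_PPP converges_periodic by blast
qed

end
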